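(* Let $X$ be a compact Hausdorff space and $E=(E_{l,m})\in\mathbb M_n\otimes C(X)$ a projection. Then there exists a unique C*-norm on the $*$-algebra generated by $C(X)$ and a finite set $\{\psi_l\}_{l=1}^n$ with relations $$f\psi_l=\psi_lf\quad(f\in C(X)),\qquad \psi_l^*\psi_m=E_{l,m},\qquad \sum_{l}\psi_l\psi_l^*=1,$$ extending the sup-norm on $C(X)$ and such that the circle action $\widehat z(\psi_l):=z\cdot\psi_l$, $z\in\mathbb T$, extends to a $\mathbb T$-action by automorphisms. The C*-algebra so generated is isomorphic to the Pimsner algebra $\mathcal O_{\mathcal E}$, where $\mathcal E\to X$ is the vector bundle corresponding to $E$ via the Serre–Swan theorem. By removing the last relation $\sum_l\psi_l\psi_l^*=1$, the Toeplitz algebra $\mathcal T_{\mathcal E}$ is obtained.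
   Context: Vector bundles are assumed to have nonzero fibres (equivalently, their modules of continuous sections are full), so $E(x)\neq0$ for all $x\in X$. The bundle $\mathcal E$ is the one whose Hilbert $C(X)$-module of continuous sections is $\widehat{\mathcal E}\simeq E\,(\oplus^nC(X))$, made into a Hilbert $C(X)$-bimodule by letting the left action coincide with the right one. The Toeplitz algebra $\mathcal T_{\mathcal E}$ is the C*-algebra of adjointable operators on the Fock module $C(X)\oplus\bigoplus_{k\ge1}\widehat{\mathcal E}^{\otimes k}$ generated by the creation operators $\overline\psi(\psi')=\psi\otimes\psi'$, $\psi\in\widehat{\mathcal E}$; the Pimsner algebra $\mathcal O_{\mathcal E}$ is the quotient of $\mathcal T_{\mathcal E}$ by the ideal of compact operators of the Fock module. *)

theory Defs
  imports "HOL-Analysis.Analysis" "HOL-Algebra.QuotRing" "HOL-Algebra.Module"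
begin

section \<open>The algebra of continuous functions\<close>

text \<open>For compact \<open>X\<close> the library type \<open>'x \<Rightarrow>\<^sub>C complex\<close> of bounded continuous functions is
  \<open>C(X)\<close>, and its library norm is the sup-norm. Only the pointwise product is missing.\<close>

lemma mult_cont:
  fixes f g :: "'x::topological_space \<Rightarrow> 'a::real_normed_algebra"
  assumes "f \<in> bcontfun" "g \<in> bcontfun"
  shows "(\<lambda>x. f x * g x) \<in> bcontfun"
proof -
  obtain a where a: "\<And>x. norm (f x) \<le> a"
    using assms(1) by (auto simp: bcontfun_def bounded_iff)
  obtain b where b: "\<And>x. norm (g x) \<le> b"
    using assms(2) by (auto simp: bcontfun_def bounded_iff)
  have "0 \<le> a"
    using a norm_ge_zero order_trans by blast
  then have "norm (f x * g x) \<le> a * b" for x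
    by (meson a b norm_mult_ineq mult_mono norm_ge_zero order_trans)
  moreover have "continuous_on UNIV (\<lambda>x. f x * g x)"
    using assms by (auto simp: bcontfun_def intro!: continuous_intros)
  ultimately show ?thesis
    by (intro bcontfun_normI)
qed

instantiation bcontfun :: (topological_space, real_normed_field) "{comm_ring_1, real_normed_algebra_1}"
begin

definition times_bcontfun :: "('a \<Rightarrow>\<^sub>C 'b) \<Rightarrow> ('a \<Rightarrow>\<^sub>C 'b) \<Rightarrow> 'a \<Rightarrow>\<^sub>C 'b"
  where "times_bcontfun f g = Bcontfun (\<lambda>x. f x * g x)"

definition one_bcontfun :: "'a \<Rightarrow>\<^sub>C 'b"
  where "one_bcontfun = const_bcontfun 1"

lemma apply_times: "apply_bcontfun (f * g) x = f x * g x" for f g :: "'a \<Rightarrow>\<^sub>C 'b"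
  unfolding times_bcontfun_def
  using mult_cont[OF apply_bcontfun[of f] apply_bcontfun[of g]] by (simp add: Bcontfun_inverse)

lemma apply_one: "apply_bcontfun (1 :: 'a \<Rightarrow>\<^sub>C 'b) x = 1"
  by (simp add: one_bcontfun_def const_bcontfun.rep_eq)

instance
proof
  fix f g h :: "'a \<Rightarrow>\<^sub>C 'b" and r :: real
  show "f * g * h = f * (g * h)" "f * g = g * f" "1 * f = f" "f * 1 = f"
    "(f + g) * h = f * h + g * h" "f * (g + h) = f * g + f * h"
    "r *\<^sub>R f * g = r *\<^sub>R (f * g)" "f * r *\<^sub>R g = r *\<^sub>R (f * g)"
    by (auto intro!: bcontfun_eqI simp: apply_times apply_one algebra_simps)
  show "(0 :: 'a \<Rightarrow>\<^sub>C 'b) \<noteq> 1"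
  proof
    assume "(0 :: 'a \<Rightarrow>\<^sub>C 'b) = 1"
    then have "apply_bcontfun (0 :: 'a \<Rightarrow>\<^sub>C 'b) undefined = apply_bcontfun 1 undefined"
      by simp
    then show False
      by (simp add: apply_one)
  qed
  show "norm (f * g) \<le> norm f * norm g"
    by (rule norm_bound)
      (simp add: apply_times norm_mult mult_mono norm_bounded)
  show "norm (1 :: 'a \<Rightarrow>\<^sub>C 'b) = 1"
  proof (rule antisym)
    show "norm (1 :: 'a \<Rightarrow>\<^sub>C 'b) \<le> 1"
      by (rule norm_bound) (simp add: apply_one)
    show "1 \<le> norm (1 :: 'a \<Rightarrow>\<^sub>C 'b)"
      using norm_bounded[of "1 :: 'a \<Rightarrow>\<^sub>C 'b" undefined] by (simp add: apply_one)
  qed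
qed

end

definition conj_bcontfun :: "('x::topological_space \<Rightarrow>\<^sub>C complex) \<Rightarrow> 'x \<Rightarrow>\<^sub>C complex"
  where "conj_bcontfun f = Bcontfun (\<lambda>x. cnj (f x))"

lemma apply_conj: "apply_bcontfun (conj_bcontfun f) x = cnj (f x)"
proof -
  have "(\<lambda>x. cnj (f x)) \<in> bcontfun"
    using norm_bounded[of f]
    by (intro bcontfun_normI[where b = "norm f"]) (auto intro!: continuous_intros)
  then show ?thesis
    by (simp add: conj_bcontfun_def Bcontfun_inverse)
qed

definition projection :: "('x::topological_space \<Rightarrow>\<^sub>C complex)^'n^'n \<Rightarrow> bool"
  where "projection E \<longleftrightarrow> E ** E = E \<and> (\<chi> l m. conj_bcontfun (E $ m $ l)) = E"


section \<open>*-algebras, C*-norms, completions, quotients\<close>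

record 'a star_algebra = "(complex, 'a) module" +
  star :: "'a \<Rightarrow> 'a"

record 'a normed_star_algebra = "'a star_algebra" +
  nrm :: "'a \<Rightarrow> real"

definition cstar_seminorm :: "('a, 'r) star_algebra_scheme \<Rightarrow> ('a \<Rightarrow> real) \<Rightarrow> bool" where
  "cstar_seminorm A N \<longleftrightarrow>
    (\<forall>a\<in>carrier A. 0 \<le> N a) \<and>
    (\<forall>a\<in>carrier A. \<forall>b\<in>carrier A. N (a \<oplus>\<^bsub>A\<^esub> b) \<le> N a + N b) \<and>
    (\<forall>c. \<forall>a\<in>carrier A. N (c \<odot>\<^bsub>A\<^esub> a) = norm c * N a) \<and>
    (\<forall>a\<in>carrier A. \<forall>b\<in>carrier A. N (a \<otimes>\<^bsub>A\<^esub> b) \<le> N a * N b) \<and>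
    (\<forall>a\<in>carrier A. N (star A a \<otimes>\<^bsub>A\<^esub> a) = (N a)\<^sup>2)"

text \<open>Norms are extensional functions, so that equality of norms is equality on the carrier.\<close>

definition cstar_norm :: "('a, 'r) star_algebra_scheme \<Rightarrow> ('a \<Rightarrow> real) \<Rightarrow> bool" where
  "cstar_norm A N \<longleftrightarrow>
    N \<in> extensional (carrier A) \<and> cstar_seminorm A N \<and>
    (\<forall>a\<in>carrier A. N a = 0 \<longrightarrow> a = \<zero>\<^bsub>A\<^esub>)"

text \<open>The universal C*-algebra of a presentation is the separated completion in this seminorm. A norm
  is too much to ask for the Toeplitz relations: they do not imply \<open>\<psi>\<^sub>l = \<Sum>\<^sub>m \<psi>\<^sub>m E\<^sub>m\<^sub>l\<close> algebraically,
  but every C*-seminorm does.\<close>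

definition greatest_cstar_seminorm :: "('a, 'r) star_algebra_scheme \<Rightarrow> ('a \<Rightarrow> real) \<Rightarrow> bool" where
  "greatest_cstar_seminorm A N \<longleftrightarrow>
    cstar_seminorm A N \<and> (\<forall>p. cstar_seminorm A p \<longrightarrow> (\<forall>a\<in>carrier A. p a \<le> N a))"

definition star_iso ::
  "('a, 'r) normed_star_algebra_scheme \<Rightarrow> ('b, 's) normed_star_algebra_scheme \<Rightarrow> ('a \<Rightarrow> 'b) set"
  where "star_iso A B = {\<phi> \<in> ring_iso A B. \<forall>a\<in>carrier A.
    (\<forall>c. \<phi> (c \<odot>\<^bsub>A\<^esub> a) = c \<odot>\<^bsub>B\<^esub> \<phi> a) \<and> \<phi> (star A a) = star B (\<phi> a) \<and> nrm B (\<phi> a) = nrm A a}"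

definition star_isomorphic ::
  "('a, 'r) normed_star_algebra_scheme \<Rightarrow> ('b, 's) normed_star_algebra_scheme \<Rightarrow> bool"
  where "star_isomorphic A B \<longleftrightarrow> star_iso A B \<noteq> {}"

text \<open>The completion of a *-algebra in a C*-seminorm: Cauchy sequences modulo null sequences.
  The kernel of the seminorm is divided out.\<close>

definition cauchy_seqs :: "('a, 'r) star_algebra_scheme \<Rightarrow> ('a \<Rightarrow> real) \<Rightarrow> (nat \<Rightarrow> 'a) set" where
  "cauchy_seqs A N = {s. (\<forall>i. s i \<in> carrier A) \<and>
    (\<forall>e>0. \<exists>M. \<forall>i\<ge>M. \<forall>j\<ge>M. N (s i \<ominus>\<^bsub>A\<^esub> s j) < e)}"

definition null_rel :: "('a, 'r) star_algebra_scheme \<Rightarrow> ('a \<Rightarrow> real) \<Rightarrow> (nat \<Rightarrow> 'a) rel" where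
  "null_rel A N = {(s, t). s \<in> cauchy_seqs A N \<and> t \<in> cauchy_seqs A N \<and>
    (\<lambda>i. N (s i \<ominus>\<^bsub>A\<^esub> t i)) \<longlonglongrightarrow> 0}"

definition cstar_completion ::
  "('a, 'r) star_algebra_scheme \<Rightarrow> ('a \<Rightarrow> real) \<Rightarrow> (nat \<Rightarrow> 'a) set normed_star_algebra" where
  "cstar_completion A N = \<lparr>
    carrier = cauchy_seqs A N // null_rel A N,
    mult = (\<lambda>S T. \<Union>s\<in>S. \<Union>t\<in>T. null_rel A N `` {\<lambda>i. s i \<otimes>\<^bsub>A\<^esub> t i}),
    one = null_rel A N `` {\<lambda>i. \<one>\<^bsub>A\<^esub>},
    zero = null_rel A N `` {\<lambda>i. \<zero>\<^bsub>A\<^esub>},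
    add = (\<lambda>S T. \<Union>s\<in>S. \<Union>t\<in>T. null_rel A N `` {\<lambda>i. s i \<oplus>\<^bsub>A\<^esub> t i}),
    smult = (\<lambda>c S. \<Union>s\<in>S. null_rel A N `` {\<lambda>i. c \<odot>\<^bsub>A\<^esub> s i}),
    star = (\<lambda>S. \<Union>s\<in>S. null_rel A N `` {\<lambda>i. star A (s i)}),
    nrm = (\<lambda>S. THE r. \<exists>s\<in>S. (\<lambda>i. N (s i)) \<longlonglongrightarrow> r)\<rparr>"

definition to_completion ::
  "('a, 'r) star_algebra_scheme \<Rightarrow> ('a \<Rightarrow> real) \<Rightarrow> 'a \<Rightarrow> (nat \<Rightarrow> 'a) set"
  where "to_completion A N a = null_rel A N `` {\<lambda>i. a}"

text \<open>Actions of the circle by automorphisms are pointwise norm continuous, as usual.\<close>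

definition circle_action ::
  "('a, 'r) normed_star_algebra_scheme \<Rightarrow> (complex \<Rightarrow> 'a \<Rightarrow> 'a) \<Rightarrow> bool" where
  "circle_action B \<alpha> \<longleftrightarrow>
    (\<forall>z\<in>sphere 0 1. \<alpha> z \<in> star_iso B B) \<and>
    (\<forall>z\<in>sphere 0 1. \<forall>w\<in>sphere 0 1. \<forall>b\<in>carrier B. \<alpha> (z * w) b = \<alpha> z (\<alpha> w b)) \<and>
    (\<forall>z\<in>sphere 0 1. \<forall>b\<in>carrier B.
      ((\<lambda>w. nrm B (\<alpha> w b \<ominus>\<^bsub>B\<^esub> \<alpha> z b)) \<longlongrightarrow> 0) (at z within sphere 0 1))"

definition closed_subspace :: "('a, 'r) normed_star_algebra_scheme \<Rightarrow> 'a set \<Rightarrow> bool" where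
  "closed_subspace A S \<longleftrightarrow>
    S \<subseteq> carrier A \<and> \<zero>\<^bsub>A\<^esub> \<in> S \<and>
    (\<forall>a\<in>S. \<forall>b\<in>S. a \<oplus>\<^bsub>A\<^esub> b \<in> S) \<and> (\<forall>c. \<forall>a\<in>S. c \<odot>\<^bsub>A\<^esub> a \<in> S) \<and>
    (\<forall>s. \<forall>a\<in>carrier A. (\<forall>i. s i \<in> S) \<and> (\<lambda>i. nrm A (s i \<ominus>\<^bsub>A\<^esub> a)) \<longlonglongrightarrow> 0 \<longrightarrow> a \<in> S)"

definition closed_span :: "('a, 'r) normed_star_algebra_scheme \<Rightarrow> 'a set \<Rightarrow> 'a set" where
  "closed_span A G = \<Inter>{S. closed_subspace A S \<and> G \<subseteq> S}"

definition generated_cstar :: "('a, 'r) normed_star_algebra_scheme \<Rightarrow> 'a set \<Rightarrow> 'a set" where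
  "generated_cstar A G = \<Inter>{S. closed_subspace A S \<and>
    (\<forall>a\<in>S. \<forall>b\<in>S. a \<otimes>\<^bsub>A\<^esub> b \<in> S) \<and> (\<forall>a\<in>S. star A a \<in> S) \<and> G \<subseteq> S}"

definition cstar_quotient ::
  "('a, 'r) normed_star_algebra_scheme \<Rightarrow> 'a set \<Rightarrow> 'a set normed_star_algebra" where
  "cstar_quotient A J = \<lparr>
    carrier = carrier (A Quot J),
    mult = mult (A Quot J),
    one = one (A Quot J),
    zero = zero (A Quot J),
    add = add (A Quot J),
    smult = (\<lambda>c S. \<Union>a\<in>S. J +>\<^bsub>A\<^esub> (c \<odot>\<^bsub>A\<^esub> a)),
    star = (\<lambda>S. \<Union>a\<in>S. J +>\<^bsub>A\<^esub> star A a),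
    nrm = (\<lambda>S. INF a\<in>S. nrm A a)\<rparr>"


section \<open>*-algebras given by generators and relations over a coefficient algebra\<close>

text \<open>Formal *-polynomials in generators \<open>Gen l\<close> with coefficients in \<open>C(X)\<close>.\<close>

datatype ('f, 'n) star_poly =
    Coef 'f
  | Gen 'n
  | Plus "('f, 'n) star_poly" "('f, 'n) star_poly"
  | Times "('f, 'n) star_poly" "('f, 'n) star_poly"
  | Scale complex "('f, 'n) star_poly"
  | Adj "('f, 'n) star_poly"

text \<open>The least congruence containing \<open>R\<close> whose quotient is a unital *-algebra over the complex
  numbers into which \<open>Coef\<close> is a unital *-homomorphism.\<close>

inductive star_cong ::
  "('x::topological_space \<Rightarrow>\<^sub>C complex, 'n) star_poly rel \<Rightarrow>
   ('x \<Rightarrow>\<^sub>C complex, 'n) star_poly \<Rightarrow> ('x \<Rightarrow>\<^sub>C complex, 'n) star_poly \<Rightarrow> bool"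
  for R where
  rel: "(a, b) \<in> R \<Longrightarrow> star_cong R a b"
| refl: "star_cong R a a"
| sym: "star_cong R a b \<Longrightarrow> star_cong R b a"
| trans: "star_cong R a b \<Longrightarrow> star_cong R b c \<Longrightarrow> star_cong R a c"
| Plus: "star_cong R a a' \<Longrightarrow> star_cong R b b' \<Longrightarrow> star_cong R (Plus a b) (Plus a' b')"
| Times: "star_cong R a a' \<Longrightarrow> star_cong R b b' \<Longrightarrow> star_cong R (Times a b) (Times a' b')"
| Scale: "star_cong R a a' \<Longrightarrow> star_cong R (Scale z a) (Scale z a')"
| Adj: "star_cong R a a' \<Longrightarrow> star_cong R (Adj a) (Adj a')"
| plus_assoc: "star_cong R (Plus (Plus a b) c) (Plus a (Plus b c))"
| plus_commute: "star_cong R (Plus a b) (Plus b a)"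
| plus_zero: "star_cong R (Plus (Coef 0) a) a"
| plus_inverse: "star_cong R (Plus (Scale (-1) a) a) (Coef 0)"
| scale_one: "star_cong R (Scale 1 a) a"
| scale_scale: "star_cong R (Scale z (Scale w a)) (Scale (z * w) a)"
| scale_add: "star_cong R (Scale (z + w) a) (Plus (Scale z a) (Scale w a))"
| scale_plus: "star_cong R (Scale z (Plus a b)) (Plus (Scale z a) (Scale z b))"
| times_assoc: "star_cong R (Times (Times a b) c) (Times a (Times b c))"
| times_plus: "star_cong R (Times a (Plus b c)) (Plus (Times a b) (Times a c))"
| plus_times: "star_cong R (Times (Plus a b) c) (Plus (Times a c) (Times b c))"
| scale_times: "star_cong R (Times (Scale z a) b) (Scale z (Times a b))"
| times_scale: "star_cong R (Times a (Scale z b)) (Scale z (Times a b))"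
| adj_adj: "star_cong R (Adj (Adj a)) a"
| adj_plus: "star_cong R (Adj (Plus a b)) (Plus (Adj a) (Adj b))"
| adj_scale: "star_cong R (Adj (Scale z a)) (Scale (cnj z) (Adj a))"
| adj_times: "star_cong R (Adj (Times a b)) (Times (Adj b) (Adj a))"
| coef_plus: "star_cong R (Plus (Coef f) (Coef g)) (Coef (f + g))"
| coef_times: "star_cong R (Times (Coef f) (Coef g)) (Coef (f * g))"
| coef_scale: "star_cong R (Scale z (Coef f)) (Coef (const_bcontfun z * f))"
| coef_adj: "star_cong R (Adj (Coef f)) (Coef (conj_bcontfun f))"
| one_times: "star_cong R (Times (Coef 1) a) a"
| times_one: "star_cong R (Times a (Coef 1)) a"

definition star_class ::
  "('x::topological_space \<Rightarrow>\<^sub>C complex, 'n) star_poly rel \<Rightarrow>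
   ('x \<Rightarrow>\<^sub>C complex, 'n) star_poly \<Rightarrow> ('x \<Rightarrow>\<^sub>C complex, 'n) star_poly set"
  where "star_class R a = {b. star_cong R a b}"

definition presented_algebra ::
  "('x::topological_space \<Rightarrow>\<^sub>C complex, 'n) star_poly rel \<Rightarrow>
   ('x \<Rightarrow>\<^sub>C complex, 'n) star_poly set star_algebra" where
  "presented_algebra R = \<lparr>
    carrier = range (star_class R),
    mult = (\<lambda>A B. \<Union>a\<in>A. \<Union>b\<in>B. star_class R (Times a b)),
    one = star_class R (Coef 1),
    zero = star_class R (Coef 0),
    add = (\<lambda>A B. \<Union>a\<in>A. \<Union>b\<in>B. star_class R (Plus a b)),
    smult = (\<lambda>c A. \<Union>a\<in>A. star_class R (Scale c a)),
    star = (\<lambda>A. \<Union>a\<in>A. star_class R (Adj a))\<rparr>"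

definition toeplitz_relations ::
  "('x::topological_space \<Rightarrow>\<^sub>C complex)^'n^'n \<Rightarrow> ('x \<Rightarrow>\<^sub>C complex, 'n) star_poly rel" where
  "toeplitz_relations E =
    {(Times (Coef f) (Gen l), Times (Gen l) (Coef f)) | f l. True} \<union>
    {(Times (Adj (Gen l)) (Gen m), Coef (E $ l $ m)) | l m. True}"

text \<open>The index type carries no order, so the sum of the \<open>\<psi>\<^sub>l \<psi>\<^sub>l\<^sup>*\<close> is written out along every
  enumeration \<open>ls\<close> of it. Modulo \<open>star_cong\<close> all of them coincide.\<close>

definition pimsner_relations ::
  "('x::topological_space \<Rightarrow>\<^sub>C complex)^'n^'n \<Rightarrow> ('x \<Rightarrow>\<^sub>C complex, 'n) star_poly rel" where
  "pimsner_relations E = toeplitz_relations E \<union>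
    {(foldr (\<lambda>l. Plus (Times (Gen l) (Adj (Gen l)))) ls (Coef 0), Coef 1) | ls.
      distinct ls \<and> set ls = UNIV}"

definition extends_sup_norm ::
  "('x::topological_space \<Rightarrow>\<^sub>C complex, 'n) star_poly rel \<Rightarrow>
   (('x \<Rightarrow>\<^sub>C complex, 'n) star_poly set \<Rightarrow> real) \<Rightarrow> bool"
  where "extends_sup_norm R N \<longleftrightarrow> (\<forall>f. N (star_class R (Coef f)) = norm f)"

definition circle_action_extends ::
  "('x::topological_space \<Rightarrow>\<^sub>C complex, 'n) star_poly rel \<Rightarrow>
   (('x \<Rightarrow>\<^sub>C complex, 'n) star_poly set \<Rightarrow> real) \<Rightarrow> bool" where
  "circle_action_extends R N \<longleftrightarrow>
    (let B = cstar_completion (presented_algebra R) N;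
         \<iota> = (\<lambda>a. to_completion (presented_algebra R) N (star_class R a))
     in \<exists>\<alpha>. circle_action B \<alpha> \<and>
       (\<forall>z\<in>sphere 0 1. (\<forall>f. \<alpha> z (\<iota> (Coef f)) = \<iota> (Coef f)) \<and>
         (\<forall>l. \<alpha> z (\<iota> (Gen l)) = z \<odot>\<^bsub>B\<^esub> \<iota> (Gen l))))"


section \<open>Hilbert modules and their operators\<close>

record (overloaded) ('x, 'v) hilbert_module =
  vecs :: "'v set"
  vzero :: 'v
  vadd :: "'v \<Rightarrow> 'v \<Rightarrow> 'v"
  vact :: "'v \<Rightarrow> ('x \<Rightarrow>\<^sub>C complex) \<Rightarrow> 'v"
  vinner :: "'v \<Rightarrow> 'v \<Rightarrow> ('x \<Rightarrow>\<^sub>C complex)"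

definition vnorm :: "('x::topological_space, 'v) hilbert_module \<Rightarrow> 'v \<Rightarrow> real"
  where "vnorm M x = sqrt (norm (vinner M x x))"

definition direct_sum ::
  "(nat \<Rightarrow> ('x::topological_space, 'v) hilbert_module) \<Rightarrow> ('x, nat \<Rightarrow> 'v) hilbert_module" where
  "direct_sum M = \<lparr>
    vecs = {x. (\<forall>k. x k \<in> vecs (M k)) \<and> summable (\<lambda>k. vinner (M k) (x k) (x k))},
    vzero = (\<lambda>k. vzero (M k)),
    vadd = (\<lambda>x y k. vadd (M k) (x k) (y k)),
    vact = (\<lambda>x f k. vact (M k) (x k) f),
    vinner = (\<lambda>x y. \<Sum>k. vinner (M k) (x k) (y k))\<rparr>"

definition is_adjoint ::
  "('x::topological_space, 'v) hilbert_module \<Rightarrow> ('v \<Rightarrow> 'v) \<Rightarrow> ('v \<Rightarrow> 'v) \<Rightarrow> bool" where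
  "is_adjoint M T S \<longleftrightarrow> S \<in> vecs M \<rightarrow>\<^sub>E vecs M \<and>
    (\<forall>x\<in>vecs M. \<forall>y\<in>vecs M. vinner M (T x) y = vinner M x (S y))"

definition adjointable_ops ::
  "('x::topological_space, 'v) hilbert_module \<Rightarrow> ('v \<Rightarrow> 'v) normed_star_algebra" where
  "adjointable_ops M = \<lparr>
    carrier = {T \<in> vecs M \<rightarrow>\<^sub>E vecs M. \<exists>S. is_adjoint M T S},
    mult = (\<lambda>S T. compose (vecs M) S T),
    one = (\<lambda>x\<in>vecs M. x),
    zero = (\<lambda>x\<in>vecs M. vzero M),
    add = (\<lambda>S T. \<lambda>x\<in>vecs M. vadd M (S x) (T x)),
    smult = (\<lambda>c T. \<lambda>x\<in>vecs M. vact M (T x) (const_bcontfun c)),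
    star = (\<lambda>T. THE S. is_adjoint M T S),
    nrm = (\<lambda>T. SUP x\<in>{x \<in> vecs M. vnorm M x \<le> 1}. vnorm M (T x))\<rparr>"

definition rank_one ::
  "('x::topological_space, 'v) hilbert_module \<Rightarrow> 'v \<Rightarrow> 'v \<Rightarrow> 'v \<Rightarrow> 'v"
  where "rank_one M x y = (\<lambda>z\<in>vecs M. vact M x (vinner M y z))"

definition compact_ops :: "('x::topological_space, 'v) hilbert_module \<Rightarrow> ('v \<Rightarrow> 'v) set" where
  "compact_ops M =
    closed_span (adjointable_ops M) {rank_one M x y | x y. x \<in> vecs M \<and> y \<in> vecs M}"


section \<open>The Fock module, the Toeplitz algebra and the Pimsner algebra\<close>

text \<open>The module of continuous sections of the bundle of \<open>E\<close>, i.e. \<open>E (\<oplus>\<^sup>n C(X))\<close>.\<close>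

definition section_module ::
  "('x::topological_space \<Rightarrow>\<^sub>C complex)^'n^'n \<Rightarrow> ('x, ('x \<Rightarrow>\<^sub>C complex)^'n) hilbert_module" where
  "section_module E = \<lparr>
    vecs = range (\<lambda>v. E *v v),
    vzero = 0,
    vadd = (+),
    vact = (\<lambda>v f. \<chi> i. v $ i * f),
    vinner = (\<lambda>v w. \<Sum>i\<in>UNIV. conj_bcontfun (v $ i) * w $ i)\<rparr>"

text \<open>The \<open>k\<close>-th tensor power sits inside the free module on the words of length \<open>k\<close> over \<open>'n\<close>;
  its elements are functions of all words which vanish off length \<open>k\<close>, and for \<open>k = 0\<close> this is
  \<open>C(X)\<close> on the empty word. An elementary tensor \<open>v \<otimes> y\<close> has the coordinates \<open>v\<^sub>i y\<^sub>w\<close> at the words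
  \<open>i # w\<close>. The finite sums of elementary tensors are already complete, since the section module is
  finitely generated and projective; see \<open>vinner_tensor\<close> and \<open>tensor_power_Suc_iff\<close> below.\<close>

definition tensor ::
  "('x::topological_space \<Rightarrow>\<^sub>C complex)^'n \<Rightarrow> ('n list \<Rightarrow> 'x \<Rightarrow>\<^sub>C complex) \<Rightarrow>
   'n list \<Rightarrow> 'x \<Rightarrow>\<^sub>C complex"
  where "tensor v y = (\<lambda>w. case w of [] \<Rightarrow> 0 | i # u \<Rightarrow> v $ i * y u)"

primrec tensor_power_vecs ::
  "('x::topological_space \<Rightarrow>\<^sub>C complex)^'n^'n \<Rightarrow> nat \<Rightarrow> ('n list \<Rightarrow> 'x \<Rightarrow>\<^sub>C complex) set" where
  "tensor_power_vecs E 0 = {y. \<forall>w. w \<noteq> [] \<longrightarrow> y w = 0}"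
| "tensor_power_vecs E (Suc k) = {\<lambda>w. \<Sum>j<m. tensor (v j) (y j) w | (m::nat) v y.
    \<forall>j<m. v j \<in> vecs (section_module E) \<and> y j \<in> tensor_power_vecs E k}"

definition tensor_power ::
  "('x::topological_space \<Rightarrow>\<^sub>C complex)^'n^'n \<Rightarrow> nat \<Rightarrow>
   ('x, 'n list \<Rightarrow> 'x \<Rightarrow>\<^sub>C complex) hilbert_module" where
  "tensor_power E k = \<lparr>
    vecs = tensor_power_vecs E k,
    vzero = (\<lambda>w. 0),
    vadd = (\<lambda>x y w. x w + y w),
    vact = (\<lambda>x f w. x w * f),
    vinner = (\<lambda>x y. \<Sum>w | length w = k. conj_bcontfun (x w) * y w)\<rparr>"

definition fock_module ::
  "('x::topological_space \<Rightarrow>\<^sub>C complex)^'n^'n \<Rightarrow>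
   ('x, nat \<Rightarrow> 'n list \<Rightarrow> 'x \<Rightarrow>\<^sub>C complex) hilbert_module"
  where "fock_module E = direct_sum (tensor_power E)"

definition creation ::
  "('x::topological_space \<Rightarrow>\<^sub>C complex)^'n^'n \<Rightarrow> ('x \<Rightarrow>\<^sub>C complex)^'n \<Rightarrow>
   (nat \<Rightarrow> 'n list \<Rightarrow> 'x \<Rightarrow>\<^sub>C complex) \<Rightarrow> nat \<Rightarrow> 'n list \<Rightarrow> 'x \<Rightarrow>\<^sub>C complex"
  where "creation E v = (\<lambda>x\<in>vecs (fock_module E).
    \<lambda>k. case k of 0 \<Rightarrow> vzero (tensor_power E 0) | Suc j \<Rightarrow> tensor v (x j))"

definition toeplitz_algebra ::
  "('x::topological_space \<Rightarrow>\<^sub>C complex)^'n^'n \<Rightarrow>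
   ((nat \<Rightarrow> 'n list \<Rightarrow> 'x \<Rightarrow>\<^sub>C complex) \<Rightarrow> nat \<Rightarrow> 'n list \<Rightarrow> 'x \<Rightarrow>\<^sub>C complex) normed_star_algebra"
  where "toeplitz_algebra E = adjointable_ops (fock_module E)
    \<lparr>carrier := generated_cstar (adjointable_ops (fock_module E))
      (creation E ` vecs (section_module E))\<rparr>"

definition pimsner_algebra ::
  "('x::topological_space \<Rightarrow>\<^sub>C complex)^'n^'n \<Rightarrow>
   ((nat \<Rightarrow> 'n list \<Rightarrow> 'x \<Rightarrow>\<^sub>C complex) \<Rightarrow> nat \<Rightarrow> 'n list \<Rightarrow> 'x \<Rightarrow>\<^sub>C complex) set
   normed_star_algebra"
  where "pimsner_algebra E = cstar_quotient (toeplitz_algebra E) (compact_ops (fock_module E))"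


text \<open>Consistency of the tensor powers with the interior tensor product: the defining formula
  \<open>\<langle>v \<otimes> y, v' \<otimes> y'\<rangle> = \<langle>y, \<langle>v, v'\<rangle> y'\<rangle>\<close> holds, and the \<open>(k+1)\<close>-st power is cut out of the
  functions on words by closed conditions.\<close>

lemma words_Suc: "{w :: 'n list. length w = Suc k} = (\<lambda>p. fst p # snd p) ` (UNIV \<times> {u. length u = k})"
  by (auto simp: length_Suc_conv image_iff)

lemma vinner_tensor:
  fixes E :: "('x::topological_space \<Rightarrow>\<^sub>C complex)^'n^'n"
  shows "vinner (tensor_power E (Suc k)) (tensor v y) (tensor v' y') =
    vinner (tensor_power E k) y (vact (tensor_power E k) y' (vinner (section_module E) v v'))"
proof -
  have conj_mult: "conj_bcontfun (f * g) = conj_bcontfun f * conj_bcontfun g"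
    for f g :: "'x \<Rightarrow>\<^sub>C complex"
    by (rule bcontfun_eqI) (simp add: apply_conj apply_times)
  have inj: "inj_on (\<lambda>p. fst p # snd p) (UNIV \<times> {u :: 'n list. length u = k})"
    by (auto simp: inj_on_def prod_eq_iff)
  have "vinner (tensor_power E (Suc k)) (tensor v y) (tensor v' y') =
    (\<Sum>(i, u)\<in>UNIV \<times> {u. length u = k}. conj_bcontfun (v $ i * y u) * (v' $ i * y' u))"
    by (simp add: tensor_power_def words_Suc sum.reindex[OF inj] tensor_def case_prod_unfold)
  also have "\<dots> = (\<Sum>i\<in>UNIV. \<Sum>u | length u = k. conj_bcontfun (v $ i * y u) * (v' $ i * y' u))"
    by (simp add: sum.cartesian_product)
  also have "\<dots> = (\<Sum>u | length u = k. \<Sum>i\<in>UNIV. conj_bcontfun (v $ i * y u) * (v' $ i * y' u))"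
    by (rule sum.swap)
  also have "\<dots> =
    vinner (tensor_power E k) y (vact (tensor_power E k) y' (vinner (section_module E) v v'))"
    by (simp add: tensor_power_def section_module_def conj_mult sum_distrib_left mult_ac)
  finally show ?thesis .
qed

lemma tensor_power_Suc_iff_aux:
  fixes E :: "('x::topological_space \<Rightarrow>\<^sub>C complex)^'n^'n"
  assumes E: "E ** E = E"
    and comb: "\<And>(J :: nat set) f y. \<forall>j\<in>J. y j \<in> tensor_power_vecs E k \<Longrightarrow> finite J \<Longrightarrow>
      (\<lambda>w. \<Sum>j\<in>J. f j * y j w) \<in> tensor_power_vecs E k"
  shows "y \<in> tensor_power_vecs E (Suc k) \<longleftrightarrow> y [] = 0 \<and>
    (\<forall>i. (\<lambda>u. y (i # u)) \<in> tensor_power_vecs E k) \<and>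
    (\<forall>i u. (\<Sum>j\<in>UNIV. E $ i $ j * y (j # u)) = y (i # u))" (is "_ \<longleftrightarrow> ?R")
proof
  assume "y \<in> tensor_power_vecs E (Suc k)"
  then obtain m :: nat and v z where y: "y = (\<lambda>w. \<Sum>j<m. tensor (v j) (z j) w)"
    and vz: "\<forall>j<m. v j \<in> vecs (section_module E) \<and> z j \<in> tensor_power_vecs E k"
    by auto
  have Ev: "(\<Sum>l\<in>UNIV. E $ i $ l * v j $ l) = v j $ i" if "j < m" for i j
  proof -
    have "v j \<in> range (\<lambda>a. E *v a)"
      using vz that by (simp add: section_module_def)
    then obtain a where a: "v j = E *v a"
      by blast
    have "E *v (v j) = v j"
      by (simp add: a matrix_vector_mul_assoc E)
    then have "(E *v (v j)) $ i = v j $ i"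
      by simp
    then show ?thesis
      by (simp add: matrix_vector_mult_def)
  qed
  have "(\<lambda>u. y (i # u)) \<in> tensor_power_vecs E k" for i
    using comb[of "{..<m}" z "\<lambda>j. v j $ i"] vz by (simp add: y tensor_def)
  moreover have "(\<Sum>l\<in>UNIV. E $ i $ l * y (l # u)) = y (i # u)" for i u
  proof -
    have "(\<Sum>l\<in>UNIV. E $ i $ l * y (l # u)) = (\<Sum>j<m. \<Sum>l\<in>UNIV. E $ i $ l * v j $ l * z j u)"
      by (simp add: y tensor_def sum_distrib_left mult.assoc sum.swap[of _ "{..<m}" UNIV])
    also have "\<dots> = y (i # u)"
      by (simp add: y tensor_def sum_distrib_right[symmetric] Ev)
    finally show ?thesis .
  qed
  ultimately show ?R
    by (simp add: y tensor_def)
next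
  assume R: ?R
  obtain h where h: "bij_betw h {..<CARD('n)} (UNIV :: 'n set)"
    using ex_bij_betw_nat_finite[of "UNIV :: 'n set"] by (auto simp: atLeast0LessThan)
  define v where "v = (\<lambda>j. E *v axis (h j) 1)"
  have v: "v j $ i = E $ i $ h j" for i j
    by (simp add: v_def matrix_vector_mult_def axis_def if_distrib cong: if_cong)
  have "y w = (\<Sum>j<CARD('n). tensor (v j) (\<lambda>u. y (h j # u)) w)" for w
  proof (cases w)
    case Nil
    then show ?thesis
      using R by (simp add: tensor_def)
  next
    case (Cons i u)
    then show ?thesis
      using R sum.reindex_bij_betw[OF h, of "\<lambda>j. E $ i $ j * y (j # u)"]
      by (simp add: tensor_def v)
  qed
  then have "y = (\<lambda>w. \<Sum>j<CARD('n). tensor (v j) (\<lambda>u. y (h j # u)) w)"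
    by (rule ext)
  moreover have "\<forall>j<CARD('n). v j \<in> vecs (section_module E) \<and>
      (\<lambda>u. y (h j # u)) \<in> tensor_power_vecs E k"
    using R by (simp add: v_def section_module_def)
  ultimately show "y \<in> tensor_power_vecs E (Suc k)"
    unfolding tensor_power_vecs.simps mem_Collect_eq
    by (intro exI[of _ "CARD('n)"] exI[of _ v] exI[of _ "\<lambda>j u. y (h j # u)"]) simp
qed

lemma tensor_power_vecs_comb:
  fixes E :: "('x::topological_space \<Rightarrow>\<^sub>C complex)^'n^'n" and J :: "nat set"
  assumes E: "E ** E = E"
  shows "\<forall>j\<in>J. y j \<in> tensor_power_vecs E k \<Longrightarrow> finite J \<Longrightarrow>
    (\<lambda>w. \<Sum>j\<in>J. f j * y j w) \<in> tensor_power_vecs E k"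
proof (induction k arbitrary: J f y)
  case 0
  then show ?case
    by simp
next
  case (Suc k)
  note iff = tensor_power_Suc_iff_aux[OF E Suc.IH]
  have y_iff: "y j [] = 0 \<and> (\<forall>i. (\<lambda>u. y j (i # u)) \<in> tensor_power_vecs E k) \<and>
      (\<forall>i u. (\<Sum>l\<in>UNIV. E $ i $ l * y j (l # u)) = y j (i # u))" if "j \<in> J" for j
    by (rule iff[THEN iffD1, OF _ _ bspec[OF Suc.prems(1) that]])
  then have y: "y j [] = 0" "(\<lambda>u. y j (i # u)) \<in> tensor_power_vecs E k"
    "(\<Sum>l\<in>UNIV. E $ i $ l * y j (l # u)) = y j (i # u)" if "j \<in> J" for i j u
    using that by simp_all
  have "(\<Sum>l\<in>UNIV. E $ i $ l * (\<Sum>j\<in>J. f j * y j (l # u))) = (\<Sum>j\<in>J. f j * y j (i # u))" for i u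
  proof -
    have "(\<Sum>l\<in>UNIV. E $ i $ l * (\<Sum>j\<in>J. f j * y j (l # u))) =
        (\<Sum>j\<in>J. f j * (\<Sum>l\<in>UNIV. E $ i $ l * y j (l # u)))"
      by (simp add: sum_distrib_left mult_ac sum.swap[of _ J UNIV])
    also have "\<dots> = (\<Sum>j\<in>J. f j * y j (i # u))"
      by (simp add: y)
    finally show ?thesis .
  qed
  moreover have "(\<lambda>u. \<Sum>j\<in>J. f j * y j (i # u)) \<in> tensor_power_vecs E k" for i
    by (rule Suc.IH) (use y Suc.prems(2) in auto)
  ultimately show ?case
    by (intro iff[THEN iffD2]) (simp_all add: y)
qed

lemmas tensor_power_Suc_iff = tensor_power_Suc_iff_aux[OF _ tensor_power_vecs_comb]

end

theory Submission
  imports Defs "HOL-Library.Function_Algebras"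
begin

text \<open>
  The relations \<open>\<psi>\<^sub>l\<^sup>*\<psi>\<^sub>m = E\<^sub>l\<^sub>m\<close> let every polynomial in the generators be written as a sum of monomials
  \<open>\<psi>\<^sub>u f \<psi>\<^sub>v\<^sup>*\<close>, where \<open>\<psi>\<^sub>u\<close> is the product of the generators along a word \<open>u\<close>. The number
  \<open>|u| - |v|\<close> grades the algebra, and the circle action multiplies the part of degree \<open>i\<close> by \<open>z\<^sup>i\<close>.

  \<^bold>\<open>Uniqueness.\<close> Let \<open>p\<close> and \<open>N\<close> be C*-seminorms, \<open>N\<close> invariant under the circle, and
  \<open>p \<le> N\<close> on \<open>C(X)\<close>. Then \<open>p \<le> N\<close> everywhere (\<open>pimsner_seminorm_le\<close>). In degree zero, let \<open>core k\<close> be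
  the span of the monomials with \<open>|u| = |v| \<le> k\<close>. Compressing \<open>y\<close> to the elements \<open>\<psi>\<^sub>l\<^sup>* y \<psi>\<^sub>m\<close> leads from
  \<open>core (k + 1)\<close> to \<open>core k\<close>, and \<open>y = \<Sum> \<psi>\<^sub>l (\<psi>\<^sub>l\<^sup>* y \<psi>\<^sub>m) \<psi>\<^sub>m\<^sup>*\<close> because \<open>\<Sum> \<psi>\<^sub>l \<psi>\<^sub>l\<^sup>* = 1\<close>. So an estimate
  \<open>p \<le> C N\<close> passes from \<open>core k\<close> to \<open>core (k + 1)\<close>, with a larger \<open>C\<close>. The constant disappears by squaring:
  \<open>p(x)\<^bsup>2^m\<^esup> = p(x\<^bsup>2^m\<^esup>) \<le> C N(x)\<^bsup>2^m\<^esup>\<close> for self-adjoint \<open>x\<close>. In general an element of degrees between \<open>-D\<close>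
  and \<open>D\<close> is the sum of \<open>2 D + 1\<close> homogeneous components. They are averages over the circle,
  so \<open>N\<close> does not increase in passing to them, and by the C*-identity the case of degree zero applies to
  each. This gives \<open>p \<le> (2 D + 1) N\<close>, and since squaring only doubles \<open>D\<close>, this factor
  disappears in the same way (\<open>seminorm_le_if_core_le\<close>). Two norms as in the theorem thus bound each other. The
  compressions also show that such an \<open>N\<close> is faithful if it is faithful on \<open>C(X)\<close>
  (\<open>pimsner_seminorm_faithful\<close>).

  \<^bold>\<open>Without the last relation\<close> the projection \<open>Q = \<Sum> \<psi>\<^sub>l \<psi>\<^sub>l\<^sup>*\<close> still acts as a unit, up to elements of
  seminorm zero, on the span of the \<open>\<psi>\<^sub>l s \<psi>\<^sub>m\<^sup>*\<close>. An element of the core is a function \<open>f\<close> plus an element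
  of this span, and the induction goes through if \<open>N(f) \<le> N(f + y)\<close> for such \<open>y\<close>
  (\<open>toeplitz_seminorm_le\<close>). The operator norm on the Fock module has this property, as the vacuum
  expectation of \<open>f + y\<close> is \<open>f\<close>. Every C*-seminorm is at most the sup-norm on \<open>C(X)\<close>
  (\<open>coef_le_norm\<close>), and so the operator norm is the greatest C*-seminorm (\<open>toeplitz_universal\<close>).

  \<^bold>\<open>Existence.\<close> The creation operators of the columns of \<open>E\<close> satisfy the Toeplitz relations. They generate
  the Toeplitz algebra together with \<open>C(X)\<close>, which is itself generated by them since the rank of a bundle with
  nonzero fibres is invertible. The operator \<open>1 - Q\<close> is the projection onto the vacuum, hence compact, so all
  relations hold in the Pimsner algebra. The projections onto the levels \<open>k < n\<close> are an approximate unit of the compact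
  operators, so the quotient norm of \<open>a\<close> is the limit of the norms of \<open>a\<close> on the levels \<open>k \<ge> n\<close>
  (\<open>quot_nrm_lim\<close>). Every level has a unit vector over every point of \<open>X\<close>; thus the
  quotient norm extends the sup-norm (\<open>nrm_coset_scalar\<close>). The circle acts by conjugation with the
  unitaries that multiply level \<open>k\<close> by \<open>z\<^sup>k\<close> (\<open>circle_action_Pim\<close>). Finally, a C*-algebra is the completion of
  any dense *-subalgebra (\<open>completion_iso\<close>).
\<close>

section \<open>Algebras with involution and their C*-seminorms\<close>

locale involutive_algebra = ring A for A :: "('a, 'm) star_algebra_scheme" (structure) +
  assumes smult_closed [simp, intro]: "a \<in> carrier A \<Longrightarrow> c \<odot> a \<in> carrier A"
    and smult_add_left: "a \<in> carrier A \<Longrightarrow> (c + d) \<odot> a = c \<odot> a \<oplus> d \<odot> a"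
    and smult_add_right: "a \<in> carrier A \<Longrightarrow> b \<in> carrier A \<Longrightarrow> c \<odot> (a \<oplus> b) = c \<odot> a \<oplus> c \<odot> b"
    and smult_smult: "a \<in> carrier A \<Longrightarrow> c \<odot> (d \<odot> a) = (c * d) \<odot> a"
    and smult_one [simp]: "a \<in> carrier A \<Longrightarrow> 1 \<odot> a = a"
    and smult_mult_left: "a \<in> carrier A \<Longrightarrow> b \<in> carrier A \<Longrightarrow> (c \<odot> a) \<otimes> b = c \<odot> (a \<otimes> b)"
    and smult_mult_right: "a \<in> carrier A \<Longrightarrow> b \<in> carrier A \<Longrightarrow> a \<otimes> (c \<odot> b) = c \<odot> (a \<otimes> b)"
    and star_closed [simp, intro]: "a \<in> carrier A \<Longrightarrow> star A a \<in> carrier A"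
    and star_star [simp]: "a \<in> carrier A \<Longrightarrow> star A (star A a) = a"
    and star_add: "a \<in> carrier A \<Longrightarrow> b \<in> carrier A \<Longrightarrow> star A (a \<oplus> b) = star A a \<oplus> star A b"
    and star_smult: "a \<in> carrier A \<Longrightarrow> star A (c \<odot> a) = cnj c \<odot> star A a"
    and star_mult: "a \<in> carrier A \<Longrightarrow> b \<in> carrier A \<Longrightarrow> star A (a \<otimes> b) = star A b \<otimes> star A a"
begin

lemma smult_zero_left [simp]: "a \<in> carrier A \<Longrightarrow> 0 \<odot> a = \<zero>"
  using smult_add_left[of a 0 0] by (simp add: add.l_cancel_one' )

lemma smult_zero_right [simp]: "c \<odot> \<zero> = \<zero>"
  using smult_add_right[of "\<zero>" "\<zero>" c] by (simp add: add.l_cancel_one' )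

lemma minus_eq_smult: "a \<in> carrier A \<Longrightarrow> \<ominus> a = (-1) \<odot> a"
proof -
  assume a: "a \<in> carrier A"
  have "(-1) \<odot> a \<oplus> a = \<zero>"
    using smult_add_left[of a "-1" 1] a by simp
  then show ?thesis
    using a by (simp add: minus_equality)
qed

lemma diff_eq_smult: "a \<in> carrier A \<Longrightarrow> b \<in> carrier A \<Longrightarrow> a \<ominus> b = a \<oplus> (-1) \<odot> b"
  by (simp add: a_minus_def minus_eq_smult)

lemma smult_diff_right:
  "a \<in> carrier A \<Longrightarrow> b \<in> carrier A \<Longrightarrow> c \<odot> (a \<ominus> b) = c \<odot> a \<ominus> c \<odot> b"
  by (simp add: diff_eq_smult smult_add_right smult_smult)

lemma star_diff: "a \<in> carrier A \<Longrightarrow> b \<in> carrier A \<Longrightarrow> star A (a \<ominus> b) = star A a \<ominus> star A b"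
  by (simp add: diff_eq_smult star_add star_smult)

lemma star_zero [simp]: "star A \<zero> = \<zero>"
  using star_smult[of "\<zero>" 0] by simp

lemma star_one [simp]: "star A \<one> = \<one>"
  using star_mult[of "star A \<one>" "\<one>"] by simp

lemma star_finsum:
  "finite I \<Longrightarrow> f \<in> I \<rightarrow> carrier A \<Longrightarrow> star A (finsum A f I) = finsum A (\<lambda>i. star A (f i)) I"
  by (induction I rule: finite_induct) (auto simp: Pi_def star_add)

lemma finsum_smult_left:
  "finite I \<Longrightarrow> a \<in> carrier A \<Longrightarrow> finsum A (\<lambda>i. h i \<odot> a) I = (\<Sum>i\<in>I. h i) \<odot> a"
  by (induction I rule: finite_induct) (auto simp: Pi_def smult_add_left)

lemma diff_add_cancel [simp]: "a \<in> carrier A \<Longrightarrow> b \<in> carrier A \<Longrightarrow> a \<ominus> b \<oplus> b = a"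
  by algebra

lemma diff_self [simp]: "a \<in> carrier A \<Longrightarrow> a \<ominus> a = \<zero>"
  by algebra

lemma diff_zero [simp]: "a \<in> carrier A \<Longrightarrow> a \<ominus> \<zero> = a"
  by algebra

lemma diff_eq_zero_iff: "a \<in> carrier A \<Longrightarrow> b \<in> carrier A \<Longrightarrow> a \<ominus> b = \<zero> \<longleftrightarrow> a = b"
  by (metis diff_add_cancel diff_self l_zero)

end

locale cstar_seminormed = involutive_algebra A for A :: "('a, 'm) star_algebra_scheme" (structure) +
  fixes N :: "'a \<Rightarrow> real"
  assumes seminorm: "cstar_seminorm A N"
begin

lemma N_nonneg [simp]: "a \<in> carrier A \<Longrightarrow> 0 \<le> N a"
  and N_add: "a \<in> carrier A \<Longrightarrow> b \<in> carrier A \<Longrightarrow> N (a \<oplus> b) \<le> N a + N b"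
  and N_smult: "a \<in> carrier A \<Longrightarrow> N (c \<odot> a) = norm c * N a"
  and N_mult: "a \<in> carrier A \<Longrightarrow> b \<in> carrier A \<Longrightarrow> N (a \<otimes> b) \<le> N a * N b"
  and N_cstar: "a \<in> carrier A \<Longrightarrow> N (star A a \<otimes> a) = (N a)\<^sup>2"
  using seminorm by (auto simp: cstar_seminorm_def)

lemma N_zero [simp]: "N \<zero> = 0"
  using N_smult[of "\<zero>" 0] by simp

lemma N_minus: "a \<in> carrier A \<Longrightarrow> N (\<ominus> a) = N a"
  by (simp add: minus_eq_smult N_smult)

lemma N_diff: "a \<in> carrier A \<Longrightarrow> b \<in> carrier A \<Longrightarrow> N (a \<ominus> b) \<le> N a + N b"
  using N_add[of a "\<ominus> b"] by (simp add: a_minus_def N_minus)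

lemma N_diff_commute: "a \<in> carrier A \<Longrightarrow> b \<in> carrier A \<Longrightarrow> N (a \<ominus> b) = N (b \<ominus> a)"
  by (metis N_minus a_minus_def add.inv_mult_group add.inv_closed add.m_closed minus_minus)

lemma N_diff_triangle:
  assumes "a \<in> carrier A" "b \<in> carrier A" "c \<in> carrier A"
  shows "N (a \<ominus> c) \<le> N (a \<ominus> b) + N (b \<ominus> c)"
proof -
  have "a \<ominus> c = (a \<ominus> b) \<oplus> (b \<ominus> c)"
    using assms by algebra
  then show ?thesis
    using N_add[of "a \<ominus> b" "b \<ominus> c"] assms by simp
qed

lemma N_le_diff: "a \<in> carrier A \<Longrightarrow> b \<in> carrier A \<Longrightarrow> N a \<le> N (a \<ominus> b) + N b"
  using N_diff_triangle[of a b "\<zero>"] by simp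

lemma N_abs_diff: "a \<in> carrier A \<Longrightarrow> b \<in> carrier A \<Longrightarrow> \<bar>N a - N b\<bar> \<le> N (a \<ominus> b)"
  using N_le_diff[of a b] N_le_diff[of b a] N_diff_commute[of a b] by linarith

lemma N_star [simp]: assumes "a \<in> carrier A" shows "N (star A a) = N a"
proof -
  have le: "N b \<le> N (star A b)" if "b \<in> carrier A" for b
  proof (cases "N b = 0")
    case False
    have "N b * N b \<le> N (star A b) * N b"
      using N_cstar[OF that] N_mult[of "star A b" b] that by (simp add: power2_eq_square)
    then show ?thesis
      using False N_nonneg[OF that] by simp
  qed (use that in auto)
  show ?thesis
    using le[OF assms] le[of "star A a"] assms by simp
qed

lemma N_one_le: "N \<one> \<le> 1"
proof -
  have "N \<one> * N \<one> = N \<one> * 1"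
    using N_cstar[of "\<one>"] by (simp add: power2_eq_square)
  then show ?thesis
    by (metis mult_cancel_left order_refl zero_le_one)
qed

lemma N_finsum:
  "finite I \<Longrightarrow> f \<in> I \<rightarrow> carrier A \<Longrightarrow> N (finsum A f I) \<le> (\<Sum>i\<in>I. N (f i))"
proof (induction I rule: finite_induct)
  case (insert i I)
  then show ?case
    using N_add[of "f i" "finsum A f I"] by (fastforce simp: Pi_def)
qed simp

lemma N_diff_mult:
  assumes "a \<in> carrier A" "a' \<in> carrier A" "b \<in> carrier A" "b' \<in> carrier A"
  shows "N (a \<otimes> b \<ominus> a' \<otimes> b') \<le> N a * N (b \<ominus> b') + N (a \<ominus> a') * N b'"
proof -
  have "a \<otimes> b \<ominus> a' \<otimes> b' = a \<otimes> (b \<ominus> b') \<oplus> (a \<ominus> a') \<otimes> b'"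
    using assms by algebra
  then show ?thesis
    using N_add[of "a \<otimes> (b \<ominus> b')" "(a \<ominus> a') \<otimes> b'"] N_mult[of a "b \<ominus> b'"]
      N_mult[of "a \<ominus> a'" b'] assms by simp
qed

lemma N_diff_add:
  assumes "a \<in> carrier A" "a' \<in> carrier A" "b \<in> carrier A" "b' \<in> carrier A"
  shows "N ((a \<oplus> b) \<ominus> (a' \<oplus> b')) \<le> N (a \<ominus> a') + N (b \<ominus> b')"
proof -
  have "(a \<oplus> b) \<ominus> (a' \<oplus> b') = (a \<ominus> a') \<oplus> (b \<ominus> b')"
    using assms by algebra
  then show ?thesis
    using N_add[of "a \<ominus> a'" "b \<ominus> b'"] assms by simp
qed

lemma N_diff_smult:
  "a \<in> carrier A \<Longrightarrow> a' \<in> carrier A \<Longrightarrow> N (c \<odot> a \<ominus> c \<odot> a') = norm c * N (a \<ominus> a')"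
  by (simp add: smult_diff_right[symmetric] N_smult)

lemma N_diff_star:
  "a \<in> carrier A \<Longrightarrow> a' \<in> carrier A \<Longrightarrow> N (star A a \<ominus> star A a') = N (a \<ominus> a')"
  by (simp add: star_diff[symmetric])

lemma N_eqI: "a \<in> carrier A \<Longrightarrow> b \<in> carrier A \<Longrightarrow> N (a \<ominus> b) = 0 \<Longrightarrow> N a = N b"
  using N_abs_diff[of a b] by simp

end

locale cstar_algebra = cstar_seminormed B "nrm B"
  for B :: "('b, 'm) normed_star_algebra_scheme" (structure) +
  assumes nrm_zeroD: "b \<in> carrier B \<Longrightarrow> nrm B b = 0 \<Longrightarrow> b = \<zero>"
    and complete: "s \<in> cauchy_seqs B (nrm B) \<Longrightarrow>
      \<exists>b\<in>carrier B. (\<lambda>i. nrm B (s i \<ominus> b)) \<longlonglongrightarrow> 0"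

definition involutive_hom ::
  "('a, 'm) star_algebra_scheme \<Rightarrow> ('b, 'k) star_algebra_scheme \<Rightarrow> ('a \<Rightarrow> 'b) \<Rightarrow> bool" where
  "involutive_hom A B h \<longleftrightarrow> h \<in> ring_hom A B \<and>
    (\<forall>a\<in>carrier A. (\<forall>c. h (c \<odot>\<^bsub>A\<^esub> a) = c \<odot>\<^bsub>B\<^esub> h a) \<and> h (star A a) = star B (h a))"

lemma involutive_homD:
  assumes "involutive_hom A B h" "a \<in> carrier A"
  shows "h a \<in> carrier B" "h (c \<odot>\<^bsub>A\<^esub> a) = c \<odot>\<^bsub>B\<^esub> h a" "h (star A a) = star B (h a)"
    "b \<in> carrier A \<Longrightarrow> h (a \<oplus>\<^bsub>A\<^esub> b) = h a \<oplus>\<^bsub>B\<^esub> h b"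
    "b \<in> carrier A \<Longrightarrow> h (a \<otimes>\<^bsub>A\<^esub> b) = h a \<otimes>\<^bsub>B\<^esub> h b"
  using assms by (auto simp: involutive_hom_def ring_hom_def)

lemma involutive_hom_one: "involutive_hom A B h \<Longrightarrow> h \<one>\<^bsub>A\<^esub> = \<one>\<^bsub>B\<^esub>"
  by (auto simp: involutive_hom_def ring_hom_def)

lemma involutive_hom_zero_diff:
  assumes "involutive_algebra A" "involutive_algebra B" "involutive_hom A B h"
  shows "h \<zero>\<^bsub>A\<^esub> = \<zero>\<^bsub>B\<^esub>"
    "a \<in> carrier A \<Longrightarrow> b \<in> carrier A \<Longrightarrow> h (a \<ominus>\<^bsub>A\<^esub> b) = h a \<ominus>\<^bsub>B\<^esub> h b"
proof -
  interpret A: involutive_algebra A by fact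
  interpret B: involutive_algebra B by fact
  note h = involutive_homD[OF assms(3)]
  show "h \<zero>\<^bsub>A\<^esub> = \<zero>\<^bsub>B\<^esub>"
    using h(2)[of "\<zero>\<^bsub>A\<^esub>" 0] h(1)[of "\<zero>\<^bsub>A\<^esub>"] by simp
  show "h (a \<ominus>\<^bsub>A\<^esub> b) = h a \<ominus>\<^bsub>B\<^esub> h b" if "a \<in> carrier A" "b \<in> carrier A"
    using that h by (simp add: A.diff_eq_smult B.diff_eq_smult)
qed

lemma cstar_seminorm_comp:
  assumes "involutive_algebra A" "involutive_hom A B h" "cstar_seminorm B N"
  shows "cstar_seminorm A (\<lambda>a. N (h a))"
  unfolding cstar_seminorm_def
  using assms(3) involutive_homD[OF assms(2)] involutive_algebra.star_closed[OF assms(1)]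
  by (auto simp: cstar_seminorm_def)

subsection \<open>Comparing C*-seminorms\<close>

text \<open>Squaring a self-adjoint element squares each C*-norm, while an inequality between two of them
  may lose a constant. Iterated squaring makes every constant of subexponential growth disappear.\<close>

lemma le_if_dyadic_powers_le:
  fixes a b :: real
  assumes "0 \<le> a" "0 \<le> b" and le: "\<And>m. a ^ (2 ^ m) \<le> K * 2 ^ m * b ^ (2 ^ m)"
  shows "a \<le> b"
proof (rule ccontr)
  assume "\<not> a \<le> b"
  then have ab: "b < a" by simp
  show False
  proof (cases "b = 0")
    case True
    then show ?thesis
      using le[of 0] ab by simp
  next
    case False
    define r where "r = b / a"
    have r: "0 \<le> r" "r < 1" "0 < r"
      using ab assms False by (auto simp: r_def)
    have "(\<lambda>n. K * (real n * r ^ n)) \<longlonglongrightarrow> K * 0"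
      by (intro tendsto_intros powser_times_n_limit_0) (use r in auto)
    moreover have "filterlim (\<lambda>m. 2 ^ m :: nat) sequentially sequentially"
      by (rule filterlim_subseq) (simp add: strict_mono_def)
    ultimately have "(\<lambda>m. K * (real (2 ^ m) * r ^ (2 ^ m))) \<longlonglongrightarrow> K * 0"
      by (rule filterlim_compose)
    then have "\<forall>\<^sub>F m in sequentially. K * (real (2 ^ m) * r ^ (2 ^ m)) < 1"
      by (intro order_tendstoD) auto
    then obtain m where m: "K * (real (2 ^ m) * r ^ (2 ^ m)) < 1"
      by (auto simp: eventually_sequentially)
    have "a ^ (2 ^ m) > 0"
      using ab assms by simp
    then have "K * (2 ^ m * b ^ (2 ^ m)) < a ^ (2 ^ m)"
      using m by (simp add: r_def power_divide field_simps)
    then show False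
      using le[of m] by (simp add: mult.assoc)
  qed
qed

lemma cstar_seminorm_le_by_squaring:
  assumes "cstar_seminormed A p" "cstar_seminormed A N"
    and x: "x \<in> D k" "x \<in> carrier A" "star A x = x"
    and square: "\<And>k x. x \<in> D k \<Longrightarrow> x \<in> carrier A \<Longrightarrow> star A x = x \<Longrightarrow> x \<otimes>\<^bsub>A\<^esub> x \<in> D (g k)"
    and bound: "\<And>m x. x \<in> D ((g ^^ m) k) \<Longrightarrow> x \<in> carrier A \<Longrightarrow> star A x = x \<Longrightarrow> p x \<le> K * 2 ^ m * N x"
  shows "p x \<le> N x"
proof -
  interpret p: cstar_seminormed A p by fact
  interpret N: cstar_seminormed A N by fact
  define y where "y = (\<lambda>m. ((\<lambda>x. x \<otimes>\<^bsub>A\<^esub> x) ^^ m) x)"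
  have y: "y m \<in> D ((g ^^ m) k) \<and> y m \<in> carrier A \<and> star A (y m) = y m \<and>
      p (y m) = p x ^ (2 ^ m) \<and> N (y m) = N x ^ (2 ^ m)" for m
  proof (induction m)
    case (Suc m)
    have "y (Suc m) = y m \<otimes>\<^bsub>A\<^esub> y m"
      by (simp add: y_def)
    moreover have "p (y m \<otimes>\<^bsub>A\<^esub> y m) = (p (y m))\<^sup>2" "N (y m \<otimes>\<^bsub>A\<^esub> y m) = (N (y m))\<^sup>2"
      using Suc p.N_cstar[of "y m"] N.N_cstar[of "y m"] by auto
    ultimately show ?case
      using Suc square by (auto simp: p.star_mult power_mult[symmetric] mult.commute)
  qed (use x in \<open>auto simp: y_def\<close>)
  show ?thesis
    by (rule le_if_dyadic_powers_le[of _ _ K])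
      (use y bound p.N_nonneg N.N_nonneg x in \<open>auto, metis\<close>)
qed

section \<open>Limits and completions\<close>

definition seq_lim ::
  "('a, 'm) star_algebra_scheme \<Rightarrow> ('a \<Rightarrow> real) \<Rightarrow> (nat \<Rightarrow> 'a) \<Rightarrow> 'a \<Rightarrow> bool" where
  "seq_lim A N s a \<longleftrightarrow> (\<forall>i. s i \<in> carrier A) \<and> a \<in> carrier A \<and> (\<lambda>i. N (s i \<ominus>\<^bsub>A\<^esub> a)) \<longlonglongrightarrow> 0"

context cstar_seminormed
begin

lemma seq_limD:
  assumes "seq_lim A N s a"
  shows "s i \<in> carrier A" "a \<in> carrier A" "(\<lambda>i. N (s i \<ominus> a)) \<longlonglongrightarrow> 0"
  using assms by (auto simp: seq_lim_def)

lemma seq_lim_const: "a \<in> carrier A \<Longrightarrow> seq_lim A N (\<lambda>i. a) a"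
  by (simp add: seq_lim_def)

lemma seq_limI_le:
  assumes "\<And>i. s i \<in> carrier A" "a \<in> carrier A" "\<And>i. N (s i \<ominus> a) \<le> e i" "e \<longlonglongrightarrow> 0"
  shows "seq_lim A N s a"
  unfolding seq_lim_def
  using assms by (auto intro: real_tendsto_sandwich[of "\<lambda>_. 0" _ _ e])

lemma seq_lim_N:
  assumes "seq_lim A N s a" shows "(\<lambda>i. N (s i)) \<longlonglongrightarrow> N a"
proof (rule LIMSEQ_I)
  fix r :: real assume "0 < r"
  then obtain M where M: "\<And>i. i \<ge> M \<Longrightarrow> \<bar>N (s i \<ominus> a)\<bar> < r"
    using LIMSEQ_D[OF seq_limD(3)[OF assms]] by fastforce
  have "norm (N (s i) - N a) < r" if "i \<ge> M" for i
    using N_abs_diff[OF seq_limD(1,2)[OF assms], of i] M[OF that] by simp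
  then show "\<exists>no. \<forall>n\<ge>no. norm (N (s n) - N a) < r"
    by blast
qed

lemma seq_lim_add:
  assumes s: "seq_lim A N s a" and t: "seq_lim A N t b"
  shows "seq_lim A N (\<lambda>i. s i \<oplus> t i) (a \<oplus> b)"
proof (rule seq_limI_le)
  show "(\<lambda>i. N (s i \<ominus> a) + N (t i \<ominus> b)) \<longlonglongrightarrow> 0"
    using tendsto_add[OF seq_limD(3)[OF s] seq_limD(3)[OF t]] by simp
qed (use seq_limD[OF s] seq_limD[OF t] N_diff_add in auto)

lemma seq_lim_smult:
  assumes s: "seq_lim A N s a"
  shows "seq_lim A N (\<lambda>i. c \<odot> s i) (c \<odot> a)"
proof (rule seq_limI_le)
  show "(\<lambda>i. norm c * N (s i \<ominus> a)) \<longlonglongrightarrow> 0"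
    using tendsto_mult[OF tendsto_const seq_limD(3)[OF s], of "norm c"] by simp
qed (use seq_limD[OF s] N_diff_smult in auto)

lemma seq_lim_star:
  assumes s: "seq_lim A N s a"
  shows "seq_lim A N (\<lambda>i. star A (s i)) (star A a)"
  using seq_limD[OF s] N_diff_star by (auto simp: seq_lim_def)

lemma seq_lim_mult:
  assumes s: "seq_lim A N s a" and t: "seq_lim A N t b"
  shows "seq_lim A N (\<lambda>i. s i \<otimes> t i) (a \<otimes> b)"
proof (rule seq_limI_le)
  have "(\<lambda>i. N (s i) * N (t i \<ominus> b) + N (s i \<ominus> a) * N b) \<longlonglongrightarrow> N a * 0 + 0 * N b"
    by (intro tendsto_intros seq_lim_N[OF s] seq_limD(3)[OF s] seq_limD(3)[OF t])
  then show "(\<lambda>i. N (s i) * N (t i \<ominus> b) + N (s i \<ominus> a) * N b) \<longlonglongrightarrow> 0"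
    by simp
qed (use seq_limD[OF s] seq_limD[OF t] N_diff_mult in auto)

lemma seq_lim_diff:
  assumes s: "seq_lim A N s a" and t: "seq_lim A N t b"
  shows "seq_lim A N (\<lambda>i. s i \<ominus> t i) (a \<ominus> b)"
proof -
  have "seq_lim A N (\<lambda>i. s i \<oplus> (-1) \<odot> t i) (a \<oplus> (-1) \<odot> b)"
    by (intro seq_lim_add seq_lim_smult s t)
  then show ?thesis
    using seq_limD[OF s] seq_limD[OF t] by (simp add: diff_eq_smult)
qed

lemma seq_lim_approx:
  assumes "\<And>e. 0 < e \<Longrightarrow> \<exists>b. P b \<and> b \<in> carrier A \<and> N (b \<ominus> a) < e" and a: "a \<in> carrier A"
  obtains s where "\<And>i. P (s i)" "seq_lim A N s a"
proof -
  have "\<exists>b. P b \<and> b \<in> carrier A \<and> N (b \<ominus> a) < inverse (real (Suc i))" for i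
    by (rule assms(1)) simp
  then obtain s where s: "\<And>i. P (s i)" "\<And>i. s i \<in> carrier A" "\<And>i. N (s i \<ominus> a) < inverse (real (Suc i))"
    by metis
  have "seq_lim A N s a"
    by (rule seq_limI_le[OF s(2) a less_imp_le[OF s(3)] LIMSEQ_inverse_real_of_nat])
  then show thesis
    using that s(1) by blast
qed

lemma seq_lim_cauchy:
  assumes s: "seq_lim A N s a" shows "s \<in> cauchy_seqs A N"
  unfolding cauchy_seqs_def
proof (intro CollectI conjI allI impI)
  fix e :: real assume "0 < e"
  then obtain M where M: "\<And>i. i \<ge> M \<Longrightarrow> \<bar>N (s i \<ominus> a)\<bar> < e / 2"
    using LIMSEQ_D[OF seq_limD(3)[OF s], of "e / 2"] by fastforce
  have "N (s i \<ominus> s j) < e" if "i \<ge> M" "j \<ge> M" for i j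
    using N_diff_triangle[of "s i" a "s j"] N_diff_commute[of a "s j"] M[OF that(1)] M[OF that(2)]
      seq_limD[OF s] by fastforce
  then show "\<exists>M. \<forall>i\<ge>M. \<forall>j\<ge>M. N (s i \<ominus> s j) < e"
    by blast
qed (use seq_limD[OF s] in auto)

lemma cauchy_seqsD: "s \<in> cauchy_seqs A N \<Longrightarrow> s i \<in> carrier A"
  by (simp add: cauchy_seqs_def)

lemma cauchy_seqs_ge:
  assumes "s \<in> cauchy_seqs A N" "0 < e"
  obtains M where "\<And>i j. i \<ge> M \<Longrightarrow> j \<ge> M \<Longrightarrow> N (s i \<ominus> s j) < e"
  using assms unfolding cauchy_seqs_def by blast

lemma cauchy_seqs_N:
  assumes s: "s \<in> cauchy_seqs A N" obtains r where "(\<lambda>i. N (s i)) \<longlonglongrightarrow> r"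
proof -
  have "Cauchy (\<lambda>i. N (s i))"
  proof (rule CauchyI)
    fix e :: real assume "0 < e"
    then obtain M where M: "\<And>i j. i \<ge> M \<Longrightarrow> j \<ge> M \<Longrightarrow> N (s i \<ominus> s j) < e"
      using cauchy_seqs_ge[OF s] by blast
    have "norm (N (s i) - N (s j)) < e" if "i \<ge> M" "j \<ge> M" for i j
      using N_abs_diff[OF cauchy_seqsD[OF s] cauchy_seqsD[OF s], of i j] M[OF that] by simp
    then show "\<exists>M. \<forall>m\<ge>M. \<forall>n\<ge>M. norm (N (s m) - N (s n)) < e"
      by blast
  qed
  then show thesis
    using that by (auto simp: Cauchy_convergent_iff convergent_def)
qed

lemma cauchy_seqs_bounded:
  assumes s: "s \<in> cauchy_seqs A N" obtains K where "0 < K" "\<And>i. N (s i) \<le> K"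
proof -
  obtain r where "(\<lambda>i. N (s i)) \<longlonglongrightarrow> r"
    using cauchy_seqs_N[OF s] by blast
  then have "Bseq (\<lambda>i. N (s i))"
    by (rule convergent_imp_Bseq[OF convergentI])
  then obtain K where "0 < K" "\<forall>i. norm (N (s i)) \<le> K"
    by (rule BseqE)
  then show thesis
    using that by (metis real_norm_def abs_le_D1)
qed

lemma cauchy_seqs_lipschitz:
  assumes s: "s \<in> cauchy_seqs A N" and t: "t \<in> cauchy_seqs A N" and "\<And>i. u i \<in> carrier A"
    and le: "\<And>i j. N (u i \<ominus> u j) \<le> K * N (s i \<ominus> s j) + L * N (t i \<ominus> t j)" and KL: "0 < K" "0 < L"
  shows "u \<in> cauchy_seqs A N"
  unfolding cauchy_seqs_def
proof (intro CollectI conjI allI impI)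
  fix e :: real assume e: "0 < e"
  obtain M where M: "\<And>i j. i \<ge> M \<Longrightarrow> j \<ge> M \<Longrightarrow> N (s i \<ominus> s j) < e / (2 * K)"
    using cauchy_seqs_ge[OF s, of "e / (2 * K)"] e KL by auto
  obtain M' where M': "\<And>i j. i \<ge> M' \<Longrightarrow> j \<ge> M' \<Longrightarrow> N (t i \<ominus> t j) < e / (2 * L)"
    using cauchy_seqs_ge[OF t, of "e / (2 * L)"] e KL by auto
  have "N (u i \<ominus> u j) < e" if "i \<ge> max M M'" "j \<ge> max M M'" for i j
  proof -
    have "K * N (s i \<ominus> s j) < e / 2" "L * N (t i \<ominus> t j) < e / 2"
      using M[of i j] M'[of i j] that KL by (auto simp: field_simps)
    then show ?thesis
      using le[of i j] by simp
  qed
  then show "\<exists>M. \<forall>i\<ge>M. \<forall>j\<ge>M. N (u i \<ominus> u j) < e"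
    by blast
qed (use assms in auto)

lemma cauchy_seqs_const: "a \<in> carrier A \<Longrightarrow> (\<lambda>i. a) \<in> cauchy_seqs A N"
  by (auto simp: cauchy_seqs_def)

lemma cauchy_seqs_add:
  assumes "s \<in> cauchy_seqs A N" "t \<in> cauchy_seqs A N"
  shows "(\<lambda>i. s i \<oplus> t i) \<in> cauchy_seqs A N"
  by (rule cauchy_seqs_lipschitz[OF assms, of _ 1 1]) (use assms[THEN cauchy_seqsD] N_diff_add in simp_all)

lemma cauchy_seqs_smult:
  assumes "s \<in> cauchy_seqs A N"
  shows "(\<lambda>i. c \<odot> s i) \<in> cauchy_seqs A N"
proof (rule cauchy_seqs_lipschitz[OF assms assms, of _ "norm c + 1" 1])
  note s = cauchy_seqsD[OF assms]
  show "N (c \<odot> s i \<ominus> c \<odot> s j) \<le> (norm c + 1) * N (s i \<ominus> s j) + 1 * N (s i \<ominus> s j)" for i j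
    using s by (simp add: N_diff_smult distrib_right)
  show "0 < norm c + 1"
    by (rule add_nonneg_pos) simp_all
qed (use cauchy_seqsD[OF assms] in auto)

lemma cauchy_seqs_star:
  assumes "s \<in> cauchy_seqs A N"
  shows "(\<lambda>i. star A (s i)) \<in> cauchy_seqs A N"
  by (rule cauchy_seqs_lipschitz[OF assms assms, of _ 1 1])
    (use cauchy_seqsD[OF assms] in \<open>simp_all add: N_diff_star\<close>)

lemma cauchy_seqs_mult:
  assumes s: "s \<in> cauchy_seqs A N" and t: "t \<in> cauchy_seqs A N"
  shows "(\<lambda>i. s i \<otimes> t i) \<in> cauchy_seqs A N"
proof -
  obtain K where K: "0 < K" "\<And>i. N (s i) \<le> K" using cauchy_seqs_bounded[OF s] by blast
  obtain L where L: "0 < L" "\<And>i. N (t i) \<le> L" using cauchy_seqs_bounded[OF t] by blast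
  note c = s[THEN cauchy_seqsD] t[THEN cauchy_seqsD]
  show ?thesis
  proof (rule cauchy_seqs_lipschitz[OF s t, of _ L K])
    fix i j
    show "N (s i \<otimes> t i \<ominus> s j \<otimes> t j) \<le> L * N (s i \<ominus> s j) + K * N (t i \<ominus> t j)"
    proof -
      have "N (s i \<otimes> t i \<ominus> s j \<otimes> t j) \<le> N (s i) * N (t i \<ominus> t j) + N (s i \<ominus> s j) * N (t j)"
        using c by (intro N_diff_mult)
      also have "N (s i) * N (t i \<ominus> t j) \<le> K * N (t i \<ominus> t j)"
        using K(2) c by (intro mult_right_mono) auto
      also have "N (s i \<ominus> s j) * N (t j) \<le> N (s i \<ominus> s j) * L"
        using L(2) c by (intro mult_left_mono) auto
      finally show ?thesis
        by (simp add: mult.commute add.commute)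
    qed
  qed (use c K L in auto)
qed

lemma null_rel_iff:
  "(s, t) \<in> null_rel A N \<longleftrightarrow>
    s \<in> cauchy_seqs A N \<and> t \<in> cauchy_seqs A N \<and> (\<lambda>i. N (s i \<ominus> t i)) \<longlonglongrightarrow> 0"
  by (auto simp: null_rel_def)

lemma null_relI_le:
  assumes "s \<in> cauchy_seqs A N" "t \<in> cauchy_seqs A N" "\<And>i. N (s i \<ominus> t i) \<le> e i" "e \<longlonglongrightarrow> 0"
  shows "(s, t) \<in> null_rel A N"
  unfolding null_rel_iff
  using assms cauchy_seqsD by (auto intro: real_tendsto_sandwich[of "\<lambda>_. 0" _ _ e])

lemma equiv_null_rel: "equiv (cauchy_seqs A N) (null_rel A N)"
proof (rule equivI)
  show "null_rel A N \<subseteq> cauchy_seqs A N \<times> cauchy_seqs A N"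
    by (auto simp: null_rel_iff)
  show "refl_on (cauchy_seqs A N) (null_rel A N)"
    using cauchy_seqsD by (auto simp: refl_on_def null_rel_iff)
  show "sym (null_rel A N)"
    by (rule symI) (auto simp: null_rel_iff N_diff_commute cauchy_seqsD)
  show "trans (null_rel A N)"
  proof (rule transI)
    fix s t u assume st: "(s, t) \<in> null_rel A N" and tu: "(t, u) \<in> null_rel A N"
    have "(\<lambda>i. N (s i \<ominus> t i) + N (t i \<ominus> u i)) \<longlonglongrightarrow> 0 + 0"
      using st tu by (intro tendsto_add) (auto simp: null_rel_iff)
    then show "(s, u) \<in> null_rel A N"
      using st tu
      by (intro null_relI_le[where e = "\<lambda>i. N (s i \<ominus> t i) + N (t i \<ominus> u i)"] N_diff_triangle)
        (auto simp: null_rel_iff cauchy_seqsD)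
  qed
qed

lemma null_rel_add:
  assumes "(s, s') \<in> null_rel A N" "(t, t') \<in> null_rel A N"
  shows "(\<lambda>i. s i \<oplus> t i, \<lambda>i. s' i \<oplus> t' i) \<in> null_rel A N"
proof (rule null_relI_le)
  show "(\<lambda>i. N (s i \<ominus> s' i) + N (t i \<ominus> t' i)) \<longlonglongrightarrow> 0"
    using assms tendsto_add[of _ 0 sequentially _ 0] by (auto simp: null_rel_iff)
qed (use assms in \<open>auto simp: null_rel_iff cauchy_seqsD intro!: cauchy_seqs_add N_diff_add\<close>)

lemma null_rel_smult:
  assumes "(s, s') \<in> null_rel A N"
  shows "(\<lambda>i. c \<odot> s i, \<lambda>i. c \<odot> s' i) \<in> null_rel A N"
proof (rule null_relI_le)
  show "(\<lambda>i. norm c * N (s i \<ominus> s' i)) \<longlonglongrightarrow> 0"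
    using assms tendsto_mult[OF tendsto_const, of _ 0 sequentially "norm c"] by (auto simp: null_rel_iff)
qed (use assms in \<open>auto simp: null_rel_iff cauchy_seqsD N_diff_smult intro!: cauchy_seqs_smult\<close>)

lemma null_rel_star:
  assumes "(s, s') \<in> null_rel A N"
  shows "(\<lambda>i. star A (s i), \<lambda>i. star A (s' i)) \<in> null_rel A N"
  using assms by (auto simp: null_rel_iff N_diff_star cauchy_seqsD intro!: cauchy_seqs_star)

lemma null_rel_mult:
  assumes s: "(s, s') \<in> null_rel A N" and t: "(t, t') \<in> null_rel A N"
  shows "(\<lambda>i. s i \<otimes> t i, \<lambda>i. s' i \<otimes> t' i) \<in> null_rel A N"
proof -
  obtain r where "(\<lambda>i. N (s i)) \<longlonglongrightarrow> r"
    using s cauchy_seqs_N by (auto simp: null_rel_iff)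
  moreover obtain r' where "(\<lambda>i. N (t' i)) \<longlonglongrightarrow> r'"
    using t cauchy_seqs_N by (auto simp: null_rel_iff)
  ultimately have "(\<lambda>i. N (s i) * N (t i \<ominus> t' i) + N (s i \<ominus> s' i) * N (t' i)) \<longlonglongrightarrow> r * 0 + 0 * r'"
    using s t by (intro tendsto_intros) (auto simp: null_rel_iff)
  then show ?thesis
    using s t by (intro null_relI_le[OF _ _ N_diff_mult])
      (auto simp: null_rel_iff cauchy_seqsD intro!: cauchy_seqs_mult)
qed

abbreviation ncls :: "(nat \<Rightarrow> 'a) \<Rightarrow> (nat \<Rightarrow> 'a) set"
  where "ncls s \<equiv> null_rel A N `` {s}"

lemma ncls_eqI: "(s, t) \<in> null_rel A N \<Longrightarrow> ncls s = ncls t"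
  by (rule equiv_class_eq[OF equiv_null_rel])

lemma completion_carrier: "carrier (cstar_completion A N) = ncls ` cauchy_seqs A N"
  by (auto simp: cstar_completion_def quotient_def)

lemma completion_mult:
  assumes "s \<in> cauchy_seqs A N" "t \<in> cauchy_seqs A N"
  shows "ncls s \<otimes>\<^bsub>cstar_completion A N\<^esub> ncls t = ncls (\<lambda>i. s i \<otimes> t i)"
  unfolding cstar_completion_def
  by (simp, rule UN_equiv_class2[OF equiv_null_rel equiv_null_rel _ assms])
    (auto intro!: congruent2I' ncls_eqI null_rel_mult)

lemma completion_add:
  assumes "s \<in> cauchy_seqs A N" "t \<in> cauchy_seqs A N"
  shows "ncls s \<oplus>\<^bsub>cstar_completion A N\<^esub> ncls t = ncls (\<lambda>i. s i \<oplus> t i)"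
  unfolding cstar_completion_def
  by (simp, rule UN_equiv_class2[OF equiv_null_rel equiv_null_rel _ assms])
    (auto intro!: congruent2I' ncls_eqI null_rel_add)

lemma completion_smult:
  assumes "s \<in> cauchy_seqs A N"
  shows "c \<odot>\<^bsub>cstar_completion A N\<^esub> ncls s = ncls (\<lambda>i. c \<odot> s i)"
  unfolding cstar_completion_def
  by (simp, rule UN_equiv_class[OF equiv_null_rel _ assms])
    (auto intro!: congruentI ncls_eqI null_rel_smult)

lemma completion_star:
  assumes "s \<in> cauchy_seqs A N"
  shows "star (cstar_completion A N) (ncls s) = ncls (\<lambda>i. star A (s i))"
  unfolding cstar_completion_def
  by (simp, rule UN_equiv_class[OF equiv_null_rel _ assms])
    (auto intro!: congruentI ncls_eqI null_rel_star)

lemma completion_nrm: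
  assumes s: "s \<in> cauchy_seqs A N" and r: "(\<lambda>i. N (s i)) \<longlonglongrightarrow> r"
  shows "nrm (cstar_completion A N) (ncls s) = r"
proof -
  have "q = r" if st: "(s, t) \<in> null_rel A N" and q: "(\<lambda>i. N (t i)) \<longlonglongrightarrow> q" for t q
  proof -
    have "(\<lambda>i. N (s i) - N (t i)) \<longlonglongrightarrow> 0"
      by (rule tendsto_rabs_zero_cancel, rule real_tendsto_sandwich[of "\<lambda>_. 0" _ _ "\<lambda>i. N (s i \<ominus> t i)"])
        (use st N_abs_diff in \<open>auto simp: null_rel_iff cauchy_seqsD\<close>)
    then have "r - q = 0"
      by (rule LIMSEQ_unique[OF tendsto_diff[OF r q]])
    then show ?thesis
      by simp
  qed
  moreover have "(s, s) \<in> null_rel A N"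
    using s by (auto simp: null_rel_iff cauchy_seqsD)
  ultimately have "(THE q. \<exists>t\<in>ncls s. (\<lambda>i. N (t i)) \<longlonglongrightarrow> q) = r"
    using r by (intro the_equality) blast+
  then show ?thesis
    by (simp add: cstar_completion_def)
qed

lemma to_completion_eq: "to_completion A N a = ncls (\<lambda>i. a)"
  by (simp add: to_completion_def)

end

lemma star_isoI:
  assumes "bij_betw \<phi> (carrier A) (carrier B)" "\<phi> \<one>\<^bsub>A\<^esub> = \<one>\<^bsub>B\<^esub>"
    and "\<And>a b. a \<in> carrier A \<Longrightarrow> b \<in> carrier A \<Longrightarrow> \<phi> (a \<otimes>\<^bsub>A\<^esub> b) = \<phi> a \<otimes>\<^bsub>B\<^esub> \<phi> b"
    and "\<And>a b. a \<in> carrier A \<Longrightarrow> b \<in> carrier A \<Longrightarrow> \<phi> (a \<oplus>\<^bsub>A\<^esub> b) = \<phi> a \<oplus>\<^bsub>B\<^esub> \<phi> b"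
    and "\<And>a c. a \<in> carrier A \<Longrightarrow> \<phi> (c \<odot>\<^bsub>A\<^esub> a) = c \<odot>\<^bsub>B\<^esub> \<phi> a"
    and "\<And>a. a \<in> carrier A \<Longrightarrow> \<phi> (star A a) = star B (\<phi> a)"
    and "\<And>a. a \<in> carrier A \<Longrightarrow> nrm B (\<phi> a) = nrm A a"
  shows "\<phi> \<in> star_iso A B"
  using assms bij_betwE[OF assms(1)] unfolding star_iso_def ring_iso_def
  by (auto intro!: ring_hom_memI)

lemma star_isoD:
  assumes "\<phi> \<in> star_iso A B"
  shows "bij_betw \<phi> (carrier A) (carrier B)" "\<phi> \<one>\<^bsub>A\<^esub> = \<one>\<^bsub>B\<^esub>"
    and "a \<in> carrier A \<Longrightarrow> \<phi> a \<in> carrier B"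
    and "a \<in> carrier A \<Longrightarrow> b \<in> carrier A \<Longrightarrow> \<phi> (a \<otimes>\<^bsub>A\<^esub> b) = \<phi> a \<otimes>\<^bsub>B\<^esub> \<phi> b"
    and "a \<in> carrier A \<Longrightarrow> b \<in> carrier A \<Longrightarrow> \<phi> (a \<oplus>\<^bsub>A\<^esub> b) = \<phi> a \<oplus>\<^bsub>B\<^esub> \<phi> b"
    and "a \<in> carrier A \<Longrightarrow> \<phi> (c \<odot>\<^bsub>A\<^esub> a) = c \<odot>\<^bsub>B\<^esub> \<phi> a"
    and "a \<in> carrier A \<Longrightarrow> \<phi> (star A a) = star B (\<phi> a)"
    and "a \<in> carrier A \<Longrightarrow> nrm B (\<phi> a) = nrm A a"
  using assms by (auto simp: star_iso_def ring_iso_def ring_hom_memE)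

text \<open>An isometry carries Cauchy sequences to Cauchy sequences and identifies two of them exactly if
  their images have the same limit, so the isomorphism sends a class to that limit. Density makes it onto.\<close>

theorem completion_iso:
  assumes "cstar_seminormed A N" "cstar_algebra B" and h: "involutive_hom A B h"
    and isometric: "\<And>a. a \<in> carrier A \<Longrightarrow> nrm B (h a) = N a"
    and dense: "\<And>b e. b \<in> carrier B \<Longrightarrow> 0 < e \<Longrightarrow> \<exists>a\<in>carrier A. nrm B (h a \<ominus>\<^bsub>B\<^esub> b) < e"
  obtains \<Phi> where "\<Phi> \<in> star_iso (cstar_completion A N) B"
    "\<And>a. a \<in> carrier A \<Longrightarrow> \<Phi> (to_completion A N a) = h a"
proof -
  interpret A: cstar_seminormed A N by fact
  interpret B: cstar_algebra B by fact
  note hD = involutive_homD[OF h]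
  note h_diff = involutive_hom_zero_diff(2)[OF A.involutive_algebra_axioms B.involutive_algebra_axioms h]
  let ?C = "cauchy_seqs A N" and ?K = "cstar_completion A N"
  let ?lim = "\<lambda>s b. seq_lim B (nrm B) (\<lambda>i. h (s i)) b"
  have lim_unique: "b = c" if "s \<in> ?C" "?lim s b" "?lim s c" for s b c
  proof -
    have "(\<lambda>i. nrm B (h (s i) \<ominus>\<^bsub>B\<^esub> h (s i))) \<longlonglongrightarrow> nrm B (b \<ominus>\<^bsub>B\<^esub> c)"
      by (intro B.seq_lim_N B.seq_lim_diff that)
    moreover have "(\<lambda>i. nrm B (h (s i) \<ominus>\<^bsub>B\<^esub> h (s i))) = (\<lambda>i. 0)"
      using that(1) A.cauchy_seqsD hD(1) by auto
    ultimately have "nrm B (b \<ominus>\<^bsub>B\<^esub> c) = 0"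
      by (simp add: LIMSEQ_const_iff)
    moreover have bc: "b \<in> carrier B" "c \<in> carrier B"
      using that B.seq_limD(2) by blast+
    ultimately show ?thesis
      using B.nrm_zeroD[of "b \<ominus>\<^bsub>B\<^esub> c"] B.diff_eq_zero_iff[OF bc] by simp
  qed
  have cauchy_h: "(\<lambda>i. h (s i)) \<in> cauchy_seqs B (nrm B)" if "s \<in> ?C" for s
    using that hD(1) by (auto simp: cauchy_seqs_def h_diff[symmetric] isometric)
  have lim_exists: "\<exists>b. ?lim s b" if "s \<in> ?C" for s
    using B.complete[OF cauchy_h[OF that]] A.cauchy_seqsD[OF that] hD(1) by (auto simp: seq_lim_def)
  have same_lim: "(s, t) \<in> null_rel A N \<longleftrightarrow> b = c"
    if st: "s \<in> ?C" "t \<in> ?C" and b: "?lim s b" and c: "?lim t c" for s t b c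
  proof -
    have "(\<lambda>i. nrm B (h (s i) \<ominus>\<^bsub>B\<^esub> h (t i))) \<longlonglongrightarrow> nrm B (b \<ominus>\<^bsub>B\<^esub> c)"
      by (intro B.seq_lim_N B.seq_lim_diff b c)
    then have lim: "(\<lambda>i. N (s i \<ominus>\<^bsub>A\<^esub> t i)) \<longlonglongrightarrow> nrm B (b \<ominus>\<^bsub>B\<^esub> c)"
      using st by (simp add: h_diff[symmetric] isometric A.cauchy_seqsD)
    have bc: "b \<in> carrier B" "c \<in> carrier B" "b \<ominus>\<^bsub>B\<^esub> c \<in> carrier B"
      using B.seq_limD(2)[OF b] B.seq_limD(2)[OF c] by simp_all
    have "nrm B (b \<ominus>\<^bsub>B\<^esub> c) = 0 \<longleftrightarrow> b = c"
      using B.nrm_zeroD[OF bc(3)] B.diff_eq_zero_iff[OF bc(1,2)] by fastforce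
    moreover have "(\<lambda>i. N (s i \<ominus>\<^bsub>A\<^esub> t i)) \<longlonglongrightarrow> 0 \<longleftrightarrow> nrm B (b \<ominus>\<^bsub>B\<^esub> c) = 0"
      using LIMSEQ_unique[OF lim] lim by metis
    ultimately show ?thesis
      using st by (simp add: A.null_rel_iff)
  qed
  define \<Phi> where "\<Phi> = (\<lambda>S. SOME b. \<exists>s\<in>S. s \<in> ?C \<and> ?lim s b)"
  have \<Phi>_eq: "\<Phi> (A.ncls s) = b" if s: "s \<in> ?C" and b: "?lim s b" for s b
    unfolding \<Phi>_def
  proof (rule some_equality)
    show "\<exists>t\<in>A.ncls s. t \<in> ?C \<and> ?lim t b"
      using s b by (intro bexI[of _ s] equiv_class_self[OF A.equiv_null_rel]) auto
    show "c = b" if ex: "\<exists>t\<in>A.ncls s. t \<in> ?C \<and> ?lim t c" for c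
    proof -
      obtain t where t: "(s, t) \<in> null_rel A N" "t \<in> ?C" "?lim t c"
        using ex by blast
      show ?thesis
        using same_lim[OF s t(2) b t(3)] t(1) by simp
    qed
  qed
  have lim_of_B: "\<exists>s\<in>?C. ?lim s b" if b: "b \<in> carrier B" for b
  proof -
    have "\<exists>a\<in>carrier A. nrm B (h a \<ominus>\<^bsub>B\<^esub> b) < inverse (real (Suc i))" for i
      by (rule dense[OF b]) simp
    then obtain s where s: "\<And>i. s i \<in> carrier A" "\<And>i. nrm B (h (s i) \<ominus>\<^bsub>B\<^esub> b) < inverse (real (Suc i))"
      by metis
    have lim: "?lim s b"
      by (rule B.seq_limI_le[OF _ b less_imp_le[OF s(2)] LIMSEQ_inverse_real_of_nat]) (use s hD in auto)
    have "s \<in> ?C"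
      using B.seq_lim_cauchy[OF lim] s(1) by (auto simp: cauchy_seqs_def h_diff[symmetric] isometric)
    then show ?thesis
      using lim by blast
  qed
  have \<Phi>_closed: "\<Phi> \<in> carrier ?K \<rightarrow> carrier B"
  proof
    fix S assume "S \<in> carrier ?K"
    then obtain s where s: "s \<in> ?C" "S = A.ncls s"
      by (auto simp: A.completion_carrier)
    obtain b where b: "?lim s b"
      using lim_exists s by blast
    show "\<Phi> S \<in> carrier B"
      using \<Phi>_eq[OF s(1) b] B.seq_limD(2)[OF b] s by simp
  qed
  have "\<Phi> \<in> star_iso ?K B"
  proof (rule star_isoI)
    show "bij_betw \<Phi> (carrier ?K) (carrier B)"
      unfolding bij_betw_def
    proof
      show "inj_on \<Phi> (carrier ?K)"
      proof (rule inj_onI)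
        fix S T assume "S \<in> carrier ?K" "T \<in> carrier ?K" and eq: "\<Phi> S = \<Phi> T"
        then obtain s t where st: "s \<in> ?C" "t \<in> ?C" "S = A.ncls s" "T = A.ncls t"
          by (auto simp: A.completion_carrier)
        obtain b c where "?lim s b" "?lim t c"
          using lim_exists st by blast
        then show "S = T"
          using eq st \<Phi>_eq same_lim A.ncls_eqI by metis
      qed
      show "\<Phi> ` carrier ?K = carrier B"
      proof
        show "\<Phi> ` carrier ?K \<subseteq> carrier B"
          using \<Phi>_closed by blast
        show "carrier B \<subseteq> \<Phi> ` carrier ?K"
        proof
          fix b assume "b \<in> carrier B"
          then obtain s where "s \<in> ?C" "?lim s b"
            using lim_of_B by blast
          then show "b \<in> \<Phi> ` carrier ?K"
            using \<Phi>_eq[of s b] by (auto simp: A.completion_carrier)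
        qed
      qed
    qed
    have "A.ncls (\<lambda>i. \<one>\<^bsub>A\<^esub>) = \<one>\<^bsub>?K\<^esub>"
      by (simp add: cstar_completion_def)
    then show "\<Phi> \<one>\<^bsub>?K\<^esub> = \<one>\<^bsub>B\<^esub>"
      using \<Phi>_eq[OF A.cauchy_seqs_const[of "\<one>\<^bsub>A\<^esub>"]] involutive_hom_one[OF h] B.seq_lim_const[of "\<one>\<^bsub>B\<^esub>"]
      by simp
  next
    fix S T assume "S \<in> carrier ?K" "T \<in> carrier ?K"
    then obtain s t where st: "s \<in> ?C" "t \<in> ?C" "S = A.ncls s" "T = A.ncls t"
      by (auto simp: A.completion_carrier)
    obtain b c where bc: "?lim s b" "?lim t c"
      using lim_exists st by blast
    have "?lim (\<lambda>i. s i \<otimes>\<^bsub>A\<^esub> t i) (b \<otimes>\<^bsub>B\<^esub> c)" "?lim (\<lambda>i. s i \<oplus>\<^bsub>A\<^esub> t i) (b \<oplus>\<^bsub>B\<^esub> c)"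
      using B.seq_lim_mult[OF bc] B.seq_lim_add[OF bc] st by (simp_all add: hD A.cauchy_seqsD)
    then show "\<Phi> (S \<otimes>\<^bsub>?K\<^esub> T) = \<Phi> S \<otimes>\<^bsub>B\<^esub> \<Phi> T" "\<Phi> (S \<oplus>\<^bsub>?K\<^esub> T) = \<Phi> S \<oplus>\<^bsub>B\<^esub> \<Phi> T"
      using st bc by (simp_all add: A.completion_mult A.completion_add \<Phi>_eq A.cauchy_seqs_mult A.cauchy_seqs_add)
  next
    fix S assume "S \<in> carrier ?K"
    then obtain s where s: "s \<in> ?C" "S = A.ncls s"
      by (auto simp: A.completion_carrier)
    obtain b where b: "?lim s b"
      using lim_exists s by blast
    have "?lim (\<lambda>i. star A (s i)) (star B b)"
      using B.seq_lim_star[OF b] s by (simp add: hD A.cauchy_seqsD)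
    then show "\<Phi> (star ?K S) = star B (\<Phi> S)"
      using s b by (simp add: A.completion_star \<Phi>_eq A.cauchy_seqs_star)
    have "?lim (\<lambda>i. c \<odot>\<^bsub>A\<^esub> s i) (c \<odot>\<^bsub>B\<^esub> b)" for c
      using B.seq_lim_smult[OF b] s by (simp add: hD A.cauchy_seqsD)
    then show "\<Phi> (c \<odot>\<^bsub>?K\<^esub> S) = c \<odot>\<^bsub>B\<^esub> \<Phi> S" for c
      using s b by (simp add: A.completion_smult \<Phi>_eq A.cauchy_seqs_smult)
    have "(\<lambda>i. N (s i)) \<longlonglongrightarrow> nrm B b"
      using B.seq_lim_N[OF b] s by (simp add: isometric A.cauchy_seqsD)
    then show "nrm B (\<Phi> S) = nrm ?K S"
      using s b by (simp add: A.completion_nrm \<Phi>_eq)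
  qed
  moreover have "\<Phi> (to_completion A N a) = h a" if "a \<in> carrier A" for a
    using that hD(1) by (simp add: A.to_completion_eq \<Phi>_eq A.cauchy_seqs_const B.seq_lim_const)
  ultimately show thesis
    using that by blast
qed

section \<open>Closed subalgebras and quotients of C*-algebras\<close>

text \<open>The second conclusion is stated because subtraction is defined through the additive inverse of the
  ring at hand, so it refers to the carrier.\<close>

lemma cstar_subalgebra:
  assumes "cstar_algebra L" and S: "closed_subspace L S"
    and mult: "\<And>a b. a \<in> S \<Longrightarrow> b \<in> S \<Longrightarrow> a \<otimes>\<^bsub>L\<^esub> b \<in> S"
    and star: "\<And>a. a \<in> S \<Longrightarrow> star L a \<in> S" and one: "\<one>\<^bsub>L\<^esub> \<in> S"
  shows "cstar_algebra (L\<lparr>carrier := S\<rparr>)"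
    and "\<And>a b. a \<in> S \<Longrightarrow> b \<in> S \<Longrightarrow> a \<ominus>\<^bsub>L\<lparr>carrier := S\<rparr>\<^esub> b = a \<ominus>\<^bsub>L\<^esub> b"
proof -
  interpret L: cstar_algebra L by fact
  let ?T = "L\<lparr>carrier := S\<rparr>"
  have sub: "S \<subseteq> carrier L" and zero: "\<zero>\<^bsub>L\<^esub> \<in> S" and add: "\<And>a b. a \<in> S \<Longrightarrow> b \<in> S \<Longrightarrow> a \<oplus>\<^bsub>L\<^esub> b \<in> S"
    and smult: "\<And>c a. a \<in> S \<Longrightarrow> c \<odot>\<^bsub>L\<^esub> a \<in> S"
    and closed: "\<And>s a. a \<in> carrier L \<Longrightarrow> (\<forall>i. s i \<in> S) \<Longrightarrow> (\<lambda>i. nrm L (s i \<ominus>\<^bsub>L\<^esub> a)) \<longlonglongrightarrow> 0 \<Longrightarrow> a \<in> S"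
    using S by (auto simp: closed_subspace_def)
  have mem: "a \<in> carrier L" if "a \<in> S" for a
    using that sub by blast
  have "ring ?T"
  proof (rule ringI)
    show "abelian_group ?T"
    proof (rule abelian_groupI)
      fix a assume "a \<in> carrier ?T"
      then have "(-1) \<odot>\<^bsub>L\<^esub> a \<in> carrier ?T" "(-1) \<odot>\<^bsub>L\<^esub> a \<oplus>\<^bsub>?T\<^esub> a = \<zero>\<^bsub>?T\<^esub>"
        using mem smult L.l_neg[of a] by (simp_all add: L.minus_eq_smult)
      then show "\<exists>y\<in>carrier ?T. y \<oplus>\<^bsub>?T\<^esub> a = \<zero>\<^bsub>?T\<^esub>"
        by blast
    qed (use mem zero add in \<open>auto simp: L.a_ac\<close>)
    show "Group.monoid ?T"
      by (rule monoidI) (use mem one mult in \<open>auto simp: L.m_assoc\<close>)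
  qed (use mem in \<open>auto simp: L.l_distr L.r_distr\<close>)
  moreover have "involutive_algebra_axioms ?T"
    by (rule involutive_algebra_axioms.intro)
      (use mem smult star in \<open>auto simp: L.smult_add_left L.smult_add_right L.smult_smult
        L.smult_mult_left L.smult_mult_right L.star_add L.star_smult L.star_mult\<close>)
  ultimately interpret T: involutive_algebra ?T
    by (rule involutive_algebra.intro)
  show diff: "a \<ominus>\<^bsub>?T\<^esub> b = a \<ominus>\<^bsub>L\<^esub> b" if "a \<in> S" "b \<in> S" for a b
    using that mem T.diff_eq_smult[of a b] L.diff_eq_smult[of a b] by simp
  have "cstar_seminorm ?T (nrm ?T)"
    using mem L.seminorm by (simp add: cstar_seminorm_def)
  moreover have "\<exists>b\<in>carrier ?T. (\<lambda>i. nrm ?T (s i \<ominus>\<^bsub>?T\<^esub> b)) \<longlonglongrightarrow> 0"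
    if s: "s \<in> cauchy_seqs ?T (nrm ?T)" for s
  proof -
    have sS: "\<And>i. s i \<in> S"
      using s by (simp add: cauchy_seqs_def)
    have "s \<in> cauchy_seqs L (nrm L)"
      using s sS mem by (simp add: cauchy_seqs_def diff)
    then obtain b where b: "b \<in> carrier L" "(\<lambda>i. nrm L (s i \<ominus>\<^bsub>L\<^esub> b)) \<longlonglongrightarrow> 0"
      using L.complete by blast
    then have "b \<in> S"
      using closed sS by blast
    then show ?thesis
      using b sS diff by auto
  qed
  ultimately show "cstar_algebra ?T"
    using mem L.nrm_zeroD by unfold_locales auto
qed

lemma (in cstar_seminormed) cauchy_if_geometric:
  assumes b: "\<And>i. b i \<in> carrier A" and step: "\<And>i. N (b (Suc i) \<ominus> b i) < (1/2) ^ i"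
  shows "b \<in> cauchy_seqs A N"
proof -
  have tail: "N (b (i + n) \<ominus> b i) \<le> 2 * (1/2) ^ i - 2 * (1/2) ^ (i + n)" for i n
  proof (induction n)
    case (Suc n)
    have "N (b (Suc (i + n)) \<ominus> b i) \<le> N (b (Suc (i + n)) \<ominus> b (i + n)) + N (b (i + n) \<ominus> b i)"
      using b by (intro N_diff_triangle)
    also have "\<dots> \<le> (1/2) ^ (i + n) + (2 * (1/2) ^ i - 2 * (1/2) ^ (i + n))"
      using step[of "i + n"] Suc by linarith
    finally show ?case
      by simp
  qed (use b in simp)
  have dist: "N (b j \<ominus> b i) \<le> 2 * (1/2) ^ i" if "i \<le> j" for i j
  proof -
    have "N (b j \<ominus> b i) \<le> 2 * (1/2) ^ i - 2 * (1/2) ^ j"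
      using tail[of i "j - i"] that by simp
    moreover have "(0::real) \<le> (1/2) ^ j"
      by simp
    ultimately show ?thesis
      by linarith
  qed
  show ?thesis
    unfolding cauchy_seqs_def
  proof (intro CollectI conjI allI impI b)
    fix e :: real assume "0 < e"
    then obtain M where M: "(1/2) ^ M < e / 4"
      using real_arch_pow_inv[of "e / 4" "1/2"] by auto
    have "N (b i \<ominus> b j) < e" if "i \<ge> M" "j \<ge> M" for i j
      using N_diff_triangle[of "b i" "b M" "b j"] N_diff_commute[of "b M" "b j"]
        dist[OF that(1)] dist[OF that(2)] M b by fastforce
    then show "\<exists>M. \<forall>i\<ge>M. \<forall>j\<ge>M. N (b i \<ominus> b j) < e"
      by blast
  qed
qed

lemma (in cstar_seminormed) seq_lim_if_subseq:
  assumes s: "s \<in> cauchy_seqs A N" and r: "strict_mono r" and lim: "seq_lim A N (\<lambda>i. s (r i)) a"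
  shows "seq_lim A N s a"
  unfolding seq_lim_def
proof (intro conjI allI)
  show "(\<lambda>i. N (s i \<ominus> a)) \<longlonglongrightarrow> 0"
  proof (rule LIMSEQ_I)
    fix e :: real assume e: "0 < e"
    obtain M where M: "\<And>i j. i \<ge> M \<Longrightarrow> j \<ge> M \<Longrightarrow> N (s i \<ominus> s j) < e / 2"
      using cauchy_seqs_ge[OF s, of "e / 2"] e by auto
    obtain M' where M': "\<And>i. i \<ge> M' \<Longrightarrow> \<bar>N (s (r i) \<ominus> a)\<bar> < e / 2"
      using LIMSEQ_D[OF seq_limD(3)[OF lim], of "e / 2"] e by fastforce
    define k where "k = max M M'"
    have k: "r k \<ge> M" "k \<ge> M'"
      using strict_mono_imp_increasing[OF r, of k] by (auto simp: k_def)
    have "norm (N (s i \<ominus> a) - 0) < e" if "i \<ge> M" for i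
      using N_diff_triangle[of "s i" "s (r k)" a] M[OF that k(1)] M'[OF k(2)]
        N_nonneg[of "s i \<ominus> a"] cauchy_seqsD[OF s] seq_limD(2)[OF lim] by (simp add: abs_le_iff)
    then show "\<exists>no. \<forall>i\<ge>no. norm (N (s i \<ominus> a) - 0) < e"
      by blast
  qed
qed (use cauchy_seqsD[OF s] seq_limD(2)[OF lim] in auto)

text \<open>The sequence \<open>q\<close> consists of complements of an approximate unit of the ideal. For the compact operators on
  the Fock module it is explicit, and having it at hand replaces the functional calculus that
  produces approximate units of arbitrary ideals.\<close>

locale cstar_ideal = cstar_algebra A for A :: "('a, 'm) normed_star_algebra_scheme" (structure) +
  fixes J :: "'a set" and q :: "nat \<Rightarrow> 'a"
  assumes J_subset: "J \<subseteq> carrier A" and J_zero: "\<zero> \<in> J"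
    and J_add: "\<And>a b. a \<in> J \<Longrightarrow> b \<in> J \<Longrightarrow> a \<oplus> b \<in> J"
    and J_left: "\<And>a b. a \<in> carrier A \<Longrightarrow> b \<in> J \<Longrightarrow> a \<otimes> b \<in> J"
    and J_right: "\<And>a b. a \<in> J \<Longrightarrow> b \<in> carrier A \<Longrightarrow> a \<otimes> b \<in> J"
    and J_star: "\<And>a. a \<in> J \<Longrightarrow> star A a \<in> J"
    and J_closed: "\<And>a. a \<in> carrier A \<Longrightarrow> (\<And>e. 0 < e \<Longrightarrow> \<exists>j\<in>J. nrm A (j \<ominus> a) < e) \<Longrightarrow> a \<in> J"
    and q_closed [simp]: "\<And>k. q k \<in> carrier A" and q_compl: "\<And>k. \<one> \<ominus> q k \<in> J"
    and q_star: "\<And>k. star A (q k) = q k" and q_le: "\<And>k. nrm A (q k) \<le> 1"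
    and q_null: "\<And>j. j \<in> J \<Longrightarrow> (\<lambda>k. nrm A (j \<otimes> q k)) \<longlonglongrightarrow> 0"
begin

lemma J_mem: "j \<in> J \<Longrightarrow> j \<in> carrier A"
  using J_subset by blast

lemma J_smult: "j \<in> J \<Longrightarrow> c \<odot> j \<in> J"
  using J_left[of "c \<odot> \<one>" j] J_mem by (simp add: smult_mult_left)

lemma J_minus: "j \<in> J \<Longrightarrow> \<ominus> j \<in> J"
  using J_smult J_mem by (simp add: minus_eq_smult)

lemma ideal_J: "ideal J A"
proof (rule idealI)
  show "subgroup J (add_monoid A)"
    by (rule subgroup.intro) (use J_subset J_add J_zero J_minus in \<open>auto simp flip: a_inv_def\<close>)
qed (use J_left J_right ring_axioms in auto)

sublocale J: ideal J A
  by (rule ideal_J)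

abbreviation quot :: "'a set normed_star_algebra" where "quot \<equiv> cstar_quotient A J"

lemma coset_iff: "a \<in> carrier A \<Longrightarrow> b \<in> J +> a \<longleftrightarrow> b \<in> carrier A \<and> b \<ominus> a \<in> J"
proof -
  assume a: "a \<in> carrier A"
  show ?thesis
  proof
    assume "b \<in> J +> a"
    then obtain j where j: "j \<in> J" "b = j \<oplus> a"
      by (auto simp: a_r_coset_def')
    then have "b \<ominus> a = j"
      using a J_mem[OF j(1)] by algebra
    then show "b \<in> carrier A \<and> b \<ominus> a \<in> J"
      using a j J_mem by simp
  next
    assume "b \<in> carrier A \<and> b \<ominus> a \<in> J"
    then show "b \<in> J +> a"
      using a by (auto simp: a_r_coset_def' intro!: bexI[of _ "b \<ominus> a"])
  qed
qed

lemma coset_eq_iff: "a \<in> carrier A \<Longrightarrow> b \<in> carrier A \<Longrightarrow> J +> a = J +> b \<longleftrightarrow> a \<ominus> b \<in> J"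
  using a_repr_independence[of a J b] J.a_subgroup coset_iff[of b a] coset_iff[of a a] J_zero by auto

lemma self_in_coset: "a \<in> carrier A \<Longrightarrow> a \<in> J +> a"
  by (simp add: coset_iff J_zero)

lemma quot_carrier: "carrier quot = (\<lambda>a. J +> a) ` carrier A"
  by (auto simp: cstar_quotient_def FactRing_def A_RCOSETS_def')

lemma quot_ops:
  "a \<in> carrier A \<Longrightarrow> b \<in> carrier A \<Longrightarrow> (J +> a) \<otimes>\<^bsub>quot\<^esub> (J +> b) = J +> (a \<otimes> b)"
  "a \<in> carrier A \<Longrightarrow> b \<in> carrier A \<Longrightarrow> (J +> a) \<oplus>\<^bsub>quot\<^esub> (J +> b) = J +> (a \<oplus> b)"
  "\<one>\<^bsub>quot\<^esub> = J +> \<one>" "\<zero>\<^bsub>quot\<^esub> = J +> \<zero>"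
  by (simp_all add: cstar_quotient_def FactRing_def J.rcoset_mult_add J.a_rcos_sum J_subset)

lemma quot_smult: "a \<in> carrier A \<Longrightarrow> c \<odot>\<^bsub>quot\<^esub> (J +> a) = J +> (c \<odot> a)"
proof -
  assume a: "a \<in> carrier A"
  have eq: "J +> (c \<odot> b) = J +> (c \<odot> a)" if "b \<in> J +> a" for b
  proof -
    have b: "b \<in> carrier A" "b \<ominus> a \<in> J"
      using that coset_iff[OF a] by simp_all
    then show ?thesis
      using a J_smult[OF b(2), of c] by (simp add: coset_eq_iff smult_diff_right)
  qed
  have "(\<Union>b\<in>J +> a. J +> (c \<odot> b)) = J +> (c \<odot> a)"
    using self_in_coset[OF a] by (intro SUP_eq_const eq) blast
  then show ?thesis
    by (simp add: cstar_quotient_def)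
qed

lemma quot_star: "a \<in> carrier A \<Longrightarrow> star quot (J +> a) = J +> star A a"
proof -
  assume a: "a \<in> carrier A"
  have eq: "J +> star A b = J +> star A a" if "b \<in> J +> a" for b
  proof -
    have b: "b \<in> carrier A" "b \<ominus> a \<in> J"
      using that coset_iff[OF a] by simp_all
    then show ?thesis
      using a J_star[OF b(2)] by (simp add: coset_eq_iff star_diff)
  qed
  have "(\<Union>b\<in>J +> a. J +> star A b) = J +> star A a"
    using self_in_coset[OF a] by (intro SUP_eq_const eq) blast
  then show ?thesis
    by (simp add: cstar_quotient_def)
qed

lemma quot_nrm_le: "a \<in> carrier A \<Longrightarrow> b \<in> J +> a \<Longrightarrow> nrm quot (J +> a) \<le> nrm A b"
  by (auto simp: cstar_quotient_def coset_iff intro!: cINF_lower bdd_belowI[of _ 0])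

lemma quot_nrm_approx:
  assumes a: "a \<in> carrier A" and e: "0 < e"
  obtains b where "b \<in> J +> a" "nrm A b < nrm quot (J +> a) + e"
proof -
  have "bdd_below (nrm A ` (J +> a))" "J +> a \<noteq> {}"
    using self_in_coset[OF a] coset_iff[OF a] by (auto intro!: bdd_belowI[of _ 0])
  moreover have "(INF b\<in>J +> a. nrm A b) < (INF b\<in>J +> a. nrm A b) + e"
    using e by simp
  ultimately obtain b where "b \<in> J +> a" "nrm A b < (INF b\<in>J +> a. nrm A b) + e"
    using cINF_less_iff by metis
  then show thesis
    using that by (simp add: cstar_quotient_def)
qed

text \<open>The elements \<open>1 - q\<^sub>k\<close> are an approximate unit of \<open>J\<close>, so cutting down by \<open>q\<^sub>k\<close> makes the part
  in \<open>J\<close> small and leaves the class modulo \<open>J\<close> unchanged. This turns the infimum that defines the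
  quotient norm into a limit, for which the C*-identity is inherited.\<close>

lemma quot_nrm_lim:
  assumes a: "a \<in> carrier A"
  shows "(\<lambda>k. nrm A (a \<otimes> q k)) \<longlonglongrightarrow> nrm quot (J +> a)"
proof (rule LIMSEQ_I)
  fix e :: real assume e: "0 < e"
  obtain b where b: "b \<in> J +> a" "nrm A b < nrm quot (J +> a) + e / 2"
    using quot_nrm_approx[OF a, of "e / 2"] e by auto
  have bc: "b \<in> carrier A" "b \<ominus> a \<in> J"
    using b a by (auto simp: coset_iff)
  obtain M where M: "\<And>k. k \<ge> M \<Longrightarrow> \<bar>nrm A ((b \<ominus> a) \<otimes> q k)\<bar> < e / 2"
    using LIMSEQ_D[OF q_null[OF bc(2)], of "e / 2"] e by fastforce
  have "norm (nrm A (a \<otimes> q k) - nrm quot (J +> a)) < e" if "k \<ge> M" for k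
  proof -
    have "a \<otimes> (\<one> \<ominus> q k) = a \<ominus> a \<otimes> q k"
      using a by (simp add: a_minus_def r_distr r_minus)
    then have "a \<otimes> q k \<ominus> a = \<ominus> (a \<otimes> (\<one> \<ominus> q k))"
      using a q_closed[of k] by algebra
    then have "a \<otimes> q k \<in> J +> a"
      using a by (simp add: coset_iff J_minus J_left q_compl)
    then have lower: "nrm quot (J +> a) \<le> nrm A (a \<otimes> q k)"
      by (rule quot_nrm_le[OF a])
    have "a \<otimes> q k = b \<otimes> q k \<ominus> (b \<ominus> a) \<otimes> q k"
      using a bc(1) q_closed[of k] by algebra
    then have "nrm A (a \<otimes> q k) \<le> nrm A (b \<otimes> q k) + nrm A ((b \<ominus> a) \<otimes> q k)"
      using N_diff[of "b \<otimes> q k" "(b \<ominus> a) \<otimes> q k"] a bc by simp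
    moreover have "nrm A (b \<otimes> q k) \<le> nrm A b * 1"
      using N_mult[OF bc(1) q_closed, of k] mult_left_mono[OF q_le[of k] N_nonneg[OF bc(1)]] by linarith
    ultimately show ?thesis
      using lower M[OF that] b(2) by (simp add: abs_if split: if_splits)
  qed
  then show "\<exists>no. \<forall>k\<ge>no. norm (nrm A (a \<otimes> q k) - nrm quot (J +> a)) < e"
    by blast
qed

lemma quot_nrm_mult_le:
  assumes a: "a \<in> carrier A" and b: "b \<in> carrier A"
  shows "nrm quot (J +> (a \<otimes> b)) \<le> nrm A a * nrm quot (J +> b)"
proof (rule LIMSEQ_le[OF quot_nrm_lim tendsto_mult[OF tendsto_const quot_nrm_lim]])
  have "nrm A (a \<otimes> b \<otimes> q k) \<le> nrm A a * nrm A (b \<otimes> q k)" for k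
    using N_mult[of a "b \<otimes> q k"] a b by (simp add: m_assoc)
  then show "\<exists>M. \<forall>k\<ge>M. nrm A (a \<otimes> b \<otimes> q k) \<le> nrm A a * nrm A (b \<otimes> q k)"
    by blast
qed (use a b in auto)

lemma involutive_algebra_quot: "involutive_algebra quot"
proof (intro involutive_algebra.intro involutive_algebra_axioms.intro)
  show "ring quot"
  proof (rule ringI)
    show "abelian_group quot"
    proof (rule abelian_groupI)
      fix b assume "b \<in> carrier quot"
      then obtain a where a: "a \<in> carrier A" "b = J +> a"
        unfolding quot_carrier by blast
      then have "(J +> (\<ominus> a)) \<oplus>\<^bsub>quot\<^esub> b = \<zero>\<^bsub>quot\<^esub>" "J +> (\<ominus> a) \<in> carrier quot"
        by (simp_all add: quot_ops l_neg quot_carrier)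
      then show "\<exists>c\<in>carrier quot. c \<oplus>\<^bsub>quot\<^esub> b = \<zero>\<^bsub>quot\<^esub>"
        by blast
    qed (auto simp: quot_carrier quot_ops a_ac)
    show "Group.monoid quot"
      by (rule monoidI) (auto simp: quot_carrier quot_ops m_assoc)
  qed (auto simp: quot_carrier quot_ops l_distr r_distr)
qed (auto simp: quot_carrier quot_ops quot_smult quot_star smult_add_left smult_add_right smult_smult
    smult_mult_left smult_mult_right star_add star_smult star_mult)

lemma quot_diff:
  "a \<in> carrier A \<Longrightarrow> b \<in> carrier A \<Longrightarrow> (J +> a) \<ominus>\<^bsub>quot\<^esub> (J +> b) = J +> (a \<ominus> b)"
  by (simp add: involutive_algebra.diff_eq_smult[OF involutive_algebra_quot] diff_eq_smult quot_carrier
      quot_smult quot_ops)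

lemma involutive_hom_coset: "involutive_hom A quot (\<lambda>a. J +> a)"
  by (auto simp: involutive_hom_def quot_carrier quot_smult quot_star quot_ops intro!: ring_hom_memI)

lemma cstar_seminorm_quot: "cstar_seminorm quot (nrm quot)"
proof -
  have nonneg: "0 \<le> nrm quot (J +> a)" if "a \<in> carrier A" for a
    using LIMSEQ_le_const[OF quot_nrm_lim[OF that]] that by auto
  have add: "nrm quot (J +> (a \<oplus> b)) \<le> nrm quot (J +> a) + nrm quot (J +> b)"
    if a: "a \<in> carrier A" and b: "b \<in> carrier A" for a b
  proof (rule LIMSEQ_le[OF quot_nrm_lim tendsto_add[OF quot_nrm_lim quot_nrm_lim]])
    show "\<exists>M. \<forall>k\<ge>M. nrm A ((a \<oplus> b) \<otimes> q k) \<le> nrm A (a \<otimes> q k) + nrm A (b \<otimes> q k)"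
      using N_add[of "a \<otimes> q _" "b \<otimes> q _"] a b by (auto simp: l_distr)
  qed (use a b in auto)
  have smult: "nrm quot (J +> (c \<odot> a)) = norm c * nrm quot (J +> a)" if a: "a \<in> carrier A" for c a
  proof (rule LIMSEQ_unique[OF quot_nrm_lim])
    show "(\<lambda>k. nrm A (c \<odot> a \<otimes> q k)) \<longlonglongrightarrow> norm c * nrm quot (J +> a)"
      using tendsto_mult[OF tendsto_const quot_nrm_lim[OF a], of "norm c"] a
      by (simp add: smult_mult_left N_smult)
  qed (use a in auto)
  have star_le: "nrm quot (J +> star A a) \<le> nrm quot (J +> a)" if a: "a \<in> carrier A" for a
  proof (rule field_le_epsilon)
    fix e :: real assume e: "0 < e"
    obtain b where b: "b \<in> J +> a" "nrm A b < nrm quot (J +> a) + e"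
      using quot_nrm_approx[OF a e] .
    have bc: "b \<in> carrier A" "b \<ominus> a \<in> J"
      using b(1) coset_iff[OF a] by simp_all
    then have "star A b \<in> J +> star A a"
      using a J_star[OF bc(2)] by (simp add: coset_iff star_diff)
    then show "nrm quot (J +> star A a) \<le> nrm quot (J +> a) + e"
      using quot_nrm_le[of "star A a" "star A b"] a b bc by simp
  qed
  have mult: "nrm quot (J +> (a \<otimes> b)) \<le> nrm quot (J +> a) * nrm quot (J +> b)"
    if a: "a \<in> carrier A" and b: "b \<in> carrier A" for a b
  proof (rule LIMSEQ_le_const[OF tendsto_mult[OF quot_nrm_lim[OF a] tendsto_const]])
    have "nrm quot (J +> (a \<otimes> b)) \<le> nrm A (a \<otimes> q k) * nrm quot (J +> b)" for k
    proof -
      have "a \<otimes> (\<one> \<ominus> q k) = a \<ominus> a \<otimes> q k"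
        using a by (simp add: a_minus_def r_distr r_minus)
      then have "a \<otimes> b \<ominus> a \<otimes> q k \<otimes> b = a \<otimes> (\<one> \<ominus> q k) \<otimes> b"
        using a b q_closed[of k] by algebra
      then have "J +> (a \<otimes> b) = J +> (a \<otimes> q k \<otimes> b)"
        using a b by (simp add: coset_eq_iff J_left J_right q_compl)
      then show ?thesis
        using quot_nrm_mult_le[of "a \<otimes> q k" b] a b by simp
    qed
    then show "\<exists>M. \<forall>k\<ge>M. nrm quot (J +> (a \<otimes> b)) \<le> nrm A (a \<otimes> q k) * nrm quot (J +> b)"
      by blast
  qed
  have cstar: "nrm quot (J +> (star A a \<otimes> a)) = (nrm quot (J +> a))\<^sup>2" if a: "a \<in> carrier A" for a
  proof (rule antisym)
    show "nrm quot (J +> (star A a \<otimes> a)) \<le> (nrm quot (J +> a))\<^sup>2"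
      using mult[of "star A a" a] mult_right_mono[OF star_le[OF a] nonneg[OF a]] a
      by (simp add: power2_eq_square)
    show "(nrm quot (J +> a))\<^sup>2 \<le> nrm quot (J +> (star A a \<otimes> a))"
    proof (rule LIMSEQ_le[OF tendsto_power[OF quot_nrm_lim] quot_nrm_lim])
      have "(nrm A (a \<otimes> q k))\<^sup>2 \<le> nrm A (star A a \<otimes> a \<otimes> q k)" for k
      proof -
        have "(nrm A (a \<otimes> q k))\<^sup>2 = nrm A (q k \<otimes> (star A a \<otimes> a \<otimes> q k))"
          using a by (simp add: N_cstar[symmetric] star_mult q_star m_assoc)
        also have "\<dots> \<le> nrm A (q k) * nrm A (star A a \<otimes> a \<otimes> q k)"
          using a by (intro N_mult) auto
        also have "\<dots> \<le> 1 * nrm A (star A a \<otimes> a \<otimes> q k)"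
          using a q_le by (intro mult_right_mono) auto
        finally show ?thesis
          by simp
      qed
      then show "\<exists>M. \<forall>k\<ge>M. (nrm A (a \<otimes> q k))\<^sup>2 \<le> nrm A (star A a \<otimes> a \<otimes> q k)"
        by blast
    qed (use a in auto)
  qed
  show ?thesis
    unfolding cstar_seminorm_def
    using nonneg add smult mult cstar by (auto simp: quot_carrier quot_ops quot_smult quot_star)
qed

text \<open>Completeness: a Cauchy sequence of cosets has a subsequence with summable steps. Representatives are
  chosen successively within the steps, so that they form a Cauchy sequence themselves.\<close>

theorem cstar_algebra_quot: "cstar_algebra quot"
proof -
  interpret Q: cstar_seminormed quot "nrm quot"
    by (rule cstar_seminormed.intro[OF involutive_algebra_quot
          cstar_seminormed_axioms.intro[OF cstar_seminorm_quot]])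
  have "b = \<zero>\<^bsub>quot\<^esub>" if b: "b \<in> carrier quot" "nrm quot b = 0" for b
  proof -
    obtain a where a: "a \<in> carrier A" "b = J +> a"
      using b(1) unfolding quot_carrier by blast
    have "a \<in> J"
    proof (rule J_closed[OF a(1)])
      fix e :: real assume "0 < e"
      then obtain c where c: "c \<in> J +> a" "nrm A c < e"
        using quot_nrm_approx[OF a(1), of e] b(2) a(2) by auto
      have cc: "c \<in> carrier A" "c \<ominus> a \<in> J"
        using c(1) coset_iff[OF a(1)] by simp_all
      have "a \<ominus> c = \<ominus> (c \<ominus> a)" "(a \<ominus> c) \<ominus> a = \<ominus> c"
        using a(1) cc(1) by algebra+
      then have "a \<ominus> c \<in> J" "nrm A ((a \<ominus> c) \<ominus> a) < e"
        using J_minus[OF cc(2)] N_minus[OF cc(1)] c(2) by simp_all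
      then show "\<exists>j\<in>J. nrm A (j \<ominus> a) < e"
        by blast
    qed
    then show ?thesis
      using a by (simp add: quot_ops coset_eq_iff)
  qed
  moreover have "\<exists>b\<in>carrier quot. (\<lambda>i. nrm quot (s i \<ominus>\<^bsub>quot\<^esub> b)) \<longlonglongrightarrow> 0"
    if s: "s \<in> cauchy_seqs quot (nrm quot)" for s
  proof -
    have "\<exists>M. \<forall>i\<ge>M. \<forall>j\<ge>M. nrm quot (s i \<ominus>\<^bsub>quot\<^esub> s j) < (1/2) ^ n" for n :: nat
      using s by (auto simp: cauchy_seqs_def)
    then obtain M where M: "\<And>n i j. i \<ge> M n \<Longrightarrow> j \<ge> M n \<Longrightarrow> nrm quot (s i \<ominus>\<^bsub>quot\<^esub> s j) < (1/2) ^ n"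
      by metis
    \<comment> \<open>The summand \<open>n\<close> makes \<open>r\<close> strictly increasing.\<close>
    define r where "r = (\<lambda>n. n + (\<Sum>k\<le>n. M k))"
    have r: "strict_mono r" "\<And>n. r n \<ge> M n"
      by (auto simp: strict_mono_Suc_iff r_def intro: trans_le_add2 member_le_sum)
    have "\<exists>b. \<forall>n. (b n \<in> carrier A \<and> s (r n) = J +> b n) \<and> nrm A (b (Suc n) \<ominus> b n) < (1/2) ^ n"
    proof (rule dependent_nat_choice)
      show "\<exists>b. b \<in> carrier A \<and> s (r 0) = J +> b"
        using Q.cauchy_seqsD[OF s, of "r 0"] unfolding quot_carrier by blast
      fix b n assume b: "b \<in> carrier A \<and> s (r n) = J +> b"
      obtain c where c: "c \<in> carrier A" "s (r (Suc n)) = J +> c"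
        using Q.cauchy_seqsD[OF s, of "r (Suc n)"] unfolding quot_carrier by blast
      have "r (Suc n) \<ge> M n"
        using r(2)[of n] strict_monoD[OF r(1), of n "Suc n"] by simp
      then have "nrm quot (J +> (c \<ominus> b)) < (1/2) ^ n"
        using M[of n "r (Suc n)" "r n"] r(2)[of n] b c by (simp add: quot_diff)
      then obtain d where d: "d \<in> J +> (c \<ominus> b)" "nrm A d < (1/2) ^ n"
        using quot_nrm_approx[of "c \<ominus> b" "(1/2) ^ n - nrm quot (J +> (c \<ominus> b))"] b c by auto
      then have dc: "d \<in> carrier A" "d \<ominus> (c \<ominus> b) \<in> J"
        using b c by (auto simp: coset_iff)
      have "(d \<oplus> b) \<ominus> c = d \<ominus> (c \<ominus> b)" "(d \<oplus> b) \<ominus> b = d"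
        using b c(1) dc(1) by algebra+
      moreover have "d \<oplus> b \<in> carrier A"
        using b dc by simp
      moreover have "J +> (d \<oplus> b) = J +> c"
        using coset_eq_iff[of "d \<oplus> b" c] b c dc calculation by simp
      ultimately have "d \<oplus> b \<in> carrier A" "s (r (Suc n)) = J +> (d \<oplus> b)" "nrm A ((d \<oplus> b) \<ominus> b) < (1/2) ^ n"
        using c(2) d(2) by simp_all
      then show "\<exists>b'. (b' \<in> carrier A \<and> s (r (Suc n)) = J +> b') \<and> nrm A (b' \<ominus> b) < (1/2) ^ n"
        by blast
    qed
    then obtain b where b: "\<And>n. b n \<in> carrier A" "\<And>n. s (r n) = J +> b n"
      "\<And>n. nrm A (b (Suc n) \<ominus> b n) < (1/2) ^ n"
      by metis
    obtain a where a: "a \<in> carrier A" "(\<lambda>i. nrm A (b i \<ominus> a)) \<longlonglongrightarrow> 0"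
      using complete[OF cauchy_if_geometric[OF b(1,3)]] by blast
    have "seq_lim quot (nrm quot) (\<lambda>i. s (r i)) (J +> a)"
    proof (rule Q.seq_limI_le[OF _ _ _ a(2)])
      show "nrm quot (s (r i) \<ominus>\<^bsub>quot\<^esub> (J +> a)) \<le> nrm A (b i \<ominus> a)" for i
        using a b quot_nrm_le[of "b i \<ominus> a" "b i \<ominus> a"] self_in_coset by (simp add: quot_diff)
    qed (use a b in \<open>auto simp: quot_carrier\<close>)
    then have "seq_lim quot (nrm quot) s (J +> a)"
      by (rule Q.seq_lim_if_subseq[OF s r(1)])
    then show ?thesis
      using Q.seq_limD by blast
  qed
  ultimately show ?thesis
    by unfold_locales auto
qed

end

section \<open>Representations of generators and relations\<close>

lemma conj_conj [simp]: "conj_bcontfun (conj_bcontfun f) = f"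
  by (rule bcontfun_eqI) (simp add: apply_conj)

locale coef_rep = involutive_algebra A for A :: "('a, 'm) star_algebra_scheme" (structure) +
  fixes c :: "('x::topological_space \<Rightarrow>\<^sub>C complex) \<Rightarrow> 'a"
  assumes c_closed [simp]: "c f \<in> carrier A"
    and c_add: "c (f + h) = c f \<oplus> c h" and c_mult: "c (f * h) = c f \<otimes> c h"
    and c_one: "c 1 = \<one>" and c_scale: "c (const_bcontfun z * f) = z \<odot> c f"
    and c_conj: "c (conj_bcontfun f) = star A (c f)"
begin

lemma c_zero: "c 0 = \<zero>"
proof -
  have "c 0 = c (const_bcontfun 0 * 0)"
    by simp
  also have "\<dots> = \<zero>"
    by (simp only: c_scale smult_zero_left c_closed)
  finally show ?thesis .
qed

lemma c_sum: "finite I \<Longrightarrow> c (\<Sum>i\<in>I. f i) = finsum A (\<lambda>i. c (f i)) I"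
  by (induction I rule: finite_induct) (auto simp: c_zero c_add)

end

text \<open>The relations of the Toeplitz algebra, in an arbitrary *-algebra. They hold in the two presented
  algebras, on the Fock module, and in the Toeplitz and the Pimsner algebra.\<close>

locale toeplitz_rep = coef_rep A c for A :: "('a, 'm) star_algebra_scheme" (structure)
    and c :: "('x::topological_space \<Rightarrow>\<^sub>C complex) \<Rightarrow> 'a" +
  fixes g :: "'n::finite \<Rightarrow> 'a" and E :: "('x \<Rightarrow>\<^sub>C complex)^'n^'n"
  assumes g_closed [simp]: "g l \<in> carrier A"
    and g_comm: "c f \<otimes> g l = g l \<otimes> c f"
    and g_inner: "star A (g l) \<otimes> g m = c (E $ l $ m)"

subsection \<open>Evaluating formal polynomials\<close>

text \<open>Used both for the universal property and for the fact that the generators span the algebra: on the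
  presented algebra, evaluation at the generators is the class map.\<close>

primrec star_eval ::
  "('a, 'm) star_algebra_scheme \<Rightarrow> ('f \<Rightarrow> 'a) \<Rightarrow> ('n \<Rightarrow> 'a) \<Rightarrow> ('f, 'n) star_poly \<Rightarrow> 'a" where
  "star_eval A c g (Coef f) = c f"
| "star_eval A c g (Gen l) = g l"
| "star_eval A c g (Plus a b) = star_eval A c g a \<oplus>\<^bsub>A\<^esub> star_eval A c g b"
| "star_eval A c g (Times a b) = star_eval A c g a \<otimes>\<^bsub>A\<^esub> star_eval A c g b"
| "star_eval A c g (Scale z a) = z \<odot>\<^bsub>A\<^esub> star_eval A c g a"
| "star_eval A c g (Adj a) = star A (star_eval A c g a)"

lemma star_eval_hom:
  assumes "coef_rep A c" "involutive_hom A B h" "range g \<subseteq> carrier A"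
  shows "star_eval A c g a \<in> carrier A"
    and "h (star_eval A c g a) = star_eval B (\<lambda>f. h (c f)) (\<lambda>l. h (g l)) a"
proof -
  interpret coef_rep A c by fact
  show cl: "star_eval A c g a \<in> carrier A" for a
    by (induction a) (use assms(3) in auto)
  show "h (star_eval A c g a) = star_eval B (\<lambda>f. h (c f)) (\<lambda>l. h (g l)) a"
    by (induction a) (use cl involutive_homD[OF assms(2)] in auto)
qed

lemma (in coef_rep) star_eval_closed: "range g \<subseteq> carrier A \<Longrightarrow> star_eval A c g a \<in> carrier A"
  by (induction a) auto

lemma (in coef_rep) star_eval_cong:
  assumes g: "range g \<subseteq> carrier A"
    and R: "\<And>a b. (a, b) \<in> R \<Longrightarrow> star_eval A c g a = star_eval A c g b"
    and cong: "star_cong R a b"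
  shows "star_eval A c g a = star_eval A c g b"
  using cong
proof (induction rule: star_cong.induct)
  case (plus_inverse a)
  then show ?case
    using star_eval_closed[OF g, of a] l_neg[of "star_eval A c g a"]
    by (simp add: c_zero minus_eq_smult)
next
  case (plus_commute a b)
  then show ?case
    using star_eval_closed[OF g] by (simp add: a_comm)
next
  case (coef_scale z f)
  then show ?case
    by (simp only: star_eval.simps c_scale)
qed (use star_eval_closed[OF g] in \<open>simp_all add: R a_assoc m_assoc l_distr r_distr c_zero c_one c_add c_mult
    c_conj smult_add_left smult_add_right smult_smult smult_mult_left smult_mult_right
    star_add star_smult star_mult\<close>)

lemma (in toeplitz_rep) star_eval_pimsner_sum:
  "distinct ls \<Longrightarrow>
    star_eval A c g (foldr (\<lambda>l. Plus (Times (Gen l) (Adj (Gen l)))) ls (Coef 0)) =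
    finsum A (\<lambda>l. g l \<otimes> star A (g l)) (set ls)"
  by (induction ls) (auto simp: c_zero)

lemma (in toeplitz_rep) toeplitz_relations_hold:
  "(a, b) \<in> toeplitz_relations E \<Longrightarrow> star_eval A c g a = star_eval A c g b"
  by (auto simp: toeplitz_relations_def g_comm g_inner)

lemma (in toeplitz_rep) pimsner_relations_hold:
  assumes "finsum A (\<lambda>l. g l \<otimes> star A (g l)) UNIV = \<one>"
  shows "(a, b) \<in> pimsner_relations E \<Longrightarrow> star_eval A c g a = star_eval A c g b"
  unfolding pimsner_relations_def
  using toeplitz_relations_hold assms by (auto simp: star_eval_pimsner_sum c_one)

subsection \<open>The presented algebra\<close>

lemma star_class_eq_iff: "star_class R a = star_class R b \<longleftrightarrow> star_cong R a b"
  unfolding star_class_def using star_cong.refl star_cong.sym star_cong.trans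
  by (metis (mono_tags, lifting) Collect_cong mem_Collect_eq)

lemma self_in_star_class: "a \<in> star_class R a"
  by (simp add: star_class_def star_cong.refl)

lemma in_star_class: "b \<in> star_class R a \<longleftrightarrow> star_cong R a b"
  by (simp add: star_class_def)

lemma presented_carrier: "carrier (presented_algebra R) = range (star_class R)"
  by (simp add: presented_algebra_def)

lemma star_class_closed [simp]: "star_class R a \<in> carrier (presented_algebra R)"
  by (simp add: presented_carrier)

lemma presented_cases:
  assumes "x \<in> carrier (presented_algebra R)" obtains a where "x = star_class R a"
  using assms by (auto simp: presented_carrier)

lemma presented_unary:
  assumes "\<And>a a'. star_cong R a a' \<Longrightarrow> star_cong R (F a) (F a')"
  shows "(\<Union>a'\<in>star_class R a. star_class R (F a')) = star_class R (F a)"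
proof (rule SUP_eq_const)
  show "star_class R a \<noteq> {}"
    using self_in_star_class by blast
  show "star_class R (F a') = star_class R (F a)" if "a' \<in> star_class R a" for a'
  proof -
    have "star_cong R (F a) (F a')"
      using that assms by (simp add: in_star_class)
    then show ?thesis
      unfolding star_class_eq_iff by (rule star_cong.sym)
  qed
qed

lemma presented_ops:
  "star_class R a \<otimes>\<^bsub>presented_algebra R\<^esub> star_class R b = star_class R (Times a b)"
  "star_class R a \<oplus>\<^bsub>presented_algebra R\<^esub> star_class R b = star_class R (Plus a b)"
  "z \<odot>\<^bsub>presented_algebra R\<^esub> star_class R a = star_class R (Scale z a)"
  "star (presented_algebra R) (star_class R a) = star_class R (Adj a)"
  "\<one>\<^bsub>presented_algebra R\<^esub> = star_class R (Coef 1)"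
  "\<zero>\<^bsub>presented_algebra R\<^esub> = star_class R (Coef 0)"
proof -
  have "(\<Union>b'\<in>star_class R b. star_class R (Times a' b')) = star_class R (Times a' b)" for a'
    by (rule presented_unary) (intro star_cong.Times star_cong.refl)
  moreover have "(\<Union>b'\<in>star_class R b. star_class R (Plus a' b')) = star_class R (Plus a' b)" for a'
    by (rule presented_unary) (intro star_cong.Plus star_cong.refl)
  moreover have "(\<Union>a'\<in>star_class R a. star_class R (Times a' b)) = star_class R (Times a b)"
    by (rule presented_unary) (intro star_cong.Times star_cong.refl)
  moreover have "(\<Union>a'\<in>star_class R a. star_class R (Plus a' b)) = star_class R (Plus a b)"
    by (rule presented_unary) (intro star_cong.Plus star_cong.refl)
  ultimately show "star_class R a \<otimes>\<^bsub>presented_algebra R\<^esub> star_class R b = star_class R (Times a b)"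
    "star_class R a \<oplus>\<^bsub>presented_algebra R\<^esub> star_class R b = star_class R (Plus a b)"
    by (simp_all add: presented_algebra_def)
  show "z \<odot>\<^bsub>presented_algebra R\<^esub> star_class R a = star_class R (Scale z a)"
    "star (presented_algebra R) (star_class R a) = star_class R (Adj a)"
    by (simp_all add: presented_algebra_def presented_unary star_cong.Scale star_cong.Adj)
qed (simp_all add: presented_algebra_def)

lemma involutive_algebra_presented: "involutive_algebra (presented_algebra R)"
proof (intro involutive_algebra.intro involutive_algebra_axioms.intro)
  show "ring (presented_algebra R)"
  proof (rule ringI)
    show "abelian_group (presented_algebra R)"
    proof (rule abelian_groupI)
      fix x assume "x \<in> carrier (presented_algebra R)"
      then obtain a where "x = star_class R a"
        by (auto simp: presented_carrier)
      then have "star_class R (Scale (-1) a) \<oplus>\<^bsub>presented_algebra R\<^esub> x = \<zero>\<^bsub>presented_algebra R\<^esub>"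
        by (simp add: presented_ops star_class_eq_iff star_cong.plus_inverse)
      then show "\<exists>y\<in>carrier (presented_algebra R). y \<oplus>\<^bsub>presented_algebra R\<^esub> x = \<zero>\<^bsub>presented_algebra R\<^esub>"
        using star_class_closed by blast
    qed (clarsimp elim!: presented_cases simp: presented_ops star_class_eq_iff star_cong.plus_assoc
        star_cong.plus_commute star_cong.plus_zero)+
    show "Group.monoid (presented_algebra R)"
      by (rule monoidI) (clarsimp elim!: presented_cases simp: presented_ops star_class_eq_iff
          star_cong.times_assoc star_cong.one_times star_cong.times_one)+
  qed (clarsimp elim!: presented_cases simp: presented_ops star_class_eq_iff star_cong.plus_times star_cong.times_plus)+
qed (clarsimp elim!: presented_cases simp: presented_ops star_class_eq_iff star_cong.scale_add star_cong.scale_plus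
    star_cong.scale_scale star_cong.scale_one star_cong.scale_times star_cong.times_scale
    star_cong.adj_adj star_cong.adj_plus star_cong.adj_scale star_cong.adj_times)+

lemma toeplitz_rep_presented:
  assumes "toeplitz_relations E \<subseteq> R"
  shows "toeplitz_rep (presented_algebra R) (\<lambda>f. star_class R (Coef f)) (\<lambda>l. star_class R (Gen l)) E"
proof (intro toeplitz_rep.intro coef_rep.intro coef_rep_axioms.intro toeplitz_rep_axioms.intro
    involutive_algebra_presented)
  have "(Times (Coef f) (Gen l), Times (Gen l) (Coef f)) \<in> R"
    "(Times (Adj (Gen l)) (Gen m), Coef (E $ l $ m)) \<in> R" for f l m
    using assms by (auto simp: toeplitz_relations_def)
  then show "star_class R (Coef f) \<otimes>\<^bsub>presented_algebra R\<^esub> star_class R (Gen l) =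
      star_class R (Gen l) \<otimes>\<^bsub>presented_algebra R\<^esub> star_class R (Coef f)"
    "star (presented_algebra R) (star_class R (Gen l)) \<otimes>\<^bsub>presented_algebra R\<^esub> star_class R (Gen m) =
      star_class R (Coef (E $ l $ m))" for f l m
    by (auto simp: presented_ops star_class_eq_iff intro: star_cong.rel)
qed (simp_all add: presented_ops star_class_eq_iff star_cong.sym[OF star_cong.coef_plus]
    star_cong.sym[OF star_cong.coef_times] star_cong.sym[OF star_cong.coef_scale]
    star_cong.sym[OF star_cong.coef_adj])

lemma star_eval_presented:
  "star_eval (presented_algebra R) (\<lambda>f. star_class R (Coef f)) (\<lambda>l. star_class R (Gen l)) a = star_class R a"
  by (induction a) (simp_all add: presented_ops)

text \<open>A class is evaluated through a choice of representative, which is immaterial as soon as the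
  relations hold in the target algebra.\<close>

definition star_lift ::
  "('a, 'm) star_algebra_scheme \<Rightarrow> ('f \<Rightarrow> 'a) \<Rightarrow> ('n \<Rightarrow> 'a) \<Rightarrow> ('f, 'n) star_poly set \<Rightarrow> 'a"
  where "star_lift A c g S = star_eval A c g (SOME a. a \<in> S)"

context coef_rep
begin

context
  fixes g :: "'n \<Rightarrow> 'a" and R :: "('x \<Rightarrow>\<^sub>C complex, 'n) star_poly rel"
  assumes g: "range g \<subseteq> carrier A"
    and R: "\<And>a b. (a, b) \<in> R \<Longrightarrow> star_eval A c g a = star_eval A c g b"
begin

lemma star_lift_class: "star_lift A c g (star_class R a) = star_eval A c g a"
proof -
  have "(SOME b. b \<in> star_class R a) \<in> star_class R a"
    using self_in_star_class by (rule someI)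
  then have "star_cong R a (SOME b. b \<in> star_class R a)"
    by (simp add: in_star_class)
  then have "star_eval A c g a = star_eval A c g (SOME b. b \<in> star_class R a)"
    by (rule star_eval_cong[OF g _, rotated]) (rule R)
  then show ?thesis
    by (simp add: star_lift_def)
qed

lemma involutive_hom_star_lift: "involutive_hom (presented_algebra R) A (star_lift A c g)"
  using star_eval_closed[OF g]
  by (auto simp: involutive_hom_def presented_carrier presented_ops star_lift_class c_one intro!: ring_hom_memI)

end

end

subsection \<open>The gauge automorphisms\<close>

lemma (in toeplitz_rep) toeplitz_rep_gauge:
  assumes z: "norm z = 1"
  shows "toeplitz_rep A c (\<lambda>l. z \<odot> g l) E"
    and "(z \<odot> g l) \<otimes> star A (z \<odot> g l) = g l \<otimes> star A (g l)"
proof -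
  have zz: "z * cnj z = 1"
    using z complex_norm_square[of z] by simp
  then have zz': "cnj z * z = 1"
    by (simp add: mult.commute)
  show "toeplitz_rep A c (\<lambda>l. z \<odot> g l) E"
    by unfold_locales (use zz zz' in \<open>simp_all add: smult_mult_left smult_mult_right star_smult smult_smult g_comm g_inner\<close>)
  show "(z \<odot> g l) \<otimes> star A (z \<odot> g l) = g l \<otimes> star A (g l)"
    using zz zz' by (simp add: smult_mult_left smult_mult_right star_smult smult_smult)
qed

text \<open>The automorphism given by the substitution of \<open>z \<psi>\<^sub>l\<close> for \<open>\<psi>\<^sub>l\<close>, which respects the relations when
  \<open>|z| = 1\<close>.\<close>

definition gauge ::
  "('x::topological_space \<Rightarrow>\<^sub>C complex, 'n) star_poly rel \<Rightarrow> complex \<Rightarrow>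
   ('x \<Rightarrow>\<^sub>C complex, 'n) star_poly set \<Rightarrow> ('x \<Rightarrow>\<^sub>C complex, 'n) star_poly set" where
  "gauge R z = star_lift (presented_algebra R) (\<lambda>f. star_class R (Coef f))
    (\<lambda>l. z \<odot>\<^bsub>presented_algebra R\<^esub> star_class R (Gen l))"

lemma gauge_presented:
  fixes E :: "('x::topological_space \<Rightarrow>\<^sub>C complex)^'n^'n"
  assumes R: "R = toeplitz_relations E \<or> R = pimsner_relations E" and z: "norm z = 1"
  shows "involutive_hom (presented_algebra R) (presented_algebra R) (gauge R z)"
    and "gauge R z (star_class R (Coef f)) = star_class R (Coef f)"
    and "gauge R z (star_class R (Gen l)) = z \<odot>\<^bsub>presented_algebra R\<^esub> star_class R (Gen l)"
proof -
  let ?A = "presented_algebra R" and ?c = "\<lambda>f. star_class R (Coef f)" and ?g = "\<lambda>l. star_class R (Gen l)"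
  have sub: "toeplitz_relations E \<subseteq> R"
    using R by (auto simp: pimsner_relations_def)
  interpret A: toeplitz_rep ?A ?c ?g E
    by (rule toeplitz_rep_presented[OF sub])
  interpret Z: toeplitz_rep ?A ?c "\<lambda>l. z \<odot>\<^bsub>?A\<^esub> ?g l" E
    by (rule A.toeplitz_rep_gauge(1)[OF z])
  have hold: "star_eval ?A ?c (\<lambda>l. z \<odot>\<^bsub>?A\<^esub> ?g l) a = star_eval ?A ?c (\<lambda>l. z \<odot>\<^bsub>?A\<^esub> ?g l) b"
    if ab: "(a, b) \<in> R" for a b
    using R
  proof
    assume "R = toeplitz_relations E"
    then show ?thesis
      using Z.toeplitz_relations_hold[of a b] ab by simp
  next
    assume Rp: "R = pimsner_relations E"
    obtain ls :: "'n list" where ls: "distinct ls" "set ls = UNIV"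
      using finite_distinct_list[of "UNIV :: 'n set"] by auto
    then have "(foldr (\<lambda>l. Plus (Times (Gen l) (Adj (Gen l)))) ls (Coef 0), Coef 1) \<in> R"
      by (auto simp: Rp pimsner_relations_def)
    then have "star_class R (foldr (\<lambda>l. Plus (Times (Gen l) (Adj (Gen l)))) ls (Coef 0)) = star_class R (Coef 1)"
      by (simp add: star_class_eq_iff star_cong.rel)
    then have "finsum ?A (\<lambda>l. ?g l \<otimes>\<^bsub>?A\<^esub> star ?A (?g l)) UNIV = \<one>\<^bsub>?A\<^esub>"
      using A.star_eval_pimsner_sum[OF ls(1)] ls(2) by (simp add: star_eval_presented presented_ops)
    then have "finsum ?A (\<lambda>l. (z \<odot>\<^bsub>?A\<^esub> ?g l) \<otimes>\<^bsub>?A\<^esub> star ?A (z \<odot>\<^bsub>?A\<^esub> ?g l)) UNIV = \<one>\<^bsub>?A\<^esub>"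
      by (simp only: A.toeplitz_rep_gauge(2)[OF z])
    then show ?thesis
      using Z.pimsner_relations_hold[of a b] ab Rp by simp
  qed
  have "range (\<lambda>l. z \<odot>\<^bsub>?A\<^esub> ?g l) \<subseteq> carrier ?A"
    by auto
  note lift = A.star_lift_class[OF this hold] A.involutive_hom_star_lift[OF this hold]
  show "involutive_hom ?A ?A (gauge R z)" "gauge R z (?c f) = ?c f" "gauge R z (?g l) = z \<odot>\<^bsub>?A\<^esub> ?g l"
    using lift(2) lift(1)[where a = "Coef f"] lift(1)[where a = "Gen l"] by (simp_all add: gauge_def)
qed

lemma pimsner_sum_presented:
  fixes E :: "('x::topological_space \<Rightarrow>\<^sub>C complex)^'n^'n"
  defines "R \<equiv> pimsner_relations E"
  shows "finsum (presented_algebra R) (\<lambda>l. star_class R (Gen l) \<otimes>\<^bsub>presented_algebra R\<^esub>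
      star (presented_algebra R) (star_class R (Gen l))) UNIV = \<one>\<^bsub>presented_algebra R\<^esub>"
proof -
  interpret A: toeplitz_rep "presented_algebra R" "\<lambda>f. star_class R (Coef f)" "\<lambda>l. star_class R (Gen l)" E
    by (rule toeplitz_rep_presented) (simp add: R_def pimsner_relations_def)
  obtain ls :: "'n list" where ls: "distinct ls" "set ls = UNIV"
    using finite_distinct_list[of "UNIV :: 'n set"] by auto
  then have "(foldr (\<lambda>l. Plus (Times (Gen l) (Adj (Gen l)))) ls (Coef 0), Coef 1) \<in> R"
    by (auto simp: R_def pimsner_relations_def)
  then have "star_class R (foldr (\<lambda>l. Plus (Times (Gen l) (Adj (Gen l)))) ls (Coef 0)) = star_class R (Coef 1)"
    by (simp add: star_class_eq_iff star_cong.rel)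
  then show ?thesis
    using A.star_eval_pimsner_sum[OF ls(1)] ls(2) by (simp add: star_eval_presented presented_ops)
qed

section \<open>Normal forms and the grading\<close>

context involutive_algebra
begin

inductive_set aspan :: "'a set \<Rightarrow> 'a set" for X where
  zero: "\<zero> \<in> aspan X"
| base: "x \<in> X \<Longrightarrow> x \<in> aspan X"
| add: "x \<in> aspan X \<Longrightarrow> y \<in> aspan X \<Longrightarrow> x \<oplus> y \<in> aspan X"

lemma aspan_closed: "X \<subseteq> carrier A \<Longrightarrow> x \<in> aspan X \<Longrightarrow> x \<in> carrier A"
  by (rotate_tac, induction rule: aspan.induct) auto

lemma aspan_map:
  assumes X: "X \<subseteq> carrier A" and x: "x \<in> aspan X" and h0: "h \<zero> = \<zero>"
    and add: "\<And>x y. x \<in> carrier A \<Longrightarrow> y \<in> carrier A \<Longrightarrow> h (x \<oplus> y) = h x \<oplus> h y"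
    and base: "\<And>x. x \<in> X \<Longrightarrow> h x \<in> aspan Y"
  shows "h x \<in> aspan Y"
  using x
proof (induction rule: aspan.induct)
  case (add x y)
  then show ?case
    using aspan_closed[OF X] assms(4) by (simp add: aspan.add)
qed (use h0 base aspan.zero in auto)

lemma aspan_mono: "X \<subseteq> Y \<Longrightarrow> x \<in> aspan X \<Longrightarrow> x \<in> aspan Y"
  by (rotate_tac, induction rule: aspan.induct) (auto intro: aspan.intros)

lemma aspan_mult:
  assumes X: "X \<subseteq> carrier A" and Y: "Y \<subseteq> carrier A"
    and base: "\<And>x y. x \<in> X \<Longrightarrow> y \<in> Y \<Longrightarrow> x \<otimes> y \<in> aspan Z"
    and x: "x \<in> aspan X" and y: "y \<in> aspan Y"
  shows "x \<otimes> y \<in> aspan Z"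
proof (rule aspan_map[where h = "\<lambda>x. x \<otimes> y", OF X x])
  note yc = aspan_closed[OF Y y]
  show "\<zero> \<otimes> y = \<zero>" "\<And>u v. u \<in> carrier A \<Longrightarrow> v \<in> carrier A \<Longrightarrow> (u \<oplus> v) \<otimes> y = u \<otimes> y \<oplus> v \<otimes> y"
    using yc by (simp_all add: l_distr)
  show "u \<otimes> y \<in> aspan Z" if u: "u \<in> X" for u
  proof -
    have uc: "u \<in> carrier A"
      using u X by blast
    show ?thesis
      by (rule aspan_map[where h = "\<lambda>y. u \<otimes> y", OF Y y]) (use uc base[OF u] in \<open>auto simp: r_distr\<close>)
  qed
qed

end

context toeplitz_rep
begin

lemma c_star_g: "c f \<otimes> star A (g l) = star A (g l) \<otimes> c f"
  using arg_cong[OF g_comm[of "conj_bcontfun f" l], of "star A"] by (simp add: star_mult c_conj)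

lemma g_inner_left: "x \<in> carrier A \<Longrightarrow> star A (g l) \<otimes> (g m \<otimes> x) = c (E $ l $ m) \<otimes> x"
  by (simp add: g_inner m_assoc[symmetric])

lemma c_g_left: "x \<in> carrier A \<Longrightarrow> c f \<otimes> (g l \<otimes> x) = g l \<otimes> (c f \<otimes> x)"
  by (simp add: g_comm m_assoc[symmetric])

primrec word :: "'n list \<Rightarrow> 'a" where
  "word [] = \<one>"
| "word (l # u) = g l \<otimes> word u"

lemma word_closed [simp]: "word u \<in> carrier A"
  by (induction u) auto

lemma word_append: "word (u @ v) = word u \<otimes> word v"
  by (induction u) (auto simp: m_assoc)

lemma c_word: "c f \<otimes> word u = word u \<otimes> c f"
  by (induction u) (auto simp: c_g_left m_assoc)

lemma c_star_word: "c f \<otimes> star A (word u) = star A (word u) \<otimes> c f"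
  using arg_cong[OF c_word[of "conj_bcontfun f" u], of "star A"] by (simp add: star_mult c_conj)

definition monomial :: "'n list \<Rightarrow> ('x \<Rightarrow>\<^sub>C complex) \<Rightarrow> 'n list \<Rightarrow> 'a"
  where "monomial u f v = word u \<otimes> (c f \<otimes> star A (word v))"

lemma monomial_closed [simp]: "monomial u f v \<in> carrier A"
  by (simp add: monomial_def)

lemma star_monomial: "star A (monomial u f v) = monomial v (conj_bcontfun f) u"
  by (simp add: monomial_def star_mult c_conj m_assoc)

lemma smult_monomial: "z \<odot> monomial u f v = monomial u (const_bcontfun z * f) v"
  by (simp add: monomial_def c_scale smult_mult_left smult_mult_right)

text \<open>Adjacent factors \<open>\<psi>\<^sub>l\<^sup>*\<psi>\<^sub>m\<close> are coefficients, so a starred word meeting an unstarred one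
  cancels the shorter of them.\<close>

lemma star_word_word:
  obtains (unstarred) k w where "star A (word v) \<otimes> word u = c k \<otimes> word w"
      "int (length u) = int (length v) + int (length w)"
  | (starred) k w where "star A (word v) \<otimes> word u = c k \<otimes> star A (word w)"
      "int (length v) = int (length u) + int (length w)"
proof -
  have "(\<exists>k w. star A (word v) \<otimes> word u = c k \<otimes> word w \<and> length u = length v + length w) \<or>
    (\<exists>k w. star A (word v) \<otimes> word u = c k \<otimes> star A (word w) \<and> length v = length u + length w)"
  proof (induction v arbitrary: u)
    case Nil
    have "star A (word []) \<otimes> word u = c 1 \<otimes> word u"
      by (simp add: c_one)
    then show ?case
      by (metis add_0 list.size(3))
  next
    case (Cons m v)
    show ?case
    proof (cases u)
      case Nil
      then have "star A (word (m # v)) \<otimes> word u = c 1 \<otimes> star A (word (m # v))"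
        by (simp add: c_one)
      then show ?thesis
        using Nil by (metis add_0 list.size(3))
    next
      case (Cons l a)
      have "star A (word (m # v)) \<otimes> word u = star A (word v) \<otimes> (c (E $ m $ l) \<otimes> word a)"
        by (simp add: Cons star_mult m_assoc g_inner_left)
      also have "\<dots> = c (E $ m $ l) \<otimes> (star A (word v) \<otimes> word a)"
        by (simp add: c_star_word m_assoc[symmetric])
      finally have eq: "star A (word (m # v)) \<otimes> word u = c (E $ m $ l) \<otimes> (star A (word v) \<otimes> word a)" .
      consider k w where "star A (word v) \<otimes> word a = c k \<otimes> word w" "length a = length v + length w"
        | k w where "star A (word v) \<otimes> word a = c k \<otimes> star A (word w)" "length v = length a + length w"
        using Cons.IH[of a] by blast
      then show ?thesis
      proof cases
        case 1
        then have "star A (word (m # v)) \<otimes> word u = c (E $ m $ l * k) \<otimes> word w"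
          using eq by (simp add: c_mult m_assoc)
        then show ?thesis
          using 1 Cons by auto
      next
        case 2
        then have "star A (word (m # v)) \<otimes> word u = c (E $ m $ l * k) \<otimes> star A (word w)"
          using eq by (simp add: c_mult m_assoc)
        then show ?thesis
          using 2 Cons by auto
      qed
    qed
  qed
  then show thesis
    using unstarred starred by fastforce
qed

text \<open>Multiplication is compatible with the degree: the cancellation in the middle shortens the two words that meet
  by the same length.\<close>

lemma monomial_mult:
  obtains a k b where "monomial u f v \<otimes> monomial u' f' v' = monomial a k b"
    "int (length a) - int (length b) =
      (int (length u) - int (length v)) + (int (length u') - int (length v'))"
proof -
  have eq: "monomial u f v \<otimes> monomial u' f' v' =
      word u \<otimes> (c f \<otimes> ((star A (word v) \<otimes> word u') \<otimes> (c f' \<otimes> star A (word v'))))"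
    by (simp add: monomial_def m_assoc)
  show thesis
  proof (cases rule: star_word_word[of v u'])
    case (unstarred k w)
    have "c k \<otimes> word w \<otimes> (c f' \<otimes> star A (word v')) = word w \<otimes> (c (k * f') \<otimes> star A (word v'))"
      by (simp add: c_mult c_word m_assoc)
    moreover have "c f \<otimes> (word w \<otimes> x) = word w \<otimes> (c f \<otimes> x)" if "x \<in> carrier A" for x
      using that by (simp add: c_word m_assoc[symmetric])
    ultimately have "monomial u f v \<otimes> monomial u' f' v' = monomial (u @ w) (f * (k * f')) v'"
      unfolding eq unstarred(1) by (simp add: monomial_def word_append c_mult m_assoc)
    then show thesis
      using that unstarred(2) by simp
  next
    case (starred k w)
    have "c k \<otimes> star A (word w) \<otimes> (c f' \<otimes> star A (word v')) = c (k * f') \<otimes> (star A (word w) \<otimes> star A (word v'))"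
    proof -
      have "star A (word w) \<otimes> (c f' \<otimes> star A (word v')) = c f' \<otimes> (star A (word w) \<otimes> star A (word v'))"
        using arg_cong[OF c_star_word[of f' w], of "\<lambda>x. x \<otimes> star A (word v')"] by (simp add: m_assoc)
      then show ?thesis
        by (simp add: c_mult m_assoc)
    qed
    then have "monomial u f v \<otimes> monomial u' f' v' = monomial u (f * (k * f')) (v' @ w)"
      unfolding eq starred(1) by (simp add: monomial_def word_append star_mult c_mult m_assoc)
    then show thesis
      using that starred(2) by simp
  qed
qed

text \<open>Spans of the monomials whose degree satisfies \<open>P\<close>: this treats homogeneous elements and elements of
  bounded degree at once. Sums suffice for the span, since scalars are absorbed by the coefficients.\<close>

definition graded :: "(int \<Rightarrow> bool) \<Rightarrow> 'a set" where
  "graded P = aspan {monomial u f v | u f v. P (int (length u) - int (length v))}"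

lemma graded_closed: "x \<in> graded P \<Longrightarrow> x \<in> carrier A"
  unfolding graded_def by (erule aspan_closed[rotated]) auto

lemma monomial_graded: "P (int (length u) - int (length v)) \<Longrightarrow> monomial u f v \<in> graded P"
  unfolding graded_def by (rule aspan.base) blast

lemma graded_induct [consumes 1, case_names zero monomial add]:
  assumes "x \<in> graded P" "Q \<zero>"
    and "\<And>u f v. P (int (length u) - int (length v)) \<Longrightarrow> Q (monomial u f v)"
    and "\<And>x y. x \<in> graded P \<Longrightarrow> y \<in> graded P \<Longrightarrow> Q x \<Longrightarrow> Q y \<Longrightarrow> Q (x \<oplus> y)"
  shows "Q x"
  using assms(1) unfolding graded_def
  by (induction rule: aspan.induct) (use assms in \<open>auto simp: graded_def\<close>)

lemma graded_zero: "\<zero> \<in> graded P"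
  and graded_add: "x \<in> graded P \<Longrightarrow> y \<in> graded P \<Longrightarrow> x \<oplus> y \<in> graded P"
  by (auto simp: graded_def intro: aspan.intros)

lemma graded_mono: "x \<in> graded P \<Longrightarrow> (\<And>i. P i \<Longrightarrow> Q i) \<Longrightarrow> x \<in> graded Q"
  by (induction rule: graded_induct) (auto intro: graded_zero graded_add monomial_graded)

lemma graded_mult:
  assumes "x \<in> graded P" "y \<in> graded Q" "\<And>i j. P i \<Longrightarrow> Q j \<Longrightarrow> T (i + j)"
  shows "x \<otimes> y \<in> graded T"
  unfolding graded_def
proof (rule aspan_mult[OF _ _ _ assms(1,2)[unfolded graded_def]])
  fix x y assume "x \<in> {monomial u f v | u f v. P (int (length u) - int (length v))}"
    "y \<in> {monomial u f v | u f v. Q (int (length u) - int (length v))}"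
  then obtain u f v u' f' v' where xy: "x = monomial u f v" "P (int (length u) - int (length v))"
      "y = monomial u' f' v'" "Q (int (length u') - int (length v'))"
    by blast
  obtain a k b where "monomial u f v \<otimes> monomial u' f' v' = monomial a k b"
    "int (length a) - int (length b) = (int (length u) - int (length v)) + (int (length u') - int (length v'))"
    by (rule monomial_mult)
  then show "x \<otimes> y \<in> aspan {monomial u f v | u f v. T (int (length u) - int (length v))}"
    using monomial_graded[of T a b k] assms(3)[OF xy(2,4)] by (simp add: xy graded_def)
qed auto

lemma graded_star: "x \<in> graded P \<Longrightarrow> (\<And>i. P i \<Longrightarrow> Q (- i)) \<Longrightarrow> star A x \<in> graded Q"
proof (induction rule: graded_induct)
  case (monomial u f v)
  then show ?case
    using monomial_graded[of Q v u "conj_bcontfun f"] monomial(2)[OF monomial(1)] by (simp add: star_monomial)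
next
  case (add x y)
  then show ?case
    by (simp add: graded_closed star_add graded_add)
qed (simp add: graded_zero)

lemma graded_smult: "x \<in> graded P \<Longrightarrow> z \<odot> x \<in> graded P"
  by (induction rule: graded_induct)
    (auto simp: graded_zero smult_monomial monomial_graded graded_closed smult_add_right graded_add)

definition homogeneous :: "int \<Rightarrow> 'a set" where "homogeneous d = graded (\<lambda>i. i = d)"

definition bounded_degree :: "nat \<Rightarrow> 'a set" where "bounded_degree D = graded (\<lambda>i. \<bar>i\<bar> \<le> int D)"

lemma bounded_degree_mono: "x \<in> bounded_degree D \<Longrightarrow> D \<le> D' \<Longrightarrow> x \<in> bounded_degree D'"
  unfolding bounded_degree_def by (erule graded_mono) simp

lemma bounded_degree_mult:
  "x \<in> bounded_degree D \<Longrightarrow> y \<in> bounded_degree D' \<Longrightarrow> x \<otimes> y \<in> bounded_degree (D + D')"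
  unfolding bounded_degree_def by (rule graded_mult, assumption, assumption, simp)

lemma bounded_degree_eval: "\<exists>D. star_eval A c g a \<in> bounded_degree D"
proof (induction a)
  case (Coef f)
  have "monomial [] f [] \<in> bounded_degree 0"
    unfolding bounded_degree_def by (rule monomial_graded) simp
  then show ?case
    by (auto simp: monomial_def)
next
  case (Gen l)
  have "monomial [l] 1 [] \<in> bounded_degree 1"
    unfolding bounded_degree_def by (rule monomial_graded) simp
  then show ?case
    by (auto simp: monomial_def c_one)
next
  case (Plus a b)
  then obtain D D' where "star_eval A c g a \<in> bounded_degree D" "star_eval A c g b \<in> bounded_degree D'"
    by blast
  then have "star_eval A c g a \<in> bounded_degree (D + D')" "star_eval A c g b \<in> bounded_degree (D + D')"
    by (auto elim: bounded_degree_mono)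
  then have "star_eval A c g a \<oplus> star_eval A c g b \<in> bounded_degree (D + D')"
    unfolding bounded_degree_def by (rule graded_add)
  then show ?case
    by auto
next
  case (Times a b)
  then show ?case
    using bounded_degree_mult by (simp, blast)
next
  case (Scale z a)
  then show ?case
    unfolding bounded_degree_def by (auto intro: graded_smult)
next
  case (Adj a)
  then obtain D where D: "star_eval A c g a \<in> bounded_degree D"
    by blast
  have "star A (star_eval A c g a) \<in> bounded_degree D"
    using D unfolding bounded_degree_def by (rule graded_star) simp
  then show ?case
    by auto
qed

subsection \<open>The core\<close>

text \<open>The elements of degree zero, filtered by the length of the words. The recursion adds one letter on both
  outer sides, and these are the letters which a compression removes.\<close>

primrec core :: "nat \<Rightarrow> 'a set" where
  "core 0 = range c"
| "core (Suc k) = aspan (range c \<union> {g l \<otimes> (s \<otimes> star A (g m)) | l s m. s \<in> core k})"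

lemma core_closed: "x \<in> core k \<Longrightarrow> x \<in> carrier A"
proof (induction k arbitrary: x)
  case (Suc k)
  have "range c \<union> {g l \<otimes> (s \<otimes> star A (g m)) | l s m. s \<in> core k} \<subseteq> carrier A"
    using Suc.IH by auto
  then show ?case
    using Suc.prems aspan_closed by (simp only: core.simps)
qed auto

lemma core_Suc_subset: "range c \<union> {g l \<otimes> (s \<otimes> star A (g m)) | l s m. s \<in> core k} \<subseteq> carrier A"
  using core_closed by auto

lemma c_core: "c f \<in> core k"
  by (cases k) (auto intro: aspan.base)

lemma core_step: "s \<in> core k \<Longrightarrow> g l \<otimes> (s \<otimes> star A (g m)) \<in> core (Suc k)"
  by (auto intro!: aspan.base)

lemma core_add: "x \<in> core k \<Longrightarrow> y \<in> core k \<Longrightarrow> x \<oplus> y \<in> core k"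
  by (cases k) (auto intro: aspan.add simp: c_add[symmetric])

lemma core_Suc: "x \<in> core k \<Longrightarrow> x \<in> core (Suc k)"
proof (induction k arbitrary: x)
  case 0
  then obtain f where "x = c f"
    by auto
  then show ?case
    by (simp only: c_core)
next
  case (Suc k)
  have "range c \<union> {g l \<otimes> (s \<otimes> star A (g m)) | l s m. s \<in> core k} \<subseteq>
      range c \<union> {g l \<otimes> (s \<otimes> star A (g m)) | l s m. s \<in> core (Suc k)}"
    using Suc.IH by blast
  then show ?case
    using Suc.prems aspan_mono by (simp only: core.simps)
qed

lemma core_mono: "k \<le> k' \<Longrightarrow> x \<in> core k \<Longrightarrow> x \<in> core k'"
  by (induction rule: dec_induct) (auto simp: core_Suc simp del: core.simps)

lemma core_mult: "x \<in> core k \<Longrightarrow> y \<in> core k \<Longrightarrow> x \<otimes> y \<in> core k"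
proof (induction k arbitrary: x y)
  case 0
  then show ?case
    by (auto simp: c_mult[symmetric])
next
  case (Suc k)
  let ?X = "range c \<union> {g l \<otimes> (s \<otimes> star A (g m)) | l s m. s \<in> core k}"
  have "x \<otimes> y \<in> core (Suc k)" if xy: "x \<in> ?X" "y \<in> ?X" for x y
  proof -
    consider f h where "x = c f" "y = c h"
      | f l t m where "x = c f" "y = g l \<otimes> (t \<otimes> star A (g m))" "t \<in> core k"
      | f l s m where "x = g l \<otimes> (s \<otimes> star A (g m))" "s \<in> core k" "y = c f"
      | l s m i t j where "x = g l \<otimes> (s \<otimes> star A (g m))" "s \<in> core k"
          "y = g i \<otimes> (t \<otimes> star A (g j))" "t \<in> core k"
      using xy by blast
    then show ?thesis
    proof cases
      case 1
      then show ?thesis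
        by (simp only: c_mult[symmetric] c_core)
    next
      case 2
      have "x \<otimes> y = g l \<otimes> ((c f \<otimes> t) \<otimes> star A (g m))"
        using 2 core_closed by (simp add: c_g_left m_assoc)
      then show ?thesis
        using core_step Suc.IH[OF c_core 2(3)] by simp
    next
      case 3
      have "x \<otimes> y = g l \<otimes> ((s \<otimes> c f) \<otimes> star A (g m))"
        using 3 core_closed by (simp add: c_star_g m_assoc)
      then show ?thesis
        using core_step Suc.IH[OF 3(2) c_core] by simp
    next
      case 4
      have "x \<otimes> y = g l \<otimes> ((s \<otimes> (c (E $ m $ i) \<otimes> t)) \<otimes> star A (g j))"
        using 4 core_closed by (simp add: g_inner_left m_assoc)
      then show ?thesis
        using core_step Suc.IH[OF 4(2) Suc.IH[OF c_core 4(4)]] by simp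
    qed
  qed
  then show ?case
    using Suc.prems aspan_mult[OF core_Suc_subset core_Suc_subset, of k k _ x y] by (simp only: core.simps)
qed

text \<open>In \<open>\<psi>\<^sub>l\<^sup>* (\<psi>\<^sub>i s \<psi>\<^sub>j\<^sup>*) \<psi>\<^sub>m\<close> the outer pairs are coefficients.\<close>

lemma core_compress:
  assumes "x \<in> core (Suc k)"
  shows "star A (g l) \<otimes> (x \<otimes> g m) \<in> core k"
  using assms unfolding core.simps
proof (induction rule: aspan.induct)
  case zero
  then show ?case
    using c_core[of 0 k] by (simp add: c_zero)
next
  case (base x)
  then consider f where "x = c f" | i s j where "x = g i \<otimes> (s \<otimes> star A (g j))" "s \<in> core k"
    by blast
  then show ?case
  proof cases
    case 1
    then have "star A (g l) \<otimes> (x \<otimes> g m) = c (E $ l $ m * f)"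
      by (simp add: g_comm g_inner_left c_mult)
    then show ?thesis
      by (simp add: c_core)
  next
    case 2
    then have "star A (g l) \<otimes> (x \<otimes> g m) = c (E $ l $ i) \<otimes> (s \<otimes> c (E $ j $ m))"
      using core_closed by (simp add: m_assoc g_inner g_inner_left)
    then show ?thesis
      using core_mult[OF c_core core_mult[OF 2(2) c_core]] by simp
  qed
next
  case (add x y)
  then show ?case
    using aspan_closed[OF core_Suc_subset] by (simp add: l_distr r_distr core_add)
qed

lemma monomial_core: "length u = length v \<Longrightarrow> monomial u f v \<in> core (length u)"
proof (induction u arbitrary: v)
  case Nil
  then show ?case
    by (simp add: monomial_def)
next
  case (Cons l u)
  then obtain m w where v: "v = m # w" "length u = length w"
    by (metis Suc_length_conv)
  then have "monomial (l # u) f v = g l \<otimes> (monomial u f w \<otimes> star A (g m))"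
    by (simp add: monomial_def star_mult m_assoc)
  then show ?case
    using core_step[OF Cons.IH[OF v(2)]] by simp
qed

lemma homogeneous_zero_core: "x \<in> homogeneous 0 \<Longrightarrow> \<exists>k. x \<in> core k"
  unfolding homogeneous_def
proof (induction rule: graded_induct)
  case (monomial u f v)
  then show ?case
    using monomial_core[of u v f] by auto
next
  case (add x y)
  then obtain k k' where "x \<in> core k" "y \<in> core k'"
    by blast
  then have "x \<in> core (max k k')" "y \<in> core (max k k')"
    using core_mono by (meson max.cobounded1 max.cobounded2)+
  then show ?case
    using core_add by blast
next
  case zero
  show ?case
    using c_core[of 0] unfolding c_zero by blast
qed

end

subsection \<open>Spectral components\<close>

text \<open>Orthogonality of the characters of the cyclic group of order \<open>M\<close>, which is all of the harmonic analysis
  needed to project onto homogeneous components.\<close>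

lemma sum_cis_multiples:
  assumes "\<bar>m\<bar> < int M"
  shows "(\<Sum>k<M. cis (2 * pi * real k * real_of_int m / real M)) = (if m = 0 then of_nat M else 0)"
proof (cases "m = 0")
  case False
  define r where "r = cis (2 * pi * real_of_int m / real M)"
  have M: "real M > 0"
    using assms by simp
  have "r \<noteq> 1"
  proof
    assume "r = 1"
    then have "cos (2 * pi * real_of_int m / real M) = 1"
      by (metis r_def Re_complex_of_real cis.simps(1) of_real_1)
    then obtain n :: int where "2 * pi * real_of_int m / real M = real_of_int n * 2 * pi"
      using cos_one_2pi_int by auto
    then have "real_of_int m = real_of_int n * real M"
      using M by (simp add: field_simps)
    then have mn: "m = n * int M"
      by (metis of_int_eq_iff of_int_mult of_int_of_nat_eq)
    then have "\<bar>m\<bar> = \<bar>n\<bar> * int M"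
      by (simp add: abs_mult)
    moreover have "1 \<le> \<bar>n\<bar>"
      using False mn by auto
    ultimately have "int M \<le> \<bar>m\<bar>"
      using mult_right_mono[of 1 "\<bar>n\<bar>" "int M"] by simp
    then show False
      using assms by simp
  qed
  moreover have "r ^ M = 1"
    using M cis_multiple_2pi[of "real_of_int m"] by (simp add: r_def Complex.DeMoivre)
  moreover have "cis (2 * pi * real k * real_of_int m / real M) = r ^ k" for k
    by (simp add: r_def Complex.DeMoivre mult_ac)
  ultimately show ?thesis
    using False by (simp add: geometric_sum)
qed simp

text \<open>The circle is only required to act on the algebraic level. That it preserves a given seminorm is
  a hypothesis of the individual results.\<close>

locale gauged_rep = toeplitz_rep A c g E for A :: "('a, 'm) star_algebra_scheme" (structure)
    and c :: "('x::topological_space \<Rightarrow>\<^sub>C complex) \<Rightarrow> 'a" and g :: "'n::finite \<Rightarrow> 'a" and E +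
  fixes gam :: "complex \<Rightarrow> 'a \<Rightarrow> 'a"
  assumes spanning: "x \<in> carrier A \<Longrightarrow> \<exists>a. x = star_eval A c g a"
    and gam_hom: "norm z = 1 \<Longrightarrow> involutive_hom A A (gam z)"
    and gam_c: "norm z = 1 \<Longrightarrow> gam z (c f) = c f"
    and gam_g: "norm z = 1 \<Longrightarrow> gam z (g l) = z \<odot> g l"
    and E: "projection E"
begin

lemma bounded_degree_all: "x \<in> carrier A \<Longrightarrow> \<exists>D. x \<in> bounded_degree D"
  using spanning bounded_degree_eval by metis

lemma gam_word:
  assumes z: "norm z = 1" shows "gam z (word u) = z ^ length u \<odot> word u"
proof (induction u)
  case Nil
  then show ?case
    using involutive_hom_one[OF gam_hom[OF z]] by simp
next
  case (Cons l u)
  then show ?case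
    using involutive_homD(5)[OF gam_hom[OF z], of "g l" "word u"]
    by (simp add: gam_g[OF z] smult_mult_left smult_mult_right smult_smult mult.commute)
qed

lemma gam_monomial:
  "gam (cis t) (monomial u f v) = cis (t * of_int (int (length u) - int (length v))) \<odot> monomial u f v"
proof -
  note h = involutive_homD[OF gam_hom[OF norm_cis[of t]]]
  have "gam (cis t) (monomial u f v) =
      (cis t ^ length u * cnj (cis t ^ length v)) \<odot> monomial u f v"
    by (simp add: monomial_def h gam_word gam_c smult_mult_left smult_mult_right star_smult smult_smult mult.commute)
  moreover have "cis t ^ length u * cnj (cis t ^ length v) = cis (t * of_int (int (length u) - int (length v)))"
    by (simp add: Complex.DeMoivre cis_cnj cis_mult algebra_simps)
  ultimately show ?thesis
    by simp
qed

text \<open>The component of degree \<open>i\<close> is an average over the roots of unity of order \<open>2 D + 1\<close>,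
  which suffices for elements whose degrees lie between \<open>-D\<close> and \<open>D\<close>.\<close>

definition component :: "nat \<Rightarrow> int \<Rightarrow> 'a \<Rightarrow> 'a" where
  "component D i x = (let M = 2 * D + 1 in complex_of_real (1 / real M) \<odot>
    finsum A (\<lambda>k. cis (- (2 * pi * real k * of_int i / real M)) \<odot> gam (cis (2 * pi * real k / real M)) x) {..<M})"

lemma gam_closed [simp]: "x \<in> carrier A \<Longrightarrow> gam (cis t) x \<in> carrier A"
  using involutive_homD(1)[OF gam_hom[OF norm_cis]] .

lemma component_closed [simp]: "x \<in> carrier A \<Longrightarrow> component D i x \<in> carrier A"
  by (auto simp: component_def Let_def intro!: smult_closed finsum_closed)

lemma component_add:
  assumes "x \<in> carrier A" "y \<in> carrier A"
  shows "component D i (x \<oplus> y) = component D i x \<oplus> component D i y"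
proof -
  define M where "M = 2 * D + 1"
  let ?t = "\<lambda>x k. cis (- (2 * pi * real k * of_int i / real M)) \<odot> gam (cis (2 * pi * real k / real M)) x"
  have t: "?t x \<in> {..<M} \<rightarrow> carrier A" "?t y \<in> {..<M} \<rightarrow> carrier A"
    using assms by auto
  have "?t (x \<oplus> y) = (\<lambda>k. ?t x k \<oplus> ?t y k)"
    using assms by (simp add: involutive_homD(4)[OF gam_hom[OF norm_cis]] smult_add_right)
  then show ?thesis
    unfolding component_def Let_def M_def[symmetric]
    using t by (simp add: finsum_addf smult_add_right finsum_closed)
qed

lemma component_zero: "component D i \<zero> = \<zero>"
  using component_add[of "\<zero>" "\<zero>" D i] component_closed[of "\<zero>" D i] by (simp add: add.l_cancel_one')

lemma component_monomial:
  assumes "\<bar>i\<bar> \<le> int D" "\<bar>int (length u) - int (length v)\<bar> \<le> int D"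
  shows "component D i (monomial u f v) =
    (if i = int (length u) - int (length v) then monomial u f v else \<zero>)"
proof -
  define M where "M = 2 * D + 1"
  define j where "j = int (length u) - int (length v)"
  have "cis (- (2 * pi * real k * of_int i / real M)) \<odot> gam (cis (2 * pi * real k / real M)) (monomial u f v)
      = cis (2 * pi * real k * of_int (j - i) / real M) \<odot> monomial u f v" for k
    by (simp add: gam_monomial smult_smult cis_mult j_def[symmetric] algebra_simps diff_divide_distrib)
  then have "component D i (monomial u f v) = complex_of_real (1 / real M) \<odot>
      ((\<Sum>k<M. cis (2 * pi * real k * of_int (j - i) / real M)) \<odot> monomial u f v)"
    unfolding component_def Let_def M_def[symmetric] by (simp add: finsum_smult_left)
  moreover have "(\<Sum>k<M. cis (2 * pi * real k * of_int (j - i) / real M)) = (if j - i = 0 then of_nat M else 0)"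
    by (rule sum_cis_multiples) (use assms in \<open>auto simp: j_def M_def\<close>)
  moreover have "real M > 0"
    by (simp add: M_def)
  ultimately show ?thesis
    unfolding j_def[symmetric] by (simp only:) (simp add: smult_smult)
qed

lemma component_homogeneous:
  assumes "x \<in> bounded_degree D" "\<bar>i\<bar> \<le> int D"
  shows "component D i x \<in> homogeneous i"
  using assms(1) unfolding bounded_degree_def homogeneous_def
proof (induction rule: graded_induct)
  case (monomial u f v)
  then show ?case
    using component_monomial[OF assms(2) monomial] by (simp add: graded_zero monomial_graded)
qed (auto simp: component_zero component_add graded_zero graded_add graded_closed)

lemma component_sum:
  assumes "x \<in> bounded_degree D"
  shows "finsum A (\<lambda>i. component D i x) {- int D..int D} = x"
  using assms unfolding bounded_degree_def
proof (induction rule: graded_induct)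
  case (monomial u f v)
  let ?j = "int (length u) - int (length v)"
  have "finsum A (\<lambda>i. component D i (monomial u f v)) {- int D..int D} =
      finsum A (\<lambda>i. if ?j = i then monomial u f v else \<zero>) {- int D..int D}"
    using monomial by (intro finsum_cong') (auto simp: component_monomial)
  also have "\<dots> = monomial u f v"
    using monomial by (subst finsum_singleton) auto
  finally show ?case .
next
  case (add x y)
  then show ?case
    by (simp add: component_add graded_closed finsum_addf Pi_def)
qed (simp add: component_zero)

end

text \<open>The component is an average of elements which all have the seminorm of \<open>x\<close>.\<close>

lemma (in cstar_seminormed) N_component:
  assumes "gauged_rep A c g E gam" and x: "x \<in> carrier A"
    and inv: "\<And>t. N (gam (cis t) x) = N x"
  shows "N (gauged_rep.component A gam D i x) \<le> N x"
proof -
  interpret G: gauged_rep A c g E gam by fact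
  define M where "M = 2 * D + 1"
  let ?f = "\<lambda>k. cis (- (2 * pi * real k * of_int i / real M)) \<odot> gam (cis (2 * pi * real k / real M)) x"
  have f: "?f \<in> {..<M} \<rightarrow> carrier A"
    using x by auto
  have "N (finsum A ?f {..<M}) \<le> (\<Sum>k<M. N (?f k))"
    by (rule N_finsum[OF _ f]) simp
  also have "\<dots> = real M * N x"
    using x by (simp add: N_smult inv)
  finally have "N (finsum A ?f {..<M}) \<le> real M * N x" .
  moreover have "real M > 0"
    by (simp add: M_def)
  ultimately show ?thesis
    unfolding G.component_def Let_def M_def[symmetric] using f
    by (simp add: N_smult finsum_closed norm_divide field_simps)
qed

section \<open>Comparison of C*-seminorms on graded algebras\<close>

text \<open>Constants are removed by squaring twice: first on each \<open>core k\<close>, which is closed under products, so that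
  a fixed constant remains; then on elements of degree at most \<open>D\<close>, where the constant \<open>2 D + 1\<close> at most
  doubles with every squaring. In between, \<open>x\<^sup>* x\<close> brings homogeneous elements to degree zero.\<close>

lemma (in gauged_rep) seminorm_le_if_core_le:
  assumes p: "cstar_seminormed A p" and N: "cstar_seminormed A N"
    and inv: "\<And>t x. x \<in> carrier A \<Longrightarrow> N (gam (cis t) x) = N x"
    and core: "\<And>k. \<exists>C. \<forall>x\<in>core k. p x \<le> C * N x"
    and x: "x \<in> carrier A"
  shows "p x \<le> N x"
proof -
  interpret p: cstar_seminormed A p by fact
  interpret N: cstar_seminormed A N by fact
  have sq: "star A (star A y \<otimes> y) = star A y \<otimes> y" if "y \<in> carrier A" for y
    using that by (simp add: star_mult)
  have le_if_sq: "p y \<le> N y" if y: "y \<in> carrier A" and le: "p (star A y \<otimes> y) \<le> N (star A y \<otimes> y)" for y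
    using le y by (simp add: p.N_cstar N.N_cstar power2_le_iff_abs_le)
  have core_le: "p y \<le> N y" if y: "y \<in> core k" "star A y = y" for k y
  proof -
    obtain C where C: "\<And>x. x \<in> core k \<Longrightarrow> p x \<le> C * N x"
      using core by blast
    show ?thesis
    proof (rule cstar_seminorm_le_by_squaring[OF p N, where D = core and k = k and g = id and K = "\<bar>C\<bar>"])
      show "x \<otimes> x \<in> core (id k)" if "x \<in> core k" for k x
        using core_mult[OF that that] by simp
      fix m x assume x: "x \<in> core ((id ^^ m) k)" "x \<in> carrier A"
      have "p x \<le> C * N x"
        using C x(1) by simp
      also have "\<dots> \<le> (\<bar>C\<bar> * 2 ^ m) * N x"
      proof (rule mult_right_mono)
        show "C \<le> \<bar>C\<bar> * 2 ^ m"
          using mult_left_mono[of 1 "2 ^ m :: real" "\<bar>C\<bar>"] by simp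
      qed (use x in simp)
      finally show "p x \<le> \<bar>C\<bar> * 2 ^ m * N x" .
    qed (use y core_closed in auto)
  qed
  have homogeneous_le: "p y \<le> N y" if y: "y \<in> homogeneous i" for i y
  proof -
    have yc: "y \<in> carrier A"
      using y graded_closed by (auto simp: homogeneous_def)
    have "star A y \<otimes> y \<in> homogeneous 0"
      using graded_mult[OF graded_star[of y "\<lambda>j. j = i" "\<lambda>j. j = - i"], of y "\<lambda>j. j = i" "\<lambda>j. j = 0"] y
      by (simp add: homogeneous_def)
    then obtain k where "star A y \<otimes> y \<in> core k"
      using homogeneous_zero_core by blast
    then show ?thesis
      using core_le sq[OF yc] le_if_sq[OF yc] by blast
  qed
  have degree_le: "p y \<le> (2 * real D + 1) * N y" if y: "y \<in> bounded_degree D" for D y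
  proof -
    have yc: "y \<in> carrier A"
      using y graded_closed by (auto simp: bounded_degree_def)
    have "p y = p (finsum A (\<lambda>i. component D i y) {- int D..int D})"
      using component_sum[OF y] by simp
    also have "\<dots> \<le> (\<Sum>i\<in>{- int D..int D}. p (component D i y))"
      by (rule p.N_finsum) (use yc in auto)
    also have "\<dots> \<le> (\<Sum>i\<in>{- int D..int D}. N y)"
    proof (rule sum_mono)
      fix i assume "i \<in> {- int D..int D}"
      then have "p (component D i y) \<le> N (component D i y)"
        by (intro homogeneous_le[of _ i] component_homogeneous[OF y]) auto
      also have "\<dots> \<le> N y"
        by (rule N.N_component[OF gauged_rep_axioms yc inv[OF yc]])
      finally show "p (component D i y) \<le> N y" .
    qed
    also have "\<dots> = (2 * real D + 1) * N y"
      by simp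
    finally show ?thesis .
  qed
  have selfadjoint_le: "p y \<le> N y" if y: "y \<in> bounded_degree D" "y \<in> carrier A" "star A y = y" for D y
  proof (rule cstar_seminorm_le_by_squaring[OF p N, where D = bounded_degree and k = D and g = "\<lambda>D. D + D"
        and K = "2 * real D + 1"])
    show "x \<otimes> x \<in> bounded_degree (k + k)" if "x \<in> bounded_degree k" for k x
      by (rule bounded_degree_mult[OF that that])
    have pow: "((\<lambda>D. D + D) ^^ m) D = 2 ^ m * D" for m
      by (induction m) auto
    fix m x assume x: "x \<in> bounded_degree (((\<lambda>D. D + D) ^^ m) D)" "x \<in> carrier A"
    have "p x \<le> (2 * real (2 ^ m * D) + 1) * N x"
      using degree_le x(1) by (simp only: pow)
    also have "\<dots> \<le> ((2 * real D + 1) * 2 ^ m) * N x"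
      by (rule mult_right_mono) (use x in \<open>auto simp: algebra_simps\<close>)
    finally show "p x \<le> (2 * real D + 1) * 2 ^ m * N x" .
  qed (use y in auto)
  have xx: "star A x \<otimes> x \<in> carrier A"
    using x by simp
  obtain D where "star A x \<otimes> x \<in> bounded_degree D"
    using bounded_degree_all[OF xx] by blast
  then show ?thesis
    using selfadjoint_le xx sq[OF x] le_if_sq[OF x] by blast
qed

subsection \<open>The range projection of the generators\<close>

context toeplitz_rep
begin

definition range_proj :: 'a where "range_proj = finsum A (\<lambda>l. g l \<otimes> star A (g l)) UNIV"

lemma range_proj_closed [simp]: "range_proj \<in> carrier A"
  by (auto simp: range_proj_def intro!: finsum_closed)

lemma star_range_proj: "star A range_proj = range_proj"
  by (simp add: range_proj_def star_finsum Pi_def star_mult)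

lemma range_proj_mult_left:
  "y \<in> carrier A \<Longrightarrow> range_proj \<otimes> y = finsum A (\<lambda>l. g l \<otimes> (star A (g l) \<otimes> y)) UNIV"
  by (simp add: range_proj_def finsum_ldistr Pi_def m_assoc)

lemma range_proj_mult_right:
  "y \<in> carrier A \<Longrightarrow> y \<otimes> range_proj = finsum A (\<lambda>l. (y \<otimes> g l) \<otimes> star A (g l)) UNIV"
  by (simp add: range_proj_def finsum_rdistr Pi_def m_assoc)

text \<open>The relations alone do not give \<open>\<psi>\<^sub>a = \<Sum>\<^sub>l \<psi>\<^sub>l \<psi>\<^sub>l\<^sup>* \<psi>\<^sub>a\<close>, but the difference \<open>d\<close> of both sides
  satisfies \<open>\<psi>\<^sub>m\<^sup>* d = 0\<close> for all \<open>m\<close>, hence \<open>d\<^sup>* d = 0\<close>, and no C*-seminorm sees \<open>d\<close>.\<close>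

lemma seminorm_range_proj:
  assumes "cstar_seminormed A p" and E: "projection E"
  shows "p (g a \<ominus> range_proj \<otimes> g a) = 0"
proof -
  interpret p: cstar_seminormed A p by fact
  have EE: "(\<Sum>l\<in>UNIV. E $ m $ l * E $ l $ k) = E $ m $ k" for m k
  proof -
    have "(E ** E) $ m $ k = E $ m $ k"
      using E by (simp add: projection_def)
    then show ?thesis
      by (simp add: matrix_matrix_mult_def)
  qed
  define d where "d = g a \<ominus> range_proj \<otimes> g a"
  have dc: "d \<in> carrier A"
    by (simp add: d_def)
  have "star A (g m) \<otimes> (range_proj \<otimes> g a) = c (E $ m $ a)" for m
  proof -
    have "star A (g m) \<otimes> (range_proj \<otimes> g a) = finsum A (\<lambda>l. star A (g m) \<otimes> (g l \<otimes> (star A (g l) \<otimes> g a))) UNIV"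
      by (simp add: range_proj_mult_left finsum_rdistr Pi_def)
    also have "\<dots> = finsum A (\<lambda>l. c (E $ m $ l * E $ l $ a)) UNIV"
      by (simp add: g_inner_left g_inner c_mult)
    also have "\<dots> = c (E $ m $ a)"
      by (simp add: c_sum[symmetric] EE)
    finally show ?thesis .
  qed
  then have gd: "star A (g m) \<otimes> d = \<zero>" for m
    by (simp add: d_def a_minus_def r_distr r_minus g_inner r_neg)
  have "range_proj \<otimes> d = \<zero>"
    using dc by (simp add: range_proj_mult_left gd)
  moreover have "star A d = star A (g a) \<ominus> star A (g a) \<otimes> range_proj"
    by (simp add: d_def star_diff star_mult star_range_proj)
  ultimately have "star A d \<otimes> d = \<zero>"
    using dc by (simp add: a_minus_def l_distr l_minus gd m_assoc)
  then have "(p d)\<^sup>2 = 0"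
    using p.N_cstar[OF dc] by simp
  then show ?thesis
    by (simp add: d_def)
qed

text \<open>By the hypotheses, \<open>y\<close> and \<open>Q y Q\<close>, with \<open>Q = \<Sum> \<psi>\<^sub>l \<psi>\<^sub>l\<^sup>*\<close>, have the same seminorm, and the latter is the sum of the
  \<open>\<psi>\<^sub>l (\<psi>\<^sub>l\<^sup>* y \<psi>\<^sub>m) \<psi>\<^sub>m\<^sup>*\<close>.\<close>

lemma seminorm_le_compressions:
  assumes "cstar_seminormed A p" and y: "y \<in> carrier A"
    and left: "p (y \<ominus> range_proj \<otimes> y) = 0" and right: "p (y \<ominus> y \<otimes> range_proj) = 0"
  shows "p y \<le> (\<Sum>l\<in>UNIV. \<Sum>m\<in>UNIV. p (g l) * (p (star A (g l) \<otimes> (y \<otimes> g m)) * p (g m)))"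
proof -
  interpret p: cstar_seminormed A p by fact
  have "p y = p (range_proj \<otimes> y)"
    by (rule p.N_eqI) (use y left in auto)
  also have "\<dots> \<le> (\<Sum>l\<in>UNIV. p (g l \<otimes> (star A (g l) \<otimes> y)))"
    unfolding range_proj_mult_left[OF y] by (rule p.N_finsum) (use y in auto)
  also have "\<dots> \<le> (\<Sum>l\<in>UNIV. p (g l) * p (star A (g l) \<otimes> y))"
    by (rule sum_mono, rule p.N_mult) (use y in auto)
  also have "\<dots> \<le> (\<Sum>l\<in>UNIV. p (g l) * (\<Sum>m\<in>UNIV. p (star A (g l) \<otimes> (y \<otimes> g m)) * p (g m)))"
  proof (intro sum_mono mult_left_mono)
    fix l :: 'n
    let ?z = "star A (g l) \<otimes> y"
    have z: "?z \<in> carrier A"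
      using y by simp
    have "?z \<ominus> ?z \<otimes> range_proj = star A (g l) \<otimes> (y \<ominus> y \<otimes> range_proj)"
      using y by (simp add: a_minus_def r_distr r_minus m_assoc)
    then have "p (?z \<ominus> ?z \<otimes> range_proj) \<le> p (star A (g l)) * p (y \<ominus> y \<otimes> range_proj)"
      using p.N_mult[of "star A (g l)" "y \<ominus> y \<otimes> range_proj"] y by simp
    moreover have "0 \<le> p (?z \<ominus> ?z \<otimes> range_proj)"
      using z by simp
    ultimately have "p (?z \<ominus> ?z \<otimes> range_proj) = 0"
      using right by simp
    then have "p ?z = p (?z \<otimes> range_proj)"
      by (intro p.N_eqI) (use z in auto)
    also have "\<dots> \<le> (\<Sum>m\<in>UNIV. p (?z \<otimes> g m \<otimes> star A (g m)))"
      unfolding range_proj_mult_right[OF z] by (rule p.N_finsum) (use z in auto)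
    also have "\<dots> \<le> (\<Sum>m\<in>UNIV. p (?z \<otimes> g m) * p (star A (g m)))"
      by (rule sum_mono, rule p.N_mult) (use z in auto)
    finally show "p ?z \<le> (\<Sum>m\<in>UNIV. p (star A (g l) \<otimes> (y \<otimes> g m)) * p (g m))"
      using y by (simp add: m_assoc)
  qed simp
  finally show ?thesis
    by (simp add: sum_distrib_left)
qed

text \<open>One step of the induction along the core. The assumptions on \<open>y\<close> allow it to be used both when the
  range projection is the unit and when it is only a unit for a part of the core.\<close>

lemma seminorm_le_step:
  assumes "cstar_seminormed A p" "cstar_seminormed A N"
    and C: "\<And>x. x \<in> core k \<Longrightarrow> p x \<le> C * N x"
  obtains K where "0 \<le> K"
    "\<And>y. y \<in> carrier A \<Longrightarrow> p (y \<ominus> range_proj \<otimes> y) = 0 \<Longrightarrow> p (y \<ominus> y \<otimes> range_proj) = 0 \<Longrightarrow>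
      (\<And>l m. star A (g l) \<otimes> (y \<otimes> g m) \<in> core k) \<Longrightarrow> p y \<le> K * N y"
proof
  interpret p: cstar_seminormed A p by fact
  interpret N: cstar_seminormed A N by fact
  let ?K = "\<Sum>l\<in>UNIV. \<Sum>m\<in>UNIV. p (g l) * (\<bar>C\<bar> * (N (g l) * N (g m)) * p (g m))"
  show "0 \<le> ?K"
    by (intro sum_nonneg mult_nonneg_nonneg) auto
  fix y assume y: "y \<in> carrier A" and left: "p (y \<ominus> range_proj \<otimes> y) = 0"
    and right: "p (y \<ominus> y \<otimes> range_proj) = 0" and comp: "\<And>l m. star A (g l) \<otimes> (y \<otimes> g m) \<in> core k"
  have bound: "p (star A (g l) \<otimes> (y \<otimes> g m)) \<le> \<bar>C\<bar> * (N (g l) * N (g m)) * N y" for l m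
  proof -
    let ?z = "star A (g l) \<otimes> (y \<otimes> g m)"
    have zc: "?z \<in> carrier A"
      using y by simp
    have "N ?z \<le> N (star A (g l)) * (N y * N (g m))"
      using N.N_mult[of "star A (g l)" "y \<otimes> g m"] N.N_mult[of y "g m"] y
        mult_left_mono[of "N (y \<otimes> g m)" "N y * N (g m)" "N (star A (g l))"] by simp
    then have Nz: "N ?z \<le> N (g l) * N (g m) * N y"
      by (simp add: mult_ac)
    have "p ?z \<le> \<bar>C\<bar> * N ?z"
      by (rule order_trans[OF C[OF comp]], rule mult_right_mono) (use N.N_nonneg[OF zc] in auto)
    also have "\<dots> \<le> \<bar>C\<bar> * (N (g l) * N (g m) * N y)"
      using Nz by (rule mult_left_mono) simp
    finally show ?thesis
      by (simp add: mult_ac)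
  qed
  have "p y \<le> (\<Sum>l\<in>UNIV. \<Sum>m\<in>UNIV. p (g l) * (p (star A (g l) \<otimes> (y \<otimes> g m)) * p (g m)))"
    by (rule seminorm_le_compressions[OF assms(1) y left right])
  also have "\<dots> \<le> (\<Sum>l\<in>UNIV. \<Sum>m\<in>UNIV. p (g l) * ((\<bar>C\<bar> * (N (g l) * N (g m)) * N y) * p (g m)))"
    by (intro sum_mono mult_left_mono mult_right_mono bound) auto
  also have "\<dots> = ?K * N y"
    by (simp add: sum_distrib_left sum_distrib_right mult_ac)
  finally show "p y \<le> ?K * N y" .
qed

end

subsection \<open>The algebra with the relation on the range projection\<close>

context gauged_rep
begin

theorem pimsner_seminorm_le:
  assumes p: "cstar_seminormed A p" and N: "cstar_seminormed A N" and one: "range_proj = \<one>"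
    and inv: "\<And>t x. x \<in> carrier A \<Longrightarrow> N (gam (cis t) x) = N x"
    and coef: "\<And>f. p (c f) \<le> N (c f)"
    and x: "x \<in> carrier A"
  shows "p x \<le> N x"
proof (rule seminorm_le_if_core_le[OF p N inv _ x])
  interpret p: cstar_seminormed A p by fact
  show "\<exists>C. \<forall>x\<in>core k. p x \<le> C * N x" for k
  proof (induction k)
    case 0
    then show ?case
      using coef by (intro exI[of _ 1]) auto
  next
    case (Suc k)
    then obtain C where "\<And>x. x \<in> core k \<Longrightarrow> p x \<le> C * N x"
      by blast
    then obtain K where K: "\<And>y. y \<in> carrier A \<Longrightarrow> p (y \<ominus> range_proj \<otimes> y) = 0 \<Longrightarrow>
      p (y \<ominus> y \<otimes> range_proj) = 0 \<Longrightarrow> (\<And>l m. star A (g l) \<otimes> (y \<otimes> g m) \<in> core k) \<Longrightarrow> p y \<le> K * N y"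
      using seminorm_le_step[OF p N] by metis
    have "p y \<le> K * N y" if y: "y \<in> core (Suc k)" for y
      using core_closed[OF y] core_compress[OF y] by (intro K) (simp_all add: one)
    then show ?case
      by blast
  qed
qed

lemma gen_star_homogeneous: "star A (g l) \<in> homogeneous (-1)"
  using monomial_graded[of "\<lambda>i. i = -1" "[]" "[l]" 1] by (simp add: homogeneous_def monomial_def c_one)

text \<open>If \<open>N x = 0\<close>, then \<open>N\<close> vanishes on all compressions of \<open>x\<close>; they move down the core to the
  coefficients, where \<open>N\<close> is faithful. An element is zero if all its products with the
  \<open>\<psi>\<^sub>l\<^sup>*\<close> are, because \<open>\<Sum> \<psi>\<^sub>l \<psi>\<^sub>l\<^sup>* = 1\<close>. This also lowers a positive degree step by step to zero.\<close>

theorem pimsner_seminorm_faithful: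
  assumes N: "cstar_seminormed A N" and one: "range_proj = \<one>"
    and inv: "\<And>t x. x \<in> carrier A \<Longrightarrow> N (gam (cis t) x) = N x"
    and coef: "\<And>f. N (c f) = 0 \<Longrightarrow> c f = \<zero>"
    and x: "x \<in> carrier A" "N x = 0"
  shows "x = \<zero>"
proof -
  interpret N: cstar_seminormed A N by fact
  have null_left: "N (a \<otimes> y) = 0" if "a \<in> carrier A" "y \<in> carrier A" "N y = 0" for a y
    using N.N_mult[OF that(1,2)] N.N_nonneg[of "a \<otimes> y"] that by (simp add: antisym)
  have null_right: "N (y \<otimes> a) = 0" if "a \<in> carrier A" "y \<in> carrier A" "N y = 0" for a y
    using N.N_mult[OF that(2,1)] N.N_nonneg[of "y \<otimes> a"] that by (simp add: antisym)
  have zero_left: "y = \<zero>" if y: "y \<in> carrier A" and z: "\<And>l. star A (g l) \<otimes> y = \<zero>" for y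
    using range_proj_mult_left[OF y] y z one by simp
  have zero_right: "y = \<zero>" if y: "y \<in> carrier A" and z: "\<And>l. y \<otimes> g l = \<zero>" for y
    using range_proj_mult_right[OF y] y z one by simp
  have core_zero: "y = \<zero>" if "y \<in> core k" "N y = 0" for k y
    using that
  proof (induction k arbitrary: y)
    case 0
    then show ?case
      using coef by auto
  next
    case (Suc k)
    have y: "y \<in> carrier A"
      using core_closed Suc.prems by blast
    have "star A (g l) \<otimes> (y \<otimes> g m) = \<zero>" for l m
      by (rule Suc.IH[OF core_compress[OF Suc.prems(1)]])
        (use y Suc.prems in \<open>simp add: null_left null_right\<close>)
    then have "y \<otimes> g m = \<zero>" for m
      using zero_left[of "y \<otimes> g m"] y by simp
    then show ?case
      using zero_right[OF y] by simp
  qed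
  have hom_zero: "y = \<zero>" if "y \<in> homogeneous (int n)" "N y = 0" for n y
    using that
  proof (induction n arbitrary: y)
    case 0
    then show ?case
      using homogeneous_zero_core core_zero by fastforce
  next
    case (Suc n)
    have y: "y \<in> carrier A"
      using Suc.prems graded_closed by (auto simp: homogeneous_def)
    have "star A (g l) \<otimes> y \<in> homogeneous (int n)" for l
      using gen_star_homogeneous[of l] Suc.prems(1) unfolding homogeneous_def
      by (rule graded_mult) simp
    then have "star A (g l) \<otimes> y = \<zero>" for l
      using Suc.IH Suc.prems(2) y by (simp add: null_left)
    then show ?case
      using zero_left[OF y] by simp
  qed
  have component_zero: "component D i x = \<zero>" if "x \<in> bounded_degree D" "\<bar>i\<bar> \<le> int D" for D i
  proof -
    let ?y = "component D i x"
    have y: "?y \<in> carrier A" "?y \<in> homogeneous i"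
      using x component_homogeneous[OF that] by auto
    have Ny: "N ?y = 0"
      using N.N_component[OF gauged_rep_axioms x(1) inv[OF x(1)], of D i] N.N_nonneg[OF y(1)] x(2) by simp
    show ?thesis
    proof (cases "0 \<le> i")
      case True
      then show ?thesis
        using hom_zero[of ?y "nat i"] y Ny by simp
    next
      case False
      have "star A ?y \<in> homogeneous (int (nat (- i)))"
        using y(2) False unfolding homogeneous_def by (elim graded_star) auto
      then have "star A ?y = \<zero>"
        by (rule hom_zero) (use y Ny in simp)
      then show ?thesis
        using star_star[OF y(1)] by simp
    qed
  qed
  obtain D where D: "x \<in> bounded_degree D"
    using bounded_degree_all x by blast
  then have "finsum A (\<lambda>i. component D i x) {- int D..int D} = finsum A (\<lambda>i. \<zero>) {- int D..int D}"
    using component_zero by (intro finsum_cong') auto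
  then show ?thesis
    using component_sum[OF D] by simp
qed

end

subsection \<open>The algebra without that relation\<close>

context toeplitz_rep
begin

text \<open>The elements of \<open>core (k + 1)\<close> without a constant term.\<close>

definition ladder :: "nat \<Rightarrow> 'a set" where
  "ladder k = aspan {g l \<otimes> (s \<otimes> star A (g m)) | l s m. s \<in> core k}"

lemma ladder_subset: "{g l \<otimes> (s \<otimes> star A (g m)) | l s m. s \<in> core k} \<subseteq> carrier A"
  using core_closed by auto

lemma ladder_closed: "y \<in> ladder k \<Longrightarrow> y \<in> carrier A"
  using aspan_closed[OF ladder_subset] by (simp add: ladder_def)

lemma ladder_core: "y \<in> ladder k \<Longrightarrow> y \<in> core (Suc k)"
  unfolding ladder_def core.simps by (erule aspan_mono[rotated]) blast

lemma core_Suc_split: "x \<in> core (Suc k) \<Longrightarrow> \<exists>f. \<exists>y\<in>ladder k. x = c f \<oplus> y"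
  unfolding core.simps ladder_def
proof (induction rule: aspan.induct)
  case zero
  show ?case
    by (rule exI[of _ 0], rule bexI[OF _ aspan.zero]) (simp add: c_zero)
next
  case (base x)
  then consider f where "x = c f" | "x \<in> {g l \<otimes> (s \<otimes> star A (g m)) | l s m. s \<in> core k}"
    by blast
  then show ?case
  proof cases
    case 1
    then show ?thesis
      by (intro exI[of _ f] bexI[OF _ aspan.zero]) simp
  next
    case 2
    then have "x = c 0 \<oplus> x"
      using ladder_subset by (simp add: c_zero subset_iff)
    then show ?thesis
      using aspan.base[OF 2] by blast
  qed
next
  case (add x y)
  then obtain f z h w where *: "x = c f \<oplus> z" "y = c h \<oplus> w"
    "z \<in> aspan {g l \<otimes> (s \<otimes> star A (g m)) | l s m. s \<in> core k}"
    "w \<in> aspan {g l \<otimes> (s \<otimes> star A (g m)) | l s m. s \<in> core k}"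
    by blast
  then have "x \<oplus> y = c (f + h) \<oplus> (z \<oplus> w)"
    using aspan_closed[OF ladder_subset] by (simp add: c_add a_ac)
  then show ?case
    using aspan.add[OF *(3,4)] by blast
qed

text \<open>Each spanning element begins with a generator and ends with an adjoint of one, which the range projection
  fixes up to seminorm zero.\<close>

lemma ladder_range_proj:
  assumes p: "cstar_seminormed A p" and E: "projection E" and y: "y \<in> ladder k"
  shows "p (y \<ominus> range_proj \<otimes> y) = 0" "p (y \<ominus> y \<otimes> range_proj) = 0"
proof -
  interpret p: cstar_seminormed A p by fact
  have null: "p (g l \<ominus> range_proj \<otimes> g l) = 0" for l
    by (rule seminorm_range_proj[OF p E])
  have "p (y \<ominus> range_proj \<otimes> y) = 0 \<and> p (y \<ominus> y \<otimes> range_proj) = 0"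
    using y unfolding ladder_def
  proof (induction rule: aspan.induct)
    case (base y)
    then obtain l s m where y: "y = g l \<otimes> (s \<otimes> star A (g m))" "s \<in> carrier A"
      using core_closed by blast
    have "y \<ominus> range_proj \<otimes> y = (g l \<ominus> range_proj \<otimes> g l) \<otimes> (s \<otimes> star A (g m))"
      using y by (simp add: a_minus_def l_distr l_minus m_assoc)
    then have "p (y \<ominus> range_proj \<otimes> y) \<le> p (g l \<ominus> range_proj \<otimes> g l) * p (s \<otimes> star A (g m))"
      using p.N_mult y by simp
    moreover have "star A (g m \<ominus> range_proj \<otimes> g m) = star A (g m) \<ominus> star A (g m) \<otimes> range_proj"
      by (simp add: star_diff star_mult star_range_proj)
    moreover have "y \<ominus> y \<otimes> range_proj = (g l \<otimes> s) \<otimes> (star A (g m) \<ominus> star A (g m) \<otimes> range_proj)"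
      using y by (simp add: a_minus_def r_distr r_minus m_assoc)
    ultimately have "p (y \<ominus> y \<otimes> range_proj) \<le> p (g l \<otimes> s) * p (star A (g m \<ominus> range_proj \<otimes> g m))"
      "p (y \<ominus> range_proj \<otimes> y) \<le> 0"
      using p.N_mult y null by simp_all
    moreover have "p (star A (g m \<ominus> range_proj \<otimes> g m)) = 0"
      using null by simp
    moreover have "0 \<le> p (y \<ominus> y \<otimes> range_proj)" "0 \<le> p (y \<ominus> range_proj \<otimes> y)"
      using y by simp_all
    ultimately show ?case
      by simp
  next
    case (add x y)
    have xy: "x \<in> carrier A" "y \<in> carrier A"
      using add aspan_closed[OF ladder_subset] by blast+
    have "(x \<oplus> y) \<ominus> range_proj \<otimes> (x \<oplus> y) = (x \<ominus> range_proj \<otimes> x) \<oplus> (y \<ominus> range_proj \<otimes> y)"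
      "(x \<oplus> y) \<ominus> (x \<oplus> y) \<otimes> range_proj = (x \<ominus> x \<otimes> range_proj) \<oplus> (y \<ominus> y \<otimes> range_proj)"
      using xy range_proj_closed by algebra+
    then have "p ((x \<oplus> y) \<ominus> range_proj \<otimes> (x \<oplus> y)) \<le> 0" "p ((x \<oplus> y) \<ominus> (x \<oplus> y) \<otimes> range_proj) \<le> 0"
      using p.N_add[of "x \<ominus> range_proj \<otimes> x" "y \<ominus> range_proj \<otimes> y"]
        p.N_add[of "x \<ominus> x \<otimes> range_proj" "y \<ominus> y \<otimes> range_proj"] add xy by simp_all
    moreover have "0 \<le> p ((x \<oplus> y) \<ominus> range_proj \<otimes> (x \<oplus> y))" "0 \<le> p ((x \<oplus> y) \<ominus> (x \<oplus> y) \<otimes> range_proj)"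
      using xy by simp_all
    ultimately show ?case
      by simp
  qed simp
  then show "p (y \<ominus> range_proj \<otimes> y) = 0" "p (y \<ominus> y \<otimes> range_proj) = 0"
    by simp_all
qed

end

text \<open>In the step of the induction the coefficient \<open>f\<close> and the rest \<open>y\<close> of an element of the core are estimated
  separately. The hypothesis on the ladder bounds \<open>N (c f)\<close>, and hence \<open>N y\<close>, by the seminorm of the whole.\<close>

theorem (in gauged_rep) toeplitz_seminorm_le:
  assumes p: "cstar_seminormed A p" and N: "cstar_seminormed A N"
    and inv: "\<And>t x. x \<in> carrier A \<Longrightarrow> N (gam (cis t) x) = N x"
    and coef: "\<And>f. p (c f) \<le> N (c f)"
    and vacuum: "\<And>f k y. y \<in> ladder k \<Longrightarrow> N (c f) \<le> N (c f \<oplus> y)"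
    and x: "x \<in> carrier A"
  shows "p x \<le> N x"
proof (rule seminorm_le_if_core_le[OF p N inv _ x])
  interpret p: cstar_seminormed A p by fact
  interpret N: cstar_seminormed A N by fact
  show "\<exists>C. \<forall>x\<in>core k. p x \<le> C * N x" for k
  proof (induction k)
    case 0
    then show ?case
      using coef by (intro exI[of _ 1]) auto
  next
    case (Suc k)
    then obtain C where "\<And>x. x \<in> core k \<Longrightarrow> p x \<le> C * N x"
      by blast
    then obtain K where "0 \<le> K" and K: "\<And>y. y \<in> carrier A \<Longrightarrow> p (y \<ominus> range_proj \<otimes> y) = 0 \<Longrightarrow>
      p (y \<ominus> y \<otimes> range_proj) = 0 \<Longrightarrow> (\<And>l m. star A (g l) \<otimes> (y \<otimes> g m) \<in> core k) \<Longrightarrow> p y \<le> K * N y"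
      using seminorm_le_step[OF p N] by metis
    have "p x \<le> (1 + 2 * K) * N x" if x: "x \<in> core (Suc k)" for x
    proof -
      obtain f y where y: "y \<in> ladder k" and xy: "x = c f \<oplus> y"
        using core_Suc_split[OF x] by blast
      have yc: "y \<in> carrier A"
        by (rule ladder_closed[OF y])
      have cf: "p (c f) \<le> N x" "N (c f) \<le> N x"
        using coef[of f] vacuum[OF y, of f] xy by simp_all
      have "p y \<le> K * N y"
        using yc ladder_range_proj[OF p E y] core_compress[OF ladder_core[OF y]] by (intro K)
      also have "\<dots> \<le> K * (2 * N x)"
      proof (rule mult_left_mono[OF _ \<open>0 \<le> K\<close>])
        have "y = x \<ominus> c f"
          using yc c_closed[of f] unfolding xy by algebra
        then show "N y \<le> 2 * N x"
          using N.N_diff[of x "c f"] core_closed[OF x] cf by simp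
      qed
      finally show ?thesis
        using p.N_add[of "c f" y] yc cf xy by (simp add: algebra_simps)
    qed
    then show ?case
      by blast
  qed
qed

subsection \<open>Coefficients\<close>

text \<open>A real function of norm at most 1 is the real part of a unitary function, and unitaries
  have seminorm at most 1.\<close>

lemma (in cstar_seminormed) coef_le_norm:
  assumes "coef_rep A c"
  shows "N (c f) \<le> norm f"
proof -
  interpret coef_rep A c by fact
  have real_le: "N (c h) \<le> 1" if h: "conj_bcontfun h = h" "norm h \<le> 1" for h
  proof -
    have hx: "apply_bcontfun h x = complex_of_real (Re (apply_bcontfun h x))" for x
      using arg_cong[OF h(1), of "\<lambda>h. apply_bcontfun h x"] by (simp add: apply_conj complex_eq_iff)
    have h1: "\<bar>Re (apply_bcontfun h x)\<bar> \<le> 1" for x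
      using norm_bounded[of h x] h(2) abs_Re_le_cmod[of "apply_bcontfun h x"] by linarith
    define w where "w = Bcontfun (\<lambda>x. complex_of_real (sqrt (1 - (Re (apply_bcontfun h x))\<^sup>2)))"
    have "(\<lambda>x. complex_of_real (sqrt (1 - (Re (apply_bcontfun h x))\<^sup>2))) \<in> bcontfun"
    proof (rule bcontfun_normI[where b = 1])
      show "norm (complex_of_real (sqrt (1 - (Re (apply_bcontfun h x))\<^sup>2))) \<le> 1" for x
        using h1[of x] by (simp add: abs_square_le_1)
    qed (intro continuous_intros continuous_on_apply_bcontfun)
    then have wx: "apply_bcontfun w x = complex_of_real (sqrt (1 - (Re (apply_bcontfun h x))\<^sup>2))" for x
      by (simp add: w_def Bcontfun_inverse)
    \<comment> \<open>The unitary \<open>h + i \<surd>(1 - h\<^sup>2)\<close>.\<close>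
    define u where "u = h + const_bcontfun \<i> * w"
    have "conj_bcontfun u * u = 1"
    proof (rule bcontfun_eqI)
      fix x
      define r where "r = Re (apply_bcontfun h x)"
      have r: "r\<^sup>2 \<le> 1"
        using h1[of x] by (simp add: r_def abs_square_le_1)
      have "apply_bcontfun u x = Complex r (sqrt (1 - r\<^sup>2))"
        using hx[of x] by (simp add: u_def apply_times const_bcontfun.rep_eq wx r_def[symmetric] complex_eq_iff)
      then have "cnj (apply_bcontfun u x) * apply_bcontfun u x = 1"
        using r by (simp add: complex_eq_iff power2_eq_square[symmetric])
      then show "apply_bcontfun (conj_bcontfun u * u) x = apply_bcontfun 1 x"
        by (simp add: apply_times apply_conj apply_one)
    qed
    then have "(N (c u))\<^sup>2 = N \<one>"
      using N_cstar[of "c u"] by (simp add: c_conj[symmetric] c_mult[symmetric] c_one)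
    then have u: "N (c u) \<le> 1"
      using N_one_le by (metis abs_le_square_iff abs_of_nonneg abs_one c_closed N_nonneg one_power2)
    have "h = const_bcontfun (1/2) * (u + conj_bcontfun u)"
    proof (rule bcontfun_eqI)
      fix x show "apply_bcontfun h x = apply_bcontfun (const_bcontfun (1/2) * (u + conj_bcontfun u)) x"
        using hx[of x] by (simp add: u_def apply_times apply_conj const_bcontfun.rep_eq wx complex_eq_iff)
    qed
    then have "N (c h) = 1/2 * N (c u \<oplus> star A (c u))"
      by (simp only: c_scale c_add c_conj) (simp add: N_smult)
    also have "\<dots> \<le> 1/2 * (N (c u) + N (star A (c u)))"
      by (intro mult_left_mono N_add) auto
    finally show ?thesis
      using u by simp
  qed
  show ?thesis
  proof (cases "f = 0")
    case False
    define r where "r = norm f"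
    have r: "r > 0"
      using False by (simp add: r_def)
    define h where "h = const_bcontfun (complex_of_real (1 / r\<^sup>2)) * (conj_bcontfun f * f)"
    have "norm h \<le> 1"
    proof (rule norm_bound)
      fix x
      have "norm (apply_bcontfun f x) * norm (apply_bcontfun f x) \<le> r * r"
        using norm_bounded[of f x] by (intro mult_mono) (auto simp: r_def)
      then show "norm (apply_bcontfun h x) \<le> 1"
        using r by (simp add: h_def apply_times apply_conj const_bcontfun.rep_eq norm_mult norm_divide
            power2_eq_square field_simps)
    qed
    moreover have "conj_bcontfun h = h"
      by (rule bcontfun_eqI) (simp add: h_def apply_times apply_conj const_bcontfun.rep_eq mult_ac)
    ultimately have "N (c h) \<le> 1"
      by (rule real_le[rotated])
    moreover have "N (c h) = (1 / r\<^sup>2) * (N (c f))\<^sup>2"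
    proof -
      have "c h = complex_of_real (1 / r\<^sup>2) \<odot> (star A (c f) \<otimes> c f)"
        unfolding h_def c_scale by (simp add: c_mult c_conj)
      then show ?thesis
        using N_cstar[of "c f"] r by (simp add: N_smult norm_divide norm_power)
    qed
    ultimately have "(1 / r\<^sup>2) * (N (c f))\<^sup>2 \<le> 1"
      by simp
    then have "(N (c f))\<^sup>2 \<le> r\<^sup>2"
      using r by (simp add: pos_divide_le_eq)
    then have "N (c f) \<le> r"
      by (rule power2_le_imp_le) (use r in simp)
    then show ?thesis
      by (simp add: r_def)
  qed (simp add: c_zero)
qed

section \<open>Closed subspaces\<close>

context cstar_algebra
begin

lemma closed_subspaceI:
  assumes "S \<subseteq> carrier B" "\<zero> \<in> S" "\<And>a b. a \<in> S \<Longrightarrow> b \<in> S \<Longrightarrow> a \<oplus> b \<in> S" "\<And>z a. a \<in> S \<Longrightarrow> z \<odot> a \<in> S"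
    and "\<And>s a. (\<And>i. s i \<in> S) \<Longrightarrow> seq_lim B (nrm B) s a \<Longrightarrow> a \<in> S"
  shows "closed_subspace B S"
  unfolding closed_subspace_def
proof (intro conjI allI ballI impI)
  fix s a assume "a \<in> carrier B" "(\<forall>i. s i \<in> S) \<and> (\<lambda>i. nrm B (s i \<ominus> a)) \<longlonglongrightarrow> 0"
  then show "a \<in> S"
    using assms(1) by (intro assms(5)[of s a]) (auto simp: seq_lim_def)
qed (use assms(1-4) in blast)+

lemma closed_subspaceD:
  assumes "closed_subspace B S"
  shows "S \<subseteq> carrier B" "\<zero> \<in> S" "a \<in> S \<Longrightarrow> b \<in> S \<Longrightarrow> a \<oplus> b \<in> S" "a \<in> S \<Longrightarrow> z \<odot> a \<in> S"
    "(\<And>i. s i \<in> S) \<Longrightarrow> seq_lim B (nrm B) s a \<Longrightarrow> a \<in> S"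
proof -
  show "a \<in> S" if "\<And>i. s i \<in> S" "seq_lim B (nrm B) s a"
    using assms that unfolding closed_subspace_def seq_lim_def by blast
qed (use assms in \<open>simp_all add: closed_subspace_def\<close>)

lemma closed_subspace_carrier: "closed_subspace B (carrier B)"
  by (rule closed_subspaceI) (auto simp: seq_lim_def)

lemma closed_subspace_vimage:
  assumes S: "closed_subspace B S"
    and h: "\<And>a. a \<in> carrier B \<Longrightarrow> h a \<in> carrier B"
    and zero: "h \<zero> = \<zero>"
    and add: "\<And>a b. a \<in> carrier B \<Longrightarrow> b \<in> carrier B \<Longrightarrow> h (a \<oplus> b) = h a \<oplus> h b"
    and smult: "\<And>z a. a \<in> carrier B \<Longrightarrow> h a \<in> S \<Longrightarrow> h (z \<odot> a) \<in> S"
    and lim: "\<And>s a. seq_lim B (nrm B) s a \<Longrightarrow> seq_lim B (nrm B) (\<lambda>i. h (s i)) (h a)"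
  shows "closed_subspace B {a \<in> carrier B. h a \<in> S}"
proof (rule closed_subspaceI)
  show "a \<in> {a \<in> carrier B. h a \<in> S}" if s: "\<And>i. s i \<in> {a \<in> carrier B. h a \<in> S}"
    and a: "seq_lim B (nrm B) s a" for s a
    using closed_subspaceD(5)[OF S _ lim[OF a]] s seq_limD(2)[OF a] by blast
qed (use closed_subspaceD(2,3)[OF S] zero add smult h in auto)

lemma closed_span_least: "closed_subspace B S \<Longrightarrow> G \<subseteq> S \<Longrightarrow> closed_span B G \<subseteq> S"
  by (auto simp: closed_span_def)

lemma closed_span_base: "G \<subseteq> closed_span B G"
  by (auto simp: closed_span_def)

lemma closed_subspace_Inter:
  assumes "\<And>S. S \<in> F \<Longrightarrow> closed_subspace B S" "F \<noteq> {}"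
  shows "closed_subspace B (\<Inter>F)"
proof (rule closed_subspaceI)
  obtain S where S: "S \<in> F"
    using assms(2) by blast
  show "\<Inter>F \<subseteq> carrier B"
    using closed_subspaceD(1)[OF assms(1)[OF S]] S by blast
  show "\<zero> \<in> \<Inter>F"
    using closed_subspaceD(2)[OF assms(1)] by blast
  show "a \<oplus> b \<in> \<Inter>F" if "a \<in> \<Inter>F" "b \<in> \<Inter>F" for a b
    using closed_subspaceD(3)[OF assms(1)] that by blast
  show "z \<odot> a \<in> \<Inter>F" if "a \<in> \<Inter>F" for z a
    using closed_subspaceD(4)[OF assms(1)] that by blast
  show "a \<in> \<Inter>F" if s: "\<And>i. s i \<in> \<Inter>F" and a: "seq_lim B (nrm B) s a" for s a
  proof
    fix T assume T: "T \<in> F"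
    then show "a \<in> T"
      using s by (intro closed_subspaceD(5)[OF assms(1)[OF T] _ a]) blast
  qed
qed

lemma closed_subspace_closed_span: "G \<subseteq> carrier B \<Longrightarrow> closed_subspace B (closed_span B G)"
  unfolding closed_span_def by (rule closed_subspace_Inter) (use closed_subspace_carrier in auto)

lemma generated_cstar_least:
  "closed_subspace B S \<Longrightarrow> (\<And>a b. a \<in> S \<Longrightarrow> b \<in> S \<Longrightarrow> a \<otimes> b \<in> S) \<Longrightarrow> (\<And>a. a \<in> S \<Longrightarrow> star B a \<in> S) \<Longrightarrow>
    G \<subseteq> S \<Longrightarrow> generated_cstar B G \<subseteq> S"
  by (auto simp: generated_cstar_def)

lemma generated_cstar:
  assumes "G \<subseteq> carrier B"
  shows "closed_subspace B (generated_cstar B G)" "G \<subseteq> generated_cstar B G"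
    "a \<in> generated_cstar B G \<Longrightarrow> b \<in> generated_cstar B G \<Longrightarrow> a \<otimes> b \<in> generated_cstar B G"
    "a \<in> generated_cstar B G \<Longrightarrow> star B a \<in> generated_cstar B G"
proof -
  show "closed_subspace B (generated_cstar B G)"
    unfolding generated_cstar_def
    by (rule closed_subspace_Inter) (use closed_subspace_carrier assms in auto)
qed (auto simp: generated_cstar_def)

end

section \<open>Hilbert modules over the continuous functions\<close>

text \<open>The operations of the module are tied to those of a group type, so that the arithmetic of vectors is the
  one of the type, and only membership in \<open>vecs M\<close> has to be tracked.\<close>

locale hilbert_cx_module =
  fixes M :: "('x::topological_space, 'v::ab_group_add) hilbert_module"
  assumes vadd_eq: "vadd M = (+)" and vzero_eq: "vzero M = 0"
    and V_zero [simp]: "0 \<in> vecs M"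
    and V_add [simp]: "x \<in> vecs M \<Longrightarrow> y \<in> vecs M \<Longrightarrow> x + y \<in> vecs M"
    and V_act [simp]: "x \<in> vecs M \<Longrightarrow> vact M x f \<in> vecs M"
    and act_add: "x \<in> vecs M \<Longrightarrow> y \<in> vecs M \<Longrightarrow> vact M (x + y) f = vact M x f + vact M y f"
    and act_plus: "x \<in> vecs M \<Longrightarrow> vact M x (f + h) = vact M x f + vact M x h"
    and act_act: "x \<in> vecs M \<Longrightarrow> vact M (vact M x f) h = vact M x (f * h)"
    and act_one [simp]: "x \<in> vecs M \<Longrightarrow> vact M x 1 = x"
    and inner_add_right: "x \<in> vecs M \<Longrightarrow> y \<in> vecs M \<Longrightarrow> z \<in> vecs M \<Longrightarrow>
      vinner M x (y + z) = vinner M x y + vinner M x z"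
    and inner_act_right: "x \<in> vecs M \<Longrightarrow> y \<in> vecs M \<Longrightarrow> vinner M x (vact M y f) = vinner M x y * f"
    and inner_conj: "x \<in> vecs M \<Longrightarrow> y \<in> vecs M \<Longrightarrow> conj_bcontfun (vinner M x y) = vinner M y x"
    and inner_pos: "x \<in> vecs M \<Longrightarrow> 0 \<le> Re (apply_bcontfun (vinner M x x) t)"
    and inner_definite: "x \<in> vecs M \<Longrightarrow> vinner M x x = 0 \<Longrightarrow> x = 0"
    and complete: "(\<And>i. s i \<in> vecs M) \<Longrightarrow>
      (\<And>e. 0 < e \<Longrightarrow> \<exists>K. \<forall>i\<ge>K. \<forall>j\<ge>K. vnorm M (s i - s j) < e) \<Longrightarrow>
      \<exists>x\<in>vecs M. (\<lambda>i. vnorm M (s i - x)) \<longlonglongrightarrow> 0"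

lemma conj_add: "conj_bcontfun (f + h) = conj_bcontfun f + conj_bcontfun h"
  and conj_mult: "conj_bcontfun (f * h) = conj_bcontfun f * conj_bcontfun h"
  and conj_one [simp]: "conj_bcontfun 1 = 1"
  and conj_const: "conj_bcontfun (const_bcontfun z) = const_bcontfun (cnj z)"
  by (rule bcontfun_eqI; simp add: apply_conj apply_times apply_one const_bcontfun.rep_eq)+

lemma const_bcontfun_simps:
  "const_bcontfun 1 = (1 :: 'x::topological_space \<Rightarrow>\<^sub>C complex)"
  "const_bcontfun (z * w) = (const_bcontfun z * const_bcontfun w :: 'x \<Rightarrow>\<^sub>C complex)"
  "const_bcontfun (z + w) = (const_bcontfun z + const_bcontfun w :: 'x \<Rightarrow>\<^sub>C complex)"
  by (rule bcontfun_eqI; simp add: apply_times apply_one const_bcontfun.rep_eq)+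

lemma norm_const_bcontfun [simp]: "norm (const_bcontfun z :: 'x::topological_space \<Rightarrow>\<^sub>C complex) = norm z"
proof (rule antisym)
  show "norm (const_bcontfun z :: 'x \<Rightarrow>\<^sub>C complex) \<le> norm z"
    by (rule norm_bound) (simp add: const_bcontfun.rep_eq)
  show "norm z \<le> norm (const_bcontfun z :: 'x \<Rightarrow>\<^sub>C complex)"
    using norm_bounded[of "const_bcontfun z :: 'x \<Rightarrow>\<^sub>C complex" undefined] by (simp add: const_bcontfun.rep_eq)
qed

context hilbert_cx_module
begin

abbreviation V :: "'v set" where "V \<equiv> vecs M"
abbreviation ip :: "'v \<Rightarrow> 'v \<Rightarrow> 'x \<Rightarrow>\<^sub>C complex" where "ip \<equiv> vinner M"
abbreviation act :: "'v \<Rightarrow> ('x \<Rightarrow>\<^sub>C complex) \<Rightarrow> 'v" where "act \<equiv> vact M"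
abbreviation nm :: "'v \<Rightarrow> real" where "nm \<equiv> vnorm M"

lemma act_zero [simp]: "x \<in> V \<Longrightarrow> act x 0 = 0"
  using act_plus[of x 0 0] by simp

lemma zero_act [simp]: "act 0 f = 0"
  using act_add[of 0 0 f] by simp

lemma act_neg_one: "x \<in> V \<Longrightarrow> act x (- 1) = - x"
  using act_plus[of x "- 1" 1] by (simp add: eq_neg_iff_add_eq_0)

lemma V_minus [simp]: "x \<in> V \<Longrightarrow> - x \<in> V"
  using V_act[of x "- 1"] by (simp add: act_neg_one)

lemma V_diff [simp]: "x \<in> V \<Longrightarrow> y \<in> V \<Longrightarrow> x - y \<in> V"
  using V_add[of x "- y"] by simp

lemma inner_add_left: "x \<in> V \<Longrightarrow> y \<in> V \<Longrightarrow> z \<in> V \<Longrightarrow> ip (x + y) z = ip x z + ip y z"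
  using inner_add_right[of z x y] inner_conj[of z "x + y"] inner_conj[of z x] inner_conj[of z y]
  by (metis V_add conj_add)

lemma inner_act_left: "x \<in> V \<Longrightarrow> y \<in> V \<Longrightarrow> ip (act x f) y = conj_bcontfun f * ip x y"
  using inner_act_right[of y x f] inner_conj[of y "act x f"] inner_conj[of y x]
  by (metis V_act conj_mult mult.commute)

lemma inner_zero_right [simp]: "x \<in> V \<Longrightarrow> ip x 0 = 0"
  using inner_add_right[of x 0 0] by simp

lemma inner_zero_left [simp]: "x \<in> V \<Longrightarrow> ip 0 x = 0"
  using inner_add_left[of 0 0 x] by simp

lemma inner_minus_right: "x \<in> V \<Longrightarrow> y \<in> V \<Longrightarrow> ip x (- y) = - ip x y"
  using inner_act_right[of x y "- 1"] by (simp add: act_neg_one)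

lemma inner_diff_right: "x \<in> V \<Longrightarrow> y \<in> V \<Longrightarrow> z \<in> V \<Longrightarrow> ip x (y - z) = ip x y - ip x z"
  using inner_add_right[of x y "- z"] by (simp add: inner_minus_right)

lemma inner_minus_left: "x \<in> V \<Longrightarrow> y \<in> V \<Longrightarrow> ip (- x) y = - ip x y"
  using inner_add_left[of x "- x" y] by (simp add: eq_neg_iff_add_eq_0 add.commute)

lemma inner_self_real: "x \<in> V \<Longrightarrow> apply_bcontfun (ip x x) t = of_real (Re (apply_bcontfun (ip x x) t))"
  using arg_cong[OF inner_conj[of x x], of "\<lambda>f. apply_bcontfun f t"]
  by (simp add: apply_conj complex_eq_iff)

text \<open>The inner product is a positive form over each point \<open>t\<close>, so the usual argument applies: the
  constant \<open>- s d\<^sup>*\<close>, where \<open>d\<close> is the value of the inner product, has the phase that makes the cross terms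
  of the quadratic expression real.\<close>

lemma inner_cauchy_schwarz:
  assumes x: "x \<in> V" and y: "y \<in> V"
  shows "(norm (apply_bcontfun (ip x y) t))\<^sup>2 \<le>
    Re (apply_bcontfun (ip x x) t) * Re (apply_bcontfun (ip y y) t)"
proof -
  define a where "a = Re (apply_bcontfun (ip x x) t)"
  define b where "b = Re (apply_bcontfun (ip y y) t)"
  define d where "d = apply_bcontfun (ip x y) t"
  have ev: "apply_bcontfun (ip x x) t = of_real a" "apply_bcontfun (ip y y) t = of_real b"
    "apply_bcontfun (ip y x) t = cnj d"
    using inner_self_real[OF x] inner_self_real[OF y] inner_conj[OF x y, symmetric]
    by (simp_all add: a_def b_def d_def apply_conj)
  have quad: "0 \<le> a - 2 * s * (norm d)\<^sup>2 + s\<^sup>2 * (norm d)\<^sup>2 * b" for s :: real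
  proof -
    let ?l = "const_bcontfun (- of_real s * cnj d) :: 'x \<Rightarrow>\<^sub>C complex"
    have "ip (x + act y ?l) (x + act y ?l) =
        ip x x + ip x y * ?l + conj_bcontfun ?l * ip y x + conj_bcontfun ?l * ip y y * ?l"
      using x y by (simp add: inner_add_left inner_add_right inner_act_left inner_act_right algebra_simps)
    then have "apply_bcontfun (ip (x + act y ?l) (x + act y ?l)) t =
        of_real a + d * (- of_real s * cnj d) + (- of_real s * d) * cnj d
          + (- of_real s * d) * of_real b * (- of_real s * cnj d)"
      by (simp add: apply_times conj_const const_bcontfun.rep_eq ev d_def)
    also have "\<dots> = of_real a - 2 * of_real s * (d * cnj d) + of_real (s\<^sup>2) * (d * cnj d) * of_real b"
      by (simp add: algebra_simps power2_eq_square)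
    also have "d * cnj d = of_real ((norm d)\<^sup>2)"
      by (rule complex_norm_square[symmetric])
    also have "of_real a - 2 * of_real s * of_real ((norm d)\<^sup>2) + of_real (s\<^sup>2) * of_real ((norm d)\<^sup>2) * of_real b =
        complex_of_real (a - 2 * s * (norm d)\<^sup>2 + s\<^sup>2 * (norm d)\<^sup>2 * b)"
      by simp
    finally have "apply_bcontfun (ip (x + act y ?l) (x + act y ?l)) t =
        complex_of_real (a - 2 * s * (norm d)\<^sup>2 + s\<^sup>2 * (norm d)\<^sup>2 * b)" .
    then show ?thesis
      using inner_pos[of "x + act y ?l" t] x y by simp
  qed
  have ab: "0 \<le> a" "0 \<le> b"
    using inner_pos x y by (simp_all add: a_def b_def)
  show ?thesis
  proof (cases "b = 0")
    case True
    have "(norm d)\<^sup>2 = 0"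
    proof (rule ccontr)
      assume "(norm d)\<^sup>2 \<noteq> 0"
      then have "a - 2 * ((a + 1) / (norm d)\<^sup>2) * (norm d)\<^sup>2 = - a - 2"
        by (simp add: field_simps)
      then show False
        using quad[of "(a + 1) / (norm d)\<^sup>2"] True ab by simp
    qed
    then show ?thesis
      using ab by (simp add: a_def[symmetric] b_def[symmetric] d_def[symmetric])
  next
    case False
    then have "(norm d)\<^sup>2 \<le> a * b"
      using quad[of "1 / b"] ab by (simp add: field_simps power2_eq_square)
    then show ?thesis
      by (simp add: a_def b_def d_def)
  qed
qed

lemma nm_nonneg [simp]: "0 \<le> nm x"
  by (simp add: vnorm_def)

lemma nm_sq: "(nm x)\<^sup>2 = norm (ip x x)"
  by (simp add: vnorm_def)

lemma inner_self_le: "x \<in> V \<Longrightarrow> Re (apply_bcontfun (ip x x) t) \<le> (nm x)\<^sup>2"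
  unfolding nm_sq using norm_bounded[of "ip x x" t] abs_Re_le_cmod[of "apply_bcontfun (ip x x) t"] by linarith

lemma nm_leI:
  assumes "x \<in> V" "0 \<le> r" "\<And>t. Re (apply_bcontfun (ip x x) t) \<le> r\<^sup>2"
  shows "nm x \<le> r"
proof -
  have "norm (ip x x) \<le> r\<^sup>2"
  proof (rule norm_bound)
    fix t
    have "norm (apply_bcontfun (ip x x) t) = Re (apply_bcontfun (ip x x) t)"
      using inner_self_real[OF assms(1), of t] inner_pos[OF assms(1), of t] by (metis abs_of_nonneg norm_of_real)
    then show "norm (apply_bcontfun (ip x x) t) \<le> r\<^sup>2"
      using assms(3) by simp
  qed
  then show ?thesis
    using assms(2) by (simp add: nm_sq[symmetric] power2_le_iff_abs_le)
qed

lemma inner_apply_le: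
  assumes "x \<in> V" "y \<in> V" shows "norm (apply_bcontfun (ip x y) t) \<le> nm x * nm y"
proof -
  have "(norm (apply_bcontfun (ip x y) t))\<^sup>2 \<le> (nm x)\<^sup>2 * (nm y)\<^sup>2"
    by (rule order_trans[OF inner_cauchy_schwarz[OF assms]])
      (intro mult_mono inner_self_le inner_pos assms, simp)
  then show ?thesis
    by (metis power_mult_distrib abs_le_square_iff abs_of_nonneg mult_nonneg_nonneg nm_nonneg norm_ge_zero)
qed

lemma inner_norm_le: "x \<in> V \<Longrightarrow> y \<in> V \<Longrightarrow> norm (ip x y) \<le> nm x * nm y"
  by (rule norm_bound) (rule inner_apply_le)

lemma nm_zero [simp]: "nm 0 = 0"
  using nm_sq[of 0] by simp

lemma nm_eq_zero: "x \<in> V \<Longrightarrow> nm x = 0 \<Longrightarrow> x = 0"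
  using nm_sq[of x] inner_definite[of x] by simp

lemma nm_add: assumes "x \<in> V" "y \<in> V" shows "nm (x + y) \<le> nm x + nm y"
proof (rule nm_leI)
  fix t
  have "ip (x + y) (x + y) = ip x x + ip x y + ip y x + ip y y"
    using assms by (simp add: inner_add_left inner_add_right)
  then have "Re (apply_bcontfun (ip (x + y) (x + y)) t) = Re (apply_bcontfun (ip x x) t)
      + Re (apply_bcontfun (ip x y) t) + Re (apply_bcontfun (ip y x) t) + Re (apply_bcontfun (ip y y) t)"
    by simp
  also have "\<dots> \<le> (nm x)\<^sup>2 + nm x * nm y + nm y * nm x + (nm y)\<^sup>2"
    using inner_self_le[OF assms(1)] inner_self_le[OF assms(2)] inner_apply_le[OF assms] inner_apply_le[OF assms(2,1)]
      complex_Re_le_cmod order_trans by (intro add_mono) blast+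
  finally show "Re (apply_bcontfun (ip (x + y) (x + y)) t) \<le> (nm x + nm y)\<^sup>2"
    by (simp add: power2_sum mult_ac)
qed (use assms in auto)

lemma nm_act: assumes "x \<in> V" shows "nm (act x f) \<le> nm x * norm f"
proof (rule nm_leI)
  fix t
  have "ip (act x f) (act x f) = conj_bcontfun f * ip x x * f"
    using assms by (simp add: inner_act_left inner_act_right)
  then have "apply_bcontfun (ip (act x f) (act x f)) t =
      apply_bcontfun (ip x x) t * (apply_bcontfun f t * cnj (apply_bcontfun f t))"
    by (simp add: apply_times apply_conj mult_ac)
  then have "apply_bcontfun (ip (act x f) (act x f)) t =
      of_real (Re (apply_bcontfun (ip x x) t)) * of_real ((norm (apply_bcontfun f t))\<^sup>2)"
    by (simp only: complex_norm_square[symmetric] inner_self_real[OF assms, of t, symmetric])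
  then have "Re (apply_bcontfun (ip (act x f) (act x f)) t) =
      Re (apply_bcontfun (ip x x) t) * (norm (apply_bcontfun f t))\<^sup>2"
    by (metis Re_complex_of_real of_real_mult)
  also have "\<dots> \<le> (nm x)\<^sup>2 * (norm f)\<^sup>2"
    using inner_self_le[OF assms, of t] norm_bounded[of f t] by (intro mult_mono power_mono) auto
  finally show "Re (apply_bcontfun (ip (act x f) (act x f)) t) \<le> (nm x * norm f)\<^sup>2"
    by (simp add: power_mult_distrib)
qed (use assms in auto)

lemma act_const_const: "x \<in> V \<Longrightarrow> act (act x (const_bcontfun z)) (const_bcontfun w) = act x (const_bcontfun (z * w))"
  by (simp add: act_act const_bcontfun_simps)

lemma nm_const: assumes "x \<in> V" shows "nm (act x (const_bcontfun z)) = norm z * nm x"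
proof (rule antisym)
  show "nm (act x (const_bcontfun z)) \<le> norm z * nm x"
    using nm_act[OF assms, of "const_bcontfun z"] by (simp add: mult.commute)
  show "norm z * nm x \<le> nm (act x (const_bcontfun z))"
  proof (cases "z = 0")
    case False
    have "act (act x (const_bcontfun z)) (const_bcontfun (1 / z)) = x"
      using False assms by (simp add: act_const_const const_bcontfun_simps)
    then have "nm x \<le> nm (act x (const_bcontfun z)) * norm (1 / z)"
      using nm_act[of "act x (const_bcontfun z)" "const_bcontfun (1 / z)"] assms by simp
    then show ?thesis
      using False by (simp add: norm_divide field_simps)
  qed simp
qed

lemma nm_minus: assumes "x \<in> V" shows "nm (- x) = nm x"
proof -
  have "ip (- x) (- x) = ip x x"
    using assms by (simp add: inner_minus_left inner_minus_right)
  then show ?thesis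
    by (simp add: vnorm_def)
qed

lemma nm_diff_commute: "x \<in> V \<Longrightarrow> y \<in> V \<Longrightarrow> nm (x - y) = nm (y - x)"
  using nm_minus[of "x - y"] by simp

lemma nm_diff_triangle: "x \<in> V \<Longrightarrow> y \<in> V \<Longrightarrow> z \<in> V \<Longrightarrow> nm (x - z) \<le> nm (x - y) + nm (y - z)"
  using nm_add[of "x - y" "y - z"] by simp

lemma inner_eqI: "x \<in> V \<Longrightarrow> y \<in> V \<Longrightarrow> (\<And>z. z \<in> V \<Longrightarrow> ip z x = ip z y) \<Longrightarrow> x = y"
  using inner_definite[of "x - y"] by (simp add: inner_diff_right)

lemma nm_lim_le:
  assumes x: "x \<in> V" and s: "\<And>i. s i \<in> V" and lim: "(\<lambda>i. nm (s i - x)) \<longlonglongrightarrow> 0"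
    and y: "y \<in> V" and le: "\<And>i. i \<ge> K \<Longrightarrow> nm (s i - y) \<le> r"
  shows "nm (x - y) \<le> r"
proof (rule LIMSEQ_le_const)
  show "(\<lambda>i. nm (s i - x) + r) \<longlonglongrightarrow> r"
    using tendsto_add[OF lim tendsto_const[of r]] by simp
  have "nm (x - y) \<le> nm (s i - x) + r" if "i \<ge> K" for i
    using nm_diff_triangle[OF x s[of i] y] nm_diff_commute[OF x s[of i]] le[OF that] by simp
  then show "\<exists>N. \<forall>n\<ge>N. nm (x - y) \<le> nm (s n - x) + r"
    by blast
qed

lemma inner_lim_eq:
  assumes x: "x \<in> V" and s: "\<And>i. s i \<in> V" and lim: "(\<lambda>i. nm (s i - x)) \<longlonglongrightarrow> 0" and y: "y \<in> V"
  shows "(\<lambda>i. ip y (s i)) \<longlonglongrightarrow> ip y x"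
proof (rule Lim_null_comparison[THEN LIM_zero_cancel])
  show "\<forall>\<^sub>F i in sequentially. norm (ip y (s i) - ip y x) \<le> nm y * nm (s i - x)"
    using inner_norm_le[OF y, of "s _ - x"] x s y by (auto simp: inner_diff_right intro!: always_eventually)
  show "(\<lambda>i. nm y * nm (s i - x)) \<longlonglongrightarrow> 0"
    using tendsto_mult[OF tendsto_const lim, of "nm y"] by simp
qed

subsection \<open>Adjointable operators are bounded\<close>

text \<open>Gliding hump. If \<open>T\<close> were unbounded, pick \<open>x\<^sub>n\<close> in the unit ball with \<open>T x\<^sub>n\<close> huge, and let \<open>y\<close> be
  a signed sum of the vectors \<open>T x\<^sub>n\<close> scaled to length \<open>3\<^sup>-\<^sup>n\<close>. Of the two signs, one makes the inner
  product of \<open>T x\<^sub>n\<close> with the partial sum large, and the rest of the series is too small to undo this.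
  But the inner product of \<open>T x\<^sub>n\<close> with \<open>y\<close> is the one of \<open>x\<^sub>n\<close> with the adjoint at \<open>y\<close>, which stays bounded.\<close>

lemma adjointable_bounded:
  assumes T: "\<And>x. x \<in> V \<Longrightarrow> T x \<in> V" and S: "is_adjoint M T S"
  obtains K where "\<And>x. x \<in> V \<Longrightarrow> nm x \<le> 1 \<Longrightarrow> nm (T x) \<le> K"
proof (rule ccontr)
  assume contra: "\<not> thesis"
  \<comment> \<open>The \<open>n\<close>-th term contributes \<open>3\<^sup>-\<^sup>n\<close> times this bound, and the tail of the series can eat up half of it.\<close>
  have "\<exists>x\<in>V. nm x \<le> 1 \<and> 2 * real n * 3 ^ n < nm (T x)" for n :: nat
    using contra that[of "2 * real n * 3 ^ n"] by force
  then obtain x where x: "\<And>n :: nat. x n \<in> V" "\<And>n. nm (x n) \<le> 1" "\<And>n. 2 * real n * 3 ^ n < nm (T (x n))"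
    by metis
  define a where "a = (\<lambda>n. T (x n))"
  have a: "a n \<in> V" "0 < nm (a n)" for n
    using T x(1) le_less_trans[OF _ x(3), of 0 n] by (auto simp: a_def)
  define u where "u = (\<lambda>n. act (a n) (const_bcontfun (of_real ((1/3) ^ n / nm (a n)))))"
  have u: "u n \<in> V" "nm (u n) = (1/3) ^ n" for n
  proof -
    show "u n \<in> V"
      using a by (simp add: u_def)
    have "nm (u n) = norm (complex_of_real ((1/3) ^ n / nm (a n))) * nm (a n)"
      unfolding u_def by (rule nm_const[OF a(1)])
    also have "\<dots> = (1/3) ^ n"
      using a(2)[of n] by (simp add: norm_divide norm_power)
    finally show "nm (u n) = (1/3) ^ n" .
  qed
  have au: "norm (ip (a n) (u n)) = (1/3) ^ n * nm (a n)" for n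
  proof -
    have "ip (a n) (u n) = ((1/3) ^ n / nm (a n)) *\<^sub>R ip (a n) (a n)"
      using a by (intro bcontfun_eqI) (simp add: u_def inner_act_right apply_times const_bcontfun.rep_eq,
          simp add: scaleR_conv_of_real)
    then have "norm (ip (a n) (u n)) = (1/3) ^ n / nm (a n) * (nm (a n))\<^sup>2"
      using a(2)[of n] by (simp add: nm_sq)
    then show ?thesis
      using a(2)[of n] by (simp add: power2_eq_square)
  qed
  define y where "y = rec_nat 0 (\<lambda>n y. if norm (ip (a n) (y - u n)) \<le> norm (ip (a n) (y + u n)) then y + u n else y - u n)"
  have y_Suc: "y (Suc n) = (if norm (ip (a n) (y n - u n)) \<le> norm (ip (a n) (y n + u n)) then y n + u n else y n - u n)" for n
    by (simp add: y_def)
  have y: "y n \<in> V" for n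
    by (induction n) (use u in \<open>auto simp: y_Suc y_def\<close>)
  have step: "nm (y (Suc n) - y n) = (1/3) ^ n" for n
    using u[of n] by (simp add: y_Suc nm_minus)
  \<comment> \<open>The two candidates differ by \<open>2 u n\<close>, so the better one is at least the inner product with \<open>u n\<close>.\<close>
  have hump: "(1/3) ^ n * nm (a n) \<le> norm (ip (a n) (y (Suc n)))" for n
  proof -
    have "ip (a n) (y n + u n) - ip (a n) (y n - u n) = ip (a n) (u n) + ip (a n) (u n)"
      using a y u by (simp add: inner_add_right inner_diff_right)
    then have "norm (ip (a n) (u n) + ip (a n) (u n)) \<le> norm (ip (a n) (y n + u n)) + norm (ip (a n) (y n - u n))"
      by (metis norm_triangle_ineq4)
    moreover have "norm (ip (a n) (u n) + ip (a n) (u n)) = 2 * norm (ip (a n) (u n))"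
      by (metis norm_scaleR scaleR_2 abs_numeral)
    ultimately show ?thesis
      unfolding au[symmetric] by (simp add: y_Suc split: if_splits)
  qed
  have tail: "nm (y (n + k) - y n) \<le> 3/2 * ((1/3) ^ n - (1/3) ^ (n + k))" for n k
  proof (induction k)
    case (Suc k)
    have "nm (y (Suc (n + k)) - y n) \<le> nm (y (Suc (n + k)) - y (n + k)) + nm (y (n + k) - y n)"
      using y by (intro nm_diff_triangle)
    also have "\<dots> \<le> (1/3) ^ (n + k) + 3/2 * ((1/3) ^ n - (1/3) ^ (n + k))"
      using Suc step by simp
    finally show ?case
      by (simp add: algebra_simps)
  qed simp
  have tail': "nm (y m - y n) \<le> 3/2 * (1/3) ^ n" if "n \<le> m" for m n
  proof -
    have "nm (y m - y n) \<le> 3/2 * ((1/3) ^ n - (1/3) ^ m)"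
      using tail[of n "m - n"] that by simp
    also have "\<dots> \<le> 3/2 * (1/3) ^ n"
      by (intro mult_left_mono) auto
    finally show ?thesis .
  qed
  have "\<exists>z\<in>V. (\<lambda>i. nm (y i - z)) \<longlonglongrightarrow> 0"
  proof (rule complete[OF y])
    fix e :: real assume e: "0 < e"
    then obtain K where K: "(1/3) ^ K < e / 3"
      using real_arch_pow_inv[of "e / 3" "1/3"] by auto
    have "nm (y i - y j) < e" if "i \<ge> K" "j \<ge> K" for i j
      using nm_diff_triangle[OF y y y, of i j K] nm_diff_commute[OF y y, of K j] tail'[OF that(1)] tail'[OF that(2)] K
      by linarith
    then show "\<exists>K. \<forall>i\<ge>K. \<forall>j\<ge>K. nm (y i - y j) < e"
      by blast
  qed
  then obtain z where z: "z \<in> V" "(\<lambda>i. nm (y i - z)) \<longlonglongrightarrow> 0"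
    by blast
  have large: "real n \<le> norm (ip (a n) z)" for n
  proof -
    have "nm (z - y (Suc n)) \<le> 3/2 * (1/3) ^ Suc n"
      by (rule nm_lim_le[OF z(1) y z(2) y, of "Suc n"]) (rule tail')
    then have near: "nm (z - y (Suc n)) \<le> 1/2 * (1/3) ^ n"
      by simp
    have "(1/3) ^ n * nm (a n) \<le> norm (ip (a n) (y (Suc n)))"
      by (rule hump)
    also have "ip (a n) (y (Suc n)) = ip (a n) z - ip (a n) (z - y (Suc n))"
      using a y z by (simp add: inner_diff_right)
    also have "norm \<dots> \<le> norm (ip (a n) z) + nm (a n) * nm (z - y (Suc n))"
      using norm_triangle_ineq4[of "ip (a n) z" "ip (a n) (z - y (Suc n))"]
        inner_norm_le[OF a(1), of "z - y (Suc n)" n] y z by simp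
    also have "nm (a n) * nm (z - y (Suc n)) \<le> nm (a n) * (1/2 * (1/3) ^ n)"
      using near by (rule mult_left_mono) simp
    finally have "1/2 * ((1/3) ^ n * nm (a n)) \<le> norm (ip (a n) z)"
      by (simp add: mult.commute)
    moreover have "(1/3) ^ n * (2 * real n * 3 ^ n) \<le> (1/3) ^ n * nm (a n)"
      using x(3)[of n] by (intro mult_left_mono) (auto simp: a_def)
    moreover have "(1/3) ^ n * (2 * real n * 3 ^ n) = 2 * real n"
      by (simp add: power_one_over)
    ultimately show ?thesis
      by linarith
  qed
  have small: "norm (ip (a n) z) \<le> nm (S z)" for n
  proof -
    have Sz: "S z \<in> V"
      using S z by (auto simp: is_adjoint_def)
    have "ip (a n) z = ip (x n) (S z)"
      using S x z by (simp add: is_adjoint_def a_def)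
    then have "norm (ip (a n) z) \<le> nm (x n) * nm (S z)"
      using inner_norm_le[OF x(1) Sz] by simp
    also have "\<dots> \<le> 1 * nm (S z)"
      using x(2) by (intro mult_right_mono) auto
    finally show ?thesis
      by simp
  qed
  obtain n :: nat where "nm (S z) < real n"
    using reals_Archimedean2 by blast
  then show False
    using large[of n] small[of n] by linarith
qed

end

subsection \<open>The C*-algebra of adjointable operators\<close>

context hilbert_cx_module
begin

abbreviation L :: "('v \<Rightarrow> 'v) normed_star_algebra" where "L \<equiv> adjointable_ops M"

lemma L_carrier_iff: "T \<in> carrier L \<longleftrightarrow> T \<in> V \<rightarrow>\<^sub>E V \<and> (\<exists>S. is_adjoint M T S)"
  by (simp add: adjointable_ops_def)

lemma L_apply [simp]: "T \<in> carrier L \<Longrightarrow> x \<in> V \<Longrightarrow> T x \<in> V"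
  by (auto simp: L_carrier_iff)

lemma L_eqI: "S \<in> carrier L \<Longrightarrow> T \<in> carrier L \<Longrightarrow> (\<And>x. x \<in> V \<Longrightarrow> S x = T x) \<Longrightarrow> S = T"
  using PiE_ext[of S V "\<lambda>_. V" T] by (auto simp: L_carrier_iff)

lemma adjoint_unique: assumes "is_adjoint M T S" "is_adjoint M T S'" "T \<in> V \<rightarrow>\<^sub>E V" shows "S = S'"
proof (rule PiE_ext[of _ V "\<lambda>_. V"])
  show "S \<in> V \<rightarrow>\<^sub>E V" "S' \<in> V \<rightarrow>\<^sub>E V"
    using assms by (simp_all add: is_adjoint_def)
  then have V: "\<And>y. y \<in> V \<Longrightarrow> S y \<in> V" "\<And>y. y \<in> V \<Longrightarrow> S' y \<in> V"
    by blast+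
  fix y assume y: "y \<in> V"
  show "S y = S' y"
    by (rule inner_eqI[OF V(1)[OF y] V(2)[OF y]]) (use assms y in \<open>auto simp: is_adjoint_def\<close>)
qed

lemma star_L_eq: "T \<in> V \<rightarrow>\<^sub>E V \<Longrightarrow> is_adjoint M T S \<Longrightarrow> star L T = S"
  using adjoint_unique by (auto simp: adjointable_ops_def)

lemma L_adjoint: assumes "T \<in> carrier L" shows "is_adjoint M T (star L T)"
  using assms star_L_eq by (auto simp: L_carrier_iff)

lemma is_adjoint_sym:
  assumes "T \<in> V \<rightarrow>\<^sub>E V" "is_adjoint M T S" shows "is_adjoint M S T"
proof -
  have V: "T y \<in> V" "S y \<in> V" if "y \<in> V" for y
    using assms that by (auto simp: is_adjoint_def)
  have "ip (S x) y = ip x (T y)" if "x \<in> V" "y \<in> V" for x y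
    using assms(2) that inner_conj[of "S x" y] inner_conj[of x "T y"] V
    by (metis conj_conj is_adjoint_def inner_conj)
  then show ?thesis
    using assms by (simp add: is_adjoint_def)
qed

lemma star_L_closed [simp]: "T \<in> carrier L \<Longrightarrow> star L T \<in> carrier L"
  using L_adjoint[of T] is_adjoint_sym[of T "star L T"] by (auto simp: L_carrier_iff is_adjoint_def)

lemma L_inner_left: "T \<in> carrier L \<Longrightarrow> x \<in> V \<Longrightarrow> y \<in> V \<Longrightarrow> ip (T x) y = ip x (star L T y)"
  using L_adjoint[of T] by (simp add: is_adjoint_def)

lemma star_star_L: "T \<in> carrier L \<Longrightarrow> star L (star L T) = T"
  using is_adjoint_sym[of T "star L T"] L_adjoint[of T]
  by (intro star_L_eq) (auto simp: L_carrier_iff is_adjoint_def)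

lemma L_inner_right: "T \<in> carrier L \<Longrightarrow> x \<in> V \<Longrightarrow> y \<in> V \<Longrightarrow> ip x (T y) = ip (star L T x) y"
  using L_inner_left[of "star L T" x y] by (simp add: star_star_L)

lemma L_I:
  assumes "\<And>x. x \<in> V \<Longrightarrow> T x \<in> V" "\<And>x. x \<in> V \<Longrightarrow> S x \<in> V"
    and "\<And>x y. x \<in> V \<Longrightarrow> y \<in> V \<Longrightarrow> ip (T x) y = ip x (S y)"
  shows "(\<lambda>x\<in>V. T x) \<in> carrier L" "star L (\<lambda>x\<in>V. T x) = (\<lambda>x\<in>V. S x)"
proof -
  have "is_adjoint M (\<lambda>x\<in>V. T x) (\<lambda>x\<in>V. S x)" "(\<lambda>x\<in>V. T x) \<in> V \<rightarrow>\<^sub>E V"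
    using assms by (auto simp: is_adjoint_def)
  then show "(\<lambda>x\<in>V. T x) \<in> carrier L" "star L (\<lambda>x\<in>V. T x) = (\<lambda>x\<in>V. S x)"
    using star_L_eq by (auto simp: L_carrier_iff)
qed

lemma L_add_apply: "T \<in> carrier L \<Longrightarrow> x \<in> V \<Longrightarrow> y \<in> V \<Longrightarrow> T (x + y) = T x + T y"
  by (rule inner_eqI) (simp_all add: inner_add_right L_inner_right)

lemma L_act_apply: "T \<in> carrier L \<Longrightarrow> x \<in> V \<Longrightarrow> T (act x f) = act (T x) f"
  by (rule inner_eqI) (simp_all add: inner_act_right L_inner_right)

lemma L_zero_apply [simp]: "T \<in> carrier L \<Longrightarrow> T 0 = 0"
  using L_add_apply[of T 0 0] by simp

lemma L_ops:
  "S \<otimes>\<^bsub>L\<^esub> T = (\<lambda>x\<in>V. S (T x))" "S \<oplus>\<^bsub>L\<^esub> T = (\<lambda>x\<in>V. S x + T x)"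
  "z \<odot>\<^bsub>L\<^esub> T = (\<lambda>x\<in>V. act (T x) (const_bcontfun z))" "\<one>\<^bsub>L\<^esub> = (\<lambda>x\<in>V. x)" "\<zero>\<^bsub>L\<^esub> = (\<lambda>x\<in>V. 0)"
  by (simp_all add: adjointable_ops_def compose_def vadd_eq vzero_eq)

lemma L_op_apply [simp]:
  assumes "x \<in> V"
  shows "(S \<otimes>\<^bsub>L\<^esub> T) x = S (T x)" "(S \<oplus>\<^bsub>L\<^esub> T) x = S x + T x"
    "(z \<odot>\<^bsub>L\<^esub> T) x = act (T x) (const_bcontfun z)" "\<one>\<^bsub>L\<^esub> x = x" "\<zero>\<^bsub>L\<^esub> x = 0"
  using assms by (simp_all add: L_ops)

lemma L_mult: assumes "S \<in> carrier L" "T \<in> carrier L"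
  shows "S \<otimes>\<^bsub>L\<^esub> T \<in> carrier L" "star L (S \<otimes>\<^bsub>L\<^esub> T) = star L T \<otimes>\<^bsub>L\<^esub> star L S"
  unfolding L_ops
  by (rule L_I[of "\<lambda>x. S (T x)" "\<lambda>x. star L T (star L S x)"]; use assms in \<open>simp add: L_inner_left\<close>)+

lemma L_plus: assumes "S \<in> carrier L" "T \<in> carrier L"
  shows "S \<oplus>\<^bsub>L\<^esub> T \<in> carrier L" "star L (S \<oplus>\<^bsub>L\<^esub> T) = star L S \<oplus>\<^bsub>L\<^esub> star L T"
  unfolding L_ops
  by (rule L_I[of "\<lambda>x. S x + T x" "\<lambda>x. star L S x + star L T x"];
      use assms in \<open>simp add: L_inner_left inner_add_left inner_add_right\<close>)+

lemma L_smult: assumes "T \<in> carrier L"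
  shows "z \<odot>\<^bsub>L\<^esub> T \<in> carrier L" "star L (z \<odot>\<^bsub>L\<^esub> T) = cnj z \<odot>\<^bsub>L\<^esub> star L T"
  unfolding L_ops
  by (rule L_I[of "\<lambda>x. act (T x) (const_bcontfun z)" "\<lambda>x. act (star L T x) (const_bcontfun (cnj z))"];
      use assms in \<open>simp add: L_inner_left inner_act_left inner_act_right conj_const mult.commute\<close>)+

lemma L_one: "\<one>\<^bsub>L\<^esub> \<in> carrier L" and L_zero: "\<zero>\<^bsub>L\<^esub> \<in> carrier L"
  unfolding L_ops by (rule L_I(1)[of "\<lambda>x. x" "\<lambda>x. x"] L_I(1)[of "\<lambda>x. 0" "\<lambda>x. 0"]; simp)+

lemma act_const_add: "x \<in> V \<Longrightarrow> act x (const_bcontfun (z + w)) = act x (const_bcontfun z) + act x (const_bcontfun w)"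
  by (simp add: const_bcontfun_simps act_plus)

lemma involutive_algebra_L: "involutive_algebra L"
proof (intro involutive_algebra.intro involutive_algebra_axioms.intro)
  show "ring L"
  proof (rule ringI)
    show "abelian_group L"
    proof (rule abelian_groupI)
      fix T assume T: "T \<in> carrier L"
      have "(-1) \<odot>\<^bsub>L\<^esub> T \<oplus>\<^bsub>L\<^esub> T = \<zero>\<^bsub>L\<^esub>"
      proof (rule L_eqI)
        fix x assume x: "x \<in> V"
        have "act (T x) (const_bcontfun (- 1)) + act (T x) (const_bcontfun 1) = act (T x) (const_bcontfun (- 1 + 1))"
          using T x by (simp only: act_const_add L_apply)
        then show "((-1) \<odot>\<^bsub>L\<^esub> T \<oplus>\<^bsub>L\<^esub> T) x = \<zero>\<^bsub>L\<^esub> x"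
          using T x by (simp add: const_bcontfun_simps(1))
      qed (use T L_plus L_smult L_zero in auto)
      then show "\<exists>S\<in>carrier L. S \<oplus>\<^bsub>L\<^esub> T = \<zero>\<^bsub>L\<^esub>"
        using L_smult[OF T] by blast
    qed (use L_plus L_zero in \<open>auto intro!: L_eqI simp: ac_simps\<close>)
    show "Group.monoid L"
      by (rule monoidI) (use L_mult L_one in \<open>auto intro!: L_eqI\<close>)
  qed (use L_mult L_plus in \<open>auto intro!: L_eqI simp: L_add_apply\<close>)
qed (use L_mult L_plus L_smult L_one L_zero in
    \<open>auto intro!: L_eqI simp: act_const_add act_add act_const_const L_act_apply const_bcontfun_simps(1)
      star_star_L mult.commute\<close>)

lemma L_bounded:
  assumes "T \<in> carrier L"
  shows "bdd_above ((\<lambda>x. nm (T x)) ` {x \<in> V. nm x \<le> 1})"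
proof -
  obtain K where "\<And>x. x \<in> V \<Longrightarrow> nm x \<le> 1 \<Longrightarrow> nm (T x) \<le> K"
    using adjointable_bounded[of T "star L T"] L_adjoint[OF assms] L_apply[OF assms] by blast
  then show ?thesis
    by (intro bdd_aboveI[of _ K]) auto
qed

lemma nrm_L: "nrm L T = (SUP x\<in>{x \<in> V. nm x \<le> 1}. nm (T x))"
  by (simp add: adjointable_ops_def)

lemma nrm_L_leI: "(\<And>x. x \<in> V \<Longrightarrow> nm x \<le> 1 \<Longrightarrow> nm (T x) \<le> K) \<Longrightarrow> nrm L T \<le> K"
  unfolding nrm_L
proof (rule cSUP_least)
  have "0 \<in> {x \<in> V. nm x \<le> 1}"
    by simp
  then show "{x \<in> V. nm x \<le> 1} \<noteq> {}"
    by blast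
qed auto

lemma nrm_L_nonneg: "T \<in> carrier L \<Longrightarrow> 0 \<le> nrm L T"
  unfolding nrm_L using L_bounded cSUP_upper[of 0 "{x \<in> V. nm x \<le> 1}" "\<lambda>x. nm (T x)"] by simp

lemma L_le:
  assumes T: "T \<in> carrier L" and x: "x \<in> V"
  shows "nm (T x) \<le> nrm L T * nm x"
proof (cases "nm x = 0")
  case True
  then show ?thesis
    using nm_eq_zero[OF x] T by simp
next
  case False
  then have pos: "0 < nm x"
    using nm_nonneg[of x] by linarith
  let ?y = "act x (const_bcontfun (1 / of_real (nm x)))"
  have y: "?y \<in> V" "nm ?y = 1"
    using x pos by (auto simp: nm_const norm_divide)
  have "nm (T ?y) \<le> nrm L T"
    unfolding nrm_L by (rule cSUP_upper[OF _ L_bounded[OF T]]) (use y in auto)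
  moreover have "nm (T ?y) = nm (T x) / nm x"
    using T x pos by (simp add: L_act_apply nm_const norm_divide)
  ultimately show ?thesis
    using pos by (simp add: field_simps)
qed

lemma L_le_of_le_one: "T \<in> carrier L \<Longrightarrow> x \<in> V \<Longrightarrow> nm x \<le> 1 \<Longrightarrow> nm (T x) \<le> nrm L T"
  using L_le[of T x] mult_left_mono[of "nm x" 1 "nrm L T"] nrm_L_nonneg[of T] by simp

lemma nrm_star_L_le: assumes T: "T \<in> carrier L" shows "nrm L (star L T) \<le> nrm L T"
proof (rule nrm_L_leI)
  fix x assume x: "x \<in> V" "nm x \<le> 1"
  let ?y = "star L T x"
  have y: "?y \<in> V"
    using T x by simp
  have "ip ?y ?y = ip (T ?y) x"
    using T x y by (simp add: L_inner_left)
  then have "(nm ?y)\<^sup>2 \<le> nm (T ?y) * nm x"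
    using inner_norm_le[of "T ?y" x] T x y by (simp add: nm_sq)
  also have "\<dots> \<le> (nrm L T * nm ?y) * 1"
    using L_le[OF T y] x nrm_L_nonneg[OF T] by (intro mult_mono) auto
  finally have "nm ?y * nm ?y \<le> nrm L T * nm ?y"
    by (simp add: power2_eq_square)
  then show "nm ?y \<le> nrm L T"
    using nm_nonneg[of ?y] nrm_L_nonneg[OF T] by (cases "nm ?y = 0") auto
qed

lemma cstar_seminorm_L: "cstar_seminorm L (nrm L)"
  unfolding cstar_seminorm_def
proof (intro conjI ballI allI)
  fix T assume T: "T \<in> carrier L"
  show "0 \<le> nrm L T"
    by (rule nrm_L_nonneg[OF T])
  have le: "nrm L (z \<odot>\<^bsub>L\<^esub> S) \<le> norm z * nrm L S" if "S \<in> carrier L" for z S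
    using that L_le_of_le_one[OF that] by (intro nrm_L_leI) (auto simp: nm_const intro!: mult_left_mono)
  show "nrm L (z \<odot>\<^bsub>L\<^esub> T) = norm z * nrm L T" for z
  proof (cases "z = 0")
    case True
    then show ?thesis
      using le[OF T, of 0] nrm_L_nonneg[OF L_smult(1)[OF T, of 0]] by simp
  next
    case False
    have "(1 / z) \<odot>\<^bsub>L\<^esub> (z \<odot>\<^bsub>L\<^esub> T) = T"
      using False T by (simp add: involutive_algebra.smult_smult[OF involutive_algebra_L]
          involutive_algebra.smult_one[OF involutive_algebra_L])
    then have "nrm L T \<le> norm (1 / z) * nrm L (z \<odot>\<^bsub>L\<^esub> T)"
      using le[OF L_smult(1)[OF T, of z], of "1 / z"] by simp
    then show ?thesis
      using le[OF T, of z] False by (simp add: norm_divide field_simps)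
  qed
  show "nrm L (star L T \<otimes>\<^bsub>L\<^esub> T) = (nrm L T)\<^sup>2"
  proof (rule antisym)
    show "nrm L (star L T \<otimes>\<^bsub>L\<^esub> T) \<le> (nrm L T)\<^sup>2"
    proof (rule nrm_L_leI)
      fix x assume x: "x \<in> V" "nm x \<le> 1"
      have "nm (star L T (T x)) \<le> nrm L (star L T) * nm (T x)"
        using T x by (intro L_le) auto
      also have "\<dots> \<le> nrm L T * nrm L T"
        using T x nrm_star_L_le[OF T] L_le_of_le_one[OF T] nrm_L_nonneg[OF T] by (intro mult_mono) auto
      finally show "nm ((star L T \<otimes>\<^bsub>L\<^esub> T) x) \<le> (nrm L T)\<^sup>2"
        using x by (simp add: power2_eq_square)
    qed
    have nonneg: "0 \<le> nrm L (star L T \<otimes>\<^bsub>L\<^esub> T)"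
      using T by (intro nrm_L_nonneg L_mult) auto
    have "nrm L T \<le> sqrt (nrm L (star L T \<otimes>\<^bsub>L\<^esub> T))"
    proof (rule nrm_L_leI)
      fix x assume x: "x \<in> V" "nm x \<le> 1"
      have "ip (T x) (T x) = ip x ((star L T \<otimes>\<^bsub>L\<^esub> T) x)"
        using T x by (simp add: L_inner_left)
      then have "(nm (T x))\<^sup>2 \<le> nm x * nm ((star L T \<otimes>\<^bsub>L\<^esub> T) x)"
        using inner_norm_le[of x "(star L T \<otimes>\<^bsub>L\<^esub> T) x"] T x L_mult by (simp add: nm_sq)
      also have "\<dots> \<le> 1 * nrm L (star L T \<otimes>\<^bsub>L\<^esub> T)"
        using x T L_mult by (intro mult_mono L_le_of_le_one) auto
      finally show "nm (T x) \<le> sqrt (nrm L (star L T \<otimes>\<^bsub>L\<^esub> T))"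
        by (intro real_le_rsqrt) simp
    qed
    then show "(nrm L T)\<^sup>2 \<le> nrm L (star L T \<otimes>\<^bsub>L\<^esub> T)"
      using nrm_L_nonneg[OF T] nonneg by (metis abs_of_nonneg abs_le_square_iff real_sqrt_ge_zero real_sqrt_pow2)
  qed
  fix S assume S: "S \<in> carrier L"
  show "nrm L (T \<oplus>\<^bsub>L\<^esub> S) \<le> nrm L T + nrm L S"
    using T S by (intro nrm_L_leI)
      (auto intro!: order_trans[OF nm_add] add_mono L_le_of_le_one)
  show "nrm L (T \<otimes>\<^bsub>L\<^esub> S) \<le> nrm L T * nrm L S"
  proof (rule nrm_L_leI)
    fix x assume x: "x \<in> V" "nm x \<le> 1"
    have "nm (T (S x)) \<le> nrm L T * nm (S x)"
      using T S x by (intro L_le) auto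
    also have "\<dots> \<le> nrm L T * nrm L S"
      using S x L_le_of_le_one[OF S] nrm_L_nonneg[OF T] by (intro mult_left_mono) auto
    finally show "nm ((T \<otimes>\<^bsub>L\<^esub> S) x) \<le> nrm L T * nrm L S"
      using x by simp
  qed
qed

lemma L_diff: assumes "S \<in> carrier L" "T \<in> carrier L" "x \<in> V" shows "(S \<ominus>\<^bsub>L\<^esub> T) x = S x - T x"
proof -
  have "act (T x) (const_bcontfun (-1)) = - T x"
  proof -
    have "const_bcontfun (- 1) = (- 1 :: 'x \<Rightarrow>\<^sub>C complex)"
      by (rule bcontfun_eqI) (simp add: const_bcontfun.rep_eq apply_one)
    then show ?thesis
      using assms by (simp add: act_neg_one)
  qed
  then show ?thesis
    using assms by (simp add: involutive_algebra.diff_eq_smult[OF involutive_algebra_L])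
qed

text \<open>A norm limit of adjointable operators is adjointable, because the adjoints form a Cauchy sequence as well and
  their pointwise limit is an adjoint.\<close>

theorem cstar_algebra_L: "cstar_algebra L"
proof -
  interpret L: cstar_seminormed L "nrm L"
    by (rule cstar_seminormed.intro[OF involutive_algebra_L cstar_seminormed_axioms.intro[OF cstar_seminorm_L]])
  have "T = \<zero>\<^bsub>L\<^esub>" if T: "T \<in> carrier L" "nrm L T = 0" for T
  proof (rule L_eqI[OF T(1) L_zero])
    fix x assume x: "x \<in> V"
    then have "nm (T x) = 0"
      using L_le[OF T(1) x] T(2) nm_nonneg[of "T x"] by simp
    then show "T x = \<zero>\<^bsub>L\<^esub> x"
      using nm_eq_zero[of "T x"] T(1) x by simp
  qed
  moreover have "\<exists>T\<in>carrier L. (\<lambda>i. nrm L (s i \<ominus>\<^bsub>L\<^esub> T)) \<longlonglongrightarrow> 0" if s: "s \<in> cauchy_seqs L (nrm L)" for s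
  proof -
    have pointwise: "\<exists>y\<in>V. (\<lambda>i. nm (s i x - y)) \<longlonglongrightarrow> 0" if s: "s \<in> cauchy_seqs L (nrm L)" and x: "x \<in> V" for s x
    proof (rule complete)
      note sc = L.cauchy_seqsD[OF s]
      show "s i x \<in> V" for i
        using sc x by simp
      fix e :: real assume e: "0 < e"
      have pos: "0 < nm x + 1"
        using nm_nonneg[of x] by linarith
      obtain K where K: "\<And>i j. i \<ge> K \<Longrightarrow> j \<ge> K \<Longrightarrow> nrm L (s i \<ominus>\<^bsub>L\<^esub> s j) < e / (nm x + 1)"
        using L.cauchy_seqs_ge[OF s, of "e / (nm x + 1)"] e pos by auto
      have "nm (s i x - s j x) < e" if ij: "i \<ge> K" "j \<ge> K" for i j
      proof -
        have "nm (s i x - s j x) \<le> nrm L (s i \<ominus>\<^bsub>L\<^esub> s j) * nm x"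
          using L_le[of "s i \<ominus>\<^bsub>L\<^esub> s j" x] sc x by (simp add: L_diff)
        also have "\<dots> \<le> nrm L (s i \<ominus>\<^bsub>L\<^esub> s j) * (nm x + 1)"
          using sc by (intro mult_left_mono) auto
        also have "\<dots> < e"
          using K[OF ij] pos by (simp add: field_simps)
        finally show ?thesis .
      qed
      then show "\<exists>K. \<forall>i\<ge>K. \<forall>j\<ge>K. nm (s i x - s j x) < e"
        by blast
    qed
    note sc = L.cauchy_seqsD[OF s]
    obtain T where T: "\<And>x. x \<in> V \<Longrightarrow> T x \<in> V" "\<And>x. x \<in> V \<Longrightarrow> (\<lambda>i. nm (s i x - T x)) \<longlonglongrightarrow> 0"
      using pointwise[OF s] by metis
    obtain S where S: "\<And>x. x \<in> V \<Longrightarrow> S x \<in> V" "\<And>x. x \<in> V \<Longrightarrow> (\<lambda>i. nm (star L (s i) x - S x)) \<longlonglongrightarrow> 0"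
      using pointwise[OF L.cauchy_seqs_star[OF s]] by metis
    have adj: "ip y (T x) = ip (S y) x" if x: "x \<in> V" and y: "y \<in> V" for x y
    proof -
      have 1: "(\<lambda>i. ip y (s i x)) \<longlonglongrightarrow> ip y (T x)"
        by (rule inner_lim_eq) (use T sc x y in auto)
      have 2: "(\<lambda>i. ip x (star L (s i) y)) \<longlonglongrightarrow> ip x (S y)"
        by (rule inner_lim_eq) (use S sc x y in auto)
      have "apply_bcontfun (ip y (T x)) t = apply_bcontfun (ip (S y) x) t" for t
      proof -
        have bl: "bounded_linear (\<lambda>f :: 'x \<Rightarrow>\<^sub>C complex. apply_bcontfun f t)"
          by (rule bounded_linear_intro[where K = 1]) (auto intro: norm_bounded)
        have "(\<lambda>i. cnj (apply_bcontfun (ip x (star L (s i) y)) t)) \<longlonglongrightarrow> cnj (apply_bcontfun (ip x (S y)) t)"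
          by (intro tendsto_cnj bounded_linear.tendsto[OF bl 2])
        moreover have "cnj (apply_bcontfun (ip x (star L (s i) y)) t) = apply_bcontfun (ip y (s i x)) t" for i
          using sc x y by (simp add: L_inner_right apply_conj[symmetric] inner_conj)
        moreover have "cnj (apply_bcontfun (ip x (S y)) t) = apply_bcontfun (ip (S y) x) t"
          using S x y by (simp add: apply_conj[symmetric] inner_conj)
        ultimately show ?thesis
          using LIMSEQ_unique[OF bounded_linear.tendsto[OF bl 1]] by simp
      qed
      then show ?thesis
        by (rule bcontfun_eqI)
    qed
    define T' where "T' = (\<lambda>x\<in>V. T x)"
    have T': "T' \<in> carrier L"
      unfolding T'_def by (rule L_I(1)[of T S])
        (use T S adj in \<open>auto, metis adj inner_conj\<close>)
    have "(\<lambda>i. nrm L (s i \<ominus>\<^bsub>L\<^esub> T')) \<longlonglongrightarrow> 0"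
    proof (rule LIMSEQ_I)
      fix e :: real assume e: "0 < e"
      obtain K where K: "\<And>i j. i \<ge> K \<Longrightarrow> j \<ge> K \<Longrightarrow> nrm L (s i \<ominus>\<^bsub>L\<^esub> s j) < e / 2"
        using L.cauchy_seqs_ge[OF s, of "e / 2"] e by auto
      have "norm (nrm L (s i \<ominus>\<^bsub>L\<^esub> T') - 0) < e" if i: "i \<ge> K" for i
      proof -
        have "nrm L (s i \<ominus>\<^bsub>L\<^esub> T') \<le> e / 2"
        proof (rule nrm_L_leI)
          fix x assume x: "x \<in> V" "nm x \<le> 1"
          have "nm (T x - s i x) \<le> e / 2"
          proof (rule nm_lim_le[where s = "\<lambda>j. s j x" and K = K])
            show "nm (s j x - s i x) \<le> e / 2" if "j \<ge> K" for j
              using L_le_of_le_one[of "s j \<ominus>\<^bsub>L\<^esub> s i" x] K[OF that i] sc x by (simp add: L_diff)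
          qed (use T sc x in auto)
          then show "nm ((s i \<ominus>\<^bsub>L\<^esub> T') x) \<le> e / 2"
            using sc T' x T nm_diff_commute[of "T x" "s i x"] by (simp add: L_diff) (simp add: T'_def)
        qed
        then show ?thesis
          using e nrm_L_nonneg[of "s i \<ominus>\<^bsub>L\<^esub> T'"] sc T' by simp
      qed
      then show "\<exists>no. \<forall>n\<ge>no. norm (nrm L (s n \<ominus>\<^bsub>L\<^esub> T') - 0) < e"
        by blast
    qed
    then show ?thesis
      using T' by blast
  qed
  ultimately show ?thesis
    by unfold_locales auto
qed

end

section \<open>Completeness of the function algebra\<close>

text \<open>Sums over the levels of the Fock module are infinite series in \<open>C(X)\<close>, and their convergence rests on
  completeness.\<close>

instance bcontfun :: (topological_space, complete_space) complete_space
proof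
  fix f :: "nat \<Rightarrow> 'a \<Rightarrow>\<^sub>C 'b"
  assume f: "Cauchy f"
  have "uniformly_Cauchy_on UNIV (\<lambda>n. apply_bcontfun (f n))"
    unfolding uniformly_Cauchy_on_def
  proof (intro allI impI)
    fix e :: real assume "0 < e"
    then obtain M where "\<And>m n. m \<ge> M \<Longrightarrow> n \<ge> M \<Longrightarrow> dist (f m) (f n) < e"
      using f unfolding Cauchy_def by blast
    then show "\<exists>M. \<forall>x\<in>UNIV. \<forall>m\<ge>M. \<forall>n\<ge>M. dist (f m x) (f n x) < e"
      using dist_bounded le_less_trans by blast
  qed
  then obtain g where "uniform_limit UNIV (\<lambda>n. apply_bcontfun (f n)) g sequentially"
    using Cauchy_uniformly_convergent uniformly_convergent_on_def by blast
  from uniform_limit_bcontfunE[OF this sequentially_bot] show "convergent f"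
    unfolding convergent_def by blast
qed

instance bcontfun :: (topological_space, banach) banach ..

section \<open>Coefficients and compact operators on a Hilbert module\<close>

context hilbert_cx_module
begin

sublocale L: cstar_algebra L
  by (rule cstar_algebra_L)

definition scalar :: "('x \<Rightarrow>\<^sub>C complex) \<Rightarrow> 'v \<Rightarrow> 'v" where "scalar f = (\<lambda>x\<in>V. act x f)"

lemma scalar_apply [simp]: "x \<in> V \<Longrightarrow> scalar f x = act x f"
  by (simp add: scalar_def)

lemma scalar_L: "scalar f \<in> carrier L" "star L (scalar f) = scalar (conj_bcontfun f)"
  unfolding scalar_def
  by (rule L_I[of "\<lambda>x. act x f" "\<lambda>x. act x (conj_bcontfun f)"];
      simp add: inner_act_left inner_act_right mult.commute)+

lemma coef_rep_scalar: "coef_rep L scalar"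
proof (intro coef_rep.intro coef_rep_axioms.intro involutive_algebra_L)
  fix f h z
  show "scalar f \<in> carrier L" "scalar (conj_bcontfun f) = star L (scalar f)"
    by (simp_all add: scalar_L)
  show "scalar (f + h) = scalar f \<oplus>\<^bsub>L\<^esub> scalar h"
    by (rule L_eqI) (simp_all add: scalar_L act_plus)
  show "scalar (f * h) = scalar f \<otimes>\<^bsub>L\<^esub> scalar h"
    by (rule L_eqI) (simp_all add: scalar_L act_act mult.commute)
  show "scalar 1 = \<one>\<^bsub>L\<^esub>"
    by (rule L_eqI) (simp_all add: scalar_L)
  show "scalar (const_bcontfun z * f) = z \<odot>\<^bsub>L\<^esub> scalar f"
    by (rule L_eqI) (simp_all add: scalar_L act_act mult.commute)
qed

lemma nrm_scalar_le: "nrm L (scalar f) \<le> norm f"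
proof (rule nrm_L_leI)
  fix x assume x: "x \<in> V" "nm x \<le> 1"
  then show "nm (scalar f x) \<le> norm f"
    using nm_act[OF x(1), of f] mult_right_mono[OF x(2), of "norm f"] by simp
qed

lemma scalar_commute: "T \<in> carrier L \<Longrightarrow> scalar f \<otimes>\<^bsub>L\<^esub> T = T \<otimes>\<^bsub>L\<^esub> scalar f"
  by (rule L_eqI) (simp_all add: scalar_L L_act_apply)

abbreviation rk :: "'v \<Rightarrow> 'v \<Rightarrow> 'v \<Rightarrow> 'v" where "rk \<equiv> rank_one M"

lemma rk_apply [simp]: "z \<in> V \<Longrightarrow> rk x y z = act x (ip y z)"
  by (simp add: rank_one_def)

lemma rk_L:
  assumes "x \<in> V" "y \<in> V"
  shows "rk x y \<in> carrier L" "star L (rk x y) = rk y x"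
  unfolding rank_one_def
  by (rule L_I[of "\<lambda>z. act x (ip y z)" "\<lambda>z. act y (ip x z)"];
      use assms in \<open>simp add: inner_act_left inner_act_right inner_conj mult.commute\<close>)+

lemma L_mult_rk: "T \<in> carrier L \<Longrightarrow> x \<in> V \<Longrightarrow> y \<in> V \<Longrightarrow> T \<otimes>\<^bsub>L\<^esub> rk x y = rk (T x) y"
  by (rule L_eqI) (simp_all add: rk_L L_act_apply)

lemma rk_mult_L: "T \<in> carrier L \<Longrightarrow> x \<in> V \<Longrightarrow> y \<in> V \<Longrightarrow> rk x y \<otimes>\<^bsub>L\<^esub> T = rk x (star L T y)"
  by (rule L_eqI) (simp_all add: rk_L L_inner_right)

lemma nrm_rk_le:
  assumes x: "x \<in> V" and y: "y \<in> V"
  shows "nrm L (rk x y) \<le> nm x * nm y"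
proof (rule nrm_L_leI)
  fix z assume z: "z \<in> V" "nm z \<le> 1"
  have "nm (act x (ip y z)) \<le> nm x * (nm y * nm z)"
    using nm_act[OF x, of "ip y z"] mult_left_mono[OF inner_norm_le[OF y z(1)], of "nm x"] by simp
  also have "\<dots> \<le> nm x * (nm y * 1)"
    using z by (intro mult_left_mono) auto
  finally show "nm (rk x y z) \<le> nm x * nm y"
    using z by simp
qed

lemma rk_diff_left: "x \<in> V \<Longrightarrow> x' \<in> V \<Longrightarrow> y \<in> V \<Longrightarrow> rk x y \<ominus>\<^bsub>L\<^esub> rk x' y = rk (x - x') y"
proof (rule L_eqI)
  fix z assume "x \<in> V" "x' \<in> V" "y \<in> V" and z: "z \<in> V"
  then show "(rk x y \<ominus>\<^bsub>L\<^esub> rk x' y) z = rk (x - x') y z"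
    using act_add[of "x - x'" x' "ip y z"] by (simp add: L_diff rk_L)
qed (simp_all add: rk_L)

lemma seq_lim_rk_left:
  assumes s: "\<And>i. s i \<in> V" and x: "x \<in> V" and y: "y \<in> V" and lim: "(\<lambda>i. nm (s i - x)) \<longlonglongrightarrow> 0"
  shows "seq_lim L (nrm L) (\<lambda>i. rk (s i) y) (rk x y)"
proof (rule L.seq_limI_le)
  show "nrm L (rk (s i) y \<ominus>\<^bsub>L\<^esub> rk x y) \<le> nm (s i - x) * nm y" for i
    using nrm_rk_le[of "s i - x" y] s x y by (simp add: rk_diff_left)
  show "(\<lambda>i. nm (s i - x) * nm y) \<longlonglongrightarrow> 0"
    using tendsto_mult[OF lim tendsto_const, of "nm y"] by simp
qed (use s x y in \<open>auto simp: rk_L\<close>)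

abbreviation K :: "('v \<Rightarrow> 'v) set" where "K \<equiv> compact_ops M"

lemma rank_ones_subset: "{rk x y | x y. x \<in> V \<and> y \<in> V} \<subseteq> carrier L"
  using rk_L by auto

lemma closed_subspace_K: "closed_subspace L K"
  unfolding compact_ops_def by (rule L.closed_subspace_closed_span[OF rank_ones_subset])

lemma rk_K: "x \<in> V \<Longrightarrow> y \<in> V \<Longrightarrow> rk x y \<in> K"
  unfolding compact_ops_def by (rule subsetD[OF L.closed_span_base]) blast

lemma K_least: "closed_subspace L S \<Longrightarrow> (\<And>x y. x \<in> V \<Longrightarrow> y \<in> V \<Longrightarrow> rk x y \<in> S) \<Longrightarrow> T \<in> K \<Longrightarrow> T \<in> S"
  unfolding compact_ops_def
  by (rule subsetD[OF L.closed_span_least[of S "{rk x y | x y. x \<in> V \<and> y \<in> V}"]]) (assumption, blast, assumption)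

lemmas K_subset = L.closed_subspaceD(1)[OF closed_subspace_K]

lemma K_left: assumes T: "T \<in> carrier L" and k: "k \<in> K" shows "T \<otimes>\<^bsub>L\<^esub> k \<in> K"
proof -
  have "closed_subspace L {k \<in> carrier L. T \<otimes>\<^bsub>L\<^esub> k \<in> K}"
    by (rule L.closed_subspace_vimage[OF closed_subspace_K])
      (use T L.closed_subspaceD(4)[OF closed_subspace_K] in
        \<open>auto simp: L.r_distr L.smult_mult_right intro: L.seq_lim_mult L.seq_lim_const\<close>)
  then have "k \<in> {k \<in> carrier L. T \<otimes>\<^bsub>L\<^esub> k \<in> K}"
    by (rule K_least[OF _ _ k]) (use T in \<open>auto simp: rk_L L_mult_rk rk_K\<close>)
  then show ?thesis
    by simp
qed

lemma K_star: assumes k: "k \<in> K" shows "star L k \<in> K"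
proof -
  have "closed_subspace L {k \<in> carrier L. star L k \<in> K}"
    by (rule L.closed_subspace_vimage[OF closed_subspace_K])
      (use L.closed_subspaceD(4)[OF closed_subspace_K] in
        \<open>auto simp: L.star_add L.star_smult intro: L.seq_lim_star\<close>)
  then have "k \<in> {k \<in> carrier L. star L k \<in> K}"
    by (rule K_least[OF _ _ k]) (auto simp: rk_L rk_K)
  then show ?thesis
    by simp
qed

lemma K_right: assumes T: "T \<in> carrier L" and k: "k \<in> K" shows "k \<otimes>\<^bsub>L\<^esub> T \<in> K"
proof -
  have kL: "k \<in> carrier L"
    using k K_subset by blast
  have "star L (star L T \<otimes>\<^bsub>L\<^esub> star L k) \<in> K"
    using T k by (intro K_star K_left) auto
  then show ?thesis
    using T kL by (simp add: L.star_mult)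
qed

end

section \<open>The Fock module\<close>

lemma finite_words: "finite {w :: 'n::finite list. length w = k}"
  using finite_lists_length_eq[of "UNIV :: 'n set" k] by simp

text \<open>A pointwise order which controls norms of complex functions by a nonnegative one. It passes to sums and
  thereby to Cauchy criteria, while the norm of a function in \<open>C(X)\<close> is not additive.\<close>

definition dominated :: "('x::topological_space \<Rightarrow>\<^sub>C complex) \<Rightarrow> ('x \<Rightarrow>\<^sub>C complex) \<Rightarrow> bool" where
  "dominated f h \<longleftrightarrow> (\<forall>t. norm (apply_bcontfun f t) \<le> Re (apply_bcontfun h t))"

lemma dominated_norm: "dominated f h \<Longrightarrow> norm f \<le> norm h"
  unfolding dominated_def by (rule norm_bound) (meson complex_Re_le_cmod norm_bounded order_trans)

lemma apply_bcontfun_sum: "apply_bcontfun (\<Sum>i\<in>I. f i) t = (\<Sum>i\<in>I. apply_bcontfun (f i) t)"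
  by (induction I rule: infinite_finite_induct) auto

lemma dominated_sum: "(\<And>i. i \<in> I \<Longrightarrow> dominated (f i) (h i)) \<Longrightarrow> dominated (\<Sum>i\<in>I. f i) (\<Sum>i\<in>I. h i)"
  unfolding dominated_def by (auto simp: apply_bcontfun_sum intro!: sum_norm_le)

lemma summable_dominated:
  fixes f h :: "nat \<Rightarrow> 'x::topological_space \<Rightarrow>\<^sub>C complex"
  assumes dom: "\<And>k. dominated (f k) (h k)" and h: "summable h"
  shows "summable f"
  unfolding summable_Cauchy
proof (intro allI impI)
  fix e :: real assume "0 < e"
  then obtain N where N: "\<And>m n. m \<ge> N \<Longrightarrow> norm (sum h {m..<n}) < e"
    using h unfolding summable_Cauchy by blast
  have "norm (sum f {m..<n}) < e" if "m \<ge> N" for m n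
  proof -
    have "dominated (sum f {m..<n}) (sum h {m..<n})"
      by (rule dominated_sum) (rule dom)
    then show ?thesis
      using dominated_norm N[OF that] le_less_trans by blast
  qed
  then show "\<exists>N. \<forall>m\<ge>N. \<forall>n. norm (sum f {m..<n}) < e"
    by blast
qed

lemma bounded_linear_apply: "bounded_linear (\<lambda>f :: 'x::topological_space \<Rightarrow>\<^sub>C complex. apply_bcontfun f t)"
  by (rule bounded_linear_intro[where K = 1]) (auto intro: norm_bounded)

lemma bounded_linear_conj: "bounded_linear (conj_bcontfun :: ('x::topological_space \<Rightarrow>\<^sub>C complex) \<Rightarrow> _)"
proof (rule bounded_linear_intro[where K = 1])
  show "norm (conj_bcontfun f) \<le> norm f * 1" for f :: "'x \<Rightarrow>\<^sub>C complex"
    by (rule norm_bound) (simp add: apply_conj norm_bounded)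
qed (auto intro!: bcontfun_eqI simp: apply_conj)

lemma conj_sum: "conj_bcontfun (\<Sum>i\<in>I. f i) = (\<Sum>i\<in>I. conj_bcontfun (f i))"
  by (rule linear_sum) (rule bounded_linear.linear[OF bounded_linear_conj])

text \<open>The \<open>k\<close>-th summand of the inner product of two vectors of the Fock module.\<close>

definition level_inner ::
  "(nat \<Rightarrow> 'n list \<Rightarrow> 'x::topological_space \<Rightarrow>\<^sub>C complex) \<Rightarrow> (nat \<Rightarrow> 'n list \<Rightarrow> 'x \<Rightarrow>\<^sub>C complex) \<Rightarrow>
   nat \<Rightarrow> 'x \<Rightarrow>\<^sub>C complex"
  where "level_inner x y k = (\<Sum>w | length w = k. conj_bcontfun (x k w) * y k w)"

lemma level_inner_self_apply:
  "apply_bcontfun (level_inner x x k) t = of_real (\<Sum>w | length w = k. (norm (apply_bcontfun (x k w) t))\<^sup>2)"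
proof -
  have "apply_bcontfun (level_inner x x k) t =
      (\<Sum>w | length w = k. of_real ((norm (apply_bcontfun (x k w) t))\<^sup>2))"
    unfolding level_inner_def apply_bcontfun_sum apply_times apply_conj complex_norm_square
    by (simp add: mult.commute)
  then show ?thesis
    by simp
qed

lemma level_inner_self_nonneg: "0 \<le> Re (apply_bcontfun (level_inner x x k) t)"
  unfolding level_inner_self_apply Re_complex_of_real by (intro sum_nonneg) auto

lemma level_inner_dominated: "dominated (level_inner x y k) (level_inner x x k + level_inner y y k)"
  unfolding dominated_def
proof
  fix t
  have "norm (apply_bcontfun (level_inner x y k) t) \<le>
      (\<Sum>w | length w = k. norm (apply_bcontfun (x k w) t) * norm (apply_bcontfun (y k w) t))"
    unfolding level_inner_def apply_bcontfun_sum apply_times apply_conj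
    by (rule sum_norm_le) (simp add: norm_mult)
  also have "\<dots> \<le> (\<Sum>w | length w = k.
      (norm (apply_bcontfun (x k w) t))\<^sup>2 + (norm (apply_bcontfun (y k w) t))\<^sup>2)"
  proof (rule sum_mono)
    fix w
    show "norm (apply_bcontfun (x k w) t) * norm (apply_bcontfun (y k w) t) \<le>
      (norm (apply_bcontfun (x k w) t))\<^sup>2 + (norm (apply_bcontfun (y k w) t))\<^sup>2"
      using sum_squares_bound[of "norm (apply_bcontfun (x k w) t)" "norm (apply_bcontfun (y k w) t)"]
        mult_nonneg_nonneg[OF norm_ge_zero[of "apply_bcontfun (x k w) t"] norm_ge_zero[of "apply_bcontfun (y k w) t"]]
      by linarith
  qed
  finally show "norm (apply_bcontfun (level_inner x y k) t) \<le>
      Re (apply_bcontfun (level_inner x x k + level_inner y y k) t)"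
    by (simp add: level_inner_self_apply sum.distrib)
qed

lemma level_inner_add_dominated:
  "dominated (level_inner (x + y) (x + y) k) (2 *\<^sub>R (level_inner x x k + level_inner y y k))"
  unfolding dominated_def
proof
  fix t
  have "(\<Sum>w | length w = k. (norm (apply_bcontfun ((x + y) k w) t))\<^sup>2) \<le>
      (\<Sum>w | length w = k. 2 * ((norm (apply_bcontfun (x k w) t))\<^sup>2 + (norm (apply_bcontfun (y k w) t))\<^sup>2))"
  proof (rule sum_mono)
    fix w
    let ?a = "norm (apply_bcontfun (x k w) t)" and ?b = "norm (apply_bcontfun (y k w) t)"
    have "norm (apply_bcontfun ((x + y) k w) t) \<le> ?a + ?b"
      by (simp add: norm_triangle_ineq)
    then have "(norm (apply_bcontfun ((x + y) k w) t))\<^sup>2 \<le> (?a + ?b)\<^sup>2"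
      by (rule power_mono) simp
    also have "\<dots> \<le> 2 * (?a\<^sup>2 + ?b\<^sup>2)"
      using sum_squares_bound[of ?a ?b] by (simp add: power2_sum)
    finally show "(norm (apply_bcontfun ((x + y) k w) t))\<^sup>2 \<le> 2 * (?a\<^sup>2 + ?b\<^sup>2)" .
  qed
  moreover have "0 \<le> (\<Sum>w | length w = k. (norm (apply_bcontfun ((x + y) k w) t))\<^sup>2)"
    by (intro sum_nonneg) auto
  ultimately show "norm (apply_bcontfun (level_inner (x + y) (x + y) k) t) \<le>
      Re (apply_bcontfun (2 *\<^sub>R (level_inner x x k + level_inner y y k)) t)"
    unfolding level_inner_self_apply norm_of_real
    by (simp add: level_inner_self_apply sum.distrib sum_distrib_left)
qed

locale projection_bundle =
  fixes E :: "('x::topological_space \<Rightarrow>\<^sub>C complex)^'n^'n"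
  assumes E: "projection E"
begin

lemma E_idem: "E ** E = E"
  using E by (simp add: projection_def)

lemma E_conj: "conj_bcontfun (E $ l $ m) = E $ m $ l"
proof -
  have "(\<chi> l m. conj_bcontfun (E $ m $ l)) $ m $ l = E $ m $ l"
    using E by (simp add: projection_def)
  then show ?thesis
    by simp
qed

lemma E_sum: "(\<Sum>j\<in>UNIV. E $ l $ j * E $ j $ m) = E $ l $ m"
proof -
  have "(E ** E) $ l $ m = E $ l $ m"
    by (simp add: E_idem)
  then show ?thesis
    by (simp add: matrix_matrix_mult_def)
qed

abbreviation tpv :: "nat \<Rightarrow> ('n list \<Rightarrow> 'x \<Rightarrow>\<^sub>C complex) set" where "tpv \<equiv> tensor_power_vecs E"

lemma tpv_Suc_iff: "y \<in> tpv (Suc k) \<longleftrightarrow> y [] = 0 \<and>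
    (\<forall>i. (\<lambda>u. y (i # u)) \<in> tpv k) \<and> (\<forall>i u. (\<Sum>j\<in>UNIV. E $ i $ j * y (j # u)) = y (i # u))"
  by (rule tensor_power_Suc_iff[OF E_idem E_idem])

lemma tpv_zero [simp]: "(\<lambda>w. 0) \<in> tpv k"
  using tensor_power_vecs_comb[OF E_idem, of "{}"] by simp

lemma tpv_act [simp]: "y \<in> tpv k \<Longrightarrow> (\<lambda>w. y w * f) \<in> tpv k"
  using tensor_power_vecs_comb[OF E_idem, of "{0}" "\<lambda>_. y" k "\<lambda>_. f"] by (simp add: mult.commute)

lemma tpv_act_left [simp]: "y \<in> tpv k \<Longrightarrow> (\<lambda>w. f * y w) \<in> tpv k"
  using tpv_act[of y k f] by (simp add: mult.commute)

lemma tpv_add [simp]: "y \<in> tpv k \<Longrightarrow> z \<in> tpv k \<Longrightarrow> (\<lambda>w. y w + z w) \<in> tpv k"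
  using tensor_power_vecs_comb[OF E_idem, of "{0, 1}" "\<lambda>j. if j = 0 then y else z" k "\<lambda>_. 1"] by simp

lemma tpv_sum: "finite I \<Longrightarrow> (\<And>i. i \<in> I \<Longrightarrow> y i \<in> tpv k) \<Longrightarrow> (\<lambda>w. \<Sum>i\<in>I. y i w) \<in> tpv k"
  by (induction I rule: finite_induct) auto

lemma tpv_support: "y \<in> tpv k \<Longrightarrow> length w \<noteq> k \<Longrightarrow> y w = 0"
proof (induction k arbitrary: y w)
  case (Suc k)
  then show ?case
    by (cases w) (auto simp: tpv_Suc_iff simp del: tensor_power_vecs.simps)
qed simp

text \<open>The tensor powers are cut out by equations between coordinates, which survive limits.\<close>

lemma tpv_lim:
  "(\<And>i :: nat. s i \<in> tpv k) \<Longrightarrow> (\<And>w. (\<lambda>i. s i w) \<longlonglongrightarrow> y w) \<Longrightarrow> y \<in> tpv k"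
proof (induction k arbitrary: s y)
  case 0
  have "y w = 0" if "w \<noteq> []" for w
    using 0 that LIMSEQ_unique[OF 0(2)[of w], of 0] by simp
  then show ?case
    by simp
next
  case (Suc k)
  note s = Suc.prems(1)[unfolded tpv_Suc_iff]
  show ?case
    unfolding tpv_Suc_iff
  proof (intro conjI allI)
    show "y [] = 0"
      using s LIMSEQ_unique[OF Suc.prems(2)[of "[]"], of 0] by simp
    show "(\<lambda>u. y (i # u)) \<in> tpv k" for i
      by (rule Suc.IH[of "\<lambda>j u. s j (i # u)"]) (use s Suc.prems(2) in auto)
    show "(\<Sum>j\<in>UNIV. E $ i $ j * y (j # u)) = y (i # u)" for i u
    proof (rule LIMSEQ_unique[OF _ Suc.prems(2)])
      have "(\<lambda>m. \<Sum>j\<in>UNIV. E $ i $ j * s m (j # u)) \<longlonglongrightarrow> (\<Sum>j\<in>UNIV. E $ i $ j * y (j # u))"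
        by (intro tendsto_sum tendsto_mult tendsto_const Suc.prems(2))
      then show "(\<lambda>m. s m (i # u)) \<longlonglongrightarrow> (\<Sum>j\<in>UNIV. E $ i $ j * y (j # u))"
        using s by simp
    qed
  qed
qed

abbreviation F :: "('x, nat \<Rightarrow> 'n list \<Rightarrow> 'x \<Rightarrow>\<^sub>C complex) hilbert_module" where "F \<equiv> fock_module E"

lemma F_vecs_iff: "x \<in> vecs F \<longleftrightarrow> (\<forall>k. x k \<in> tpv k) \<and> summable (level_inner x x)"
  by (simp add: fock_module_def direct_sum_def tensor_power_def level_inner_def[abs_def])

lemma F_ops:
  "vadd F x y = x + y" "vzero F = 0" "vact F x f = (\<lambda>k w. x k w * f)" "vinner F x y = (\<Sum>k. level_inner x y k)"
  by (simp_all add: fock_module_def direct_sum_def tensor_power_def level_inner_def fun_eq_iff)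

lemma F_summable:
  assumes "x \<in> vecs F" "y \<in> vecs F" shows "summable (level_inner x y)"
  by (rule summable_dominated[OF level_inner_dominated], rule summable_add) (use assms in \<open>simp_all add: F_vecs_iff\<close>)

lemma F_apply_self:
  assumes "x \<in> vecs F"
  shows "(\<lambda>k. Re (apply_bcontfun (level_inner x x k) t)) sums Re (apply_bcontfun (vinner F x x) t)"
  unfolding F_ops
  by (intro bounded_linear.sums[OF bounded_linear_Re] bounded_linear.sums[OF bounded_linear_apply]
      summable_sums F_summable assms)

lemma F_level_le:
  assumes "x \<in> vecs F" "finite I"
  shows "(\<Sum>k\<in>I. Re (apply_bcontfun (level_inner x x k) t)) \<le> Re (apply_bcontfun (vinner F x x) t)"
  using F_apply_self[OF assms(1), of t] level_inner_self_nonneg assms(2)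
  by (metis sum_le_suminf sums_summable sums_unique)

lemma F_partial_le:
  assumes "x \<in> vecs F" "finite I"
  shows "norm (\<Sum>k\<in>I. level_inner x x k) \<le> (vnorm F x)\<^sup>2"
proof -
  have "dominated (\<Sum>k\<in>I. level_inner x x k) (vinner F x x)"
    unfolding dominated_def
  proof
    fix t
    have "apply_bcontfun (\<Sum>k\<in>I. level_inner x x k) t =
        of_real (\<Sum>k\<in>I. Re (apply_bcontfun (level_inner x x k) t))"
      by (simp add: apply_bcontfun_sum level_inner_self_apply)
    moreover have "0 \<le> (\<Sum>k\<in>I. Re (apply_bcontfun (level_inner x x k) t))"
      by (rule sum_nonneg) (rule level_inner_self_nonneg)
    ultimately show "norm (apply_bcontfun (\<Sum>k\<in>I. level_inner x x k) t) \<le> Re (apply_bcontfun (vinner F x x) t)"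
      using F_level_le[OF assms, of t] by (simp only: norm_of_real abs_of_nonneg)
  qed
  then show ?thesis
    using dominated_norm by (simp add: vnorm_def)
qed

lemma F_coord_le:
  assumes x: "x \<in> vecs F" shows "norm (x k w) \<le> vnorm F x"
proof (cases "length w = k")
  case True
  have "(norm (apply_bcontfun (x k w) t))\<^sup>2 \<le> (vnorm F x)\<^sup>2" for t
  proof -
    have "(norm (apply_bcontfun (x k w) t))\<^sup>2 \<le> (\<Sum>w | length w = k. (norm (apply_bcontfun (x k w) t))\<^sup>2)"
      using True by (intro member_le_sum finite_words) auto
    also have "\<dots> = norm (apply_bcontfun (level_inner x x k) t)"
      unfolding level_inner_self_apply norm_of_real by (simp add: sum_nonneg)
    also have "\<dots> \<le> norm (level_inner x x k)"
      by (rule norm_bounded)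
    also have "\<dots> \<le> (vnorm F x)\<^sup>2"
      using F_partial_le[OF x, of "{k}"] by simp
    finally show ?thesis .
  qed
  moreover have "0 \<le> vnorm F x"
    by (simp add: vnorm_def)
  ultimately have "norm (apply_bcontfun (x k w) t) \<le> vnorm F x" for t
    by (rule power2_le_imp_le)
  then show ?thesis
    by (rule norm_bound)
next
  case False
  then have "x k w = 0"
    using x tpv_support by (auto simp: F_vecs_iff)
  then show ?thesis
    by (simp add: vnorm_def)
qed

lemma F_add_closed: "x \<in> vecs F \<Longrightarrow> y \<in> vecs F \<Longrightarrow> x + y \<in> vecs F"
proof -
  assume xy: "x \<in> vecs F" "y \<in> vecs F"
  have "summable (level_inner (x + y) (x + y))"
    by (rule summable_dominated[OF level_inner_add_dominated], rule summable_scaleR_right, rule summable_add)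
      (use xy in \<open>simp_all add: F_vecs_iff\<close>)
  moreover have "(x + y) k \<in> tpv k" for k
    using tpv_add[of "x k" k "y k"] xy by (simp add: F_vecs_iff plus_fun_def)
  ultimately show ?thesis
    by (simp add: F_vecs_iff)
qed

lemma level_inner_act_right: "level_inner x (\<lambda>k w. y k w * f) k = level_inner x y k * f"
  by (simp add: level_inner_def sum_distrib_right mult.assoc)

lemma level_inner_act_left: "level_inner (\<lambda>k w. x k w * f) y k = level_inner x y k * conj_bcontfun f"
  by (simp add: level_inner_def sum_distrib_left conj_mult mult_ac)

lemma F_act_closed: "x \<in> vecs F \<Longrightarrow> (\<lambda>k w. x k w * f) \<in> vecs F"
  by (simp add: F_vecs_iff level_inner_act_right[abs_def] level_inner_act_left[abs_def] summable_mult2)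

lemma F_minus_closed: "x \<in> vecs F \<Longrightarrow> y \<in> vecs F \<Longrightarrow> x - y \<in> vecs F"
proof -
  assume xy: "x \<in> vecs F" "y \<in> vecs F"
  have "x + (\<lambda>k w. y k w * (- 1)) \<in> vecs F"
    by (intro F_add_closed F_act_closed xy)
  moreover have "x + (\<lambda>k w. y k w * (- 1)) = x - y"
    by (simp add: fun_eq_iff)
  ultimately show ?thesis
    by simp
qed

lemma level_inner_add_right: "level_inner x (y + z) k = level_inner x y k + level_inner x z k"
  by (simp add: level_inner_def sum.distrib distrib_left)

lemma level_inner_conj: "conj_bcontfun (level_inner x y k) = level_inner y x k"
  by (simp add: level_inner_def conj_sum conj_mult) (simp add: mult.commute)

text \<open>The coordinates converge, since each is bounded by the norm. Estimates for finite sums of levels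
  pass to the limit, and they show that the limit lies in the module and is approached in norm.\<close>

lemma F_complete:
  assumes s: "\<And>i. s i \<in> vecs F"
    and cauchy: "\<And>e. 0 < e \<Longrightarrow> \<exists>K. \<forall>i\<ge>K. \<forall>j\<ge>K. vnorm F (s i - s j) < e"
  shows "\<exists>x\<in>vecs F. (\<lambda>i. vnorm F (s i - x)) \<longlonglongrightarrow> 0"
proof -
  have "convergent (\<lambda>i. s i k w)" for k w
  proof (rule Cauchy_convergent, rule CauchyI)
    fix e :: real assume "0 < e"
    then obtain K where K: "\<forall>i\<ge>K. \<forall>j\<ge>K. vnorm F (s i - s j) < e"
      using cauchy by blast
    have "norm (s i k w - s j k w) < e" if "i \<ge> K" "j \<ge> K" for i j
      using F_coord_le[OF F_minus_closed[OF s s], of i j k w] K that by force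
    then show "\<exists>M. \<forall>m\<ge>M. \<forall>n\<ge>M. norm (s m k w - s n k w) < e"
      by blast
  qed
  then obtain y where y: "\<And>k w. (\<lambda>i. s i k w) \<longlonglongrightarrow> y k w"
    unfolding convergent_def by metis
  have ytpv: "y k \<in> tpv k" for k
    by (rule tpv_lim[of "\<lambda>i. s i k"]) (use s y in \<open>auto simp: F_vecs_iff\<close>)
  have close: "\<exists>K. \<forall>i\<ge>K. \<forall>I. finite I \<longrightarrow> norm (\<Sum>k\<in>I. level_inner (s i - y) (s i - y) k) \<le> e\<^sup>2" if e: "0 < e" for e
  proof -
    obtain K where K: "\<And>i j. i \<ge> K \<Longrightarrow> j \<ge> K \<Longrightarrow> vnorm F (s i - s j) < e"
      using cauchy[OF e] by blast
    have "norm (\<Sum>k\<in>I. level_inner (s i - y) (s i - y) k) \<le> e\<^sup>2" if i: "i \<ge> K" and I: "finite I" for i I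
    proof (rule LIMSEQ_le_const2)
      have "(\<lambda>j. level_inner (s i - s j) (s i - s j) k) \<longlonglongrightarrow> level_inner (s i - y) (s i - y) k" for k
        unfolding level_inner_def
        by (intro tendsto_sum tendsto_mult bounded_linear.tendsto[OF bounded_linear_conj])
          (auto intro!: tendsto_diff tendsto_const y)
      then show "(\<lambda>j. norm (\<Sum>k\<in>I. level_inner (s i - s j) (s i - s j) k)) \<longlonglongrightarrow>
          norm (\<Sum>k\<in>I. level_inner (s i - y) (s i - y) k)"
        by (intro tendsto_norm tendsto_sum)
      have "norm (\<Sum>k\<in>I. level_inner (s i - s j) (s i - s j) k) \<le> e\<^sup>2" if "j \<ge> K" for j
      proof -
        have "(vnorm F (s i - s j))\<^sup>2 \<le> e\<^sup>2"
          using K[OF i that] by (intro power_mono) (auto simp: vnorm_def)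
        then show ?thesis
          using F_partial_le[OF F_minus_closed[OF s s] I, of i j] by linarith
      qed
      then show "\<exists>N. \<forall>j\<ge>N. norm (\<Sum>k\<in>I. level_inner (s i - s j) (s i - s j) k) \<le> e\<^sup>2"
        by blast
    qed
    then show ?thesis
      by blast
  qed
  have "summable (level_inner y y)"
    unfolding summable_Cauchy
  proof (intro allI impI)
    fix e :: real assume e: "0 < e"
    \<comment> \<open>Twice the sum of two terms below \<open>e / 8\<close> stays below \<open>e\<close>.\<close>
    define d where "d = sqrt (e / 8)"
    have d: "0 < d" "d\<^sup>2 = e / 8"
      using e by (simp_all add: d_def)
    obtain i where i: "\<And>I. finite I \<Longrightarrow> norm (\<Sum>k\<in>I. level_inner (s i - y) (s i - y) k) \<le> d\<^sup>2"
      using close[OF d(1)] by blast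
    have "summable (level_inner (s i) (s i))"
      using s by (simp add: F_vecs_iff)
    then obtain N where N: "\<And>m n. m \<ge> N \<Longrightarrow> norm (\<Sum>k = m..<n. level_inner (s i) (s i) k) < e / 8"
      unfolding summable_Cauchy using e by (metis divide_pos_pos zero_less_numeral)
    have "norm (\<Sum>k = m..<n. level_inner y y k) < e" if m: "m \<ge> N" for m n
    proof -
      let ?z = "y - s i"
      have "dominated (level_inner (?z + s i) (?z + s i) k) (2 *\<^sub>R (level_inner ?z ?z k + level_inner (s i) (s i) k))" for k
        by (rule level_inner_add_dominated)
      then have "norm (\<Sum>k = m..<n. level_inner y y k) \<le>
          norm (\<Sum>k = m..<n. 2 *\<^sub>R (level_inner ?z ?z k + level_inner (s i) (s i) k))"
        by (intro dominated_norm dominated_sum) simp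
      also have "\<dots> = 2 * norm ((\<Sum>k = m..<n. level_inner ?z ?z k) + (\<Sum>k = m..<n. level_inner (s i) (s i) k))"
        by (simp add: scaleR_sum_right[symmetric] sum.distrib)
      also have "\<dots> \<le> 2 * (norm (\<Sum>k = m..<n. level_inner ?z ?z k) + norm (\<Sum>k = m..<n. level_inner (s i) (s i) k))"
        by (intro mult_left_mono norm_triangle_ineq) simp
      also have "level_inner ?z ?z = level_inner (s i - y) (s i - y)"
        by (rule ext, rule bcontfun_eqI) (simp add: level_inner_self_apply norm_minus_commute)
      finally show ?thesis
        using i[of "{m..<n}"] N[OF m, of n] d e by simp
    qed
    then show "\<exists>N. \<forall>m\<ge>N. \<forall>n. norm (\<Sum>k = m..<n. level_inner y y k) < e"
      by blast
  qed
  then have yF: "y \<in> vecs F"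
    using ytpv by (simp add: F_vecs_iff)
  have "(\<lambda>i. vnorm F (s i - y)) \<longlonglongrightarrow> 0"
  proof (rule LIMSEQ_I)
    fix e :: real assume e: "0 < e"
    obtain K where K: "\<And>i I. i \<ge> K \<Longrightarrow> finite I \<Longrightarrow> norm (\<Sum>k\<in>I. level_inner (s i - y) (s i - y) k) \<le> (e / 2)\<^sup>2"
      using close[of "e / 2"] e by auto
    have "norm (vnorm F (s i - y) - 0) < e" if i: "i \<ge> K" for i
    proof -
      have "(\<lambda>n. norm (\<Sum>k<n. level_inner (s i - y) (s i - y) k)) \<longlonglongrightarrow> norm (vinner F (s i - y) (s i - y))"
        unfolding F_ops by (intro tendsto_norm summable_LIMSEQ F_summable F_minus_closed s yF)
      then have "norm (vinner F (s i - y) (s i - y)) \<le> (e / 2)\<^sup>2"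
        by (rule LIMSEQ_le_const2) (use K[OF i] in auto)
      then have "vnorm F (s i - y) \<le> e / 2"
        unfolding vnorm_def using e by (intro real_le_lsqrt) auto
      then show ?thesis
        using e by (simp add: vnorm_def)
    qed
    then show "\<exists>no. \<forall>n\<ge>no. norm (vnorm F (s n - y) - 0) < e"
      by blast
  qed
  then show ?thesis
    using yF by blast
qed

lemma hilbert_cx_module_F: "hilbert_cx_module F"
proof (rule hilbert_cx_module.intro)
  show "vadd F = (+)" "vzero F = 0"
    by (auto simp: F_ops fun_eq_iff)
  show "0 \<in> vecs F"
    by (simp add: F_vecs_iff zero_fun_def[where ?'b = "'x \<Rightarrow>\<^sub>C complex"] level_inner_def[abs_def])
  show "x + y \<in> vecs F" if "x \<in> vecs F" "y \<in> vecs F" for x y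
    by (rule F_add_closed[OF that])
  show "vact F x f \<in> vecs F" if "x \<in> vecs F" for x f
    unfolding F_ops by (rule F_act_closed[OF that])
  show "vact F (x + y) f = vact F x f + vact F y f" "vact F x (f + h) = vact F x f + vact F x h"
    "vact F (vact F x f) h = vact F x (f * h)" "vact F x 1 = x" for x y f h
    by (auto simp: F_ops fun_eq_iff algebra_simps)
  show "vinner F x (y + z) = vinner F x y + vinner F x z" if "x \<in> vecs F" "y \<in> vecs F" "z \<in> vecs F" for x y z
    using that by (simp add: F_ops level_inner_add_right suminf_add F_summable)
  show "vinner F x (vact F y f) = vinner F x y * f" if "x \<in> vecs F" "y \<in> vecs F" for x y f
    using that by (simp add: F_ops level_inner_act_right suminf_mult2 F_summable)
  show "conj_bcontfun (vinner F x y) = vinner F y x" if "x \<in> vecs F" "y \<in> vecs F" for x y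
    unfolding F_ops bounded_linear.suminf[OF bounded_linear_conj F_summable[OF that]] level_inner_conj ..
  show "0 \<le> Re (apply_bcontfun (vinner F x x) t)" if "x \<in> vecs F" for x t
    using F_level_le[OF that, of "{}" t] by simp
  show "x = 0" if x: "x \<in> vecs F" and "vinner F x x = 0" for x
  proof (rule ext, rule ext)
    fix k w
    have "vnorm F x = 0"
      using that by (simp add: vnorm_def)
    then show "x k w = 0 k w"
      using F_coord_le[OF x, of k w] by simp
  qed
  show "\<exists>x\<in>vecs F. (\<lambda>i. vnorm F (s i - x)) \<longlonglongrightarrow> 0" if "\<And>i. s i \<in> vecs F"
    "\<And>e. 0 < e \<Longrightarrow> \<exists>K. \<forall>i\<ge>K. \<forall>j\<ge>K. vnorm F (s i - s j) < e" for s
    by (rule F_complete[OF that])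
qed

sublocale F: hilbert_cx_module F
  by (rule hilbert_cx_module_F)

end

section \<open>Creation operators\<close>

lemma sum_fun_apply: "(\<Sum>i\<in>I. f i) x = (\<Sum>i\<in>I. f i x)"
  by (induction I rule: infinite_finite_induct) auto

lemma (in hilbert_cx_module) finsum_L_apply:
  "finite I \<Longrightarrow> f \<in> I \<rightarrow> carrier L \<Longrightarrow> x \<in> V \<Longrightarrow> finsum L f I x = (\<Sum>i\<in>I. f i x)"
  by (induction I rule: finite_induct) (auto simp: Pi_def)

lemma sum_words_Suc:
  "(\<Sum>w :: 'n::finite list | length w = Suc k. f w) = (\<Sum>u | length u = k. \<Sum>i\<in>UNIV. f (i # u))"
proof -
  have "inj_on (\<lambda>p. fst p # snd p) (UNIV \<times> {u :: 'n list. length u = k})"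
    by (auto simp: inj_on_def prod_eq_iff)
  then have "(\<Sum>w :: 'n list | length w = Suc k. f w) = (\<Sum>(i, u)\<in>UNIV \<times> {u. length u = k}. f (i # u))"
    by (simp add: words_Suc sum.reindex case_prod_unfold)
  also have "\<dots> = (\<Sum>i\<in>UNIV. \<Sum>u | length u = k. f (i # u))"
    by (simp add: sum.cartesian_product)
  also have "\<dots> = (\<Sum>u | length u = k. \<Sum>i\<in>UNIV. f (i # u))"
    by (rule sum.swap)
  finally show ?thesis .
qed

lemma level_inner_self_norm:
  "norm (apply_bcontfun (level_inner x x k) t) = (\<Sum>w | length w = k. (norm (apply_bcontfun (x k w) t))\<^sup>2)"
  unfolding level_inner_self_apply norm_of_real by (simp add: sum_nonneg)

lemma (in ring) minus_add_split:
  "c \<in> carrier R \<Longrightarrow> s \<in> carrier R \<Longrightarrow> \<one> \<ominus> c = (\<one> \<ominus> (s \<oplus> c)) \<oplus> s"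
  using one_closed by algebra

context projection_bundle
begin

abbreviation sections :: "(('x \<Rightarrow>\<^sub>C complex)^'n) set" where "sections \<equiv> vecs (section_module E)"

lemma sections_iff: "v \<in> sections \<longleftrightarrow> (\<forall>i. (\<Sum>j\<in>UNIV. E $ i $ j * v $ j) = v $ i)"
proof -
  have "v \<in> sections \<longleftrightarrow> E *v v = v"
    using E_idem by (auto simp: section_module_def matrix_vector_mul_assoc image_iff) metis
  then show ?thesis
    by (simp add: vec_eq_iff matrix_vector_mult_def)
qed

definition column :: "'n \<Rightarrow> ('x \<Rightarrow>\<^sub>C complex)^'n" where "column l = (\<chi> i. E $ i $ l)"

lemma column_section: "column l \<in> sections"
  by (simp add: sections_iff column_def E_sum)

text \<open>The functions underlying creation operators and their adjoints, without restriction to the Fock module, so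
  that their coordinates can be computed freely.\<close>

definition raise ::
  "('x \<Rightarrow>\<^sub>C complex)^'n \<Rightarrow> (nat \<Rightarrow> 'n list \<Rightarrow> 'x \<Rightarrow>\<^sub>C complex) \<Rightarrow> nat \<Rightarrow> 'n list \<Rightarrow> 'x \<Rightarrow>\<^sub>C complex"
  where "raise v x = (\<lambda>k w. case k of 0 \<Rightarrow> 0 | Suc j \<Rightarrow> tensor v (x j) w)"

definition lower ::
  "('x \<Rightarrow>\<^sub>C complex)^'n \<Rightarrow> (nat \<Rightarrow> 'n list \<Rightarrow> 'x \<Rightarrow>\<^sub>C complex) \<Rightarrow> nat \<Rightarrow> 'n list \<Rightarrow> 'x \<Rightarrow>\<^sub>C complex"
  where "lower v y = (\<lambda>k u. \<Sum>i\<in>UNIV. conj_bcontfun (v $ i) * y (Suc k) (i # u))"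

lemma raise_simps [simp]: "raise v x 0 w = 0" "raise v x (Suc k) [] = 0"
  "raise v x (Suc k) (i # u) = v $ i * x k u"
  by (simp_all add: raise_def tensor_def)

lemma creation_eq: "creation E v = (\<lambda>x\<in>vecs F. raise v x)"
proof -
  have "(\<lambda>k. case k of 0 \<Rightarrow> vzero (tensor_power E 0) | Suc j \<Rightarrow> tensor v (x j)) = raise v x" for x
    by (auto simp: fun_eq_iff raise_def tensor_power_def split: nat.splits)
  then show ?thesis
    by (simp add: creation_def)
qed

lemma level_inner_raise:
  "level_inner (raise v x) y (Suc k) = level_inner x (lower v y) k"
  "level_inner (raise v x) y 0 = 0"
  by (simp_all add: level_inner_def sum_words_Suc lower_def conj_mult sum_distrib_left mult_ac
      conj_sum[of _ "{}", simplified])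

lemma raise_closed:
  assumes v: "v \<in> sections" and x: "x \<in> vecs F" shows "raise v x \<in> vecs F"
  unfolding F_vecs_iff
proof (intro conjI allI)
  have xk: "x k \<in> tpv k" for k
    using x by (simp add: F_vecs_iff)
  show "raise v x k \<in> tpv k" for k
  proof (cases k)
    case 0
    then show ?thesis
      by (simp add: raise_def)
  next
    case (Suc j)
    show ?thesis
      unfolding Suc tpv_Suc_iff
      using v xk[of j] by (simp add: sections_iff mult.assoc[symmetric] sum_distrib_right[symmetric])
  qed
  define a where "a = (\<Sum>i\<in>UNIV. conj_bcontfun (v $ i) * v $ i)"
  have "level_inner (raise v x) (raise v x) (Suc k) = level_inner x x k * a" for k
    by (simp add: level_inner_def sum_words_Suc a_def conj_mult sum_distrib_left sum_distrib_right mult_ac)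
  then have "summable (\<lambda>k. level_inner (raise v x) (raise v x) (Suc k))"
    using summable_mult2[of "level_inner x x" a] x by (simp add: F_vecs_iff)
  then show "summable (level_inner (raise v x) (raise v x))"
    by (rule summable_Suc_iff[THEN iffD1])
qed

text \<open>By Cauchy-Schwarz, lowering costs at most the factor \<open>\<Sum> |v\<^sub>i|\<^sup>2\<close> in each level.\<close>

lemma lower_closed:
  assumes y: "y \<in> vecs F" shows "lower v y \<in> vecs F"
  unfolding F_vecs_iff
proof (intro conjI allI)
  have yk: "y k \<in> tpv k" for k
    using y by (simp add: F_vecs_iff)
  show "lower v y k \<in> tpv k" for k
    unfolding lower_def
    by (intro tpv_sum tpv_act_left) (use yk[of "Suc k"] in \<open>simp_all add: tpv_Suc_iff del: tensor_power_vecs.simps\<close>)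
  define C where "C = (\<Sum>i\<in>UNIV. (norm (v $ i))\<^sup>2)"
  have "dominated (level_inner (lower v y) (lower v y) k) (C *\<^sub>R level_inner y y (Suc k))" for k
    unfolding dominated_def
  proof
    fix t
    have "(norm (apply_bcontfun (lower v y k u) t))\<^sup>2 \<le>
        C * (\<Sum>i\<in>UNIV. (norm (apply_bcontfun (y (Suc k) (i # u)) t))\<^sup>2)" for u
    proof -
      let ?a = "\<lambda>i. norm (apply_bcontfun (v $ i) t)" and ?b = "\<lambda>i. norm (apply_bcontfun (y (Suc k) (i # u)) t)"
      have "norm (apply_bcontfun (lower v y k u) t) \<le> (\<Sum>i\<in>UNIV. ?a i * ?b i)"
        unfolding lower_def apply_bcontfun_sum apply_times apply_conj
        by (rule sum_norm_le) (simp add: norm_mult)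
      then have "(norm (apply_bcontfun (lower v y k u) t))\<^sup>2 \<le> (\<Sum>i\<in>UNIV. ?a i * ?b i)\<^sup>2"
        by (rule power_mono) simp
      also have "\<dots> \<le> (\<Sum>i\<in>UNIV. (?a i)\<^sup>2) * (\<Sum>i\<in>UNIV. (?b i)\<^sup>2)"
        by (rule Cauchy_Schwarz_ineq_sum)
      also have "\<dots> \<le> C * (\<Sum>i\<in>UNIV. (?b i)\<^sup>2)"
        unfolding C_def by (intro mult_right_mono sum_mono power_mono norm_bounded sum_nonneg) auto
      finally show ?thesis .
    qed
    then have "(\<Sum>u | length u = k. (norm (apply_bcontfun (lower v y k u) t))\<^sup>2) \<le>
        (\<Sum>u | length u = k. C * (\<Sum>i\<in>UNIV. (norm (apply_bcontfun (y (Suc k) (i # u)) t))\<^sup>2))"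
      by (intro sum_mono)
    also have "\<dots> = C * (\<Sum>w | length w = Suc k. (norm (apply_bcontfun (y (Suc k) w) t))\<^sup>2)"
      by (simp add: sum_words_Suc sum_distrib_left)
    finally show "norm (apply_bcontfun (level_inner (lower v y) (lower v y) k) t) \<le>
        Re (apply_bcontfun (C *\<^sub>R level_inner y y (Suc k)) t)"
      unfolding level_inner_self_norm by (simp add: level_inner_self_apply)
  qed
  moreover have "summable (\<lambda>k. C *\<^sub>R level_inner y y (Suc k))"
    using y by (intro summable_scaleR_right) (simp add: F_vecs_iff summable_Suc_iff)
  ultimately show "summable (level_inner (lower v y) (lower v y))"
    by (rule summable_dominated)
qed

lemma inner_raise:
  assumes v: "v \<in> sections" and x: "x \<in> vecs F" and y: "y \<in> vecs F"
  shows "vinner F (raise v x) y = vinner F x (lower v y)"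
proof -
  have "summable (level_inner (raise v x) y)"
    by (rule F_summable[OF raise_closed[OF v x] y])
  then have "(\<Sum>k. level_inner (raise v x) y k) = (\<Sum>k. level_inner (raise v x) y (Suc k)) + level_inner (raise v x) y 0"
    using suminf_split_head[of "level_inner (raise v x) y"] by simp
  then show ?thesis
    by (simp add: F_ops level_inner_raise)
qed

lemma creation_L:
  assumes "v \<in> sections"
  shows "creation E v \<in> carrier F.L" "star F.L (creation E v) = (\<lambda>y\<in>vecs F. lower v y)"
  unfolding creation_eq
  by (rule F.L_I[of "raise v" "lower v"]; use assms in \<open>simp add: raise_closed lower_closed inner_raise\<close>)+

lemma creation_apply: "x \<in> vecs F \<Longrightarrow> creation E v x = raise v x"
  by (simp add: creation_eq)

lemma star_creation_apply: "v \<in> sections \<Longrightarrow> x \<in> vecs F \<Longrightarrow> star F.L (creation E v) x = lower v x"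
  by (simp add: creation_L)

lemma star_creation_creation:
  assumes "v \<in> sections" "w \<in> sections"
  shows "star F.L (creation E v) \<otimes>\<^bsub>F.L\<^esub> creation E w = F.scalar (vinner (section_module E) v w)"
proof (rule F.L_eqI)
  fix x assume x: "x \<in> vecs F"
  have "lower v (raise w x) = vact F x (vinner (section_module E) v w)"
    by (simp add: fun_eq_iff lower_def F_ops section_module_def sum_distrib_left mult_ac)
  then show "(star F.L (creation E v) \<otimes>\<^bsub>F.L\<^esub> creation E w) x = F.scalar (vinner (section_module E) v w) x"
    using x assms by (simp add: creation_apply star_creation_apply raise_closed)
qed (use assms creation_L(1) in \<open>auto simp: F.scalar_L\<close>)

definition gen :: "'n \<Rightarrow> (nat \<Rightarrow> 'n list \<Rightarrow> 'x \<Rightarrow>\<^sub>C complex) \<Rightarrow> nat \<Rightarrow> 'n list \<Rightarrow> 'x \<Rightarrow>\<^sub>C complex"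
  where "gen l = creation E (column l)"

lemma gen_L [simp]: "gen l \<in> carrier F.L"
  by (simp add: gen_def creation_L column_section)

lemma gen_apply: "x \<in> vecs F \<Longrightarrow> gen l x = raise (column l) x"
  and star_gen_apply: "x \<in> vecs F \<Longrightarrow> star F.L (gen l) x = lower (column l) x"
  by (simp_all add: gen_def creation_apply star_creation_apply column_section)

sublocale fock: toeplitz_rep F.L F.scalar gen E
proof (rule toeplitz_rep.intro[OF F.coef_rep_scalar toeplitz_rep_axioms.intro])
  show "gen l \<in> carrier F.L" for l
    by simp
  show "F.scalar f \<otimes>\<^bsub>F.L\<^esub> gen l = gen l \<otimes>\<^bsub>F.L\<^esub> F.scalar f" for f l
    by (simp add: F.scalar_commute)
  show "star F.L (gen l) \<otimes>\<^bsub>F.L\<^esub> gen m = F.scalar (E $ l $ m)" for l m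
    by (simp add: gen_def star_creation_creation column_section) (simp add: section_module_def column_def E_conj E_sum)
qed

lemma creation_act:
  assumes v: "v \<in> sections"
  shows "(\<chi> i. v $ i * f) \<in> sections"
    and "creation E (\<chi> i. v $ i * f) = creation E v \<otimes>\<^bsub>F.L\<^esub> F.scalar f"
proof -
  show w: "(\<chi> i. v $ i * f) \<in> sections"
    using v by (simp add: sections_iff mult.assoc[symmetric] sum_distrib_right[symmetric])
  show "creation E (\<chi> i. v $ i * f) = creation E v \<otimes>\<^bsub>F.L\<^esub> F.scalar f"
  proof (rule F.L_eqI)
    fix x assume x: "x \<in> vecs F"
    have "raise (\<chi> i. v $ i * f) x k w = raise v (vact F x f) k w" for k w
      by (cases k; cases w) (auto simp: F_ops mult_ac)
    then have "raise (\<chi> i. v $ i * f) x = raise v (vact F x f)"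
      by (intro ext)
    then show "creation E (\<chi> i. v $ i * f) x = (creation E v \<otimes>\<^bsub>F.L\<^esub> F.scalar f) x"
      using x by (simp add: creation_eq)
  qed (use v w creation_L(1) F.scalar_L in auto)
qed

text \<open>The equation \<open>v = E v\<close> expresses a section by the columns of \<open>E\<close>.\<close>

lemma creation_sum:
  assumes v: "v \<in> sections"
  shows "creation E v = finsum F.L (\<lambda>l. gen l \<otimes>\<^bsub>F.L\<^esub> F.scalar (v $ l)) UNIV"
proof (rule F.L_eqI)
  fix x assume x: "x \<in> vecs F"
  have "raise v x k w = (\<Sum>l\<in>UNIV. raise (column l) (vact F x (v $ l)) k w)" for k w
  proof (cases k)
    case (Suc j)
    show ?thesis
    proof (cases w)
      case (Cons i u)
      have "(\<Sum>l\<in>UNIV. E $ i $ l * (x j u * v $ l)) = (\<Sum>l\<in>UNIV. E $ i $ l * v $ l) * x j u"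
        unfolding sum_distrib_right by (rule sum.cong) (simp_all only: mult_ac)
      also have "\<dots> = v $ i * x j u"
        using v by (simp add: sections_iff)
      finally show ?thesis
        by (simp add: Suc Cons column_def F_ops)
    qed (simp add: Suc)
  qed simp
  then have "raise v x = (\<Sum>l\<in>UNIV. raise (column l) (vact F x (v $ l)))"
    by (simp add: fun_eq_iff sum_fun_apply)
  then show "creation E v x = finsum F.L (\<lambda>l. gen l \<otimes>\<^bsub>F.L\<^esub> F.scalar (v $ l)) UNIV x"
    using x by (simp add: F.finsum_L_apply Pi_def F.scalar_L gen_apply creation_eq)
qed (use v creation_L(1) F.scalar_L in \<open>auto intro!: F.L.finsum_closed\<close>)

subsection \<open>Truncations of the Fock module\<close>

definition drop_levels ::
  "nat \<Rightarrow> (nat \<Rightarrow> 'n list \<Rightarrow> 'x \<Rightarrow>\<^sub>C complex) \<Rightarrow> nat \<Rightarrow> 'n list \<Rightarrow> 'x \<Rightarrow>\<^sub>C complex"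
  where "drop_levels n x = (\<lambda>k. if k < n then 0 else x k)"

definition cut :: "nat \<Rightarrow> (nat \<Rightarrow> 'n list \<Rightarrow> 'x \<Rightarrow>\<^sub>C complex) \<Rightarrow> nat \<Rightarrow> 'n list \<Rightarrow> 'x \<Rightarrow>\<^sub>C complex"
  where "cut n = (\<lambda>x\<in>vecs F. drop_levels n x)"

lemma level_inner_drop:
  "level_inner (drop_levels n x) y k = (if k < n then 0 else level_inner x y k)"
  "level_inner x (drop_levels n y) k = (if k < n then 0 else level_inner x y k)"
proof -
  have "conj_bcontfun 0 = (0 :: 'x \<Rightarrow>\<^sub>C complex)"
    by (rule bcontfun_eqI) (simp add: apply_conj)
  then show "level_inner (drop_levels n x) y k = (if k < n then 0 else level_inner x y k)"
    "level_inner x (drop_levels n y) k = (if k < n then 0 else level_inner x y k)"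
    by (simp_all add: level_inner_def drop_levels_def)
qed

lemma drop_closed: assumes x: "x \<in> vecs F" shows "drop_levels n x \<in> vecs F"
proof -
  have "dominated (level_inner (drop_levels n x) (drop_levels n x) k) (level_inner x x k)" for k
    unfolding dominated_def level_inner_drop
    using level_inner_self_nonneg[of x k] by (simp add: level_inner_self_norm) (simp add: level_inner_self_apply)
  then have "summable (level_inner (drop_levels n x) (drop_levels n x))"
    by (rule summable_dominated) (use x in \<open>simp add: F_vecs_iff\<close>)
  moreover have "drop_levels n x k \<in> tpv k" for k
    using x tpv_zero[of k] by (auto simp: drop_levels_def F_vecs_iff zero_fun_def)
  ultimately show ?thesis
    by (simp add: F_vecs_iff)
qed

lemma cut_apply: "x \<in> vecs F \<Longrightarrow> cut n x = drop_levels n x"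
  by (simp add: cut_def)

lemma cut_L [simp]: "cut n \<in> carrier F.L" and star_cut: "star F.L (cut n) = cut n"
  unfolding cut_def
  by (rule F.L_I[of "drop_levels n" "drop_levels n"]; simp add: drop_closed F_ops level_inner_drop cong: if_cong)+

lemma cut_zero: "cut 0 = \<one>\<^bsub>F.L\<^esub>"
  by (rule F.L_eqI) (auto simp: cut_apply drop_levels_def)

lemma cut_cut: "cut n \<otimes>\<^bsub>F.L\<^esub> cut n = cut n"
proof (rule F.L_eqI)
  show "(cut n \<otimes>\<^bsub>F.L\<^esub> cut n) x = cut n x" if "x \<in> vecs F" for x
    using that by (simp add: cut_apply drop_closed) (simp add: drop_levels_def fun_eq_iff)
qed simp_all

lemma nrm_cut_le: "nrm F.L (cut n) \<le> 1"
proof -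
  have "(nrm F.L (cut n))\<^sup>2 = nrm F.L (cut n)"
    using F.L.N_cstar[of "cut n"] by (simp add: star_cut cut_cut)
  then show ?thesis
    by (metis mult_cancel_left order_refl power2_eq_square zero_le_one mult.right_neutral)
qed

text \<open>On the tensor powers of positive degree, \<open>\<Sum> \<psi>\<^sub>l \<psi>\<^sub>l\<^sup>*\<close> applies \<open>E\<close> to the first letter, so it acts
  as the identity.\<close>

lemma cut_Suc:
  "cut (Suc n) = finsum F.L (\<lambda>l. gen l \<otimes>\<^bsub>F.L\<^esub> (cut n \<otimes>\<^bsub>F.L\<^esub> star F.L (gen l))) UNIV"
proof (rule F.L_eqI)
  fix y assume y: "y \<in> vecs F"
  have yk: "y k \<in> tpv k" for k
    using y by (simp add: F_vecs_iff)
  have "drop_levels (Suc n) y k w = (\<Sum>l\<in>UNIV. raise (column l) (drop_levels n (lower (column l) y)) k w)" for k w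
  proof (cases k)
    case (Suc j)
    show ?thesis
    proof (cases w)
      case Nil
      then show ?thesis
        using tpv_support[OF yk[of k], of "[]"] Suc by (simp add: drop_levels_def)
    next
      case (Cons i u)
      have "(\<Sum>l\<in>UNIV. E $ i $ l * (\<Sum>a\<in>UNIV. conj_bcontfun (E $ a $ l) * y (Suc j) (a # u))) =
          (\<Sum>l\<in>UNIV. \<Sum>a\<in>UNIV. E $ i $ l * E $ l $ a * y (Suc j) (a # u))"
        by (simp add: sum_distrib_left E_conj mult.assoc)
      also have "\<dots> = (\<Sum>a\<in>UNIV. \<Sum>l\<in>UNIV. E $ i $ l * E $ l $ a * y (Suc j) (a # u))"
        by (rule sum.swap)
      also have "\<dots> = (\<Sum>a\<in>UNIV. E $ i $ a * y (Suc j) (a # u))"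
        by (simp add: sum_distrib_right[symmetric] E_sum)
      also have "\<dots> = y (Suc j) (i # u)"
        using yk[of "Suc j"] by (simp add: tpv_Suc_iff del: tensor_power_vecs.simps)
      finally show ?thesis
        using Suc Cons by (simp add: drop_levels_def lower_def column_def)
    qed
  qed (simp add: drop_levels_def)
  then have "drop_levels (Suc n) y = (\<Sum>l\<in>UNIV. raise (column l) (drop_levels n (lower (column l) y)))"
    by (simp add: fun_eq_iff sum_fun_apply)
  then show "cut (Suc n) y = finsum F.L (\<lambda>l. gen l \<otimes>\<^bsub>F.L\<^esub> (cut n \<otimes>\<^bsub>F.L\<^esub> star F.L (gen l))) UNIV y"
    using y by (simp add: F.finsum_L_apply Pi_def gen_apply star_gen_apply cut_apply drop_closed lower_closed)
qed (auto intro!: F.L.finsum_closed)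

definition vacuum :: "nat \<Rightarrow> 'n list \<Rightarrow> 'x \<Rightarrow>\<^sub>C complex" where
  "vacuum = (\<lambda>k w. if k = 0 \<and> w = [] then 1 else 0)"

lemma level_inner_vacuum: "level_inner vacuum x k = (if k = 0 then x 0 [] else 0)"
proof -
  have "conj_bcontfun 0 = (0 :: 'x \<Rightarrow>\<^sub>C complex)"
    by (rule bcontfun_eqI) (simp add: apply_conj)
  then show ?thesis
    by (simp add: level_inner_def vacuum_def)
qed

lemma vacuum_V [simp]: "vacuum \<in> vecs F"
proof -
  have "vacuum k \<in> tpv k" for k
    using tpv_zero[of k] by (cases k) (auto simp: vacuum_def simp del: tensor_power_vecs.simps(2))
  moreover have "summable (level_inner vacuum vacuum)"
    by (rule summable_finite[of "{0}"]) (simp_all add: level_inner_vacuum)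
  ultimately show ?thesis
    by (simp add: F_vecs_iff)
qed

lemma inner_vacuum: "vinner F vacuum x = x 0 []"
  unfolding F_ops using suminf_finite[of "{0}" "level_inner vacuum x"] by (simp add: level_inner_vacuum)

lemma vnorm_vacuum: "vnorm F vacuum = 1"
  by (simp add: vnorm_def inner_vacuum) (simp add: vacuum_def)

lemma star_gen_vacuum: "star F.L (gen l) vacuum = 0"
  by (simp add: star_gen_apply) (simp add: fun_eq_iff lower_def vacuum_def)

lemma vacuum_projection: "\<one>\<^bsub>F.L\<^esub> \<ominus>\<^bsub>F.L\<^esub> cut 1 = rank_one F vacuum vacuum"
proof (rule F.L_eqI)
  fix x assume x: "x \<in> vecs F"
  have "x k w - drop_levels 1 x k w = vacuum k w * x 0 []" for k w
  proof (cases "k = 0")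
    case True
    then show ?thesis
      using x tpv_support[of "x 0" 0 w] by (auto simp: drop_levels_def vacuum_def F_vecs_iff simp del: tensor_power_vecs.simps)
  qed (simp add: drop_levels_def vacuum_def)
  then show "(\<one>\<^bsub>F.L\<^esub> \<ominus>\<^bsub>F.L\<^esub> cut 1) x = rank_one F vacuum vacuum x"
    using x by (simp add: F.L_diff cut_apply inner_vacuum F_ops(3) fun_eq_iff)
qed (simp_all add: F.rk_L)

text \<open>Split \<open>1 - cut (n + 1)\<close> into \<open>1 - cut 1\<close>, the vacuum projection, and \<open>cut 1 - cut (n + 1)\<close>, the
  conjugate of \<open>1 - cut n\<close> by the generators. This recursion yields compactness, and it
  builds all rank-one operators from the vacuum projection.\<close>

lemma cut_compl_Suc:
  "\<one>\<^bsub>F.L\<^esub> \<ominus>\<^bsub>F.L\<^esub> cut (Suc n) = rank_one F vacuum vacuum \<oplus>\<^bsub>F.L\<^esub>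
    finsum F.L (\<lambda>l. gen l \<otimes>\<^bsub>F.L\<^esub> ((\<one>\<^bsub>F.L\<^esub> \<ominus>\<^bsub>F.L\<^esub> cut n) \<otimes>\<^bsub>F.L\<^esub> star F.L (gen l))) UNIV"
proof -
  let ?S = "\<lambda>T. finsum F.L (\<lambda>l. gen l \<otimes>\<^bsub>F.L\<^esub> (T \<otimes>\<^bsub>F.L\<^esub> star F.L (gen l))) UNIV"
  have "?S (\<one>\<^bsub>F.L\<^esub>) = ?S ((\<one>\<^bsub>F.L\<^esub> \<ominus>\<^bsub>F.L\<^esub> cut n) \<oplus>\<^bsub>F.L\<^esub> cut n)"
    by simp
  also have "\<dots> = ?S (\<one>\<^bsub>F.L\<^esub> \<ominus>\<^bsub>F.L\<^esub> cut n) \<oplus>\<^bsub>F.L\<^esub> ?S (cut n)"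
    by (simp only: F.L.l_distr F.L.r_distr F.L.minus_closed F.L.one_closed cut_L gen_L F.L.star_closed
        F.L.m_closed) (rule F.L.finsum_addf, auto)
  finally have "cut 1 = ?S (\<one>\<^bsub>F.L\<^esub> \<ominus>\<^bsub>F.L\<^esub> cut n) \<oplus>\<^bsub>F.L\<^esub> cut (Suc n)"
    using cut_Suc[of 0] by (simp add: cut_zero cut_Suc[of n])
  moreover have "?S (\<one>\<^bsub>F.L\<^esub> \<ominus>\<^bsub>F.L\<^esub> cut n) \<in> carrier F.L"
    by (auto intro!: F.L.finsum_closed)
  ultimately show ?thesis
    using F.L.minus_add_split[of "cut (Suc n)" "?S (\<one>\<^bsub>F.L\<^esub> \<ominus>\<^bsub>F.L\<^esub> cut n)"] vacuum_projection
    by (simp only: cut_L)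
qed

lemma cut_compl_compact: "\<one>\<^bsub>F.L\<^esub> \<ominus>\<^bsub>F.L\<^esub> cut n \<in> compact_ops F"
proof (induction n)
  case 0
  then show ?case
    using F.L.closed_subspaceD(2)[OF F.closed_subspace_K] by (simp add: cut_zero)
next
  case (Suc n)
  note add = F.L.closed_subspaceD(3)[OF F.closed_subspace_K]
  note KL = subsetD[OF F.K_subset]
  have fin: "finsum F.L f I \<in> compact_ops F" if "finite I" "\<And>l. l \<in> I \<Longrightarrow> f l \<in> compact_ops F" for f and I :: "'n set"
    using that
  proof (induction I rule: finite_induct)
    case empty
    then show ?case
      using F.L.closed_subspaceD(2)[OF F.closed_subspace_K] by simp
  next
    case (insert l I)
    then show ?case
      using KL by (auto simp: Pi_def intro: add)
  qed
  show ?case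
    unfolding cut_compl_Suc
    by (intro add F.rk_K vacuum_V fin F.K_left F.K_right Suc F.L.star_closed gen_L) simp
qed

lemma drop_tends_zero: assumes y: "y \<in> vecs F" shows "(\<lambda>n. vnorm F (drop_levels n y)) \<longlonglongrightarrow> 0"
proof -
  have sm: "summable (level_inner y y)"
    using y by (simp add: F_vecs_iff)
  have "vinner F (drop_levels n y) (drop_levels n y) = vinner F y y - (\<Sum>k<n. level_inner y y k)" for n
  proof -
    let ?d = "drop_levels n y"
    have "summable (level_inner ?d ?d)"
      using drop_closed[OF y] by (simp add: F_vecs_iff)
    then have "(\<Sum>k. level_inner ?d ?d k) = (\<Sum>k. level_inner ?d ?d (k + n)) + (\<Sum>k<n. level_inner ?d ?d k)"
      by (rule suminf_split_initial_segment)
    then have "(\<Sum>k. level_inner ?d ?d k) = (\<Sum>k. level_inner y y (k + n))"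
      by (simp add: level_inner_drop)
    moreover have "(\<Sum>k. level_inner y y k) = (\<Sum>k. level_inner y y (k + n)) + (\<Sum>k<n. level_inner y y k)"
      by (rule suminf_split_initial_segment[OF sm])
    ultimately show ?thesis
      by (simp add: F_ops)
  qed
  moreover have "(\<lambda>n. vinner F y y - (\<Sum>k<n. level_inner y y k)) \<longlonglongrightarrow> vinner F y y - vinner F y y"
    using summable_LIMSEQ[OF sm] by (intro tendsto_diff tendsto_const) (simp add: F_ops)
  ultimately have "(\<lambda>n. vinner F (drop_levels n y) (drop_levels n y)) \<longlonglongrightarrow> 0"
    by simp
  then have "(\<lambda>n. sqrt (norm (vinner F (drop_levels n y) (drop_levels n y)))) \<longlonglongrightarrow> sqrt 0"
    by (intro tendsto_real_sqrt tendsto_norm_zero)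
  then show ?thesis
    by (simp add: vnorm_def)
qed

text \<open>Clear for rank-one operators, as the tails of a vector tend to zero; and the property passes to
  limits because the truncations are contractions.\<close>

lemma compact_cut_null:
  assumes j: "j \<in> compact_ops F" shows "(\<lambda>n. nrm F.L (j \<otimes>\<^bsub>F.L\<^esub> cut n)) \<longlonglongrightarrow> 0"
proof -
  let ?S = "{j \<in> carrier F.L. (\<lambda>n. nrm F.L (j \<otimes>\<^bsub>F.L\<^esub> cut n)) \<longlonglongrightarrow> 0}"
  have "closed_subspace F.L ?S"
  proof (rule F.L.closed_subspaceI)
    show "a \<oplus>\<^bsub>F.L\<^esub> b \<in> ?S" if "a \<in> ?S" "b \<in> ?S" for a b
    proof -
      have "(\<lambda>n. nrm F.L ((a \<oplus>\<^bsub>F.L\<^esub> b) \<otimes>\<^bsub>F.L\<^esub> cut n)) \<longlonglongrightarrow> 0"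
      proof (rule real_tendsto_sandwich[of "\<lambda>_. 0"])
        show "(\<lambda>n. nrm F.L (a \<otimes>\<^bsub>F.L\<^esub> cut n) + nrm F.L (b \<otimes>\<^bsub>F.L\<^esub> cut n)) \<longlonglongrightarrow> 0"
          using that tendsto_add[of _ 0 sequentially _ 0] by auto
      qed (use that F.L.N_add in \<open>auto simp: F.L.l_distr intro!: always_eventually\<close>)
      then show ?thesis
        using that by auto
    qed
    show "z \<odot>\<^bsub>F.L\<^esub> a \<in> ?S" if "a \<in> ?S" for z a
      using that tendsto_mult[OF tendsto_const[of "norm z"], of "\<lambda>n. nrm F.L (a \<otimes>\<^bsub>F.L\<^esub> cut n)" 0]
      by (auto simp: F.L.smult_mult_left F.L.N_smult)
    show "a \<in> ?S" if s: "\<And>i. s i \<in> ?S" and lim: "seq_lim F.L (nrm F.L) s a" for s a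
    proof -
      have a: "a \<in> carrier F.L"
        by (rule F.L.seq_limD(2)[OF lim])
      have "(\<lambda>n. nrm F.L (a \<otimes>\<^bsub>F.L\<^esub> cut n)) \<longlonglongrightarrow> 0"
      proof (rule LIMSEQ_I)
        fix e :: real assume e: "0 < e"
        obtain i where i: "\<bar>nrm F.L (s i \<ominus>\<^bsub>F.L\<^esub> a)\<bar> < e / 2"
          using LIMSEQ_D[OF F.L.seq_limD(3)[OF lim], of "e / 2"] e by fastforce
        have sc: "s i \<in> carrier F.L" and "(\<lambda>n. nrm F.L (s i \<otimes>\<^bsub>F.L\<^esub> cut n)) \<longlonglongrightarrow> 0"
          using s by auto
        then obtain N where N: "\<And>n. n \<ge> N \<Longrightarrow> \<bar>nrm F.L (s i \<otimes>\<^bsub>F.L\<^esub> cut n)\<bar> < e / 2"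
          using LIMSEQ_D[of "\<lambda>n. nrm F.L (s i \<otimes>\<^bsub>F.L\<^esub> cut n)" 0 "e / 2"] e by fastforce
        have "norm (nrm F.L (a \<otimes>\<^bsub>F.L\<^esub> cut n) - 0) < e" if n: "n \<ge> N" for n
        proof -
          have "nrm F.L (a \<otimes>\<^bsub>F.L\<^esub> cut n) \<le>
              nrm F.L (a \<otimes>\<^bsub>F.L\<^esub> cut n \<ominus>\<^bsub>F.L\<^esub> s i \<otimes>\<^bsub>F.L\<^esub> cut n) + nrm F.L (s i \<otimes>\<^bsub>F.L\<^esub> cut n)"
            using a sc by (intro F.L.N_le_diff) auto
          also have "nrm F.L (a \<otimes>\<^bsub>F.L\<^esub> cut n \<ominus>\<^bsub>F.L\<^esub> s i \<otimes>\<^bsub>F.L\<^esub> cut n) \<le> nrm F.L (a \<ominus>\<^bsub>F.L\<^esub> s i) * nrm F.L (cut n)"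
            using F.L.N_diff_mult[of a "s i" "cut n" "cut n"] a sc by simp
          also have "\<dots> \<le> nrm F.L (a \<ominus>\<^bsub>F.L\<^esub> s i) * 1"
            using a sc nrm_cut_le by (intro mult_left_mono) auto
          finally show ?thesis
            using i N[OF n] F.L.N_diff_commute[of a "s i"] F.L.N_nonneg[of "a \<otimes>\<^bsub>F.L\<^esub> cut n"] a sc by simp
        qed
        then show "\<exists>no. \<forall>n\<ge>no. norm (nrm F.L (a \<otimes>\<^bsub>F.L\<^esub> cut n) - 0) < e"
          by blast
      qed
      then show ?thesis
        using a by simp
    qed
  qed auto
  moreover have "rank_one F x y \<in> ?S" if x: "x \<in> vecs F" and y: "y \<in> vecs F" for x y
  proof -
    have "(\<lambda>n. nrm F.L (rank_one F x y \<otimes>\<^bsub>F.L\<^esub> cut n)) \<longlonglongrightarrow> 0"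
    proof (rule real_tendsto_sandwich[of "\<lambda>_. 0"])
      show "(\<lambda>n. vnorm F x * vnorm F (drop_levels n y)) \<longlonglongrightarrow> 0"
        using tendsto_mult[OF tendsto_const drop_tends_zero[OF y], of "vnorm F x"] by simp
    qed (use x y F.nrm_rk_le[OF x drop_closed[OF y]] in
        \<open>auto simp: F.rk_L F.rk_mult_L star_cut cut_apply drop_closed intro!: always_eventually\<close>)
    then show ?thesis
      using x y by (simp add: F.rk_L)
  qed
  ultimately have "j \<in> ?S"
    by (rule F.K_least[OF _ _ j])
  then show ?thesis
    by simp
qed

end

section \<open>The Toeplitz and the Pimsner algebra\<close>

text \<open>The limits of sequences in a *-subalgebra form a closed *-subalgebra.\<close>

lemma (in cstar_algebra) closure_subalgebra:
  assumes D: "D \<subseteq> carrier B" and zero: "\<zero> \<in> D"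
    and add: "\<And>a b. a \<in> D \<Longrightarrow> b \<in> D \<Longrightarrow> a \<oplus> b \<in> D" and smult: "\<And>z a. a \<in> D \<Longrightarrow> z \<odot> a \<in> D"
    and mult: "\<And>a b. a \<in> D \<Longrightarrow> b \<in> D \<Longrightarrow> a \<otimes> b \<in> D" and star: "\<And>a. a \<in> D \<Longrightarrow> star B a \<in> D"
    and GD: "G \<subseteq> D" and a: "a \<in> generated_cstar B G" and e: "0 < e"
  shows "\<exists>d\<in>D. nrm B (d \<ominus> a) < e"
proof -
  define C where "C = {a. \<exists>s. (\<forall>i. s i \<in> D) \<and> seq_lim B (nrm B) s a}"
  have CI: "a \<in> C" if "\<And>i. s i \<in> D" "seq_lim B (nrm B) s a" for s a
    using that by (auto simp: C_def)
  have CE: "\<exists>s. (\<forall>i. s i \<in> D) \<and> seq_lim B (nrm B) s a" if "a \<in> C" for a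
    using that by (simp add: C_def)
  have approx: "\<exists>d\<in>D. nrm B (d \<ominus> a) < e" if a: "a \<in> C" and e: "0 < e" for a e
  proof -
    obtain s where s: "\<And>i. s i \<in> D" "seq_lim B (nrm B) s a"
      using CE[OF a] by blast
    obtain i where "\<bar>nrm B (s i \<ominus> a)\<bar> < e"
      using LIMSEQ_D[OF seq_limD(3)[OF s(2)] e] by fastforce
    then show ?thesis
      using s(1)[of i] by (intro bexI[of _ "s i"]) auto
  qed
  have DC: "D \<subseteq> C"
    using CI[OF _ seq_lim_const] D by blast
  have "closed_subspace B C"
  proof (rule closed_subspaceI)
    show "C \<subseteq> carrier B"
      using CE seq_limD(2) by blast
    show "\<zero> \<in> C"
      using zero DC by blast
    show "a \<oplus> b \<in> C" if ab: "a \<in> C" "b \<in> C" for a b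
    proof -
      obtain s t where "\<forall>i. s i \<in> D" "seq_lim B (nrm B) s a" "\<forall>i. t i \<in> D" "seq_lim B (nrm B) t b"
        using CE ab by metis
      then show ?thesis
        using add by (intro CI[OF _ seq_lim_add]) auto
    qed
    show "z \<odot> a \<in> C" if az: "a \<in> C" for z a
    proof -
      obtain s where "\<forall>i. s i \<in> D" "seq_lim B (nrm B) s a"
        using CE az by metis
      then show ?thesis
        using smult by (intro CI[OF _ seq_lim_smult]) auto
    qed
    show "a \<in> C" if s: "\<And>i. s i \<in> C" and lim: "seq_lim B (nrm B) s a" for s a
    proof -
      have ac: "a \<in> carrier B" and sc: "\<And>i. s i \<in> carrier B"
        using seq_limD[OF lim] by blast+
      have "\<exists>d. d \<in> D \<and> d \<in> carrier B \<and> nrm B (d \<ominus> a) < e" if e: "0 < e" for e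
      proof -
        obtain i where i: "\<bar>nrm B (s i \<ominus> a)\<bar> < e / 2"
          using LIMSEQ_D[OF seq_limD(3)[OF lim], of "e / 2"] e by fastforce
        obtain d where d: "d \<in> D" "nrm B (d \<ominus> s i) < e / 2"
          using approx[OF s, of "e / 2" i] e by auto
        have "nrm B (d \<ominus> a) < e"
          using N_diff_triangle[of d "s i" a] d i D ac sc by force
        then show ?thesis
          using d D by blast
      qed
      then obtain t where "\<And>i. t i \<in> D" "seq_lim B (nrm B) t a"
        using seq_lim_approx[of "\<lambda>d. d \<in> D" a] ac by blast
      then show ?thesis
        by (rule CI)
    qed
  qed
  then have "generated_cstar B G \<subseteq> C"
  proof (rule generated_cstar_least)
    show "a \<otimes> b \<in> C" if ab: "a \<in> C" "b \<in> C" for a b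
    proof -
      obtain s t where "\<forall>i. s i \<in> D" "seq_lim B (nrm B) s a" "\<forall>i. t i \<in> D" "seq_lim B (nrm B) t b"
        using CE ab by metis
      then show ?thesis
        using mult by (intro CI[OF _ seq_lim_mult]) auto
    qed
    show "star B a \<in> C" if ab: "a \<in> C" for a
    proof -
      obtain s where "\<forall>i. s i \<in> D" "seq_lim B (nrm B) s a"
        using CE ab by metis
      then show ?thesis
        using star by (intro CI[OF _ seq_lim_star]) auto
    qed
  qed (use GD DC in blast)
  then show ?thesis
    using approx a e by blast
qed

lemma toeplitz_rep_hom:
  assumes "toeplitz_rep A c g E" "involutive_algebra B" and h: "involutive_hom A B h"
  shows "toeplitz_rep B (\<lambda>f. h (c f)) (\<lambda>l. h (g l)) E"
proof -
  interpret A: toeplitz_rep A c g E by fact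
  note h = involutive_homD[OF h]
  show ?thesis
  proof (intro toeplitz_rep.intro coef_rep.intro coef_rep_axioms.intro toeplitz_rep_axioms.intro assms(2))
    fix f k z l m
    show "h (c f) \<in> carrier B" "h (g l) \<in> carrier B"
      by (rule h(1), simp)+
    show "h (c (f + k)) = h (c f) \<oplus>\<^bsub>B\<^esub> h (c k)"
      by (simp add: A.c_add h(4))
    show "h (c (f * k)) = h (c f) \<otimes>\<^bsub>B\<^esub> h (c k)"
      by (simp add: A.c_mult h(5))
    show "h (c 1) = \<one>\<^bsub>B\<^esub>"
      by (simp add: A.c_one involutive_hom_one[OF assms(3)])
    show "h (c (const_bcontfun z * f)) = z \<odot>\<^bsub>B\<^esub> h (c f)"
      unfolding A.c_scale by (rule h(2)) simp
    show "h (c (conj_bcontfun f)) = star B (h (c f))"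
      by (simp add: A.c_conj h(3))
    show "h (c f) \<otimes>\<^bsub>B\<^esub> h (g l) = h (g l) \<otimes>\<^bsub>B\<^esub> h (c f)"
      using A.g_comm[of f l] by (simp add: h(5)[symmetric])
    show "star B (h (g l)) \<otimes>\<^bsub>B\<^esub> h (g m) = h (c (E $ l $ m))"
      by (simp add: h(3)[symmetric] h(5)[symmetric] A.g_inner)
  qed
qed

locale full_bundle = projection_bundle E for E :: "('x::topological_space \<Rightarrow>\<^sub>C complex)^'n^'n" +
  assumes compact_base: "compact (UNIV :: 'x set)"
    and nonzero_fibres: "\<exists>l m. apply_bcontfun (E $ l $ m) t \<noteq> 0"
begin

lemma E_diag_apply: "apply_bcontfun (E $ l $ l) t = of_real (\<Sum>m\<in>UNIV. (norm (apply_bcontfun (E $ l $ m) t))\<^sup>2)"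
proof -
  have "apply_bcontfun (E $ l $ l) t = (\<Sum>m\<in>UNIV. apply_bcontfun (E $ l $ m) t * cnj (apply_bcontfun (E $ l $ m) t))"
    by (subst E_sum[symmetric]) (simp add: apply_bcontfun_sum apply_times apply_conj[symmetric] E_conj)
  then show ?thesis
    by (simp only: complex_norm_square[symmetric] of_real_sum)
qed

lemma E_diag_nonneg: "0 \<le> Re (apply_bcontfun (E $ l $ l) t)"
  by (simp add: E_diag_apply sum_nonneg)

lemma E_diag_nonzero: "\<exists>l. apply_bcontfun (E $ l $ l) t \<noteq> 0"
proof -
  obtain l m where lm: "apply_bcontfun (E $ l $ m) t \<noteq> 0"
    using nonzero_fibres by blast
  have "(norm (apply_bcontfun (E $ l $ m) t))\<^sup>2 \<le> (\<Sum>m\<in>UNIV. (norm (apply_bcontfun (E $ l $ m) t))\<^sup>2)"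
    by (rule member_le_sum) auto
  moreover have "0 < (norm (apply_bcontfun (E $ l $ m) t))\<^sup>2"
    using lm by simp
  ultimately have "0 < (\<Sum>m\<in>UNIV. (norm (apply_bcontfun (E $ l $ m) t))\<^sup>2)"
    by linarith
  then show ?thesis
    unfolding E_diag_apply by (metis less_irrefl of_real_eq_0_iff)
qed

text \<open>The trace of \<open>E\<close> is the rank of the bundle. It vanishes nowhere, so it is invertible over
  the compact base.\<close>

lemma trace_inverse: obtains h where "(\<Sum>l\<in>UNIV. E $ l $ l) * h = 1"
proof -
  let ?tr = "\<Sum>l\<in>UNIV. E $ l $ l"
  have tr: "apply_bcontfun ?tr t \<noteq> 0" for t
  proof
    assume "apply_bcontfun ?tr t = 0"
    then have "(\<Sum>l\<in>UNIV. Re (apply_bcontfun (E $ l $ l) t)) = 0"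
      by (simp add: apply_bcontfun_sum flip: Re_sum)
    then have "\<forall>l. Re (apply_bcontfun (E $ l $ l) t) = 0"
      using E_diag_nonneg by (subst (asm) sum_nonneg_eq_0_iff) auto
    then show False
      using E_diag_nonzero[of t] by (auto simp: E_diag_apply)
  qed
  define h where "h = Bcontfun (\<lambda>t. 1 / apply_bcontfun ?tr t)"
  have cont: "continuous_on UNIV (\<lambda>t. 1 / apply_bcontfun ?tr t)"
    using tr by (intro continuous_intros) auto
  then have "bounded (range (\<lambda>t. 1 / apply_bcontfun ?tr t))"
    using compact_base by (intro compact_imp_bounded compact_continuous_image)
  then have "(\<lambda>t. 1 / apply_bcontfun ?tr t) \<in> bcontfun"
    using cont by (simp add: bcontfun_def)
  then have "apply_bcontfun h t = 1 / apply_bcontfun ?tr t" for t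
    by (simp add: h_def Bcontfun_inverse)
  then have "?tr * h = 1"
    using tr by (intro bcontfun_eqI) (simp add: apply_times apply_one)
  then show thesis
    using that by blast
qed

abbreviation G :: "((nat \<Rightarrow> 'n list \<Rightarrow> 'x \<Rightarrow>\<^sub>C complex) \<Rightarrow> nat \<Rightarrow> 'n list \<Rightarrow> 'x \<Rightarrow>\<^sub>C complex) set" where
  "G \<equiv> generated_cstar F.L (creation E ` sections)"

abbreviation T :: "((nat \<Rightarrow> 'n list \<Rightarrow> 'x \<Rightarrow>\<^sub>C complex) \<Rightarrow> nat \<Rightarrow> 'n list \<Rightarrow> 'x \<Rightarrow>\<^sub>C complex) normed_star_algebra" where
  "T \<equiv> toeplitz_algebra E"

lemma T_eq: "T = F.L\<lparr>carrier := G\<rparr>"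
  by (simp add: toeplitz_algebra_def)

lemma creations_subset: "creation E ` sections \<subseteq> carrier F.L"
  using creation_L(1) by blast

lemmas G_closed_subspace = F.L.generated_cstar(1)[OF creations_subset]
lemmas G_mult = F.L.generated_cstar(3)[OF creations_subset]
lemmas G_star = F.L.generated_cstar(4)[OF creations_subset]
lemmas G_subset = F.L.closed_subspaceD(1)[OF G_closed_subspace]
lemmas G_zero = F.L.closed_subspaceD(2)[OF G_closed_subspace]
lemmas G_add = F.L.closed_subspaceD(3)[OF G_closed_subspace]
lemmas G_smult = F.L.closed_subspaceD(4)[OF G_closed_subspace]
lemmas G_lim = F.L.closed_subspaceD(5)[OF G_closed_subspace]

lemma creation_G: "v \<in> sections \<Longrightarrow> creation E v \<in> G"
  using F.L.generated_cstar(2)[OF creations_subset] by blast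

lemma gen_G: "gen l \<in> G"
  by (simp add: gen_def creation_G column_section)

lemma G_L: "a \<in> G \<Longrightarrow> a \<in> carrier F.L"
  using G_subset by blast

lemma G_diff: "a \<in> G \<Longrightarrow> b \<in> G \<Longrightarrow> a \<ominus>\<^bsub>F.L\<^esub> b \<in> G"
  using G_L by (simp add: F.L.diff_eq_smult G_add G_smult)

lemma G_finsum: "finite I \<Longrightarrow> (\<And>i. i \<in> I \<Longrightarrow> f i \<in> G) \<Longrightarrow> finsum F.L f I \<in> G"
proof (induction I rule: finite_induct)
  case empty
  show ?case
    using G_zero by simp
next
  case (insert i I)
  then have "finsum F.L f (insert i I) = f i \<oplus>\<^bsub>F.L\<^esub> finsum F.L f I"
    by (intro F.L.finsum_insert) (auto intro: G_L)
  then show ?case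
    using insert by (simp add: G_add)
qed

text \<open>If \<open>h\<close> is an inverse of the trace, then \<open>f = \<Sum> E\<^sub>l\<^sub>l h f\<close>, and \<open>E\<^sub>l\<^sub>l = \<psi>\<^sub>l\<^sup>* \<psi>\<^sub>l\<close>.\<close>

lemma scalar_G: "F.scalar f \<in> G"
proof -
  obtain h where h: "(\<Sum>l\<in>UNIV. E $ l $ l) * h = 1"
    by (rule trace_inverse)
  have "F.scalar f = F.scalar (\<Sum>l\<in>UNIV. E $ l $ l * (h * f))"
    by (simp add: sum_distrib_right[symmetric] mult.assoc[symmetric] h)
  also have "\<dots> = finsum F.L (\<lambda>l. F.scalar (E $ l $ l * (h * f))) UNIV"
    by (rule fock.c_sum) simp
  also have "(\<lambda>l. F.scalar (E $ l $ l * (h * f))) = (\<lambda>l. star F.L (gen l) \<otimes>\<^bsub>F.L\<^esub> (gen l \<otimes>\<^bsub>F.L\<^esub> F.scalar (h * f)))"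
    by (simp add: fock.g_inner_left fock.c_mult F.scalar_L)
  also have "finsum F.L \<dots> UNIV \<in> G"
  proof (rule G_finsum)
    fix l
    have "gen l \<otimes>\<^bsub>F.L\<^esub> F.scalar (h * f) \<in> G"
      unfolding gen_def creation_act(2)[OF column_section, symmetric]
      by (rule creation_G[OF creation_act(1)[OF column_section]])
    then show "star F.L (gen l) \<otimes>\<^bsub>F.L\<^esub> (gen l \<otimes>\<^bsub>F.L\<^esub> F.scalar (h * f)) \<in> G"
      by (rule G_mult[OF G_star[OF gen_G]])
  qed simp
  finally show ?thesis .
qed

lemma one_G: "\<one>\<^bsub>F.L\<^esub> \<in> G"
  using scalar_G[of 1] by (simp add: fock.c_one)

lemma cstar_algebra_T: "cstar_algebra T"
  and T_diff: "a \<in> G \<Longrightarrow> b \<in> G \<Longrightarrow> a \<ominus>\<^bsub>T\<^esub> b = a \<ominus>\<^bsub>F.L\<^esub> b"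
  unfolding T_eq
  using cstar_subalgebra[OF F.cstar_algebra_L G_closed_subspace G_mult G_star one_G] by blast+

sublocale T: cstar_algebra T
  by (rule cstar_algebra_T)

lemma T_simps [simp]: "carrier T = G" "(\<otimes>\<^bsub>T\<^esub>) = (\<otimes>\<^bsub>F.L\<^esub>)" "(\<oplus>\<^bsub>T\<^esub>) = (\<oplus>\<^bsub>F.L\<^esub>)" "\<one>\<^bsub>T\<^esub> = \<one>\<^bsub>F.L\<^esub>"
  "\<zero>\<^bsub>T\<^esub> = \<zero>\<^bsub>F.L\<^esub>" "star T = star F.L" "(\<odot>\<^bsub>T\<^esub>) = (\<odot>\<^bsub>F.L\<^esub>)" "nrm T = nrm F.L"
  by (simp_all add: T_eq)

lemma toeplitz_rep_T: "toeplitz_rep T F.scalar gen E"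
proof (intro toeplitz_rep.intro coef_rep.intro coef_rep_axioms.intro toeplitz_rep_axioms.intro
    T.involutive_algebra_axioms)
  show "F.scalar (const_bcontfun z * f) = z \<odot>\<^bsub>T\<^esub> F.scalar f" for z f
    unfolding fock.c_scale by simp
qed (simp_all add: scalar_G gen_G fock.c_add fock.c_mult fock.c_one fock.c_conj fock.g_comm fock.g_inner)

abbreviation ev :: "('x \<Rightarrow>\<^sub>C complex, 'n) star_poly \<Rightarrow> _" where "ev \<equiv> star_eval T F.scalar gen"

lemma ev_G: "ev a \<in> G"
  using coef_rep.star_eval_closed[OF toeplitz_rep.axioms(1)[OF toeplitz_rep_T], of gen a] gen_G by auto

lemma ev_dense: assumes b: "b \<in> G" and e: "0 < e" shows "\<exists>a. nrm F.L (ev a \<ominus>\<^bsub>F.L\<^esub> b) < e"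
proof -
  have "\<exists>d\<in>range ev. nrm F.L (d \<ominus>\<^bsub>F.L\<^esub> b) < e"
  proof (rule F.L.closure_subalgebra[OF _ _ _ _ _ _ _ b e])
    show "range ev \<subseteq> carrier F.L"
      using ev_G G_L by blast
    show "\<zero>\<^bsub>F.L\<^esub> \<in> range ev"
      using range_eqI[of _ ev "Coef 0"] by (simp add: fock.c_zero)
    show "x \<oplus>\<^bsub>F.L\<^esub> y \<in> range ev" if xy: "x \<in> range ev" "y \<in> range ev" for x y
    proof -
      obtain a b where "x = ev a" "y = ev b"
        using xy by blast
      then have "x \<oplus>\<^bsub>F.L\<^esub> y = ev (Plus a b)"
        by simp
      then show ?thesis
        by blast
    qed
    show "x \<otimes>\<^bsub>F.L\<^esub> y \<in> range ev" if xy: "x \<in> range ev" "y \<in> range ev" for x y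
    proof -
      obtain a b where "x = ev a" "y = ev b"
        using xy by blast
      then have "x \<otimes>\<^bsub>F.L\<^esub> y = ev (Times a b)"
        by simp
      then show ?thesis
        by blast
    qed
    show "z \<odot>\<^bsub>F.L\<^esub> x \<in> range ev" if x: "x \<in> range ev" for z x
    proof -
      obtain a where "x = ev a"
        using x by blast
      then have "z \<odot>\<^bsub>F.L\<^esub> x = ev (Scale z a)"
        by simp
      then show ?thesis
        by blast
    qed
    show "star F.L x \<in> range ev" if x: "x \<in> range ev" for x
    proof -
      obtain a where "x = ev a"
        using x by blast
      then have "star F.L x = ev (Adj a)"
        by simp
      then show ?thesis
        by blast
    qed
    show "creation E ` sections \<subseteq> range ev"
    proof
      fix x assume "x \<in> creation E ` sections"
      then obtain v where v: "v \<in> sections" "x = creation E v"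
        by blast
      have "finsum F.L (\<lambda>l. gen l \<otimes>\<^bsub>F.L\<^esub> F.scalar (v $ l)) I \<in> range ev" if "finite I" for I
        using that
      proof (induction I rule: finite_induct)
        case empty
        show ?case
          using range_eqI[of _ ev "Coef 0"] by (simp add: fock.c_zero)
      next
        case (insert l I)
        then obtain a where a: "finsum F.L (\<lambda>l. gen l \<otimes>\<^bsub>F.L\<^esub> F.scalar (v $ l)) I = ev a"
          by blast
        have "finsum F.L (\<lambda>l. gen l \<otimes>\<^bsub>F.L\<^esub> F.scalar (v $ l)) (insert l I) =
            ev (Plus (Times (Gen l) (Coef (v $ l))) a)"
          using insert.hyps by (simp add: a Pi_def F.scalar_L)
        then show ?case
          by blast
      qed
      then show "x \<in> range ev"
        using v creation_sum by simp
    qed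
  qed
  then show ?thesis
    by blast
qed

text \<open>The vacuum projection is \<open>1 - \<Sum> \<psi>\<^sub>l \<psi>\<^sub>l\<^sup>*\<close>. Applying generators to it builds \<open>rank_one F x vacuum\<close> for
  vectors \<open>x\<close> with finitely many levels, and approximation gives all \<open>x\<close>. Adjoints turn this into
  \<open>rank_one F vacuum y\<close> for all \<open>y\<close>, and the same construction, started there, gives all rank-one operators.\<close>

lemma compact_G: assumes j: "j \<in> compact_ops F" shows "j \<in> G"
proof -
  have "cut 1 = finsum F.L (\<lambda>l. gen l \<otimes>\<^bsub>F.L\<^esub> star F.L (gen l)) UNIV"
    using cut_Suc[of 0] by (simp add: cut_zero)
  moreover have "finsum F.L (\<lambda>l. gen l \<otimes>\<^bsub>F.L\<^esub> star F.L (gen l)) UNIV \<in> G"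
    by (rule G_finsum) (simp_all add: G_mult gen_G G_star)
  ultimately have rk00: "rank_one F vacuum vacuum \<in> G"
    unfolding vacuum_projection[symmetric] by (intro G_diff one_G) simp
  \<comment> \<open>The part of \<open>x\<close> in the levels below \<open>n\<close>.\<close>
  define keep where "keep = (\<lambda>n (x :: nat \<Rightarrow> 'n list \<Rightarrow> 'x \<Rightarrow>\<^sub>C complex). x - drop_levels n x)"
  have keep_V: "keep n x \<in> vecs F" if "x \<in> vecs F" for n x
    unfolding keep_def by (rule F.V_diff[OF that drop_closed[OF that]])
  have keep0: "keep 0 x = 0" for x
    by (simp add: keep_def drop_levels_def fun_eq_iff)
  have step: "rank_one F (keep n x) y \<in> G"
    if y: "y \<in> vecs F" and vac: "rank_one F vacuum y \<in> G" and x: "x \<in> vecs F" for n x y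
    using x
  proof (induction n arbitrary: x)
    case 0
    have "rank_one F (keep 0 x) y = \<zero>\<^bsub>F.L\<^esub>"
      by (rule F.L_eqI) (use y in \<open>auto simp: F.rk_L F.rk_apply drop_levels_def keep_def[symmetric] keep_V keep0\<close>)
    then show ?case
      using G_zero by (simp only:)
  next
    case (Suc n)
    let ?P = "\<lambda>n. \<one>\<^bsub>F.L\<^esub> \<ominus>\<^bsub>F.L\<^esub> cut n"
    have Pn: "?P n x = keep n x" if "x \<in> vecs F" for n x
      using that by (simp add: F.L_diff cut_apply keep_def)
    have rk: "?P n \<otimes>\<^bsub>F.L\<^esub> rank_one F x y = rank_one F (keep n x) y" if "x \<in> vecs F" for n x
      using that y by (simp add: F.L_mult_rk Pn)
    have "rank_one F (keep (Suc n) x) y = ?P (Suc n) \<otimes>\<^bsub>F.L\<^esub> rank_one F x y"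
      using Suc.prems by (simp add: rk)
    also have "\<dots> = rank_one F vacuum vacuum \<otimes>\<^bsub>F.L\<^esub> rank_one F x y \<oplus>\<^bsub>F.L\<^esub>
        finsum F.L (\<lambda>l. gen l \<otimes>\<^bsub>F.L\<^esub> (?P n \<otimes>\<^bsub>F.L\<^esub> (star F.L (gen l) \<otimes>\<^bsub>F.L\<^esub> rank_one F x y))) UNIV"
      unfolding cut_compl_Suc using Suc.prems y
      by (simp add: F.L.l_distr F.rk_L F.L.finsum_closed Pi_def F.L.finsum_ldistr F.L.m_assoc)
    also have "\<dots> \<in> G"
    proof (rule G_add)
      have "rank_one F vacuum vacuum \<otimes>\<^bsub>F.L\<^esub> rank_one F x y = F.scalar (vinner F vacuum x) \<otimes>\<^bsub>F.L\<^esub> rank_one F vacuum y"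
        using Suc.prems y by (simp add: F.L_mult_rk F.rk_L F.scalar_L)
      then show "rank_one F vacuum vacuum \<otimes>\<^bsub>F.L\<^esub> rank_one F x y \<in> G"
        using vac by (simp add: G_mult scalar_G)
      have "?P n \<otimes>\<^bsub>F.L\<^esub> (star F.L (gen l) \<otimes>\<^bsub>F.L\<^esub> rank_one F x y) \<in> G" for l
        using Suc.IH[of "star F.L (gen l) x"] Suc.prems y by (simp add: F.L_mult_rk Pn)
      then show "finsum F.L (\<lambda>l. gen l \<otimes>\<^bsub>F.L\<^esub> (?P n \<otimes>\<^bsub>F.L\<^esub> (star F.L (gen l) \<otimes>\<^bsub>F.L\<^esub> rank_one F x y))) UNIV \<in> G"
        by (intro G_finsum G_mult[OF gen_G]) simp
    qed
    finally show ?case .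
  qed
  have lim: "rank_one F x y \<in> G" if x: "x \<in> vecs F" and y: "y \<in> vecs F" and vac: "rank_one F vacuum y \<in> G" for x y
  proof (rule G_lim[OF step[OF y vac x] F.seq_lim_rk_left[OF _ x y]])
    show "keep n x \<in> vecs F" for n
      by (rule keep_V[OF x])
    have "keep n x - x = - drop_levels n x" for n
      by (simp add: keep_def fun_eq_iff)
    then have "vnorm F (keep n x - x) = vnorm F (drop_levels n x)" for n
      using F.nm_minus[OF drop_closed[OF x], of n] by simp
    then show "(\<lambda>n. vnorm F (keep n x - x)) \<longlonglongrightarrow> 0"
      using drop_tends_zero[OF x] by simp
  qed
  have "rank_one F vacuum y \<in> G" if y: "y \<in> vecs F" for y
    using G_star[OF lim[OF y vacuum_V rk00]] y by (simp add: F.rk_L)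
  then have "rank_one F x y \<in> G" if "x \<in> vecs F" "y \<in> vecs F" for x y
    using lim that by blast
  then show ?thesis
    by (rule F.K_least[OF G_closed_subspace _ j])
qed

lemma cstar_ideal_T: "cstar_ideal T (compact_ops F) cut"
proof (intro cstar_ideal.intro cstar_ideal_axioms.intro cstar_algebra_T)
  have cutG: "cut n \<in> G" for n
  proof -
    have "cut n = \<one>\<^bsub>F.L\<^esub> \<ominus>\<^bsub>F.L\<^esub> (\<one>\<^bsub>F.L\<^esub> \<ominus>\<^bsub>F.L\<^esub> cut n)"
      by (rule F.L_eqI) (simp_all add: F.L_diff)
    then show ?thesis
      using G_diff[OF one_G compact_G[OF cut_compl_compact]] by metis
  qed
  then show "cut n \<in> carrier T" for n
    by simp
  show "\<one>\<^bsub>T\<^esub> \<ominus>\<^bsub>T\<^esub> cut n \<in> compact_ops F" for n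
    using cut_compl_compact[of n] T_diff[OF one_G cutG] by simp
  show "a \<in> compact_ops F" if a: "a \<in> carrier T" and near: "\<And>e. 0 < e \<Longrightarrow> \<exists>j\<in>compact_ops F. nrm T (j \<ominus>\<^bsub>T\<^esub> a) < e" for a
  proof -
    have aG: "a \<in> G"
      using a by simp
    have "\<exists>j. j \<in> compact_ops F \<and> j \<in> carrier F.L \<and> nrm F.L (j \<ominus>\<^bsub>F.L\<^esub> a) < e" if "0 < e" for e
      using near[OF that] T_diff[OF compact_G aG] subsetD[OF F.K_subset] by auto
    then obtain s where "\<And>i. s i \<in> compact_ops F" "seq_lim F.L (nrm F.L) s a"
      using F.L.seq_lim_approx[of "\<lambda>j. j \<in> compact_ops F" a] G_L[OF aG] by blast
    then show ?thesis
      by (rule F.L.closed_subspaceD(5)[OF F.closed_subspace_K])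
  qed
qed (use F.L.closed_subspaceD(2,3)[OF F.closed_subspace_K] in
    \<open>simp_all add: compact_G subsetI F.K_left F.K_right F.K_star G_L star_cut nrm_cut_le compact_cut_null\<close>)

sublocale J: cstar_ideal T "compact_ops F" cut
  by (rule cstar_ideal_T)

abbreviation Pim :: "((nat \<Rightarrow> 'n list \<Rightarrow> 'x \<Rightarrow>\<^sub>C complex) \<Rightarrow> nat \<Rightarrow> 'n list \<Rightarrow> 'x \<Rightarrow>\<^sub>C complex) set normed_star_algebra" where
  "Pim \<equiv> pimsner_algebra E"

abbreviation coset where "coset a \<equiv> compact_ops F +>\<^bsub>T\<^esub> a"

lemma O_eq: "Pim = cstar_quotient T (compact_ops F)"
  by (simp add: pimsner_algebra_def)

sublocale Pim: cstar_algebra Pim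
  unfolding O_eq by (rule J.cstar_algebra_quot)

lemma coset_hom: "involutive_hom T Pim coset"
  unfolding O_eq by (rule J.involutive_hom_coset)

lemma O_carrier: "carrier Pim = coset ` G"
  unfolding O_eq J.quot_carrier by simp

lemma toeplitz_rep_O: "toeplitz_rep Pim (\<lambda>f. coset (F.scalar f)) (\<lambda>l. coset (gen l)) E"
  by (rule toeplitz_rep_hom[OF toeplitz_rep_T Pim.involutive_algebra_axioms coset_hom])

text \<open>The missing relation holds modulo compact operators, since \<open>1 - \<Sum> \<psi>\<^sub>l \<psi>\<^sub>l\<^sup>*\<close> is the vacuum projection.\<close>

lemma range_proj_O: "finsum Pim (\<lambda>l. coset (gen l) \<otimes>\<^bsub>Pim\<^esub> star Pim (coset (gen l))) UNIV = \<one>\<^bsub>Pim\<^esub>"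
proof -
  note h = involutive_homD[OF coset_hom]
  have c1: "cut 1 = finsum F.L (\<lambda>l. gen l \<otimes>\<^bsub>F.L\<^esub> star F.L (gen l)) UNIV"
    using cut_Suc[of 0] by (simp add: cut_zero)
  have fin: "finsum Pim (\<lambda>l. coset (f l)) I = coset (finsum F.L f I)" if "finite I" "\<And>l. f l \<in> G" for f and I :: "'n set"
    using that(1)
  proof (induction I rule: finite_induct)
    case empty
    then show ?case
      using involutive_hom_zero_diff(1)[OF T.involutive_algebra_axioms Pim.involutive_algebra_axioms coset_hom] by simp
  next
    case (insert l I)
    have "finsum F.L f I \<in> G"
      using insert that(2) by (intro G_finsum) auto
    then show ?case
      using insert that(2) h(4)[of "f l" "finsum F.L f I"] h(1) G_L by (simp add: Pi_def)
  qed
  have "coset (gen l) \<otimes>\<^bsub>Pim\<^esub> star Pim (coset (gen l)) = coset (gen l \<otimes>\<^bsub>F.L\<^esub> star F.L (gen l))" for l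
    using h(3)[of "gen l"] h(5)[of "gen l" "star F.L (gen l)"] gen_G G_star by simp
  then have "finsum Pim (\<lambda>l. coset (gen l) \<otimes>\<^bsub>Pim\<^esub> star Pim (coset (gen l))) UNIV = coset (cut 1)"
    unfolding c1 using fin[of UNIV "\<lambda>l. gen l \<otimes>\<^bsub>F.L\<^esub> star F.L (gen l)"] gen_G G_star G_mult by simp
  also have "\<dots> = coset \<one>\<^bsub>T\<^esub>"
    using J.coset_eq_iff[of "\<one>\<^bsub>T\<^esub>" "cut 1"] J.q_closed[of 1] J.q_compl[of 1] one_G by simp
  finally show ?thesis
    using involutive_hom_one[OF coset_hom] by simp
qed

subsection \<open>Norms of coefficients\<close>

lemma inner_le_nrm:
  assumes a: "a \<in> carrier F.L" and x: "x \<in> vecs F" "vnorm F x \<le> 1"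
  shows "norm (apply_bcontfun (vinner F x (a x)) t) \<le> nrm F.L a"
proof -
  have "norm (apply_bcontfun (vinner F x (a x)) t) \<le> vnorm F x * vnorm F (a x)"
    using a x by (intro F.inner_apply_le) auto
  also have "\<dots> \<le> 1 * nrm F.L a"
    using a x F.L_le_of_le_one[OF a x] by (intro mult_mono) auto
  finally show ?thesis
    by simp
qed

lemma nrm_scalar: "nrm F.L (F.scalar f) = norm f"
proof (rule antisym[OF F.nrm_scalar_le])
  have "vinner F vacuum (F.scalar f vacuum) = f"
    by (simp add: inner_vacuum F_ops(3)) (simp add: vacuum_def)
  then show "norm f \<le> nrm F.L (F.scalar f)"
    using inner_le_nrm[OF F.scalar_L(1)[of f] vacuum_V] vnorm_vacuum by (intro norm_bound) simp
qed

lemma tensor_power_nonzero: "\<exists>y\<in>tpv k. apply_bcontfun (\<Sum>w | length w = k. conj_bcontfun (y w) * y w) t \<noteq> 0"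
proof (induction k)
  case 0
  have "(\<lambda>w. if w = [] then 1 else 0) \<in> tpv 0"
    by simp
  then show ?case
    by (rule bexI[rotated]) (simp add: apply_times apply_conj apply_one)
next
  case (Suc k)
  then obtain y where y: "y \<in> tpv k" "apply_bcontfun (\<Sum>w | length w = k. conj_bcontfun (y w) * y w) t \<noteq> 0"
    by blast
  obtain l where l: "apply_bcontfun (E $ l $ l) t \<noteq> 0"
    using E_diag_nonzero by blast
  let ?z = "tensor (column l) y"
  have z: "?z \<in> tpv (Suc k)"
    unfolding tpv_Suc_iff using y(1) column_section[of l]
    by (simp add: tensor_def sections_iff mult.assoc[symmetric] sum_distrib_right[symmetric])
  have "(\<Sum>w | length w = Suc k. conj_bcontfun (?z w) * ?z w) =
      (\<Sum>u | length u = k. conj_bcontfun (y u) * y u * (\<Sum>i\<in>UNIV. E $ l $ i * E $ i $ l))"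
    unfolding sum_words_Suc
    by (simp add: tensor_def column_def conj_mult E_conj sum_distrib_left mult_ac)
  also have "\<dots> = (\<Sum>u | length u = k. conj_bcontfun (y u) * y u) * E $ l $ l"
    by (simp add: E_sum sum_distrib_right)
  finally have "apply_bcontfun (\<Sum>w | length w = Suc k. conj_bcontfun (?z w) * ?z w) t \<noteq> 0"
    using y l by (simp add: apply_times)
  then show ?case
    using z by blast
qed

text \<open>The fibres of all tensor powers are nonzero, so every point has, in every level, a vector of
  norm at most 1 which has length 1 over that point.\<close>

lemma unit_vector_at:
  obtains x where "x \<in> vecs F" "vnorm F x \<le> 1" "drop_levels k x = x" "apply_bcontfun (vinner F x x) t = 1"
proof -
  obtain y where y: "y \<in> tpv k" "apply_bcontfun (\<Sum>w | length w = k. conj_bcontfun (y w) * y w) t \<noteq> 0"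
    using tensor_power_nonzero by blast
  define z where "z = (\<lambda>j. if j = k then y else (\<lambda>w. 0))"
  define e where "e = (\<Sum>w | length w = k. conj_bcontfun (y w) * y w)"
  have conj0: "conj_bcontfun 0 = (0 :: 'x \<Rightarrow>\<^sub>C complex)"
    by (rule bcontfun_eqI) (simp add: apply_conj)
  have lz: "level_inner z z j = (if j = k then e else 0)" for j
    by (simp add: level_inner_def z_def e_def conj0)
  have "z j \<in> tpv j" for j
    using y(1) by (simp add: z_def)
  moreover have "summable (level_inner z z)"
    by (rule summable_finite[of "{k}"]) (simp_all add: lz)
  ultimately have z: "z \<in> vecs F"
    by (simp add: F_vecs_iff)
  have zz: "vinner F z z = e"
    unfolding F_ops using suminf_finite[of "{k}" "level_inner z z"] by (simp add: lz)
  define r where "r = (\<lambda>s. Re (apply_bcontfun e s))"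
  have er: "apply_bcontfun e s = of_real (r s)" for s
    using F.inner_self_real[OF z, of s] by (simp add: zz r_def)
  have r0: "0 < r t"
    using F.inner_pos[OF z, of t] y(2) er[of t] by (simp add: zz e_def[symmetric] r_def[symmetric] le_less)
  define h where "h = Bcontfun (\<lambda>s. complex_of_real (1 / sqrt (max (r s) (r t))))"
  have pos: "0 < max (r s) (r t)" for s
    using r0 by (simp add: less_max_iff_disj)
  have "(\<lambda>s. complex_of_real (1 / sqrt (max (r s) (r t)))) \<in> bcontfun"
  proof (rule bcontfun_normI[where b = "1 / sqrt (r t)"])
    have "continuous_on UNIV r"
      unfolding r_def by (intro continuous_intros continuous_on_apply_bcontfun)
    moreover have "sqrt (max (r s) (r t)) \<noteq> 0" for s
      using pos[of s] by simp
    ultimately show "continuous_on UNIV (\<lambda>s. complex_of_real (1 / sqrt (max (r s) (r t))))"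
      by (intro continuous_intros) auto
    show "norm (complex_of_real (1 / sqrt (max (r s) (r t)))) \<le> 1 / sqrt (r t)" for s
      using pos[of s] r0 by (auto simp: norm_divide intro!: divide_left_mono)
  qed
  then have hs: "apply_bcontfun h s = complex_of_real (1 / sqrt (max (r s) (r t)))" for s
    by (simp add: h_def Bcontfun_inverse)
  define x where "x = vact F z h"
  have x: "x \<in> vecs F"
    using z by (simp add: x_def)
  have xx: "apply_bcontfun (vinner F x x) s = of_real (r s / max (r s) (r t))" for s
  proof -
    have "vinner F x x = conj_bcontfun h * e * h"
      using z by (simp add: x_def F.inner_act_left F.inner_act_right zz)
    then have "apply_bcontfun (vinner F x x) s =
        of_real (1 / sqrt (max (r s) (r t)) * r s * (1 / sqrt (max (r s) (r t))))"
      by (simp only: apply_times apply_conj hs er complex_cnj_complex_of_real of_real_mult)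
    also have "1 / sqrt (max (r s) (r t)) * r s * (1 / sqrt (max (r s) (r t))) = r s / (sqrt (max (r s) (r t)) * sqrt (max (r s) (r t)))"
      by simp
    also have "sqrt (max (r s) (r t)) * sqrt (max (r s) (r t)) = max (r s) (r t)"
      using pos[of s] by simp
    finally show ?thesis .
  qed
  have "vnorm F x \<le> 1"
  proof (rule F.nm_leI[OF x])
    show "Re (apply_bcontfun (vinner F x x) s) \<le> 1\<^sup>2" for s
      using pos[of s] by (simp add: xx pos_divide_le_eq)
  qed simp
  moreover have "drop_levels k x = x"
    by (simp add: drop_levels_def x_def F_ops(3) z_def fun_eq_iff)
  moreover have "apply_bcontfun (vinner F x x) t = 1"
    using r0 by (simp add: xx)
  ultimately show thesis
    using that x by blast
qed

text \<open>The norm of the coset is a limit of norms on the levels from \<open>k\<close> on, and there every point carries a vector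
  on which \<open>f\<close> acts by its value.\<close>

lemma nrm_coset_scalar: "nrm Pim (coset (F.scalar f)) = norm f"
proof (rule antisym)
  have "nrm Pim (coset (F.scalar f)) \<le> nrm F.L (F.scalar f)"
    unfolding O_eq using J.quot_nrm_le[OF _ J.self_in_coset, of "F.scalar f"] scalar_G by simp
  then show "nrm Pim (coset (F.scalar f)) \<le> norm f"
    by (simp add: nrm_scalar)
  have lower: "norm f \<le> nrm F.L (F.scalar f \<otimes>\<^bsub>F.L\<^esub> cut k)" for k
  proof (rule norm_bound)
    fix t
    obtain x where x: "x \<in> vecs F" "vnorm F x \<le> 1" "drop_levels k x = x" "apply_bcontfun (vinner F x x) t = 1"
      by (rule unit_vector_at)
    have "vinner F x ((F.scalar f \<otimes>\<^bsub>F.L\<^esub> cut k) x) = vinner F x x * f"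
      using x by (simp add: cut_apply F.inner_act_right)
    then have "apply_bcontfun (vinner F x ((F.scalar f \<otimes>\<^bsub>F.L\<^esub> cut k) x)) t = apply_bcontfun f t"
      using x by (simp add: apply_times)
    then show "norm (apply_bcontfun f t) \<le> nrm F.L (F.scalar f \<otimes>\<^bsub>F.L\<^esub> cut k)"
      using inner_le_nrm[OF _ x(1,2), of "F.scalar f \<otimes>\<^bsub>F.L\<^esub> cut k" t] F.scalar_L by simp
  qed
  have "(\<lambda>k. nrm F.L (F.scalar f \<otimes>\<^bsub>F.L\<^esub> cut k)) \<longlonglongrightarrow> nrm Pim (coset (F.scalar f))"
    unfolding O_eq using J.quot_nrm_lim[of "F.scalar f"] scalar_G by simp
  then show "norm f \<le> nrm Pim (coset (F.scalar f))"
    by (rule LIMSEQ_le_const) (intro exI allI impI lower)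
qed

end

section \<open>Circle actions\<close>

context cstar_seminormed
begin

lemma ncls_closed [simp]: "s \<in> cauchy_seqs A N \<Longrightarrow> ncls s \<in> carrier (cstar_completion A N)"
  by (auto simp: completion_carrier)

lemma completion_cases:
  assumes "S \<in> carrier (cstar_completion A N)" obtains s where "s \<in> cauchy_seqs A N" "S = ncls s"
  using assms by (auto simp: completion_carrier)

lemma completion_const: "\<one>\<^bsub>cstar_completion A N\<^esub> = ncls (\<lambda>i. \<one>)" "\<zero>\<^bsub>cstar_completion A N\<^esub> = ncls (\<lambda>i. \<zero>)"
  by (simp_all add: cstar_completion_def)

lemma involutive_algebra_completion: "involutive_algebra (cstar_completion A N)"
proof -
  let ?C = "cstar_completion A N"
  note ops = completion_add completion_mult completion_smult completion_star completion_const
    cauchy_seqs_add cauchy_seqs_mult cauchy_seqs_smult cauchy_seqs_star cauchy_seqs_const cauchy_seqsD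
  show ?thesis
  proof (intro involutive_algebra.intro involutive_algebra_axioms.intro)
    show "ring ?C"
    proof (rule ringI)
      show "abelian_group ?C"
      proof (rule abelian_groupI)
        fix S assume "S \<in> carrier ?C"
        then obtain s where s: "s \<in> cauchy_seqs A N" "S = ncls s"
          by (rule completion_cases)
        have "(-1) \<odot> s i \<oplus> s i = \<zero>" for i
          using cauchy_seqsD[OF s(1), of i] l_neg[of "s i"] by (simp add: minus_eq_smult)
        then have "ncls (\<lambda>i. (-1) \<odot> s i) \<oplus>\<^bsub>?C\<^esub> S = \<zero>\<^bsub>?C\<^esub>"
          using s by (simp add: ops)
        then show "\<exists>T\<in>carrier ?C. T \<oplus>\<^bsub>?C\<^esub> S = \<zero>\<^bsub>?C\<^esub>"
          using s cauchy_seqs_smult by (intro bexI[of _ "ncls (\<lambda>i. (-1) \<odot> s i)"]) auto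
      qed (clarsimp elim!: completion_cases simp: ops a_ac)+
      show "Group.monoid ?C"
        by (rule monoidI) (clarsimp elim!: completion_cases simp: ops m_assoc)+
    qed (clarsimp elim!: completion_cases simp: ops l_distr r_distr)+
  qed (clarsimp elim!: completion_cases simp: ops smult_add_left smult_add_right smult_smult
      smult_mult_left smult_mult_right star_add star_smult star_mult)+
qed

lemma involutive_hom_to_completion: "involutive_hom A (cstar_completion A N) (to_completion A N)"
  by (auto simp: involutive_hom_def to_completion_eq completion_smult completion_star completion_add completion_mult
      completion_const cauchy_seqs_const intro!: ring_hom_memI)

lemma nrm_to_completion: "a \<in> carrier A \<Longrightarrow> nrm (cstar_completion A N) (to_completion A N a) = N a"
  by (simp add: to_completion_eq completion_nrm cauchy_seqs_const)

end

text \<open>The action of \<open>B\<close> is pulled back along the isomorphism. Stated because the definition of a circle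
  action asks for maps of the completion itself.\<close>

lemma circle_action_transport:
  assumes \<Phi>: "\<Phi> \<in> star_iso C B" and C: "involutive_algebra C" and B: "involutive_algebra B"
    and \<alpha>: "circle_action B \<alpha>"
  shows "circle_action C (\<lambda>z a. inv_into (carrier C) \<Phi> (\<alpha> z (\<Phi> a)))"
proof -
  interpret C: involutive_algebra C by fact
  interpret B: involutive_algebra B by fact
  let ?\<Psi> = "inv_into (carrier C) \<Phi>"
  define \<beta> where "\<beta> = (\<lambda>z a. ?\<Psi> (\<alpha> z (\<Phi> a)))"
  note iso = star_isoD[OF \<Phi>]
  have inj: "a = b" if "\<Phi> a = \<Phi> b" "a \<in> carrier C" "b \<in> carrier C" for a b
    using bij_betw_imp_inj_on[OF iso(1)] that by (auto dest: inj_onD)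
  have \<Psi>: "?\<Psi> b \<in> carrier C" "\<Phi> (?\<Psi> b) = b" if "b \<in> carrier B" for b
    using bij_betw_imp_surj_on[OF iso(1)] that by (auto intro: inv_into_into f_inv_into_f)
  have \<alpha>z: "\<alpha> z \<in> star_iso B B" if "z \<in> sphere 0 1" for z
    using \<alpha> that by (simp add: circle_action_def)
  have \<beta>: "\<beta> z a \<in> carrier C" "\<Phi> (\<beta> z a) = \<alpha> z (\<Phi> a)" if "z \<in> sphere 0 1" "a \<in> carrier C" for z a
    using \<Psi> star_isoD(3)[OF \<alpha>z[OF that(1)]] iso(3) that(2) by (auto simp: \<beta>_def)
  have diff: "\<Phi> (a \<ominus>\<^bsub>C\<^esub> b) = \<Phi> a \<ominus>\<^bsub>B\<^esub> \<Phi> b" if "a \<in> carrier C" "b \<in> carrier C" for a b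
    using that iso by (simp add: C.diff_eq_smult B.diff_eq_smult)
  have "circle_action C \<beta>"
    unfolding circle_action_def
  proof (intro conjI ballI)
    fix z :: complex assume z: "z \<in> sphere 0 1"
    note a = star_isoD[OF \<alpha>z[OF z]]
    show "\<beta> z \<in> star_iso C C"
    proof (rule star_isoI)
      have "bij_betw (?\<Psi> \<circ> (\<alpha> z \<circ> \<Phi>)) (carrier C) (carrier C)"
        by (intro bij_betw_trans[OF bij_betw_trans[OF iso(1) a(1)] bij_betw_inv_into[OF iso(1)]])
      then show "bij_betw (\<beta> z) (carrier C) (carrier C)"
        by (simp add: comp_def \<beta>_def)
      show "\<beta> z \<one>\<^bsub>C\<^esub> = \<one>\<^bsub>C\<^esub>"
        by (rule inj) (use \<beta>[OF z] iso a in simp_all)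
      show "\<beta> z (x \<otimes>\<^bsub>C\<^esub> y) = \<beta> z x \<otimes>\<^bsub>C\<^esub> \<beta> z y" "\<beta> z (x \<oplus>\<^bsub>C\<^esub> y) = \<beta> z x \<oplus>\<^bsub>C\<^esub> \<beta> z y"
        if "x \<in> carrier C" "y \<in> carrier C" for x y
        by (rule inj; use that \<beta>[OF z] iso a in simp)+
      show "\<beta> z (c \<odot>\<^bsub>C\<^esub> x) = c \<odot>\<^bsub>C\<^esub> \<beta> z x" if "x \<in> carrier C" for x c
        by (rule inj; use that \<beta>[OF z] iso a in simp)+
      show "\<beta> z (star C x) = star C (\<beta> z x)" if "x \<in> carrier C" for x
        by (rule inj; use that \<beta>[OF z] iso a in simp)+
      show "nrm C (\<beta> z x) = nrm C x" if "x \<in> carrier C" for x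
        using iso(8)[OF \<beta>(1)[OF z that]] \<beta>(2)[OF z that] a(8)[OF iso(3)[OF that]] iso(8)[OF that] by simp
    qed
    show "\<beta> (z * w) b = \<beta> z (\<beta> w b)" if w: "w \<in> sphere 0 1" and b: "b \<in> carrier C" for w b
    proof -
      have "\<alpha> (z * w) (\<Phi> b) = \<alpha> z (\<alpha> w (\<Phi> b))"
        using \<alpha> z w iso(3)[OF b] by (simp add: circle_action_def)
      then show ?thesis
        using \<beta>(2)[OF w b] by (simp add: \<beta>_def)
    qed
    show "((\<lambda>w. nrm C (\<beta> w b \<ominus>\<^bsub>C\<^esub> \<beta> z b)) \<longlongrightarrow> 0) (at z within sphere 0 1)" if b: "b \<in> carrier C" for b
    proof (rule tendsto_cong[THEN iffD2])
      show "((\<lambda>w. nrm B (\<alpha> w (\<Phi> b) \<ominus>\<^bsub>B\<^esub> \<alpha> z (\<Phi> b))) \<longlongrightarrow> 0) (at z within sphere 0 1)"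
        using \<alpha> z iso(3)[OF b] by (simp add: circle_action_def)
      have "nrm C (\<beta> w b \<ominus>\<^bsub>C\<^esub> \<beta> z b) = nrm B (\<alpha> w (\<Phi> b) \<ominus>\<^bsub>B\<^esub> \<alpha> z (\<Phi> b))" if w: "w \<in> sphere 0 1" for w
        using iso(8)[of "\<beta> w b \<ominus>\<^bsub>C\<^esub> \<beta> z b"] \<beta>[OF z b] \<beta>[OF w b] by (simp add: diff)
      then show "\<forall>\<^sub>F w in at z within sphere 0 1. nrm C (\<beta> w b \<ominus>\<^bsub>C\<^esub> \<beta> z b) = nrm B (\<alpha> w (\<Phi> b) \<ominus>\<^bsub>B\<^esub> \<alpha> z (\<Phi> b))"
        by (simp add: eventually_at_filter)
    qed
  qed
  then show ?thesis
    by (simp add: \<beta>_def)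
qed

subsection \<open>The gauge automorphisms in representations\<close>

lemma gauged_rep_presented:
  fixes E :: "('x::topological_space \<Rightarrow>\<^sub>C complex)^'n^'n"
  assumes R: "R = toeplitz_relations E \<or> R = pimsner_relations E" and E: "projection E"
  shows "gauged_rep (presented_algebra R) (\<lambda>f. star_class R (Coef f)) (\<lambda>l. star_class R (Gen l)) E (gauge R)"
proof (intro gauged_rep.intro gauged_rep_axioms.intro toeplitz_rep_presented E)
  show "toeplitz_relations E \<subseteq> R"
    using R by (auto simp: pimsner_relations_def)
  show "\<exists>a. x = star_eval (presented_algebra R) (\<lambda>f. star_class R (Coef f)) (\<lambda>l. star_class R (Gen l)) a"
    if x: "x \<in> carrier (presented_algebra R)" for x
    unfolding star_eval_presented by (rule presented_cases[OF x]) blast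
qed (rule gauge_presented[OF R]; assumption)+

text \<open>Both sides are *-homomorphisms of the presented algebra which agree on coefficients and generators.\<close>

lemma gauge_equivariant:
  fixes E :: "('x::topological_space \<Rightarrow>\<^sub>C complex)^'n^'n"
  assumes R: "R = toeplitz_relations E \<or> R = pimsner_relations E" and E: "projection E" and z: "norm z = 1"
    and h: "involutive_hom (presented_algebra R) B h" and \<beta>: "involutive_hom B B \<beta>"
    and B: "involutive_algebra B"
    and coef: "\<And>f. \<beta> (h (star_class R (Coef f))) = h (star_class R (Coef f))"
    and gen: "\<And>l. \<beta> (h (star_class R (Gen l))) = z \<odot>\<^bsub>B\<^esub> h (star_class R (Gen l))"
    and x: "x \<in> carrier (presented_algebra R)"
  shows "\<beta> (h x) = h (gauge R z x)"
proof -
  let ?A = "presented_algebra R" and ?c = "\<lambda>f. star_class R (Coef f)" and ?g = "\<lambda>l. star_class R (Gen l)"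
  interpret A: gauged_rep ?A ?c ?g E "gauge R"
    by (rule gauged_rep_presented[OF R E])
  note hD = involutive_homD[OF h]
  obtain a where a: "x = star_eval ?A ?c ?g a"
    using A.spanning[OF x] by blast
  have rB: "coef_rep B (\<lambda>f. h (?c f))"
    using toeplitz_rep_hom[OF A.toeplitz_rep_axioms B h] by (rule toeplitz_rep.axioms(1))
  have "\<beta> (h x) = \<beta> (star_eval B (\<lambda>f. h (?c f)) (\<lambda>l. h (?g l)) a)"
    unfolding a by (subst star_eval_hom(2)[OF A.coef_rep_axioms h]) auto
  also have "\<dots> = star_eval B (\<lambda>f. h (?c f)) (\<lambda>l. z \<odot>\<^bsub>B\<^esub> h (?g l)) a"
  proof -
    have "range (\<lambda>l. h (?g l)) \<subseteq> carrier B"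
      using hD(1)[OF A.g_closed] by blast
    from star_eval_hom(2)[OF rB \<beta> this] show ?thesis
      by (simp only: coef gen)
  qed
  also have "\<dots> = h (star_eval ?A ?c (\<lambda>l. z \<odot>\<^bsub>?A\<^esub> ?g l) a)"
  proof -
    have "range (\<lambda>l. z \<odot>\<^bsub>?A\<^esub> ?g l) \<subseteq> carrier ?A"
      using A.smult_closed[OF A.g_closed] by blast
    from star_eval_hom(2)[OF A.coef_rep_axioms h this] show ?thesis
      by (simp only: hD(2)[OF A.g_closed])
  qed
  also have "star_eval ?A ?c (\<lambda>l. z \<odot>\<^bsub>?A\<^esub> ?g l) a = gauge R z x"
  proof -
    have "range ?g \<subseteq> carrier ?A"
      by auto
    from star_eval_hom(2)[OF A.coef_rep_axioms A.gam_hom[OF z] this] show ?thesis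
      by (simp only: a A.gam_c[OF z] A.gam_g[OF z])
  qed
  finally show ?thesis .
qed

subsection \<open>The gauge action on the Fock module\<close>

context projection_bundle
begin

definition rot :: "complex \<Rightarrow> (nat \<Rightarrow> 'n list \<Rightarrow> 'x \<Rightarrow>\<^sub>C complex) \<Rightarrow> nat \<Rightarrow> 'n list \<Rightarrow> 'x \<Rightarrow>\<^sub>C complex"
  where "rot z x = (\<lambda>k w. const_bcontfun (z ^ k) * x k w)"

definition rotation where "rotation z = (\<lambda>x\<in>vecs F. rot z x)"

lemma level_inner_rot:
  "level_inner (rot z x) y k = const_bcontfun (cnj z ^ k) * level_inner x y k"
  "level_inner x (rot z y) k = const_bcontfun (z ^ k) * level_inner x y k"
  by (simp_all add: level_inner_def rot_def conj_mult conj_const sum_distrib_left mult_ac)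

lemma rot_rot: "rot z (rot w x) = rot (z * w) x"
  by (simp add: rot_def fun_eq_iff power_mult_distrib const_bcontfun_simps(2) mult.assoc)

lemma rot_one: "rot 1 x = x"
  by (simp add: rot_def const_bcontfun_simps(1))

lemma unit_circle: "norm z = 1 \<Longrightarrow> z * cnj z = 1" "norm z = 1 \<Longrightarrow> cnj z * z = 1"
  using complex_norm_square[of z] by (simp_all add: mult.commute)

lemma rot_closed:
  assumes z: "norm z = 1" and x: "x \<in> vecs F" shows "rot z x \<in> vecs F"
proof -
  have "level_inner (rot z x) (rot z x) k = level_inner x x k" for k
  proof -
    have "const_bcontfun (cnj z ^ k) * const_bcontfun (z ^ k) = (1 :: 'x \<Rightarrow>\<^sub>C complex)"
      "const_bcontfun (z ^ k) * const_bcontfun (cnj z ^ k) = (1 :: 'x \<Rightarrow>\<^sub>C complex)"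
      using unit_circle[OF z] by (simp_all add: const_bcontfun_simps(1) flip: const_bcontfun_simps(2) power_mult_distrib)
    then show ?thesis
      by (simp add: level_inner_rot mult.assoc[symmetric])
  qed
  then have "level_inner (rot z x) (rot z x) = level_inner x x"
    by (rule ext)
  then show ?thesis
    using x by (simp add: F_vecs_iff) (simp add: rot_def)
qed

lemma rotation_apply: "x \<in> vecs F \<Longrightarrow> rotation z x = rot z x"
  by (simp add: rotation_def)

lemma rotation_L:
  assumes "norm z = 1"
  shows "rotation z \<in> carrier F.L" "star F.L (rotation z) = rotation (cnj z)"
  unfolding rotation_def
  by (rule F.L_I[of "rot z" "rot (cnj z)"]; use assms in \<open>simp add: rot_closed F_ops level_inner_rot\<close>)+

lemma rotation_mult:
  assumes "norm z = 1" "norm w = 1"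
  shows "rotation z \<otimes>\<^bsub>F.L\<^esub> rotation w = rotation (z * w)"
  by (rule F.L_eqI) (use assms in \<open>auto simp: rotation_L norm_mult rotation_apply rot_closed rot_rot\<close>)

lemma rotation_one: "rotation 1 = \<one>\<^bsub>F.L\<^esub>"
  by (rule F.L_eqI) (auto simp: rotation_L rotation_apply rot_one)

text \<open>Conjugation with the unitary that multiplies level \<open>k\<close> by \<open>z\<^sup>k\<close>. A creation operator raises the level
  by one, and so it is multiplied by \<open>z\<close>.\<close>

definition Ad where "Ad z a = rotation z \<otimes>\<^bsub>F.L\<^esub> (a \<otimes>\<^bsub>F.L\<^esub> rotation (cnj z))"

lemma Ad_closed [simp]: "norm z = 1 \<Longrightarrow> a \<in> carrier F.L \<Longrightarrow> Ad z a \<in> carrier F.L"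
  by (simp add: Ad_def rotation_L)

lemma Ad_Ad:
  assumes z: "norm z = 1" and w: "norm w = 1" and a: "a \<in> carrier F.L"
  shows "Ad z (Ad w a) = Ad (z * w) a"
proof -
  have "Ad z (Ad w a) = (rotation z \<otimes>\<^bsub>F.L\<^esub> rotation w) \<otimes>\<^bsub>F.L\<^esub> (a \<otimes>\<^bsub>F.L\<^esub> (rotation (cnj w) \<otimes>\<^bsub>F.L\<^esub> rotation (cnj z)))"
    using z w a by (simp add: Ad_def rotation_L F.L.m_assoc)
  then show ?thesis
    using z w by (simp add: rotation_mult Ad_def mult.commute)
qed

lemma Ad_one: "a \<in> carrier F.L \<Longrightarrow> Ad 1 a = a"
  by (simp add: Ad_def rotation_one)

lemma rotation_cancel:
  assumes z: "norm z = 1" and a: "a \<in> carrier F.L"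
  shows "rotation (cnj z) \<otimes>\<^bsub>F.L\<^esub> (rotation z \<otimes>\<^bsub>F.L\<^esub> a) = a" "rotation z \<otimes>\<^bsub>F.L\<^esub> rotation (cnj z) = \<one>\<^bsub>F.L\<^esub>"
proof -
  have "rotation (cnj z) \<otimes>\<^bsub>F.L\<^esub> (rotation z \<otimes>\<^bsub>F.L\<^esub> a) = (rotation (cnj z) \<otimes>\<^bsub>F.L\<^esub> rotation z) \<otimes>\<^bsub>F.L\<^esub> a"
    using z a by (simp add: rotation_L F.L.m_assoc)
  then show "rotation (cnj z) \<otimes>\<^bsub>F.L\<^esub> (rotation z \<otimes>\<^bsub>F.L\<^esub> a) = a"
    using z a unit_circle[OF z] by (simp add: rotation_mult rotation_one)
  show "rotation z \<otimes>\<^bsub>F.L\<^esub> rotation (cnj z) = \<one>\<^bsub>F.L\<^esub>"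
    using z unit_circle[OF z] by (simp add: rotation_mult rotation_one)
qed

lemma Ad_mult:
  assumes "norm z = 1" "a \<in> carrier F.L" "b \<in> carrier F.L"
  shows "Ad z (a \<otimes>\<^bsub>F.L\<^esub> b) = Ad z a \<otimes>\<^bsub>F.L\<^esub> Ad z b"
  using assms by (simp add: Ad_def rotation_L F.L.m_assoc rotation_cancel(1))

lemma Ad_add:
  assumes "norm z = 1" "a \<in> carrier F.L" "b \<in> carrier F.L"
  shows "Ad z (a \<oplus>\<^bsub>F.L\<^esub> b) = Ad z a \<oplus>\<^bsub>F.L\<^esub> Ad z b"
  using assms by (simp add: Ad_def rotation_L F.L.l_distr F.L.r_distr)

lemma Ad_smult: "norm z = 1 \<Longrightarrow> a \<in> carrier F.L \<Longrightarrow> Ad z (c \<odot>\<^bsub>F.L\<^esub> a) = c \<odot>\<^bsub>F.L\<^esub> Ad z a"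
  by (simp add: Ad_def rotation_L F.L.smult_mult_left F.L.smult_mult_right)

lemma Ad_star: "norm z = 1 \<Longrightarrow> a \<in> carrier F.L \<Longrightarrow> Ad z (star F.L a) = star F.L (Ad z a)"
  by (simp add: Ad_def rotation_L F.L.star_mult F.L.m_assoc)

lemma Ad_diff:
  "norm z = 1 \<Longrightarrow> a \<in> carrier F.L \<Longrightarrow> b \<in> carrier F.L \<Longrightarrow> Ad z (a \<ominus>\<^bsub>F.L\<^esub> b) = Ad z a \<ominus>\<^bsub>F.L\<^esub> Ad z b"
  by (simp add: F.L.diff_eq_smult Ad_add Ad_smult)

lemma Ad_unit: "norm z = 1 \<Longrightarrow> Ad z \<one>\<^bsub>F.L\<^esub> = \<one>\<^bsub>F.L\<^esub>"
  using rotation_cancel(2)[of z "\<one>\<^bsub>F.L\<^esub>"] by (simp add: Ad_def rotation_L)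

lemma Ad_scalar: assumes z: "norm z = 1" shows "Ad z (F.scalar f) = F.scalar f"
proof -
  have "Ad z (F.scalar f) = (rotation z \<otimes>\<^bsub>F.L\<^esub> rotation (cnj z)) \<otimes>\<^bsub>F.L\<^esub> F.scalar f"
    using z F.scalar_commute[of "rotation (cnj z)" f] by (simp add: Ad_def rotation_L F.scalar_L F.L.m_assoc)
  then show ?thesis
    using rotation_cancel(2)[OF z F.scalar_L(1)[of f]] by (simp add: F.scalar_L)
qed

lemma Ad_creation:
  assumes z: "norm z = 1" and v: "v \<in> sections"
  shows "Ad z (creation E v) = z \<odot>\<^bsub>F.L\<^esub> creation E v"
proof (rule F.L_eqI)
  fix x assume x: "x \<in> vecs F"
  have "rot z (raise v (rot (cnj z) x)) k w = raise v x k w * const_bcontfun z" for k w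
  proof (cases k)
    case (Suc j)
    have "const_bcontfun (z ^ j) * const_bcontfun (cnj z ^ j) = (1 :: 'x \<Rightarrow>\<^sub>C complex)"
      using unit_circle(1)[OF z] by (simp add: const_bcontfun_simps(1) flip: const_bcontfun_simps(2) power_mult_distrib)
    then have "const_bcontfun (z ^ j) * (const_bcontfun (cnj z ^ j) * f) = f" for f :: "'x \<Rightarrow>\<^sub>C complex"
      by (simp add: mult.assoc[symmetric])
    then show ?thesis
      by (cases w) (simp_all add: Suc rot_def const_bcontfun_simps(2) mult_ac)
  qed (simp add: rot_def)
  then have "rot z (raise v (rot (cnj z) x)) = vact F (raise v x) (const_bcontfun z)"
    by (simp add: fun_eq_iff F_ops(3))
  then show "Ad z (creation E v) x = (z \<odot>\<^bsub>F.L\<^esub> creation E v) x"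
    using z v x by (simp add: Ad_def rotation_apply rot_closed creation_apply raise_closed)
qed (use z v creation_L(1) in auto)

lemma nrm_Ad: assumes z: "norm z = 1" and a: "a \<in> carrier F.L" shows "nrm F.L (Ad z a) = nrm F.L a"
proof -
  have r: "nrm F.L (rotation w) \<le> 1" if w: "norm w = 1" for w
  proof -
    have "(nrm F.L (rotation w))\<^sup>2 = nrm F.L \<one>\<^bsub>F.L\<^esub>"
      using F.L.N_cstar[OF rotation_L(1)[OF w]] rotation_L(2)[OF w] rotation_mult[of "cnj w" w] w unit_circle(2)[OF w]
      by (simp add: rotation_one)
    then have "(nrm F.L (rotation w))\<^sup>2 \<le> 1\<^sup>2"
      using F.L.N_one_le by simp
    then show ?thesis
      by (rule power2_le_imp_le) simp
  qed
  have le: "nrm F.L (Ad w b) \<le> nrm F.L b" if w: "norm w = 1" and b: "b \<in> carrier F.L" for w b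
  proof -
    have w': "norm (cnj w) = 1"
      using w by simp
    have "nrm F.L (Ad w b) \<le> nrm F.L (rotation w) * nrm F.L (b \<otimes>\<^bsub>F.L\<^esub> rotation (cnj w))"
      unfolding Ad_def using w w' b by (intro F.L.N_mult) (auto simp: rotation_L)
    also have "\<dots> \<le> 1 * (nrm F.L b * 1)"
    proof (intro mult_mono r w)
      show "nrm F.L (b \<otimes>\<^bsub>F.L\<^esub> rotation (cnj w)) \<le> nrm F.L b * 1"
        using F.L.N_mult[OF b rotation_L(1)[OF w']] mult_left_mono[OF r[OF w'] F.L.N_nonneg[OF b]] by linarith
    qed (use w w' b in \<open>auto simp: rotation_L\<close>)
    finally show ?thesis
      by simp
  qed
  have "Ad (cnj z) (Ad z a) = a"
    using z a unit_circle(2)[OF z] by (simp add: Ad_Ad Ad_one)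
  then show ?thesis
    using le[OF z a] le[of "cnj z" "Ad z a"] z a by simp
qed

lemma Ad_K: "norm z = 1 \<Longrightarrow> k \<in> compact_ops F \<Longrightarrow> Ad z k \<in> compact_ops F"
  unfolding Ad_def by (intro F.K_left F.K_right) (auto simp: rotation_L)

lemma generated_gauge_stable:
  assumes z: "norm z = 1" and a: "a \<in> generated_cstar F.L (creation E ` sections)"
  shows "Ad z a \<in> generated_cstar F.L (creation E ` sections)"
proof -
  let ?G = "generated_cstar F.L (creation E ` sections)"
  have sub: "creation E ` sections \<subseteq> carrier F.L"
    using creation_L(1) by blast
  note G = F.L.generated_cstar[OF sub]
  have lim: "seq_lim F.L (nrm F.L) (\<lambda>i. Ad z (s i)) (Ad z b)" if "seq_lim F.L (nrm F.L) s b" for s b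
    unfolding Ad_def using z by (intro F.L.seq_lim_mult F.L.seq_lim_const that) (auto simp: rotation_L)
  have "Ad z \<zero>\<^bsub>F.L\<^esub> = \<zero>\<^bsub>F.L\<^esub>"
    using z by (simp add: Ad_def rotation_L)
  then have "closed_subspace F.L {a \<in> carrier F.L. Ad z a \<in> ?G}"
    by (intro F.L.closed_subspace_vimage[OF G(1)] lim)
      (use z F.L.closed_subspaceD(4)[OF G(1)] in \<open>auto simp: Ad_add Ad_smult\<close>)
  then have "?G \<subseteq> {a \<in> carrier F.L. Ad z a \<in> ?G}"
  proof (rule F.L.generated_cstar_least)
    show "creation E ` sections \<subseteq> {a \<in> carrier F.L. Ad z a \<in> ?G}"
      using z G(2) F.L.closed_subspaceD(4)[OF G(1)] sub by (auto simp: Ad_creation)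
  qed (use z G(3,4) in \<open>auto simp: Ad_mult Ad_star\<close>)
  then show ?thesis
    using a by blast
qed

text \<open>The conjugations are isometric, so the elements with a continuous orbit form a closed *-subalgebra. It
  contains the creation operators, whose orbits are scalar multiples.\<close>

lemma Ad_continuous:
  assumes a: "a \<in> generated_cstar F.L (creation E ` sections)" and z: "norm z = 1"
  shows "((\<lambda>w. nrm F.L (Ad w a \<ominus>\<^bsub>F.L\<^esub> Ad z a)) \<longlongrightarrow> 0) (at z within sphere 0 1)"
proof -
  let ?F = "at z within sphere 0 1"
  have on: "\<forall>\<^sub>F w in ?F. norm w = 1"
    by (simp add: eventually_at_filter)
  define S where "S = {a \<in> carrier F.L. ((\<lambda>w. nrm F.L (Ad w a \<ominus>\<^bsub>F.L\<^esub> Ad z a)) \<longlongrightarrow> 0) ?F}"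
  have SI: "a \<in> S" if a: "a \<in> carrier F.L" and e: "(e \<longlongrightarrow> 0) ?F"
    and le: "\<And>w. norm w = 1 \<Longrightarrow> nrm F.L (Ad w a \<ominus>\<^bsub>F.L\<^esub> Ad z a) \<le> e w" for a e
  proof -
    have "((\<lambda>w. nrm F.L (Ad w a \<ominus>\<^bsub>F.L\<^esub> Ad z a)) \<longlongrightarrow> 0) ?F"
    proof (rule real_tendsto_sandwich[OF _ _ tendsto_const e])
      show "\<forall>\<^sub>F w in ?F. 0 \<le> nrm F.L (Ad w a \<ominus>\<^bsub>F.L\<^esub> Ad z a)"
        using on by eventually_elim (use a z in simp)
      show "\<forall>\<^sub>F w in ?F. nrm F.L (Ad w a \<ominus>\<^bsub>F.L\<^esub> Ad z a) \<le> e w"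
        using on by eventually_elim (rule le)
    qed
    then show ?thesis
      using a by (simp add: S_def)
  qed
  have SD: "a \<in> carrier F.L" "((\<lambda>w. nrm F.L (Ad w a \<ominus>\<^bsub>F.L\<^esub> Ad z a)) \<longlongrightarrow> 0) ?F" if "a \<in> S" for a
    using that by (simp_all add: S_def)
  have "closed_subspace F.L S"
  proof (rule F.L.closed_subspaceI)
    show "S \<subseteq> carrier F.L"
      using SD by blast
    show "\<zero>\<^bsub>F.L\<^esub> \<in> S"
      by (rule SI[of _ "\<lambda>_. 0"]) (use z in \<open>simp_all add: Ad_def rotation_L\<close>)
    show "a \<oplus>\<^bsub>F.L\<^esub> b \<in> S" if ab: "a \<in> S" "b \<in> S" for a b
    proof (rule SI)
      show "((\<lambda>w. nrm F.L (Ad w a \<ominus>\<^bsub>F.L\<^esub> Ad z a) + nrm F.L (Ad w b \<ominus>\<^bsub>F.L\<^esub> Ad z b)) \<longlongrightarrow> 0) ?F"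
        using tendsto_add[OF SD(2)[OF ab(1)] SD(2)[OF ab(2)]] by simp
    qed (use SD(1) ab z F.L.N_diff_add in \<open>simp_all add: Ad_add\<close>)
    show "c \<odot>\<^bsub>F.L\<^esub> a \<in> S" if a: "a \<in> S" for c a
    proof (rule SI)
      show "((\<lambda>w. norm c * nrm F.L (Ad w a \<ominus>\<^bsub>F.L\<^esub> Ad z a)) \<longlongrightarrow> 0) ?F"
        using tendsto_mult[OF tendsto_const SD(2)[OF a], of "norm c"] by simp
    qed (use SD(1)[OF a] z in \<open>simp_all add: Ad_smult F.L.N_diff_smult\<close>)
    show "a \<in> S" if s: "\<And>i. s i \<in> S" and lim: "seq_lim F.L (nrm F.L) s a" for s a
    proof -
      have a: "a \<in> carrier F.L"
        by (rule F.L.seq_limD(2)[OF lim])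
      have "((\<lambda>w. nrm F.L (Ad w a \<ominus>\<^bsub>F.L\<^esub> Ad z a)) \<longlongrightarrow> 0) ?F"
      proof (rule tendstoI)
        fix e :: real assume e: "0 < e"
        obtain i where i: "\<bar>nrm F.L (s i \<ominus>\<^bsub>F.L\<^esub> a)\<bar> < e / 3"
          using LIMSEQ_D[OF F.L.seq_limD(3)[OF lim], of "e / 3"] e by fastforce
        note sc = SD(1)[OF s[of i]]
        have "\<forall>\<^sub>F w in ?F. dist (nrm F.L (Ad w (s i) \<ominus>\<^bsub>F.L\<^esub> Ad z (s i))) 0 < e / 3"
          by (rule tendstoD[OF SD(2)[OF s[of i]]]) (use e in simp)
        then show "\<forall>\<^sub>F w in ?F. dist (nrm F.L (Ad w a \<ominus>\<^bsub>F.L\<^esub> Ad z a)) 0 < e"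
          using on
        proof eventually_elim
          case (elim w)
          have near: "nrm F.L (Ad u (s i) \<ominus>\<^bsub>F.L\<^esub> Ad u a) < e / 3" if "norm u = 1" for u
            using i that sc a by (simp add: Ad_diff[symmetric] nrm_Ad)
          have "nrm F.L (Ad w a \<ominus>\<^bsub>F.L\<^esub> Ad z a) \<le> nrm F.L (Ad w a \<ominus>\<^bsub>F.L\<^esub> Ad w (s i)) + nrm F.L (Ad w (s i) \<ominus>\<^bsub>F.L\<^esub> Ad z a)"
            using elim z a sc by (intro F.L.N_diff_triangle) auto
          also have "nrm F.L (Ad w (s i) \<ominus>\<^bsub>F.L\<^esub> Ad z a) \<le>
              nrm F.L (Ad w (s i) \<ominus>\<^bsub>F.L\<^esub> Ad z (s i)) + nrm F.L (Ad z (s i) \<ominus>\<^bsub>F.L\<^esub> Ad z a)"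
            using elim z a sc by (intro F.L.N_diff_triangle) auto
          also have "nrm F.L (Ad w a \<ominus>\<^bsub>F.L\<^esub> Ad w (s i)) = nrm F.L (Ad w (s i) \<ominus>\<^bsub>F.L\<^esub> Ad w a)"
            using elim a sc by (intro F.L.N_diff_commute) auto
          finally have "nrm F.L (Ad w a \<ominus>\<^bsub>F.L\<^esub> Ad z a) < e"
            using near[OF elim(2)] near[OF z] elim(1) by (simp add: dist_real_def)
          then show ?case
            using elim(2) a z by (simp add: dist_real_def)
        qed
      qed
      then show ?thesis
        using a by (simp add: S_def)
    qed
  qed
  then have "generated_cstar F.L (creation E ` sections) \<subseteq> S"
  proof (rule F.L.generated_cstar_least)
    show "a \<otimes>\<^bsub>F.L\<^esub> b \<in> S" if ab: "a \<in> S" "b \<in> S" for a b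
    proof (rule SI)
      show "((\<lambda>w. nrm F.L a * nrm F.L (Ad w b \<ominus>\<^bsub>F.L\<^esub> Ad z b) + nrm F.L (Ad w a \<ominus>\<^bsub>F.L\<^esub> Ad z a) * nrm F.L b) \<longlongrightarrow> 0) ?F"
        using tendsto_add[OF tendsto_mult[OF tendsto_const SD(2)[OF ab(2)], of "nrm F.L a"]
            tendsto_mult[OF SD(2)[OF ab(1)] tendsto_const, of "nrm F.L b"]] by simp
      show "nrm F.L (Ad w (a \<otimes>\<^bsub>F.L\<^esub> b) \<ominus>\<^bsub>F.L\<^esub> Ad z (a \<otimes>\<^bsub>F.L\<^esub> b)) \<le>
          nrm F.L a * nrm F.L (Ad w b \<ominus>\<^bsub>F.L\<^esub> Ad z b) + nrm F.L (Ad w a \<ominus>\<^bsub>F.L\<^esub> Ad z a) * nrm F.L b" if w: "norm w = 1" for w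
        using F.L.N_diff_mult[of "Ad w a" "Ad z a" "Ad w b" "Ad z b"] w z SD(1)[OF ab(1)] SD(1)[OF ab(2)]
        by (simp add: Ad_mult nrm_Ad)
    qed (use SD(1) ab in auto)
    show "star F.L a \<in> S" if a: "a \<in> S" for a
      by (rule SI[OF _ SD(2)[OF a]]) (use SD(1)[OF a] z in \<open>simp_all add: Ad_star F.L.N_diff_star\<close>)
    show "creation E ` sections \<subseteq> S"
    proof
      fix b assume "b \<in> creation E ` sections"
      then obtain v where v: "v \<in> sections" "b = creation E v"
        by blast
      note c = creation_L(1)[OF v(1)]
      have "creation E v \<in> S"
      proof (rule SI[OF c])
        have "((\<lambda>w. norm (w - z) * nrm F.L (creation E v)) \<longlongrightarrow> norm (z - z) * nrm F.L (creation E v)) ?F"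
          by (intro tendsto_intros)
        then show "((\<lambda>w. norm (w - z) * nrm F.L (creation E v)) \<longlongrightarrow> 0) ?F"
          by simp
        show "nrm F.L (Ad w (creation E v) \<ominus>\<^bsub>F.L\<^esub> Ad z (creation E v)) \<le> norm (w - z) * nrm F.L (creation E v)"
          if w: "norm w = 1" for w
        proof -
          have "w \<odot>\<^bsub>F.L\<^esub> creation E v \<ominus>\<^bsub>F.L\<^esub> z \<odot>\<^bsub>F.L\<^esub> creation E v = (w - z) \<odot>\<^bsub>F.L\<^esub> creation E v"
            using c F.L.smult_add_left[OF c, of w "- z"] by (simp add: F.L.diff_eq_smult F.L.smult_smult)
          then show ?thesis
            using w z v c by (simp add: Ad_creation F.L.N_smult)
        qed
      qed
      then show "b \<in> S"
        by (simp add: v)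
    qed
  qed
  then show ?thesis
    using a SD(2) by blast
qed

end

subsection \<open>The gauge action on the Pimsner algebra\<close>

lemma cstar_seminormedI: "involutive_algebra A \<Longrightarrow> cstar_seminorm A N \<Longrightarrow> cstar_seminormed A N"
  by (simp add: cstar_seminormed_def cstar_seminormed_axioms_def)

lemma star_iso_hom: "\<phi> \<in> star_iso A B \<Longrightarrow> involutive_hom A B \<phi>"
  by (auto simp: star_iso_def ring_iso_def involutive_hom_def)

context full_bundle
begin

lemma Ad_G: "norm z = 1 \<Longrightarrow> a \<in> G \<Longrightarrow> Ad z a \<in> G"
  by (rule generated_gauge_stable)

lemma Ad_coset:
  assumes z: "norm z = 1" and a: "a \<in> G"
  shows "Ad z ` coset a = coset (Ad z a)"
proof
  have sub: "Ad w ` coset b \<subseteq> coset (Ad w b)" if w: "norm w = 1" and b: "b \<in> G" for w b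
  proof
    fix x assume "x \<in> Ad w ` coset b"
    then obtain y where y: "y \<in> coset b" "x = Ad w y"
      by blast
    then have yG: "y \<in> G" and "y \<ominus>\<^bsub>T\<^esub> b \<in> compact_ops F"
      using J.coset_iff[of b y] b by auto
    then have "Ad w y \<ominus>\<^bsub>T\<^esub> Ad w b \<in> compact_ops F"
      using Ad_K[OF w, of "y \<ominus>\<^bsub>F.L\<^esub> b"] w b by (simp add: T_diff Ad_G Ad_diff G_L)
    then show "x \<in> coset (Ad w b)"
      using J.coset_iff[of "Ad w b" x] w b yG y(2) by (simp add: Ad_G)
  qed
  show "Ad z ` coset a \<subseteq> coset (Ad z a)"
    by (rule sub[OF z a])
  show "coset (Ad z a) \<subseteq> Ad z ` coset a"
  proof
    fix x assume x: "x \<in> coset (Ad z a)"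
    have xG: "x \<in> G"
      using x J.coset_iff[of "Ad z a" x] Ad_G[OF z a] by simp
    have "Ad (cnj z) x \<in> coset (Ad (cnj z) (Ad z a))"
      using sub[of "cnj z" "Ad z a"] x z a by (auto simp: Ad_G)
    moreover have "Ad (cnj z) (Ad z a) = a" "Ad z (Ad (cnj z) x) = x"
      using z G_L[OF a] G_L[OF xG] unit_circle[OF z] by (simp_all add: Ad_Ad Ad_one)
    ultimately show "x \<in> Ad z ` coset a"
      by (metis imageI)
  qed
qed

lemma nrm_coset_Ad:
  assumes z: "norm z = 1" and a: "a \<in> G"
  shows "nrm Pim (coset (Ad z a)) = nrm Pim (coset a)"
proof -
  have "nrm F.L (Ad z b) = nrm F.L b" if "b \<in> coset a" for b
    using that J.coset_iff[of a b] a z by (simp add: nrm_Ad G_L)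
  then have "(INF b\<in>coset a. nrm F.L (Ad z b)) = (INF b\<in>coset a. nrm F.L b)"
    by (intro INF_cong) auto
  then show ?thesis
    by (simp add: O_eq cstar_quotient_def Ad_coset[OF z a, symmetric] image_image)
qed

lemma Pim_ops:
  assumes "a \<in> G" "b \<in> G"
  shows "coset a \<in> carrier Pim" "coset a \<otimes>\<^bsub>Pim\<^esub> coset b = coset (a \<otimes>\<^bsub>F.L\<^esub> b)"
    "coset a \<oplus>\<^bsub>Pim\<^esub> coset b = coset (a \<oplus>\<^bsub>F.L\<^esub> b)"
    "c \<odot>\<^bsub>Pim\<^esub> coset a = coset (c \<odot>\<^bsub>F.L\<^esub> a)" "star Pim (coset a) = coset (star F.L a)"
    "\<one>\<^bsub>Pim\<^esub> = coset \<one>\<^bsub>F.L\<^esub>"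
    "coset a \<ominus>\<^bsub>Pim\<^esub> coset b = coset (a \<ominus>\<^bsub>F.L\<^esub> b)"
proof -
  note h = involutive_homD[OF coset_hom]
  show "coset a \<in> carrier Pim" "coset a \<otimes>\<^bsub>Pim\<^esub> coset b = coset (a \<otimes>\<^bsub>F.L\<^esub> b)"
    "coset a \<oplus>\<^bsub>Pim\<^esub> coset b = coset (a \<oplus>\<^bsub>F.L\<^esub> b)"
    "c \<odot>\<^bsub>Pim\<^esub> coset a = coset (c \<odot>\<^bsub>F.L\<^esub> a)" "star Pim (coset a) = coset (star F.L a)"
    using h(1)[of a] h(5)[of a b] h(4)[of a b] h(2)[of a c] h(3)[of a] assms by simp_all
  show "\<one>\<^bsub>Pim\<^esub> = coset \<one>\<^bsub>F.L\<^esub>"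
    using involutive_hom_one[OF coset_hom] by simp
  show "coset a \<ominus>\<^bsub>Pim\<^esub> coset b = coset (a \<ominus>\<^bsub>F.L\<^esub> b)"
    using J.quot_diff[of a b] assms by (simp add: O_eq T_diff)
qed

lemma circle_action_Pim: "circle_action Pim (\<lambda>z S. Ad z ` S)"
  unfolding circle_action_def
proof (intro conjI ballI)
  fix z :: complex assume "z \<in> sphere 0 1"
  then have z: "norm z = 1"
    by simp
  have undo: "Ad (cnj w) (Ad w a) = a" if "norm w = 1" "a \<in> G" for w a
    using that G_L unit_circle[of w] by (simp add: Ad_Ad Ad_one)
  show "(`) (Ad z) \<in> star_iso Pim Pim"
  proof (rule star_isoI)
    show "bij_betw ((`) (Ad z)) (carrier Pim) (carrier Pim)"
      by (rule bij_betw_byWitness[where f' = "(`) (Ad (cnj z))"])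
        (use z undo[of z] undo[of "cnj z"] in \<open>auto simp: O_carrier Ad_coset Ad_G\<close>)
    show "Ad z ` \<one>\<^bsub>Pim\<^esub> = \<one>\<^bsub>Pim\<^esub>"
      using Pim_ops(6)[OF one_G one_G] Ad_coset[OF z one_G] Ad_unit[OF z] by simp
    fix S assume "S \<in> carrier Pim"
    then obtain a where a: "a \<in> G" "S = coset a"
      by (auto simp: O_carrier)
    show "Ad z ` (c \<odot>\<^bsub>Pim\<^esub> S) = c \<odot>\<^bsub>Pim\<^esub> (Ad z ` S)" for c
      using a z by (simp add: Pim_ops(4) Ad_coset Ad_G Ad_smult G_smult G_L)
    show "Ad z ` star Pim S = star Pim (Ad z ` S)"
      using a z by (simp add: Pim_ops(5) Ad_coset Ad_G Ad_star G_star G_L)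
    show "nrm Pim (Ad z ` S) = nrm Pim S"
      using a z by (simp add: Ad_coset nrm_coset_Ad)
    fix U assume "U \<in> carrier Pim"
    then obtain b where b: "b \<in> G" "U = coset b"
      by (auto simp: O_carrier)
    show "Ad z ` (S \<otimes>\<^bsub>Pim\<^esub> U) = Ad z ` S \<otimes>\<^bsub>Pim\<^esub> Ad z ` U"
      "Ad z ` (S \<oplus>\<^bsub>Pim\<^esub> U) = Ad z ` S \<oplus>\<^bsub>Pim\<^esub> Ad z ` U"
      using a b z by (simp_all add: Pim_ops(2,3) Ad_coset Ad_G Ad_mult Ad_add G_mult G_add G_L)
  qed
  fix S assume "S \<in> carrier Pim"
  then obtain a where a: "a \<in> G" "S = coset a"
    by (auto simp: O_carrier)
  show "Ad (z * w) ` S = Ad z ` Ad w ` S" if "w \<in> sphere 0 1" for w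
    using that a z by (simp add: Ad_coset Ad_G Ad_Ad G_L norm_mult)
  show "((\<lambda>w. nrm Pim (Ad w ` S \<ominus>\<^bsub>Pim\<^esub> Ad z ` S)) \<longlongrightarrow> 0) (at z within sphere 0 1)"
  proof (rule real_tendsto_sandwich[OF _ _ tendsto_const Ad_continuous[OF a(1) z]])
    have eq: "Ad w ` S \<ominus>\<^bsub>Pim\<^esub> Ad z ` S = coset (Ad w a \<ominus>\<^bsub>F.L\<^esub> Ad z a)" "Ad w a \<ominus>\<^bsub>F.L\<^esub> Ad z a \<in> G"
      if "norm w = 1" for w
      using a z that by (simp_all add: Ad_coset Pim_ops(7) Ad_G G_diff)
    have on: "\<forall>\<^sub>F w in at z within sphere 0 1. norm w = 1"
      by (simp add: eventually_at_filter)
    show "\<forall>\<^sub>F w in at z within sphere 0 1. 0 \<le> nrm Pim (Ad w ` S \<ominus>\<^bsub>Pim\<^esub> Ad z ` S)"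
      using on by eventually_elim (simp add: eq(1) Pim.N_nonneg Pim_ops(1)[OF eq(2) one_G])
    show "\<forall>\<^sub>F w in at z within sphere 0 1. nrm Pim (Ad w ` S \<ominus>\<^bsub>Pim\<^esub> Ad z ` S) \<le> nrm F.L (Ad w a \<ominus>\<^bsub>F.L\<^esub> Ad z a)"
      using on
    proof eventually_elim
      case (elim w)
      show ?case
        unfolding eq(1)[OF elim] unfolding O_eq
        using J.quot_nrm_le[OF _ J.self_in_coset, of "Ad w a \<ominus>\<^bsub>F.L\<^esub> Ad z a"] eq(2)[OF elim] by simp
    qed
  qed
qed

section \<open>The universal algebras\<close>

definition toeplitz_hom where "toeplitz_hom = star_lift T F.scalar gen"

lemma toeplitz_hom:
  "involutive_hom (presented_algebra (toeplitz_relations E)) T toeplitz_hom"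
  "toeplitz_hom (star_class (toeplitz_relations E) a) = ev a"
proof -
  interpret TR: toeplitz_rep T F.scalar gen E
    by (rule toeplitz_rep_T)
  have g: "range gen \<subseteq> carrier T"
    using gen_G by auto
  show "involutive_hom (presented_algebra (toeplitz_relations E)) T toeplitz_hom"
    unfolding toeplitz_hom_def by (rule TR.involutive_hom_star_lift[OF g TR.toeplitz_relations_hold])
  show "toeplitz_hom (star_class (toeplitz_relations E) a) = ev a"
    unfolding toeplitz_hom_def by (rule TR.star_lift_class[OF g TR.toeplitz_relations_hold])
qed

definition pimsner_hom where "pimsner_hom = star_lift Pim (\<lambda>f. coset (F.scalar f)) (\<lambda>l. coset (gen l))"

lemma pimsner_hom:
  "involutive_hom (presented_algebra (pimsner_relations E)) Pim pimsner_hom"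
  "pimsner_hom (star_class (pimsner_relations E) a) = coset (ev a)"
proof -
  interpret TR: toeplitz_rep T F.scalar gen E
    by (rule toeplitz_rep_T)
  interpret OR: toeplitz_rep Pim "\<lambda>f. coset (F.scalar f)" "\<lambda>l. coset (gen l)" E
    by (rule toeplitz_rep_O)
  have g: "range (\<lambda>l. coset (gen l)) \<subseteq> carrier Pim" "range gen \<subseteq> carrier T"
    using OR.g_closed gen_G by auto
  note hold = OR.pimsner_relations_hold[OF range_proj_O]
  show "involutive_hom (presented_algebra (pimsner_relations E)) Pim pimsner_hom"
    unfolding pimsner_hom_def by (rule OR.involutive_hom_star_lift[OF g(1) hold])
  have "pimsner_hom (star_class (pimsner_relations E) a) =
      star_eval Pim (\<lambda>f. coset (F.scalar f)) (\<lambda>l. coset (gen l)) a"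
    unfolding pimsner_hom_def by (rule OR.star_lift_class[OF g(1) hold])
  then show "pimsner_hom (star_class (pimsner_relations E) a) = coset (ev a)"
    using star_eval_hom(2)[OF TR.coef_rep_axioms coset_hom g(2), of a] by simp
qed

subsection \<open>The Toeplitz algebra\<close>

lemma Ad_hom: "norm z = 1 \<Longrightarrow> involutive_hom T T (Ad z)"
  by (auto simp: involutive_hom_def Ad_G Ad_mult Ad_add Ad_unit Ad_smult Ad_star G_L intro!: ring_hom_memI)

text \<open>The adjoint of a generator kills the vacuum, so elements of the ladder do as well. The vacuum
  expectation of \<open>f + y\<close> is therefore \<open>f\<close>, which is the condition that the comparison of seminorms requires.\<close>

theorem toeplitz_universal:
  "\<exists>N. greatest_cstar_seminorm (presented_algebra (toeplitz_relations E)) N \<and>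
    star_isomorphic (cstar_completion (presented_algebra (toeplitz_relations E)) N) T"
proof -
  let ?R = "toeplitz_relations E"
  let ?A = "presented_algebra ?R"
  let ?c = "\<lambda>f. star_class ?R (Coef f)"
  let ?N = "\<lambda>x. nrm T (toeplitz_hom x)"
  interpret A: gauged_rep ?A ?c "\<lambda>l. star_class ?R (Gen l)" E "gauge ?R"
    by (rule gauged_rep_presented) (simp_all add: E)
  note h = involutive_homD[OF toeplitz_hom(1)]
  have semi: "cstar_seminorm ?A ?N"
    by (rule cstar_seminorm_comp[OF A.involutive_algebra_axioms toeplitz_hom(1) T.seminorm])
  interpret N: cstar_seminormed ?A ?N
    by (rule cstar_seminormedI[OF A.involutive_algebra_axioms semi])
  have inv: "?N (gauge ?R (cis t) x) = ?N x" if x: "x \<in> carrier ?A" for t x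
  proof -
    have t: "norm (cis t) = 1"
      by simp
    have "Ad (cis t) (toeplitz_hom x) = toeplitz_hom (gauge ?R (cis t) x)"
      by (rule gauge_equivariant[OF _ E t toeplitz_hom(1) Ad_hom[OF t] T.involutive_algebra_axioms _ _ x])
        (simp_all add: toeplitz_hom(2) Ad_scalar gen_def Ad_creation column_section)
    then show ?thesis
      using nrm_Ad[OF t, of "toeplitz_hom x"] h(1)[OF x] G_L by simp
  qed
  have vac_zero: "toeplitz_hom y vacuum = 0" if y: "y \<in> A.ladder k" for y k
    using y unfolding A.ladder_def
  proof (induction rule: A.aspan.induct)
    case zero
    show ?case
      using involutive_hom_zero_diff(1)[OF A.involutive_algebra_axioms T.involutive_algebra_axioms toeplitz_hom(1)] by simp
  next
    case (base y)
    then obtain l s m where y: "y = star_class ?R (Gen l) \<otimes>\<^bsub>?A\<^esub> (s \<otimes>\<^bsub>?A\<^esub> star ?A (star_class ?R (Gen m)))"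
      and s: "s \<in> carrier ?A"
      using A.core_closed by blast
    have sG: "toeplitz_hom s \<in> carrier F.L"
      using h(1)[OF s] G_L by simp
    have "toeplitz_hom y = gen l \<otimes>\<^bsub>F.L\<^esub> (toeplitz_hom s \<otimes>\<^bsub>F.L\<^esub> star F.L (gen m))"
      using s by (simp add: y h toeplitz_hom(2))
    then have "toeplitz_hom y vacuum = gen l (toeplitz_hom s (star F.L (gen m) vacuum))"
      using sG by simp
    then show ?case
      by (simp only: star_gen_vacuum F.L_zero_apply[OF sG] F.L_zero_apply[OF gen_L])
  next
    case (add x y)
    have "x \<in> carrier ?A" "y \<in> carrier ?A"
      using add A.aspan_closed[OF A.ladder_subset] by blast+
    then show ?case
      using add by (simp add: h)
  qed
  have vac: "?N (?c f) \<le> ?N (?c f \<oplus>\<^bsub>?A\<^esub> y)" if y: "y \<in> A.ladder k" for f k y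
  proof -
    have yc: "toeplitz_hom y \<in> carrier F.L"
      using h(1)[OF A.ladder_closed[OF y]] G_L by simp
    have eq: "toeplitz_hom (?c f \<oplus>\<^bsub>?A\<^esub> y) = F.scalar f \<oplus>\<^bsub>F.L\<^esub> toeplitz_hom y"
      using A.ladder_closed[OF y] by (simp add: h toeplitz_hom(2))
    have "(F.scalar f \<oplus>\<^bsub>F.L\<^esub> toeplitz_hom y) vacuum = F.scalar f vacuum"
      using vac_zero[OF y] by simp
    moreover have "vinner F vacuum (F.scalar f vacuum) = f"
      by (simp add: inner_vacuum F_ops(3)) (simp add: vacuum_def)
    ultimately have "norm (apply_bcontfun f t) \<le> nrm F.L (F.scalar f \<oplus>\<^bsub>F.L\<^esub> toeplitz_hom y)" for t
      using inner_le_nrm[of "F.scalar f \<oplus>\<^bsub>F.L\<^esub> toeplitz_hom y" vacuum t] yc F.scalar_L vnorm_vacuum by simp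
    then have "norm f \<le> nrm F.L (F.scalar f \<oplus>\<^bsub>F.L\<^esub> toeplitz_hom y)"
      by (rule norm_bound)
    then show ?thesis
      by (simp add: eq toeplitz_hom(2) nrm_scalar)
  qed
  have "p x \<le> ?N x" if p: "cstar_seminorm ?A p" and x: "x \<in> carrier ?A" for p x
  proof -
    interpret p: cstar_seminormed ?A p
      by (rule cstar_seminormedI[OF A.involutive_algebra_axioms p])
    have "p (?c f) \<le> ?N (?c f)" for f
      using p.coef_le_norm[OF A.coef_rep_axioms, of f] by (simp add: toeplitz_hom(2) nrm_scalar)
    then show ?thesis
      by (intro A.toeplitz_seminorm_le[OF p.cstar_seminormed_axioms N.cstar_seminormed_axioms inv _ vac x])
  qed
  then have greatest: "greatest_cstar_seminorm ?A ?N"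
    using semi by (simp add: greatest_cstar_seminorm_def)
  have dense: "\<exists>a\<in>carrier ?A. nrm T (toeplitz_hom a \<ominus>\<^bsub>T\<^esub> b) < e" if b: "b \<in> carrier T" and e: "0 < e" for b e
  proof -
    obtain a where "nrm F.L (ev a \<ominus>\<^bsub>F.L\<^esub> b) < e"
      using ev_dense[of b e] b e by auto
    then show ?thesis
      using b ev_G by (intro bexI[of _ "star_class ?R a"]) (simp_all add: toeplitz_hom(2) T_diff)
  qed
  obtain \<Phi> where "\<Phi> \<in> star_iso (cstar_completion ?A ?N) T"
    by (rule completion_iso[OF N.cstar_seminormed_axioms cstar_algebra_T toeplitz_hom(1) HOL.refl dense]) blast
  then show ?thesis
    using greatest unfolding star_isomorphic_def by blast
qed

end

subsection \<open>The Pimsner algebra\<close>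

text \<open>An automorphism of the completion is isometric, and on the image of the presented algebra it is given by the
  gauge automorphism, since both agree on coefficients and generators.\<close>

lemma gauge_invariant_if_circle_action_extends:
  fixes E :: "('x::topological_space \<Rightarrow>\<^sub>C complex)^'n^'n"
  assumes R: "R = toeplitz_relations E \<or> R = pimsner_relations E" and E: "projection E"
    and N: "cstar_seminorm (presented_algebra R) N" and ext: "circle_action_extends R N"
    and z: "norm z = 1" and x: "x \<in> carrier (presented_algebra R)"
  shows "N (gauge R z x) = N x"
proof -
  let ?A = "presented_algebra R"
  let ?\<iota> = "to_completion ?A N"
  interpret A: gauged_rep ?A "\<lambda>f. star_class R (Coef f)" "\<lambda>l. star_class R (Gen l)" E "gauge R"
    by (rule gauged_rep_presented[OF R E])
  interpret N: cstar_seminormed ?A N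
    by (rule cstar_seminormedI[OF A.involutive_algebra_axioms N])
  obtain \<alpha> where \<alpha>: "circle_action (cstar_completion ?A N) \<alpha>"
    and coef: "\<And>z f. norm z = 1 \<Longrightarrow> \<alpha> z (?\<iota> (star_class R (Coef f))) = ?\<iota> (star_class R (Coef f))"
    and rotate: "\<And>z l. norm z = 1 \<Longrightarrow> \<alpha> z (?\<iota> (star_class R (Gen l))) =
      z \<odot>\<^bsub>cstar_completion ?A N\<^esub> ?\<iota> (star_class R (Gen l))"
    using ext unfolding circle_action_extends_def Let_def by auto
  have \<alpha>z: "\<alpha> z \<in> star_iso (cstar_completion ?A N) (cstar_completion ?A N)"
    using \<alpha> z by (simp add: circle_action_def)
  have "\<alpha> z (?\<iota> x) = ?\<iota> (gauge R z x)"
    by (rule gauge_equivariant[OF R E z N.involutive_hom_to_completion star_iso_hom[OF \<alpha>z]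
          N.involutive_algebra_completion coef[OF z] rotate[OF z] x])
  then have "nrm (cstar_completion ?A N) (?\<iota> (gauge R z x)) = nrm (cstar_completion ?A N) (?\<iota> x)"
    using star_isoD(8)[OF \<alpha>z, of "?\<iota> x"] involutive_homD(1)[OF N.involutive_hom_to_completion x] by simp
  then show ?thesis
    using x involutive_homD(1)[OF A.gam_hom[OF z] x] by (simp add: N.nrm_to_completion)
qed

text \<open>Both norms are invariant under the circle and equal to the sup-norm on coefficients, so each bounds the
  other.\<close>

lemma pimsner_norm_unique:
  fixes E :: "('x::topological_space \<Rightarrow>\<^sub>C complex)^'n^'n"
  defines "A \<equiv> presented_algebra (pimsner_relations E)"
  assumes E: "projection E"
    and N: "cstar_norm A N" "extends_sup_norm (pimsner_relations E) N" "circle_action_extends (pimsner_relations E) N"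
    and M: "cstar_norm A M" "extends_sup_norm (pimsner_relations E) M" "circle_action_extends (pimsner_relations E) M"
  shows "N = M"
proof (rule extensionalityI[of _ "carrier A"])
  show "N \<in> extensional (carrier A)" "M \<in> extensional (carrier A)"
    using N M by (auto simp: cstar_norm_def)
  let ?R = "pimsner_relations E"
  interpret A: gauged_rep A "\<lambda>f. star_class ?R (Coef f)" "\<lambda>l. star_class ?R (Gen l)" E "gauge ?R"
    unfolding A_def by (rule gauged_rep_presented) (simp_all add: E)
  have one: "A.range_proj = \<one>\<^bsub>A\<^esub>"
    unfolding A.range_proj_def unfolding A_def by (rule pimsner_sum_presented)
  have le: "N x \<le> M x" if x: "x \<in> carrier A"
    and N: "cstar_norm A N" "extends_sup_norm ?R N" "circle_action_extends ?R N"
    and M: "cstar_norm A M" "extends_sup_norm ?R M" "circle_action_extends ?R M" for N M x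
  proof -
    have sN: "cstar_seminorm A N" and sM: "cstar_seminorm A M"
      using N M by (auto simp: cstar_norm_def)
    show ?thesis
    proof (rule A.pimsner_seminorm_le[OF _ _ one _ _ x])
      show "cstar_seminormed A N" "cstar_seminormed A M"
        using sN sM A.involutive_algebra_axioms by (auto intro: cstar_seminormedI)
      show "M (gauge ?R (cis t) y) = M y" if "y \<in> carrier A" for t y
        by (rule gauge_invariant_if_circle_action_extends[OF _ E sM[unfolded A_def] M(3)])
          (use that in \<open>simp_all add: A_def\<close>)
      show "N (star_class ?R (Coef f)) \<le> M (star_class ?R (Coef f))" for f
        using N(2) M(2) by (simp add: extends_sup_norm_def)
    qed
  qed
  show "N x = M x" if "x \<in> carrier A" for x
    using le[OF that N M] le[OF that M N] by simp
qed

context full_bundle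
begin

text \<open>The norm is pulled back from the Pimsner algebra. That it is a norm follows from its invariance under the
  circle, hence only after its completion is known to carry the action.\<close>

theorem pimsner_norm_exists:
  defines "R \<equiv> pimsner_relations E"
  shows "\<exists>N. cstar_norm (presented_algebra R) N \<and> extends_sup_norm R N \<and> circle_action_extends R N \<and>
    star_isomorphic (cstar_completion (presented_algebra R) N) Pim"
proof -
  let ?A = "presented_algebra R"
  let ?c = "\<lambda>f. star_class R (Coef f)"
  define N where "N = (\<lambda>x\<in>carrier ?A. nrm Pim (pimsner_hom x))"
  have N: "N x = nrm Pim (pimsner_hom x)" if "x \<in> carrier ?A" for x
    using that by (simp add: N_def)
  have R: "R = toeplitz_relations E \<or> R = pimsner_relations E"
    by (simp add: R_def)
  interpret A: gauged_rep ?A ?c "\<lambda>l. star_class R (Gen l)" E "gauge R"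
    by (rule gauged_rep_presented[OF R E])
  note hom = pimsner_hom(1)[folded R_def] and cls = pimsner_hom(2)[folded R_def]
  have "cstar_seminorm ?A (\<lambda>x. nrm Pim (pimsner_hom x))"
    by (rule cstar_seminorm_comp[OF A.involutive_algebra_axioms hom Pim.seminorm])
  then have semi: "cstar_seminorm ?A N"
    unfolding cstar_seminorm_def by (simp add: N)
  interpret N: cstar_seminormed ?A N
    by (rule cstar_seminormedI[OF A.involutive_algebra_axioms semi])
  have sup: "extends_sup_norm R N"
    by (simp add: extends_sup_norm_def N cls nrm_coset_scalar)
  have dense: "\<exists>a\<in>carrier ?A. nrm Pim (pimsner_hom a \<ominus>\<^bsub>Pim\<^esub> S) < e" if S: "S \<in> carrier Pim" and e: "0 < e" for S e
  proof -
    obtain b where b: "b \<in> G" "S = coset b"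
      using S by (auto simp: O_carrier)
    obtain a where a: "nrm F.L (ev a \<ominus>\<^bsub>F.L\<^esub> b) < e"
      using ev_dense[OF b(1) e] by blast
    have "nrm Pim (coset (ev a \<ominus>\<^bsub>F.L\<^esub> b)) \<le> nrm F.L (ev a \<ominus>\<^bsub>F.L\<^esub> b)"
      unfolding O_eq using J.quot_nrm_le[OF _ J.self_in_coset, of "ev a \<ominus>\<^bsub>F.L\<^esub> b"] G_diff[OF ev_G b(1)] by simp
    then show ?thesis
      using a by (intro bexI[of _ "star_class R a"]) (simp_all add: cls b Pim_ops(7) ev_G)
  qed
  have isometric: "nrm Pim (pimsner_hom a) = N a" if "a \<in> carrier ?A" for a
    using that by (simp add: N)
  obtain \<Phi> where \<Phi>: "\<Phi> \<in> star_iso (cstar_completion ?A N) Pim"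
    "\<And>a. a \<in> carrier ?A \<Longrightarrow> \<Phi> (to_completion ?A N a) = pimsner_hom a"
  proof (rule completion_iso[OF N.cstar_seminormed_axioms Pim.cstar_algebra_axioms hom isometric dense])
    fix \<Phi> assume "\<Phi> \<in> star_iso (cstar_completion ?A N) Pim"
      "\<And>a. a \<in> carrier ?A \<Longrightarrow> \<Phi> (to_completion ?A N a) = pimsner_hom a"
    then show thesis
      by (rule that)
  qed
  let ?C = "cstar_completion ?A N"
  define \<alpha> where "\<alpha> = (\<lambda>z a. inv_into (carrier ?C) \<Phi> (Ad z ` \<Phi> a))"
  have action: "circle_action ?C \<alpha>"
    unfolding \<alpha>_def
    by (rule circle_action_transport[OF \<Phi>(1) N.involutive_algebra_completion Pim.involutive_algebra_axioms circle_action_Pim])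
  have inv: "inv_into (carrier ?C) \<Phi> (\<Phi> b) = b" if "b \<in> carrier ?C" for b
    using bij_betw_inv_into_left[OF star_isoD(1)[OF \<Phi>(1)] that] .
  have \<iota>: "to_completion ?A N a \<in> carrier ?C" if "a \<in> carrier ?A" for a
    by (rule involutive_homD(1)[OF N.involutive_hom_to_completion that])
  have "\<alpha> z (to_completion ?A N (?c f)) = to_completion ?A N (?c f)" if z: "norm z = 1" for z f
  proof -
    have "Ad z ` \<Phi> (to_completion ?A N (?c f)) = \<Phi> (to_completion ?A N (?c f))"
      by (simp add: \<Phi>(2) cls Ad_coset[OF z] scalar_G Ad_scalar[OF z])
    then show ?thesis
      by (simp add: \<alpha>_def inv[OF \<iota>])
  qed
  moreover have "\<alpha> z (to_completion ?A N (star_class R (Gen l))) =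
      z \<odot>\<^bsub>?C\<^esub> to_completion ?A N (star_class R (Gen l))" if z: "norm z = 1" for z l
  proof -
    let ?g = "to_completion ?A N (star_class R (Gen l))"
    have "Ad z ` \<Phi> ?g = coset (Ad z (gen l))"
      by (simp add: \<Phi>(2) cls Ad_coset[OF z gen_G])
    also have "\<dots> = z \<odot>\<^bsub>Pim\<^esub> \<Phi> ?g"
      using Ad_creation[OF z column_section] by (simp add: gen_def \<Phi>(2) cls Pim_ops(4)[OF gen_G gen_G, unfolded gen_def])
    also have "\<dots> = \<Phi> (z \<odot>\<^bsub>?C\<^esub> ?g)"
      using star_isoD(6)[OF \<Phi>(1) \<iota>] by simp
    finally show ?thesis
      using inv involutive_algebra.smult_closed[OF N.involutive_algebra_completion \<iota>] by (simp add: \<alpha>_def)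
  qed
  ultimately have ext: "circle_action_extends R N"
    using action by (auto simp: circle_action_extends_def Let_def)
  have "x = \<zero>\<^bsub>?A\<^esub>" if x: "x \<in> carrier ?A" "N x = 0" for x
  proof (rule A.pimsner_seminorm_faithful[OF N.cstar_seminormed_axioms _ _ _ x])
    show "A.range_proj = \<one>\<^bsub>?A\<^esub>"
      unfolding A.range_proj_def unfolding R_def by (rule pimsner_sum_presented)
    show "N (gauge R (cis t) y) = N y" if "y \<in> carrier ?A" for t y
      by (rule gauge_invariant_if_circle_action_extends[OF R E semi ext _ that]) simp
    show "?c f = \<zero>\<^bsub>?A\<^esub>" if "N (?c f) = 0" for f
      using that sup A.c_zero by (simp add: extends_sup_norm_def)
  qed
  then have "cstar_norm ?A N"
    using semi by (simp add: cstar_norm_def N_def)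
  then show ?thesis
    using sup ext \<Phi>(1) unfolding star_isomorphic_def by blast
qed

end

theorem theorem4p13:
  fixes E :: "('x::t2_space \<Rightarrow>\<^sub>C complex)^'n^'n"
  assumes "compact (UNIV :: 'x set)"
    and "projection E"
    and "\<And>x. \<exists>l m. apply_bcontfun (E $ l $ m) x \<noteq> 0"
  shows "(\<exists>!N. cstar_norm (presented_algebra (pimsner_relations E)) N \<and>
             extends_sup_norm (pimsner_relations E) N \<and>
             circle_action_extends (pimsner_relations E) N) \<and>
         (\<forall>N. cstar_norm (presented_algebra (pimsner_relations E)) N \<and>
             extends_sup_norm (pimsner_relations E) N \<and>
             circle_action_extends (pimsner_relations E) N \<longrightarrow>
           star_isomorphic (cstar_completion (presented_algebra (pimsner_relations E)) N)
             (pimsner_algebra E)) \<and>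
         (\<exists>N. greatest_cstar_seminorm (presented_algebra (toeplitz_relations E)) N \<and>
           star_isomorphic (cstar_completion (presented_algebra (toeplitz_relations E)) N)
             (toeplitz_algebra E))"
proof -
  interpret full_bundle E
    by (intro full_bundle.intro projection_bundle.intro full_bundle_axioms.intro assms)
  show ?thesis
    using pimsner_norm_exists toeplitz_universal pimsner_norm_unique[OF assms(2)] by metis
qed

end
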